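(* Let $H$ be a Hopf algebra and $\chi:H\otimes H\to k$ a unital 2-cocycle. Then first order bicovariant differential calculi over $H$ and over $H^\chi$ are in one-to-one correspondence, and exterior (super-Hopf) algebras over $H$ and over $H^\chi$ are in one-to-one correspondence, by the twisting functor $\mathcal{G}^\chi$. The functor $\mathcal{G}^\chi$ is trivial on $\mathrm{d}$ (i.e. the exterior differential of the twisted calculus is the same linear map $\mathrm{d}$).
   Context: $k$ is a field; Hopf algebras have invertible antipode; Sweedler notation $\Delta h=h_{(1)}\otimes h_{(2)}$. A unital 2-cocycle on $H$ is a convolution-invertible linear map $\chi:H\otimes H\to k$ with $\chi(g_{(1)}\otimes f_{(1)})\chi(h\otimes g_{(2)}f_{(2)})=\chi(h_{(1)}\otimes g_{(1)})\chi(h_{(2)}g_{(2)}\otimes f)$ and $\chi(1\otimes h)=\epsilon(h)$. $H^\chi$ is the Hopf algebra with the same coalgebra and unit as $H$ and with product $h\bullet g=\chi(h_{(1)}\otimes g_{(1)})h_{(2)}g_{(2)}\chi^{-1}(h_{(3)}\otimes g_{(3)})$ and antipode $S^\chi h=U(h_{(1)})\,Sh_{(2)}\,U^{-1}(h_{(3)})$, $U(h)=\chi(h_{(1)}\otimes Sh_{(2)})$. A bicovariant bimodule over $H$ is an $H$-bimodule and $H$-bicomodule whose left and right coactions $\beta_L,\beta_R$ are bimodule maps; applying both coactions is written $v\mapsto v_{(1)}\otimes v_{(\underline 2)}\otimes v_{(3)}\in H\otimes V\otimes H$. A first order bicovariant differential calculus over $H$ is a bicovariant bimodule $\Omega^1$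 with a bicomodule map $\mathrm{d}:H\to\Omega^1$ obeying $\mathrm{d}(hg)=(\mathrm{d}h)g+h\,\mathrm{d}g$ and $\Omega^1=\mathrm{span}\{h\,\mathrm{d}g\}$. $T_{-1}\Omega^1=\bigoplus_n(\Omega^1)^{\otimes_H n}$ (degree $0$ part $H$) is the super-Hopf algebra whose coproduct is $\Delta$ on $H$ and $\beta_L+\beta_R$ on $\Omega^1$, extended multiplicatively with respect to the super tensor product; its antipode is $S\alpha=-(S\alpha_{(1)})\cdot\alpha_{(\underline 2)}\cdot(S\alpha_{(3)})$ in degree 1. An exterior (super-Hopf) algebra over $H$ associated to a first order bicovariant calculus $\Omega^1$ is a super-Hopf algebra quotient $\Omega^\cdot$ of $T_{-1}\Omega^1$ with $H,\Omega^1$ in degrees $0,1$ such that $\mathrm{d}$ extends to make $\Omega^\cdot$ a differential graded algebra ($\mathrm{d}^2=0$, graded Leibniz rule) and commutes with $\Delta$ and $S$. The functor $\mathcal{G}^\chi$ keeps the vector space and coactions (respectively the coproduct) and replaces products by $$\alpha\bullet\beta=\chi(\alpha_{(1)}\otimes\beta_{(1)})\,\alpha_{(\underline 2)}\beta_{(\underline 2)}\,\chi^{-1}(\alpha_{(3)}\otimes\beta_{(3)}),$$ where for elements of a bicovariant bimodule or exterior algebra the outer legs in $H$ are obtained from the left and right $H$-coactions (for $\Omega^\cdot$: the coproduct with the outer components projected to degree $0$). Applied to $\Omega^1$ (actions of $H$) it gives a bicovariant bimodule over $H^\chi$, and applied to $\Omega^\cdot$ the algebra $(\Omega^\cdot)^\chi$.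 *)

theory Defs
  imports Complex_Main "HOL-Library.Function_Algebras"
begin

section \<open>Vector spaces, quotients of free vector spaces, tensor products\<close>

text \<open>
  A vector space over the field \<open>'k\<close> is a subspace of an ambient abelian group with scalar action.
  The carrier is the whole type for the Hopf algebra, the bimodules and the exterior algebras
  below; proper subspaces occur only for tensor products and for the tensor algebra.
\<close>

record ('k, 'a) space =
  elems :: "'a set"
  scl :: "'k \<Rightarrow> 'a \<Rightarrow> 'a"

definition is_space :: "('k::field, 'a::ab_group_add) space \<Rightarrow> bool" where
  "is_space V \<longleftrightarrow> vector_space (scl V) \<and> module.subspace (scl V) (elems V)"

definition full :: "('k \<Rightarrow> 'a \<Rightarrow> 'a) \<Rightarrow> ('k, 'a) space" where
  "full s = \<lparr>elems = UNIV, scl = s\<rparr>"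

abbreviation ground :: "('k::field, 'k) space" where
  "ground \<equiv> full (*)"

definition linear_map ::
  "('k, 'a::ab_group_add) space \<Rightarrow> ('k, 'b::ab_group_add) space \<Rightarrow> ('a \<Rightarrow> 'b) \<Rightarrow> bool" where
  "linear_map V W f \<longleftrightarrow>
     (\<forall>x\<in>elems V. f x \<in> elems W) \<and>
     (\<forall>x\<in>elems V. \<forall>y\<in>elems V. f (x + y) = f x + f y) \<and>
     (\<forall>c. \<forall>x\<in>elems V. f (scl V c x) = scl W c (f x))"

definition bilinear_map ::
  "('k, 'a::ab_group_add) space \<Rightarrow> ('k, 'b::ab_group_add) space \<Rightarrow>
   ('k, 'c::ab_group_add) space \<Rightarrow> ('a \<Rightarrow> 'b \<Rightarrow> 'c) \<Rightarrow> bool" where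
  "bilinear_map U V W f \<longleftrightarrow>
     (\<forall>u\<in>elems U. linear_map V W (f u)) \<and>
     (\<forall>v\<in>elems V. linear_map U W (\<lambda>u. f u v))"

text \<open>
  Let \<open>F\<close> be a set of functions \<open>X \<Rightarrow> 'k\<close> cut out by linear relations between values
  (bilinearity, say).  The free vector space on \<open>X\<close> modulo these relations has \<open>F\<close> as its dual, and
  since \<open>'k\<close> is a field it embeds into its bidual.  We use this copy of the quotient: the class of
  the generator \<open>x\<close> is evaluation at \<open>x\<close> on \<open>F\<close>.  In the instances below a scalar multiple of a
  generator is again a generator, so that every element is a plain sum of generators.
  \<open>gen_lift X F f\<close> is the map on the quotient induced by \<open>f\<close>; it is meaningful if \<open>f\<close> satisfies the
  relations, see \<open>gen_lift_sum\<close>.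
\<close>

type_synonym ('x, 'k) quot = "('x \<Rightarrow> 'k) \<Rightarrow> 'k"

definition fun_scale :: "'k::field \<Rightarrow> ('x \<Rightarrow> 'k) \<Rightarrow> ('x \<Rightarrow> 'k)" where
  "fun_scale c t = (\<lambda>x. c * t x)"

definition gen :: "('x \<Rightarrow> 'k::field) set \<Rightarrow> 'x \<Rightarrow> ('x, 'k) quot" where
  "gen F x = (\<lambda>\<phi>. if \<phi> \<in> F then \<phi> x else 0)"

definition gen_sums :: "'x set \<Rightarrow> ('x \<Rightarrow> 'k::field) set \<Rightarrow> ('x, 'k) quot set" where
  "gen_sums X F = {t. \<exists>xs\<in>lists X. t = (\<Sum>x\<leftarrow>xs. gen F x)}"

definition gen_lift ::
  "'x set \<Rightarrow> ('x \<Rightarrow> 'k::field) set \<Rightarrow> ('x \<Rightarrow> 'c::ab_group_add) \<Rightarrow> ('x, 'k) quot \<Rightarrow> 'c" where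
  "gen_lift X F f t =
     (THE y. \<exists>xs\<in>lists X. t = (\<Sum>x\<leftarrow>xs. gen F x) \<and> y = (\<Sum>x\<leftarrow>xs. f x))"

lemma vector_space_fun_scale: "vector_space (fun_scale :: 'k::field \<Rightarrow> ('x \<Rightarrow> 'k) \<Rightarrow> 'x \<Rightarrow> 'k)"
  by unfold_locales (auto simp: fun_scale_def fun_eq_iff algebra_simps)

lemma separating_functional:
  fixes s :: "'k::field \<Rightarrow> 'c::ab_group_add \<Rightarrow> 'c"
  assumes "vector_space s" and "y \<noteq> 0"
  shows "\<exists>\<psi>. linear_map (full s) ground \<psi> \<and> \<psi> y \<noteq> 0"
proof -
  interpret V: vector_space s by fact
  interpret P: vector_space_pair s "(*) :: 'k \<Rightarrow> 'k \<Rightarrow> 'k"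
    by unfold_locales (auto simp: algebra_simps)
  have ind: "V.independent {y}" using assms(2) by simp
  let ?\<psi> = "P.construct {y} (\<lambda>_. 1)"
  have "Vector_Spaces.linear s (*) ?\<psi>" by (rule P.linear_construct[OF ind])
  then interpret L: Vector_Spaces.linear s "(*)" ?\<psi> .
  have "linear_map (full s) ground ?\<psi>"
    by (simp add: linear_map_def full_def L.add L.scale)
  moreover have "?\<psi> y = 1" by (rule P.construct_basis[OF ind]) simp
  ultimately show ?thesis by (metis zero_neq_one)
qed

lemma linear_map_sum_list:
  assumes "linear_map (full s) ground \<psi>"
  shows "\<psi> (\<Sum>x\<leftarrow>xs. f x) = (\<Sum>x\<leftarrow>xs. \<psi> (f x))"
proof -
  have add: "\<psi> (x + y) = \<psi> x + \<psi> y" for x y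
    using assms by (simp add: linear_map_def full_def)
  have "\<psi> 0 = 0" using add[of 0 0] by (metis add.right_neutral add_left_imp_eq)
  then show ?thesis by (induction xs) (simp_all add: add)
qed

lemma sum_list_gen: "\<phi> \<in> F \<Longrightarrow> (\<Sum>x\<leftarrow>xs. gen F x) \<phi> = (\<Sum>x\<leftarrow>xs. \<phi> x)"
  by (induction xs) (simp_all add: gen_def)

lemma gen_lift_sum:
  assumes "vector_space s"
    and F: "\<And>\<psi>. linear_map (full s) ground \<psi> \<Longrightarrow> \<psi> \<circ> f \<in> F"
    and xs: "xs \<in> lists X"
  shows "gen_lift X F f (\<Sum>x\<leftarrow>xs. gen F x) = (\<Sum>x\<leftarrow>xs. f x)"
  unfolding gen_lift_def
proof (rule the_equality)
  show "\<exists>ys\<in>lists X. (\<Sum>x\<leftarrow>xs. gen F x) = (\<Sum>x\<leftarrow>ys. gen F x) \<and>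
      (\<Sum>x\<leftarrow>xs. f x) = (\<Sum>x\<leftarrow>ys. f x)"
    using xs by blast
  fix y assume "\<exists>ys\<in>lists X. (\<Sum>x\<leftarrow>xs. gen F x) = (\<Sum>x\<leftarrow>ys. gen F x) \<and> y = (\<Sum>x\<leftarrow>ys. f x)"
  then obtain ys where eq: "(\<Sum>x\<leftarrow>xs. gen F x) = (\<Sum>x\<leftarrow>ys. gen F x)"
    and y: "y = (\<Sum>x\<leftarrow>ys. f x)" by blast
  show "y = (\<Sum>x\<leftarrow>xs. f x)"
  proof (rule ccontr)
    assume "y \<noteq> (\<Sum>x\<leftarrow>xs. f x)"
    then have "y - (\<Sum>x\<leftarrow>xs. f x) \<noteq> 0" by simp
    from separating_functional[OF assms(1) this] obtain \<psi>
      where \<psi>: "linear_map (full s) ground \<psi>" and ne: "\<psi> (y - (\<Sum>x\<leftarrow>xs. f x)) \<noteq> 0" by blast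
    have add: "\<psi> (x + y) = \<psi> x + \<psi> y" for x y
      using \<psi> by (simp add: linear_map_def full_def)
    have "\<psi> y = \<psi> (\<Sum>x\<leftarrow>xs. f x)"
      using fun_cong[OF eq, of "\<psi> \<circ> f"]
      by (simp add: y sum_list_gen F[OF \<psi>] linear_map_sum_list[OF \<psi>])
    then show False using ne add[of "y - (\<Sum>x\<leftarrow>xs. f x)" "\<Sum>x\<leftarrow>xs. f x"] by simp
  qed
qed

definition tensor_forms ::
  "('k::field, 'a::ab_group_add) space \<Rightarrow> ('k, 'b::ab_group_add) space \<Rightarrow> ('a \<times> 'b \<Rightarrow> 'k) set" where
  "tensor_forms A B = {\<phi>. bilinear_map A B ground (curry \<phi>)}"

definition tens ::
  "('k::field, 'a::ab_group_add) space \<Rightarrow> ('k, 'b::ab_group_add) space \<Rightarrow>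
   'a \<Rightarrow> 'b \<Rightarrow> ('a \<times> 'b, 'k) quot" where
  "tens A B a b = gen (tensor_forms A B) (a, b)"

definition tensor ::
  "('k::field, 'a::ab_group_add) space \<Rightarrow> ('k, 'b::ab_group_add) space \<Rightarrow>
   ('k, ('a \<times> 'b, 'k) quot) space" where
  "tensor A B = \<lparr>elems = gen_sums (elems A \<times> elems B) (tensor_forms A B), scl = fun_scale\<rparr>"

text \<open>
  The linear map on \<open>A \<otimes> B\<close> induced by a bilinear map.  With \<open>t = \<Delta> h\<close> the term
  \<open>tlift H H (\<lambda>h1 h2. f h1 h2) t\<close> is the Sweedler expression \<open>f(h\<^sub>(\<^sub>1\<^sub>), h\<^sub>(\<^sub>2\<^sub>))\<close>.
\<close>

definition tlift ::
  "('k::field, 'a::ab_group_add) space \<Rightarrow> ('k, 'b::ab_group_add) space \<Rightarrow>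
   ('a \<Rightarrow> 'b \<Rightarrow> 'c::ab_group_add) \<Rightarrow> ('a \<times> 'b, 'k) quot \<Rightarrow> 'c" where
  "tlift A B f = gen_lift (elems A \<times> elems B) (tensor_forms A B) (\<lambda>(a, b). f a b)"

lemma tlift_sum:
  assumes C: "is_space C" and f: "bilinear_map A B C f" and ps: "ps \<in> lists (elems A \<times> elems B)"
  shows "tlift A B f (\<Sum>(a, b)\<leftarrow>ps. tens A B a b) = (\<Sum>(a, b)\<leftarrow>ps. f a b)"
proof -
  have "(\<psi> \<circ> (\<lambda>(a, b). f a b)) \<in> tensor_forms A B" if "linear_map (full (scl C)) ground \<psi>" for \<psi>
    using f that
    by (simp add: tensor_forms_def bilinear_map_def linear_map_def full_def)
  moreover have "(\<Sum>(a, b)\<leftarrow>ps. tens A B a b) = (\<Sum>p\<leftarrow>ps. gen (tensor_forms A B) p)"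
    by (simp add: tens_def case_prod_beta')
  ultimately show ?thesis
    unfolding tlift_def using gen_lift_sum[of "scl C" "\<lambda>(a, b). f a b", OF _ _ ps] C
    by (simp add: is_space_def)
qed

text \<open>The universal property, which justifies the construction of the tensor product.\<close>

theorem tensor_universal:
  fixes A :: "('k::field, 'a::ab_group_add) space" and B :: "('k, 'b::ab_group_add) space"
    and C :: "('k, 'c::ab_group_add) space"
  assumes A: "is_space A" and C: "is_space C" and f: "bilinear_map A B C f"
  shows "bilinear_map A B (tensor A B) (tens A B)"
    and "linear_map (tensor A B) C (tlift A B f)"
    and "\<lbrakk>a \<in> elems A; b \<in> elems B\<rbrakk> \<Longrightarrow> tlift A B f (tens A B a b) = f a b"
    and "\<lbrakk>linear_map (tensor A B) C g;
          \<And>a b. \<lbrakk>a \<in> elems A; b \<in> elems B\<rbrakk> \<Longrightarrow> g (tens A B a b) = f a b; t \<in> elems (tensor A B)\<rbrakk>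
         \<Longrightarrow> g t = tlift A B f t"
proof -
  interpret C: vector_space "scl C" using C by (simp add: is_space_def)
  have C0: "0 \<in> elems C" and Cadd: "\<And>x y. x \<in> elems C \<Longrightarrow> y \<in> elems C \<Longrightarrow> x + y \<in> elems C"
    using C by (auto simp: is_space_def C.subspace_def)
  interpret A: vector_space "scl A" using A by (simp add: is_space_def)
  have Ascl: "scl A c x \<in> elems A" if "x \<in> elems A" for c x
    using A that by (simp add: is_space_def A.subspace_def)
  have rep: "\<exists>ps\<in>lists (elems A \<times> elems B). t = (\<Sum>(a, b)\<leftarrow>ps. tens A B a b)"
    if "t \<in> elems (tensor A B)" for t
    using that by (simp add: tensor_def gen_sums_def tens_def case_prod_beta')
  have elemsI: "(\<Sum>(a, b)\<leftarrow>ps. tens A B a b) \<in> elems (tensor A B)"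
    if "ps \<in> lists (elems A \<times> elems B)" for ps
    using that by (auto simp: tensor_def gen_sums_def tens_def case_prod_beta')
  have gen1: "tens A B a b \<in> elems (tensor A B)" if "a \<in> elems A" "b \<in> elems B" for a b
    using elemsI[of "[(a, b)]"] that by simp
  have tadd: "x + y \<in> elems (tensor A B)" if xy: "x \<in> elems (tensor A B)" "y \<in> elems (tensor A B)" for x y
  proof -
    obtain ps qs where "ps \<in> lists (elems A \<times> elems B)" "qs \<in> lists (elems A \<times> elems B)"
      "x = (\<Sum>(a, b)\<leftarrow>ps. tens A B a b)" "y = (\<Sum>(a, b)\<leftarrow>qs. tens A B a b)"
      using rep[OF xy(1)] rep[OF xy(2)] by blast
    then show ?thesis using elemsI[of "ps @ qs"] by simp
  qed
  show bil: "bilinear_map A B (tensor A B) (tens A B)"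
    by (auto simp: bilinear_map_def linear_map_def gen1)
       (auto simp: tensor_def fun_scale_def tens_def gen_def tensor_forms_def bilinear_map_def
         linear_map_def full_def fun_eq_iff)
  have sclt: "fun_scale c (tens A B a b) = tens A B (scl A c a) b"
    if "a \<in> elems A" "b \<in> elems B" for a b c
    using bil that by (simp add: bilinear_map_def linear_map_def tensor_def)
  have scls: "fun_scale c (\<Sum>(a, b)\<leftarrow>ps. tens A B a b) =
      (\<Sum>(a, b)\<leftarrow>map (\<lambda>(a, b). (scl A c a, b)) ps. tens A B a b)"
    if "ps \<in> lists (elems A \<times> elems B)" for ps c
    using that
  proof (induction ps)
    case Nil
    show ?case by (simp add: fun_scale_def fun_eq_iff)
  next
    case (Cons p ps)
    have add: "fun_scale c (x + y) = fun_scale c x + fun_scale c y"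
      for x y :: "('a \<times> 'b, 'k) quot"
      by (simp add: fun_scale_def fun_eq_iff algebra_simps)
    obtain a b where p: "p = (a, b)" by fastforce
    then have "a \<in> elems A" "b \<in> elems B" "ps \<in> lists (elems A \<times> elems B)" using Cons by auto
    then show ?case
      using Cons.IH by (simp only: p list.map sum_list.Cons prod.case add sclt)
  qed
  have fscl: "f (scl A c a) b = scl C c (f a b)" "f a b \<in> elems C"
    if "a \<in> elems A" "b \<in> elems B" for a b c
    using f that by (auto simp: bilinear_map_def linear_map_def)
  note ts = tlift_sum[OF C f]
  show lift_gen: "tlift A B f (tens A B a b) = f a b" if "a \<in> elems A" "b \<in> elems B" for a b
    using ts[of "[(a, b)]"] that by simp
  show "linear_map (tensor A B) C (tlift A B f)"
    unfolding linear_map_def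
  proof (intro conjI ballI allI)
    fix x assume "x \<in> elems (tensor A B)"
    then obtain ps where ps: "ps \<in> lists (elems A \<times> elems B)" "x = (\<Sum>(a, b)\<leftarrow>ps. tens A B a b)"
      using rep by blast
    have "(\<Sum>(a, b)\<leftarrow>ps. f a b) \<in> elems C"
      using ps(1) by (induction ps) (auto simp: C0 Cadd fscl)
    then show "tlift A B f x \<in> elems C" using ps ts by simp
    fix c
    let ?qs = "map (\<lambda>(a, b). (scl A c a, b)) ps"
    have qs: "?qs \<in> lists (elems A \<times> elems B)" using ps(1) by (force intro: Ascl)
    have "scl (tensor A B) c x = (\<Sum>(a, b)\<leftarrow>?qs. tens A B a b)"
      using ps scls by (simp add: tensor_def)
    then have "tlift A B f (scl (tensor A B) c x) = (\<Sum>(a, b)\<leftarrow>?qs. f a b)"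
      using ts[OF qs] by simp
    also have "\<dots> = scl C c (\<Sum>(a, b)\<leftarrow>ps. f a b)"
      using ps(1) by (induction ps) (auto simp: C.scale_right_distrib fscl)
    finally show "tlift A B f (scl (tensor A B) c x) = scl C c (tlift A B f x)"
      using ps ts by simp
  next
    fix x y assume xy: "x \<in> elems (tensor A B)" "y \<in> elems (tensor A B)"
    obtain ps qs where "ps \<in> lists (elems A \<times> elems B)" "qs \<in> lists (elems A \<times> elems B)"
      "x = (\<Sum>(a, b)\<leftarrow>ps. tens A B a b)" "y = (\<Sum>(a, b)\<leftarrow>qs. tens A B a b)"
      using rep[OF xy(1)] rep[OF xy(2)] by blast
    then show "tlift A B f (x + y) = tlift A B f x + tlift A B f y"
      using ts[of ps] ts[of qs] ts[of "ps @ qs"] by simp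
  qed
  show "g t = tlift A B f t"
    if g: "linear_map (tensor A B) C g"
      and eq: "\<And>a b. \<lbrakk>a \<in> elems A; b \<in> elems B\<rbrakk> \<Longrightarrow> g (tens A B a b) = f a b"
      and t: "t \<in> elems (tensor A B)"
  proof -
    obtain ps where ps: "ps \<in> lists (elems A \<times> elems B)" "t = (\<Sum>(a, b)\<leftarrow>ps. tens A B a b)"
      using rep t by blast
    have gadd: "g (x + y) = g x + g y" if "x \<in> elems (tensor A B)" "y \<in> elems (tensor A B)" for x y
      using g that by (simp add: linear_map_def)
    have z: "(0 :: ('a \<times> 'b, 'k) quot) \<in> elems (tensor A B)" using elemsI[of "[]"] by simp
    have g0: "g 0 = 0" using gadd[OF z z] by simp
    have "g (\<Sum>(a, b)\<leftarrow>ps. tens A B a b) = (\<Sum>(a, b)\<leftarrow>ps. f a b)"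
      using ps(1)
    proof (induction ps)
      case (Cons p ps)
      obtain a b where p: "p = (a, b)" by fastforce
      then have "a \<in> elems A" "b \<in> elems B" "ps \<in> lists (elems A \<times> elems B)" using Cons by auto
      then show ?case
        using Cons.IH elemsI[of ps]
        by (simp only: p list.map sum_list.Cons prod.case gadd gen1 eq)
    qed (simp only: list.map sum_list.Nil g0)
    then show ?thesis using ps ts by simp
  qed
qed

section \<open>Hopf algebras and cocycle twists\<close>

definition is_algebra ::
  "('k::field, 'a::ab_group_add) space \<Rightarrow> ('a \<Rightarrow> 'a \<Rightarrow> 'a) \<Rightarrow> 'a \<Rightarrow> bool" where
  "is_algebra A m e \<longleftrightarrow>
     is_space A \<and> bilinear_map A A A m \<and> e \<in> elems A \<and>
     (\<forall>x\<in>elems A. \<forall>y\<in>elems A. \<forall>z\<in>elems A. m (m x y) z = m x (m y z)) \<and>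
     (\<forall>x\<in>elems A. m e x = x \<and> m x e = x)"

text \<open>Triple tensor products are bracketed as \<open>(C \<otimes> C) \<otimes> C\<close>.\<close>

definition is_coalgebra ::
  "('k::field, 'a::ab_group_add) space \<Rightarrow> ('a \<Rightarrow> ('a \<times> 'a, 'k) quot) \<Rightarrow> ('a \<Rightarrow> 'k) \<Rightarrow> bool" where
  "is_coalgebra C \<Delta> \<epsilon> \<longleftrightarrow>
     is_space C \<and> linear_map C (tensor C C) \<Delta> \<and> linear_map C ground \<epsilon> \<and>
     (\<forall>x\<in>elems C.
        tlift C C (\<lambda>x1 x2. tens (tensor C C) C (\<Delta> x1) x2) (\<Delta> x) =
        tlift C C (\<lambda>x1 x2. tlift C C (\<lambda>y z. tens (tensor C C) C (tens C C x1 y) z) (\<Delta> x2)) (\<Delta> x)) \<and>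
     (\<forall>x\<in>elems C.
        tlift C C (\<lambda>x1 x2. scl C (\<epsilon> x1) x2) (\<Delta> x) = x \<and>
        tlift C C (\<lambda>x1 x2. scl C (\<epsilon> x2) x1) (\<Delta> x) = x)"

definition is_antipode ::
  "('k::field, 'a::ab_group_add) space \<Rightarrow> ('a \<Rightarrow> 'a \<Rightarrow> 'a) \<Rightarrow> 'a \<Rightarrow>
   ('a \<Rightarrow> ('a \<times> 'a, 'k) quot) \<Rightarrow> ('a \<Rightarrow> 'k) \<Rightarrow> ('a \<Rightarrow> 'a) \<Rightarrow> bool" where
  "is_antipode A m e \<Delta> \<epsilon> S \<longleftrightarrow>
     linear_map A A S \<and>
     (\<forall>x\<in>elems A.
        tlift A A (\<lambda>x1 x2. m (S x1) x2) (\<Delta> x) = scl A (\<epsilon> x) e \<and>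
        tlift A A (\<lambda>x1 x2. m x1 (S x2)) (\<Delta> x) = scl A (\<epsilon> x) e)"

text \<open>\<open>sweedler3 C \<Delta> f x\<close> is \<open>f(x\<^sub>(\<^sub>1\<^sub>), x\<^sub>(\<^sub>2\<^sub>), x\<^sub>(\<^sub>3\<^sub>))\<close>.\<close>

definition sweedler3 ::
  "('k::field, 'a::ab_group_add) space \<Rightarrow> ('a \<Rightarrow> ('a \<times> 'a, 'k) quot) \<Rightarrow>
   ('a \<Rightarrow> 'a \<Rightarrow> 'a \<Rightarrow> 'c::ab_group_add) \<Rightarrow> 'a \<Rightarrow> 'c" where
  "sweedler3 C \<Delta> f x = tlift C C (\<lambda>y x3. tlift C C (\<lambda>x1 x2. f x1 x2 x3) (\<Delta> y)) (\<Delta> x)"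

record ('k, 'h) hopf =
  hscale :: "'k \<Rightarrow> 'h \<Rightarrow> 'h"
  hmult :: "'h \<Rightarrow> 'h \<Rightarrow> 'h"
  hone :: "'h"
  hcomult :: "'h \<Rightarrow> ('h \<times> 'h, 'k) quot"
  hcounit :: "'h \<Rightarrow> 'k"
  hantipode :: "'h \<Rightarrow> 'h"

abbreviation hspace :: "('k, 'h) hopf \<Rightarrow> ('k, 'h) space" where
  "hspace H \<equiv> full (hscale H)"

definition hopf_algebra :: "('k::field, 'h::ab_group_add) hopf \<Rightarrow> bool" where
  "hopf_algebra H \<longleftrightarrow>
     is_algebra (hspace H) (hmult H) (hone H) \<and>
     is_coalgebra (hspace H) (hcomult H) (hcounit H) \<and>
     (\<forall>h g. hcomult H (hmult H h g) =
        tlift (hspace H) (hspace H) (\<lambda>h1 h2.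
          tlift (hspace H) (hspace H) (\<lambda>g1 g2.
            tens (hspace H) (hspace H) (hmult H h1 g1) (hmult H h2 g2))
          (hcomult H g)) (hcomult H h)) \<and>
     hcomult H (hone H) = tens (hspace H) (hspace H) (hone H) (hone H) \<and>
     (\<forall>h g. hcounit H (hmult H h g) = hcounit H h * hcounit H g) \<and>
     hcounit H (hone H) = 1 \<and>
     is_antipode (hspace H) (hmult H) (hone H) (hcomult H) (hcounit H) (hantipode H) \<and>
     bij (hantipode H)"

text \<open>
  Linear maps \<open>H \<otimes> H \<Rightarrow> 'k\<close> are given by bilinear maps \<open>\<chi>\<close>, with \<open>\<chi> h g\<close> standing for
  \<open>\<chi>(h \<otimes> g)\<close>.
\<close>

definition conv1 ::
  "('k::field, 'h::ab_group_add) hopf \<Rightarrow> ('h \<Rightarrow> 'k) \<Rightarrow> ('h \<Rightarrow> 'k) \<Rightarrow> 'h \<Rightarrow> 'k" where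
  "conv1 H u v h = tlift (hspace H) (hspace H) (\<lambda>h1 h2. u h1 * v h2) (hcomult H h)"

definition is_conv_inverse1 ::
  "('k::field, 'h::ab_group_add) hopf \<Rightarrow> ('h \<Rightarrow> 'k) \<Rightarrow> ('h \<Rightarrow> 'k) \<Rightarrow> bool" where
  "is_conv_inverse1 H u v \<longleftrightarrow>
     linear_map (hspace H) ground v \<and> conv1 H u v = hcounit H \<and> conv1 H v u = hcounit H"

definition conv_inverse1 :: "('k::field, 'h::ab_group_add) hopf \<Rightarrow> ('h \<Rightarrow> 'k) \<Rightarrow> 'h \<Rightarrow> 'k" where
  "conv_inverse1 H u = (THE v. is_conv_inverse1 H u v)"

definition conv2 ::
  "('k::field, 'h::ab_group_add) hopf \<Rightarrow> ('h \<Rightarrow> 'h \<Rightarrow> 'k) \<Rightarrow> ('h \<Rightarrow> 'h \<Rightarrow> 'k) \<Rightarrow> 'h \<Rightarrow> 'h \<Rightarrow> 'k" where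
  "conv2 H \<chi> \<xi> h g =
     tlift (hspace H) (hspace H) (\<lambda>h1 h2.
       tlift (hspace H) (hspace H) (\<lambda>g1 g2. \<chi> h1 g1 * \<xi> h2 g2) (hcomult H g)) (hcomult H h)"

definition is_conv_inverse2 ::
  "('k::field, 'h::ab_group_add) hopf \<Rightarrow> ('h \<Rightarrow> 'h \<Rightarrow> 'k) \<Rightarrow> ('h \<Rightarrow> 'h \<Rightarrow> 'k) \<Rightarrow> bool" where
  "is_conv_inverse2 H \<chi> \<xi> \<longleftrightarrow>
     bilinear_map (hspace H) (hspace H) ground \<xi> \<and>
     conv2 H \<chi> \<xi> = (\<lambda>h g. hcounit H h * hcounit H g) \<and>
     conv2 H \<xi> \<chi> = (\<lambda>h g. hcounit H h * hcounit H g)"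

definition conv_inverse2 ::
  "('k::field, 'h::ab_group_add) hopf \<Rightarrow> ('h \<Rightarrow> 'h \<Rightarrow> 'k) \<Rightarrow> 'h \<Rightarrow> 'h \<Rightarrow> 'k" where
  "conv_inverse2 H \<chi> = (THE \<xi>. is_conv_inverse2 H \<chi> \<xi>)"

definition two_cocycle :: "('k::field, 'h::ab_group_add) hopf \<Rightarrow> ('h \<Rightarrow> 'h \<Rightarrow> 'k) \<Rightarrow> bool" where
  "two_cocycle H \<chi> \<longleftrightarrow>
     bilinear_map (hspace H) (hspace H) ground \<chi> \<and>
     (\<exists>\<xi>. is_conv_inverse2 H \<chi> \<xi>) \<and>
     (\<forall>h g f.
        tlift (hspace H) (hspace H) (\<lambda>g1 g2.
          tlift (hspace H) (hspace H) (\<lambda>f1 f2. \<chi> g1 f1 * \<chi> h (hmult H g2 f2))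
          (hcomult H f)) (hcomult H g) =
        tlift (hspace H) (hspace H) (\<lambda>h1 h2.
          tlift (hspace H) (hspace H) (\<lambda>g1 g2. \<chi> h1 g1 * \<chi> (hmult H h2 g2) f)
          (hcomult H g)) (hcomult H h)) \<and>
     (\<forall>h. \<chi> (hone H) h = hcounit H h)"

definition twist_U ::
  "('k::field, 'h::ab_group_add) hopf \<Rightarrow> ('h \<Rightarrow> 'h \<Rightarrow> 'k) \<Rightarrow> 'h \<Rightarrow> 'k" where
  "twist_U H \<chi> h = tlift (hspace H) (hspace H) (\<lambda>h1 h2. \<chi> h1 (hantipode H h2)) (hcomult H h)"

definition twist_hopf ::
  "('k::field, 'h::ab_group_add) hopf \<Rightarrow> ('h \<Rightarrow> 'h \<Rightarrow> 'k) \<Rightarrow> ('k, 'h) hopf" where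
  "twist_hopf H \<chi> = H\<lparr>
     hmult := \<lambda>h g.
       sweedler3 (hspace H) (hcomult H) (\<lambda>h1 h2 h3.
         sweedler3 (hspace H) (hcomult H) (\<lambda>g1 g2 g3.
           hscale H (\<chi> h1 g1 * conv_inverse2 H \<chi> h3 g3) (hmult H h2 g2)) g) h,
     hantipode := \<lambda>h.
       sweedler3 (hspace H) (hcomult H) (\<lambda>h1 h2 h3.
         hscale H (twist_U H \<chi> h1 * conv_inverse1 H (twist_U H \<chi>) h3) (hantipode H h2)) h\<rparr>"

section \<open>Bicovariant bimodules and first order calculi\<close>

record ('k, 'h, 'v) bimod =
  vscale :: "'k \<Rightarrow> 'v \<Rightarrow> 'v"
  lact :: "'h \<Rightarrow> 'v \<Rightarrow> 'v"
  ract :: "'v \<Rightarrow> 'h \<Rightarrow> 'v"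
  lcoact :: "'v \<Rightarrow> ('h \<times> 'v, 'k) quot"
  rcoact :: "'v \<Rightarrow> ('v \<times> 'h, 'k) quot"

abbreviation vspace :: "('k, 'h, 'v, 'z) bimod_scheme \<Rightarrow> ('k, 'v) space" where
  "vspace V \<equiv> full (vscale V)"

definition bimodule ::
  "('k::field, 'h::ab_group_add) hopf \<Rightarrow> ('k, 'h, 'v::ab_group_add, 'z) bimod_scheme \<Rightarrow> bool" where
  "bimodule H V \<longleftrightarrow>
     is_space (vspace V) \<and>
     bilinear_map (hspace H) (vspace V) (vspace V) (lact V) \<and>
     bilinear_map (vspace V) (hspace H) (vspace V) (ract V) \<and>
     (\<forall>h g v. lact V (hmult H h g) v = lact V h (lact V g v)) \<and>
     (\<forall>v. lact V (hone H) v = v) \<and>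
     (\<forall>h g v. ract V v (hmult H h g) = ract V (ract V v h) g) \<and>
     (\<forall>v. ract V v (hone H) = v) \<and>
     (\<forall>h g v. ract V (lact V h v) g = lact V h (ract V v g))"

definition bicomodule ::
  "('k::field, 'h::ab_group_add) hopf \<Rightarrow> ('k, 'h, 'v::ab_group_add, 'z) bimod_scheme \<Rightarrow> bool" where
  "bicomodule H V \<longleftrightarrow> (let A = hspace H; M = vspace V in
     linear_map M (tensor A M) (lcoact V) \<and>
     linear_map M (tensor M A) (rcoact V) \<and>
     (\<forall>v. tlift A M (\<lambda>h w. tens (tensor A A) M (hcomult H h) w) (lcoact V v) =
          tlift A M (\<lambda>h w. tlift A M (\<lambda>g u. tens (tensor A A) M (tens A A h g) u) (lcoact V w))
            (lcoact V v)) \<and>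
     (\<forall>v. tlift A M (\<lambda>h w. vscale V (hcounit H h) w) (lcoact V v) = v) \<and>
     (\<forall>v. tlift M A (\<lambda>w h. tens (tensor M A) A (rcoact V w) h) (rcoact V v) =
          tlift M A (\<lambda>w h. tlift A A (\<lambda>h1 h2. tens (tensor M A) A (tens M A w h1) h2) (hcomult H h))
            (rcoact V v)) \<and>
     (\<forall>v. tlift M A (\<lambda>w h. vscale V (hcounit H h) w) (rcoact V v) = v) \<and>
     (\<forall>v. tlift M A (\<lambda>w h. tens (tensor A M) A (lcoact V w) h) (rcoact V v) =
          tlift A M (\<lambda>h w. tlift M A (\<lambda>u g. tens (tensor A M) A (tens A M h u) g) (rcoact V w))
            (lcoact V v)))"

text \<open>
  The coactions are bimodule maps for the actions of \<open>H\<close> on \<open>H \<otimes> V\<close> and \<open>V \<otimes> H\<close> through the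
  coproduct.
\<close>

definition bicovariant_bimodule ::
  "('k::field, 'h::ab_group_add) hopf \<Rightarrow> ('k, 'h, 'v::ab_group_add, 'z) bimod_scheme \<Rightarrow> bool" where
  "bicovariant_bimodule H V \<longleftrightarrow> (let A = hspace H; M = vspace V in
     bimodule H V \<and> bicomodule H V \<and>
     (\<forall>h v. lcoact V (lact V h v) =
        tlift A A (\<lambda>h1 h2. tlift A M (\<lambda>g w. tens A M (hmult H h1 g) (lact V h2 w)) (lcoact V v))
          (hcomult H h)) \<and>
     (\<forall>h v. lcoact V (ract V v h) =
        tlift A A (\<lambda>h1 h2. tlift A M (\<lambda>g w. tens A M (hmult H g h1) (ract V w h2)) (lcoact V v))
          (hcomult H h)) \<and>
     (\<forall>h v. rcoact V (lact V h v) =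
        tlift A A (\<lambda>h1 h2. tlift M A (\<lambda>w g. tens M A (lact V h1 w) (hmult H h2 g)) (rcoact V v))
          (hcomult H h)) \<and>
     (\<forall>h v. rcoact V (ract V v h) =
        tlift A A (\<lambda>h1 h2. tlift M A (\<lambda>w g. tens M A (ract V w h1) (hmult H g h2)) (rcoact V v))
          (hcomult H h)))"

text \<open>\<open>bicoact3 H V f v\<close> is \<open>f(v\<^sub>(\<^sub>1\<^sub>), v\<^sub>(\<^sub>2\<^sub>), v\<^sub>(\<^sub>3\<^sub>))\<close> with the outer legs in \<open>H\<close>.\<close>

definition bicoact3 ::
  "('k::field, 'h::ab_group_add) hopf \<Rightarrow> ('k, 'h, 'v::ab_group_add, 'z) bimod_scheme \<Rightarrow>
   ('h \<Rightarrow> 'v \<Rightarrow> 'h \<Rightarrow> 'c::ab_group_add) \<Rightarrow> 'v \<Rightarrow> 'c" where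
  "bicoact3 H V f v =
     tlift (vspace V) (hspace H) (\<lambda>w v3.
       tlift (hspace H) (vspace V) (\<lambda>v1 v2. f v1 v2 v3) (lcoact V w)) (rcoact V v)"

record ('k, 'h, 'v) calculus = "('k, 'h, 'v) bimod" +
  dif :: "'h \<Rightarrow> 'v"

definition bicovariant_calculus ::
  "('k::field, 'h::ab_group_add) hopf \<Rightarrow> ('k, 'h, 'v::ab_group_add) calculus \<Rightarrow> bool" where
  "bicovariant_calculus H \<Omega> \<longleftrightarrow> (let A = hspace H; M = vspace \<Omega> in
     bicovariant_bimodule H \<Omega> \<and>
     linear_map A M (dif \<Omega>) \<and>
     (\<forall>h. lcoact \<Omega> (dif \<Omega> h) = tlift A A (\<lambda>h1 h2. tens A M h1 (dif \<Omega> h2)) (hcomult H h)) \<and>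
     (\<forall>h. rcoact \<Omega> (dif \<Omega> h) = tlift A A (\<lambda>h1 h2. tens M A (dif \<Omega> h1) h2) (hcomult H h)) \<and>
     (\<forall>h g. dif \<Omega> (hmult H h g) = ract \<Omega> (dif \<Omega> h) g + lact \<Omega> h (dif \<Omega> g)) \<and>
     module.span (vscale \<Omega>) {lact \<Omega> h (dif \<Omega> g) | h g. True} = UNIV)"

definition calculus_hom ::
  "('k::field, 'h::ab_group_add) hopf \<Rightarrow> ('k, 'h, 'v::ab_group_add) calculus \<Rightarrow>
   ('k, 'h, 'u::ab_group_add) calculus \<Rightarrow> ('v \<Rightarrow> 'u) \<Rightarrow> bool" where
  "calculus_hom H \<Omega> \<Omega>' f \<longleftrightarrow> (let A = hspace H; M = vspace \<Omega>; N = vspace \<Omega>' in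
     linear_map M N f \<and>
     (\<forall>h v. f (lact \<Omega> h v) = lact \<Omega>' h (f v)) \<and>
     (\<forall>h v. f (ract \<Omega> v h) = ract \<Omega>' (f v) h) \<and>
     (\<forall>v. lcoact \<Omega>' (f v) = tlift A M (\<lambda>h w. tens A N h (f w)) (lcoact \<Omega> v)) \<and>
     (\<forall>v. rcoact \<Omega>' (f v) = tlift M A (\<lambda>w h. tens N A (f w) h) (rcoact \<Omega> v)) \<and>
     (\<forall>h. f (dif \<Omega> h) = dif \<Omega>' h))"

definition twist_calculus ::
  "('k::field, 'h::ab_group_add) hopf \<Rightarrow> ('h \<Rightarrow> 'h \<Rightarrow> 'k) \<Rightarrow>
   ('k, 'h, 'v::ab_group_add) calculus \<Rightarrow> ('k, 'h, 'v) calculus" where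
  "twist_calculus H \<chi> \<Omega> = \<Omega>\<lparr>
     lact := \<lambda>h v.
       sweedler3 (hspace H) (hcomult H) (\<lambda>h1 h2 h3.
         bicoact3 H \<Omega> (\<lambda>v1 v2 v3.
           vscale \<Omega> (\<chi> h1 v1 * conv_inverse2 H \<chi> h3 v3) (lact \<Omega> h2 v2)) v) h,
     ract := \<lambda>v h.
       bicoact3 H \<Omega> (\<lambda>v1 v2 v3.
         sweedler3 (hspace H) (hcomult H) (\<lambda>h1 h2 h3.
           vscale \<Omega> (\<chi> v1 h1 * conv_inverse2 H \<chi> v3 h3) (ract \<Omega> v2 h2)) h) v\<rparr>"

section \<open>Super-Hopf algebras\<close>

text \<open>All super structures are graded by \<open>nat\<close>; the parity is the degree modulo 2.\<close>

definition is_decomposition :: "(nat \<Rightarrow> 'a::ab_group_add set) \<Rightarrow> 'a \<Rightarrow> (nat \<Rightarrow> 'a) \<Rightarrow> bool" where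
  "is_decomposition G x f \<longleftrightarrow>
     (\<forall>n. f n \<in> G n) \<and> finite {n. f n \<noteq> 0} \<and> x = (\<Sum>n | f n \<noteq> 0. f n)"

definition hparts :: "(nat \<Rightarrow> 'a::ab_group_add set) \<Rightarrow> 'a \<Rightarrow> nat \<Rightarrow> 'a" where
  "hparts G x = (THE f. is_decomposition G x f)"

text \<open>
  The product \<open>(a \<otimes> b)(c \<otimes> e) = (-1)\<^sup>|\<^sup>b\<^sup>|\<^sup>|\<^sup>c\<^sup>| ac \<otimes> be\<close> of the super tensor product of a
  graded algebra with itself.
\<close>

definition super_tensor_mult ::
  "('k::field, 'a::ab_group_add) space \<Rightarrow> (nat \<Rightarrow> 'a set) \<Rightarrow> ('a \<Rightarrow> 'a \<Rightarrow> 'a) \<Rightarrow>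
   ('a \<times> 'a, 'k) quot \<Rightarrow> ('a \<times> 'a, 'k) quot \<Rightarrow> ('a \<times> 'a, 'k) quot" where
  "super_tensor_mult A G m t u =
     tlift A A (\<lambda>a b. tlift A A (\<lambda>c e.
       \<Sum>i | hparts G b i \<noteq> 0. \<Sum>j | hparts G c j \<noteq> 0.
         fun_scale ((- 1) ^ (i * j)) (tens A A (m a (hparts G c j)) (m (hparts G b i) e))) u) t"

record ('k, 'a) super_hopf =
  sscale :: "'k \<Rightarrow> 'a \<Rightarrow> 'a"
  grade :: "nat \<Rightarrow> 'a set"
  smult :: "'a \<Rightarrow> 'a \<Rightarrow> 'a"
  sone :: "'a"
  scomult :: "'a \<Rightarrow> ('a \<times> 'a, 'k) quot"
  scounit :: "'a \<Rightarrow> 'k"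
  santipode :: "'a \<Rightarrow> 'a"

definition graded_space :: "('k::field \<Rightarrow> 'a::ab_group_add \<Rightarrow> 'a) \<Rightarrow> (nat \<Rightarrow> 'a set) \<Rightarrow> ('k, 'a) space" where
  "graded_space s G = \<lparr>elems = module.span s (\<Union>n. G n), scl = s\<rparr>"

abbreviation sspace :: "('k::field, 'a::ab_group_add, 'z) super_hopf_scheme \<Rightarrow> ('k, 'a) space" where
  "sspace W \<equiv> graded_space (sscale W) (grade W)"

definition super_hopf_algebra ::
  "('k::field, 'a::ab_group_add, 'z) super_hopf_scheme \<Rightarrow> bool" where
  "super_hopf_algebra W \<longleftrightarrow> (let A = sspace W in
     (\<forall>n. module.subspace (sscale W) (grade W n)) \<and>
     (\<forall>x\<in>elems A. \<exists>!f. is_decomposition (grade W) x f) \<and>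
     is_algebra A (smult W) (sone W) \<and>
     sone W \<in> grade W 0 \<and>
     (\<forall>m n. \<forall>x\<in>grade W m. \<forall>y\<in>grade W n. smult W x y \<in> grade W (m + n)) \<and>
     is_coalgebra A (scomult W) (scounit W) \<and>
     (\<forall>n. \<forall>x\<in>grade W n.
        scomult W x \<in> gen_sums (\<Union>i\<le>n. grade W i \<times> grade W (n - i)) (tensor_forms A A)) \<and>
     (\<forall>n>0. \<forall>x\<in>grade W n. scounit W x = 0) \<and>
     (\<forall>x\<in>elems A. \<forall>y\<in>elems A.
        scomult W (smult W x y) =
        super_tensor_mult A (grade W) (smult W) (scomult W x) (scomult W y)) \<and>
     scomult W (sone W) = tens A A (sone W) (sone W) \<and>
     (\<forall>x\<in>elems A. \<forall>y\<in>elems A. scounit W (smult W x y) = scounit W x * scounit W y) \<and>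
     scounit W (sone W) = 1 \<and>
     is_antipode A (smult W) (sone W) (scomult W) (scounit W) (santipode W) \<and>
     (\<forall>n. \<forall>x\<in>grade W n. santipode W x \<in> grade W n))"

definition super_hopf_hom ::
  "('k::field, 'a::ab_group_add, 'y) super_hopf_scheme \<Rightarrow>
   ('k, 'b::ab_group_add, 'z) super_hopf_scheme \<Rightarrow> ('a \<Rightarrow> 'b) \<Rightarrow> bool" where
  "super_hopf_hom A B f \<longleftrightarrow> (let X = sspace A; Y = sspace B in
     linear_map X Y f \<and>
     (\<forall>n. \<forall>x\<in>grade A n. f x \<in> grade B n) \<and>
     (\<forall>x\<in>elems X. \<forall>y\<in>elems X. f (smult A x y) = smult B (f x) (f y)) \<and>
     f (sone A) = sone B \<and>
     (\<forall>x\<in>elems X. scomult B (f x) = tlift X X (\<lambda>y z. tens Y Y (f y) (f z)) (scomult A x)) \<and>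
     (\<forall>x\<in>elems X. scounit B (f x) = scounit A x) \<and>
     (\<forall>x\<in>elems X. f (santipode A x) = santipode B (f x)))"

section \<open>The super-Hopf algebra $T_{-1}\Omega^1$\<close>

text \<open>
  The generators of \<open>\<Oplus>\<^sub>n (\<Omega>\<^sup>1)\<^sup>\<otimes>\<^sup>n\<close>, with tensor products over \<open>H\<close>: an element \<open>Inl h\<close> of degree 0,
  or a nonempty list \<open>Inr [v\<^sub>1, \<dots>, v\<^sub>n]\<close> standing for \<open>v\<^sub>1 \<otimes>\<^sub>H \<dots> \<otimes>\<^sub>H v\<^sub>n\<close>.  The relations
  are linearity in \<open>h\<close>, linearity in each \<open>v\<^sub>i\<close>, and
  \<open>\<dots> \<otimes> v h \<otimes> w \<otimes> \<dots> = \<dots> \<otimes> v \<otimes> h w \<otimes> \<dots>\<close>.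
\<close>

type_synonym ('h, 'v) word = "'h + 'v list"

definition words :: "('h, 'v) word set" where
  "words = range Inl \<union> Inr ` {vs. vs \<noteq> []}"

definition word_forms ::
  "('k::field, 'h::ab_group_add) hopf \<Rightarrow> ('k, 'h, 'v::ab_group_add, 'z) bimod_scheme \<Rightarrow>
   (('h, 'v) word \<Rightarrow> 'k) set" where
  "word_forms H V = {\<phi>.
     linear_map (hspace H) ground (\<lambda>h. \<phi> (Inl h)) \<and>
     (\<forall>us ws. linear_map (vspace V) ground (\<lambda>v. \<phi> (Inr (us @ [v] @ ws)))) \<and>
     (\<forall>us v h w ws. \<phi> (Inr (us @ [ract V v h, w] @ ws)) = \<phi> (Inr (us @ [v, lact V h w] @ ws)))}"

abbreviation wgen ::
  "('k::field, 'h::ab_group_add) hopf \<Rightarrow> ('k, 'h, 'v::ab_group_add, 'z) bimod_scheme \<Rightarrow>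
   ('h, 'v) word \<Rightarrow> (('h, 'v) word, 'k) quot" where
  "wgen H V \<equiv> gen (word_forms H V)"

fun word_degree :: "('h, 'v) word \<Rightarrow> nat" where
  "word_degree (Inl h) = 0"
| "word_degree (Inr vs) = length vs"

definition T_grade ::
  "('k::field, 'h::ab_group_add) hopf \<Rightarrow> ('k, 'h, 'v::ab_group_add, 'z) bimod_scheme \<Rightarrow>
   nat \<Rightarrow> (('h, 'v) word, 'k) quot set" where
  "T_grade H V n = gen_sums {w \<in> words. word_degree w = n} (word_forms H V)"

definition T_space ::
  "('k::field, 'h::ab_group_add) hopf \<Rightarrow> ('k, 'h, 'v::ab_group_add, 'z) bimod_scheme \<Rightarrow>
   ('k, (('h, 'v) word, 'k) quot) space" where
  "T_space H V = graded_space fun_scale (T_grade H V)"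

text \<open>On nonempty lists; the values on \<open>Inr []\<close> are irrelevant.\<close>

fun word_mult ::
  "('k::field, 'h::ab_group_add) hopf \<Rightarrow> ('k, 'h, 'v::ab_group_add, 'z) bimod_scheme \<Rightarrow>
   ('h, 'v) word \<Rightarrow> ('h, 'v) word \<Rightarrow> ('h, 'v) word" where
  "word_mult H V (Inl h) (Inl g) = Inl (hmult H h g)"
| "word_mult H V (Inl h) (Inr vs) = Inr (lact V h (hd vs) # tl vs)"
| "word_mult H V (Inr vs) (Inl h) = Inr (butlast vs @ [ract V (last vs) h])"
| "word_mult H V (Inr vs) (Inr ws) = Inr (vs @ ws)"

definition T_mult ::
  "('k::field, 'h::ab_group_add) hopf \<Rightarrow> ('k, 'h, 'v::ab_group_add, 'z) bimod_scheme \<Rightarrow>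
   (('h, 'v) word, 'k) quot \<Rightarrow> (('h, 'v) word, 'k) quot \<Rightarrow> (('h, 'v) word, 'k) quot" where
  "T_mult H V t u =
     gen_lift words (word_forms H V) (\<lambda>w.
       gen_lift words (word_forms H V) (\<lambda>w'. wgen H V (word_mult H V w w')) u) t"

definition T_one ::
  "('k::field, 'h::ab_group_add) hopf \<Rightarrow> ('k, 'h, 'v::ab_group_add, 'z) bimod_scheme \<Rightarrow>
   (('h, 'v) word, 'k) quot" where
  "T_one H V = wgen H V (Inl (hone H))"

text \<open>\<open>\<beta>\<^sub>L + \<beta>\<^sub>R\<close>, in degree 1.\<close>

definition T_comult1 ::
  "('k::field, 'h::ab_group_add) hopf \<Rightarrow> ('k, 'h, 'v::ab_group_add, 'z) bimod_scheme \<Rightarrow>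
   'v \<Rightarrow> ((('h, 'v) word, 'k) quot \<times> (('h, 'v) word, 'k) quot, 'k) quot" where
  "T_comult1 H V v =
     tlift (hspace H) (vspace V) (\<lambda>h w.
       tens (T_space H V) (T_space H V) (wgen H V (Inl h)) (wgen H V (Inr [w]))) (lcoact V v) +
     tlift (vspace V) (hspace H) (\<lambda>w h.
       tens (T_space H V) (T_space H V) (wgen H V (Inr [w])) (wgen H V (Inl h))) (rcoact V v)"

fun word_comult ::
  "('k::field, 'h::ab_group_add) hopf \<Rightarrow> ('k, 'h, 'v::ab_group_add, 'z) bimod_scheme \<Rightarrow>
   ('h, 'v) word \<Rightarrow> ((('h, 'v) word, 'k) quot \<times> (('h, 'v) word, 'k) quot, 'k) quot" where
  "word_comult H V (Inl h) =
     tlift (hspace H) (hspace H) (\<lambda>h1 h2.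
       tens (T_space H V) (T_space H V) (wgen H V (Inl h1)) (wgen H V (Inl h2))) (hcomult H h)"
| "word_comult H V (Inr vs) =
     foldr (\<lambda>v. super_tensor_mult (T_space H V) (T_grade H V) (T_mult H V) (T_comult1 H V v)) vs
       (tens (T_space H V) (T_space H V) (T_one H V) (T_one H V))"

fun word_counit :: "('k::field, 'h::ab_group_add) hopf \<Rightarrow> ('h, 'v) word \<Rightarrow> 'k" where
  "word_counit H (Inl h) = hcounit H h"
| "word_counit H (Inr vs) = 0"

definition T_antipode1 ::
  "('k::field, 'h::ab_group_add) hopf \<Rightarrow> ('k, 'h, 'v::ab_group_add, 'z) bimod_scheme \<Rightarrow>
   'v \<Rightarrow> (('h, 'v) word, 'k) quot" where
  "T_antipode1 H V v =
     - bicoact3 H V (\<lambda>v1 v2 v3.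
         wgen H V (Inr [ract V (lact V (hantipode H v1) v2) (hantipode H v3)])) v"

text \<open>The antipode is extended by \<open>S(\<alpha>\<beta>) = (-1)\<^sup>|\<^sup>\<alpha>\<^sup>|\<^sup>|\<^sup>\<beta>\<^sup>| (S\<beta>)(S\<alpha>)\<close>.\<close>

fun list_antipode ::
  "('k::field, 'h::ab_group_add) hopf \<Rightarrow> ('k, 'h, 'v::ab_group_add, 'z) bimod_scheme \<Rightarrow>
   'v list \<Rightarrow> (('h, 'v) word, 'k) quot" where
  "list_antipode H V [] = T_one H V"
| "list_antipode H V (v # vs) =
     fun_scale ((- 1) ^ length vs) (T_mult H V (list_antipode H V vs) (T_antipode1 H V v))"

fun word_antipode ::
  "('k::field, 'h::ab_group_add) hopf \<Rightarrow> ('k, 'h, 'v::ab_group_add, 'z) bimod_scheme \<Rightarrow>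
   ('h, 'v) word \<Rightarrow> (('h, 'v) word, 'k) quot" where
  "word_antipode H V (Inl h) = wgen H V (Inl (hantipode H h))"
| "word_antipode H V (Inr vs) = list_antipode H V vs"

definition T_minus_one ::
  "('k::field, 'h::ab_group_add) hopf \<Rightarrow> ('k, 'h, 'v::ab_group_add, 'z) bimod_scheme \<Rightarrow>
   ('k, (('h, 'v) word, 'k) quot) super_hopf" where
  "T_minus_one H V = \<lparr>
     sscale = fun_scale,
     grade = T_grade H V,
     smult = T_mult H V,
     sone = T_one H V,
     scomult = gen_lift words (word_forms H V) (word_comult H V),
     scounit = gen_lift words (word_forms H V) (word_counit H),
     santipode = gen_lift words (word_forms H V) (word_antipode H V)\<rparr>"

section \<open>Exterior algebras and their twists\<close>

text \<open>
  \<open>inc0\<close> and \<open>inc1\<close> are the identifications of \<open>H\<close> and \<open>\<Omega>\<^sup>1\<close> with the degrees 0 and 1.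
\<close>

record ('k, 'h, 'v, 'w) ext_alg = "('k, 'w) super_hopf" +
  inc0 :: "'h \<Rightarrow> 'w"
  inc1 :: "'v \<Rightarrow> 'w"
  ext_dif :: "'w \<Rightarrow> 'w"

text \<open>
  An exterior algebra is a quotient \<open>p\<close> of \<open>T\<^sub>-\<^sub>1\<Omega>\<^sup>1\<close> together with a differential.
  The compatibility with the coproduct refers to the differential
  \<open>x \<otimes> y \<mapsto> dx \<otimes> y + (-1)\<^sup>|\<^sup>x\<^sup>| x \<otimes> dy\<close> of the tensor product.
\<close>

definition exterior_algebra ::
  "('k::field, 'h::ab_group_add) hopf \<Rightarrow> ('k, 'h, 'v::ab_group_add) calculus \<Rightarrow>
   ('k, 'h, 'v, 'w::ab_group_add) ext_alg \<Rightarrow> bool" where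
  "exterior_algebra H \<Omega> W \<longleftrightarrow> (let A = sspace W; d = ext_dif W in
     super_hopf_algebra W \<and> elems A = UNIV \<and>
     bij_betw (inc0 W) UNIV (grade W 0) \<and>
     bij_betw (inc1 W) UNIV (grade W 1) \<and>
     (\<exists>p. super_hopf_hom (T_minus_one H \<Omega>) W p \<and>
          p ` elems (sspace (T_minus_one H \<Omega>)) = UNIV \<and>
          (\<forall>h. p (wgen H \<Omega> (Inl h)) = inc0 W h) \<and>
          (\<forall>v. p (wgen H \<Omega> (Inr [v])) = inc1 W v)) \<and>
     linear_map A A d \<and>
     (\<forall>n. \<forall>x\<in>grade W n. d x \<in> grade W (Suc n)) \<and>
     (\<forall>x. d (d x) = 0) \<and>
     (\<forall>n. \<forall>x\<in>grade W n. \<forall>y.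
        d (smult W x y) = smult W (d x) y + sscale W ((- 1) ^ n) (smult W x (d y))) \<and>
     (\<forall>h. d (inc0 W h) = inc1 W (dif \<Omega> h)) \<and>
     (\<forall>x. scomult W (d x) =
        tlift A A (\<lambda>y z. tens A A (d y) z +
          (\<Sum>n | hparts (grade W) y n \<noteq> 0.
             fun_scale ((- 1) ^ n) (tens A A (hparts (grade W) y n) (d z)))) (scomult W x)) \<and>
     (\<forall>x. santipode W (d x) = d (santipode W x)))"

definition exterior_algebras ::
  "('k::field, 'h::ab_group_add) hopf \<Rightarrow>
   (('k, 'h, 'v::ab_group_add) calculus \<times> ('k, 'h, 'v, 'w::ab_group_add) ext_alg) set" where
  "exterior_algebras H = {(\<Omega>, W). bicovariant_calculus H \<Omega> \<and> exterior_algebra H \<Omega> W}"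

text \<open>Morphisms over \<open>H\<close>; the component in degree 1 is a morphism of first order calculi.\<close>

definition exterior_hom ::
  "('k::field, 'h, 'v, 'w::ab_group_add) ext_alg \<Rightarrow>
   ('k, 'h, 'u, 'x::ab_group_add) ext_alg \<Rightarrow> ('w \<Rightarrow> 'x) \<Rightarrow> bool" where
  "exterior_hom W W' f \<longleftrightarrow>
     super_hopf_hom W W' f \<and>
     (\<forall>h. f (inc0 W h) = inc0 W' h) \<and>
     (\<forall>x. f (ext_dif W x) = ext_dif W' (f x))"

definition ext_proj0 :: "('k, 'h, 'v, 'w::ab_group_add) ext_alg \<Rightarrow> 'w \<Rightarrow> 'h" where
  "ext_proj0 W x = the_inv (inc0 W) (hparts (grade W) x 0)"

text \<open>
  \<open>f(x\<^sub>(\<^sub>1\<^sub>), x\<^sub>(\<^sub>2\<^sub>), x\<^sub>(\<^sub>3\<^sub>))\<close> with the outer legs of the iterated coproduct projected to degree 0.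
\<close>

definition ext_coact3 ::
  "('k::field, 'h, 'v, 'w::ab_group_add) ext_alg \<Rightarrow>
   ('h \<Rightarrow> 'w \<Rightarrow> 'h \<Rightarrow> 'c::ab_group_add) \<Rightarrow> 'w \<Rightarrow> 'c" where
  "ext_coact3 W f =
     sweedler3 (sspace W) (scomult W) (\<lambda>x1 x2 x3. f (ext_proj0 W x1) x2 (ext_proj0 W x3))"

text \<open>The antipode is given by the formula for \<open>H\<^sup>\<chi>\<close>, with \<open>\<chi>\<close> extended by 0 to higher degrees.\<close>

definition twist_exterior ::
  "('k::field, 'h::ab_group_add) hopf \<Rightarrow> ('h \<Rightarrow> 'h \<Rightarrow> 'k) \<Rightarrow>
   ('k, 'h, 'v, 'w::ab_group_add) ext_alg \<Rightarrow> ('k, 'h, 'v, 'w) ext_alg" where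
  "twist_exterior H \<chi> W = W\<lparr>
     smult := \<lambda>x y.
       ext_coact3 W (\<lambda>x1 x2 x3. ext_coact3 W (\<lambda>y1 y2 y3.
         sscale W (\<chi> x1 y1 * conv_inverse2 H \<chi> x3 y3) (smult W x2 y2)) y) x,
     santipode := \<lambda>x.
       ext_coact3 W (\<lambda>x1 x2 x3.
         sscale W (twist_U H \<chi> x1 * conv_inverse1 H (twist_U H \<chi>) x3) (santipode W x2)) x\<rparr>"

end

theory Submission
  imports Defs
begin

text \<open>
  A bicomodule over \<open>H\<close> is studied through its linear forms: a cocycle acts on the forms of
  \<open>A \<otimes> B\<close> from both sides, and a twisted product is the original product precomposed with such
  an action.  Products that are bicolinear let the action pass through, so that associativity of a
  twisted product reduces to the two sides of the cocycle identity.  Coproducts and coactions are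
  cotensor splittings, on which the two factors in the middle cancel; hence they stay multiplicative.
  The twisted antipode is treated in the same way, with \<open>U\<close> and its convolution inverse.
  The inverse \<open>\<chi>\<^sup>-\<^sup>1\<close> is a cocycle on \<open>H\<^sup>\<chi>\<close>, and twisting by it undoes the twist, which gives all bijections.

  A super-Hopf algebra in which \<open>H\<close> is the degree 0 part is such a bicomodule through the
  projection to degree 0, and the sign of the super tensor product is \<open>1 - 2 o(b) o(c)\<close> with the
  bicolinear projection \<open>o\<close> to odd degrees.  Being a quotient of \<open>T\<^sub>-\<^sub>1\<Omega>\<^sup>1\<close> can be
  expressed without \<open>T\<^sub>-\<^sub>1\<Omega>\<^sup>1\<close>: \<open>H\<close> and \<open>\<Omega>\<^sup>1\<close> embed compatibly with all operations and
  degree \<open>n + 1\<close> is spanned by products of \<open>\<Omega>\<^sup>1\<close> with degree \<open>n\<close>; in this form the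
  condition is visibly preserved by twisting.
\<close>

section \<open>Sweedler sums and spaces of forms\<close>

text \<open>Coproducts and coactions take values in a quotient and have no canonical lists of legs.
  Lists are therefore chosen, and every identity is tested on linear forms, which separate points
  because the scalars form a field. The delicate points are the signs and the antipode. Signs vanish
  in the coactions because the projected leg has degree 0, so \<open>W\<close> is an ordinary
  comodule algebra over \<open>H\<close> although its full coproduct is multiplicative only up to
  signs. The expression 1 - 2 o(b) o(c) is valid in every characteristic and twisting is linear, so
  both of its terms can be twisted separately. For the antipode the inverse of \<open>U\<close> is
  needed in closed form. It is \<xi>(S h1, h2), and the proof multiplies the cocycle identity by
  inverses until an antipode and its partner meet inside one argument. When a twist is undone, the
  antipode returns by uniqueness and not by a second calculation.\<close>

definition ssum :: "('a \<times> 'b) list => ('a => 'b => 'c::comm_monoid_add) => 'c" where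
 "ssum r f = (SUM (x, y)<-r. f x y)"

lemma ssum_Nil [simp]: "ssum [] f = 0"
 and ssum_Cons [simp]: "ssum ((a, b) # r) f = f a b + ssum r f"
 and ssum_append: "ssum (r @ r') f = ssum r f + ssum r' f"
 by (simp_all add: ssum_def)

lemma ssum_zero [simp]: "ssum r (%x y. 0) = 0"
 by (induction r) (auto simp: ssum_def)

lemma ssum_add: "ssum r (%x y. f x y + g x y) = ssum r f + ssum r g"
 by (induction r) (auto simp: ssum_def algebra_simps)

lemma ssum_minus: "ssum r (%x y. - f x y) = - ssum r (f :: _ => _ => 'c::ab_group_add)"
 by (induction r) (auto simp: ssum_def algebra_simps)

lemma ssum_diff: "ssum r (%x y. f x y - g x y) = ssum r f - ssum r (g :: _ => _ => 'c::ab_group_add)"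
 by (induction r) (auto simp: ssum_def algebra_simps)

lemma ssum_mult_left: "ssum r (%x y. c * f x y) = (c :: 'c::comm_ring_1) * ssum r f"
 by (induction r) (auto simp: ssum_def algebra_simps)

lemma ssum_mult_right: "ssum r (%x y. f x y * c) = ssum r f * (c :: 'c::comm_ring_1)"
 by (induction r) (auto simp: ssum_def algebra_simps)

lemma ssum_swap: "ssum r (%x y. ssum s (%a b. f x y a b)) = ssum s (%a b. ssum r (%x y. f x y a b))"
proof (induction r)
 case (Cons p r)
 then show ?case by (cases p) (simp add: ssum_add)
qed simp

lemma ssum_additive:
 assumes "!!x y. \<phi> (x + y) = \<phi> x + \<phi> y" and "\<phi> 0 = 0"
 shows "\<phi> (ssum r f) = ssum r (%x y. \<phi> (f x y))"
 by (induction r) (auto simp: ssum_def assms)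

lemma ssum_map:
 "ssum (map (%(x, y). (g x y, h x y)) r) f = ssum r (%x y. f (g x y) (h x y))"
 by (induction r) (auto simp: ssum_def)

lemma ssum_cong: "(!!x y. (x, y) \<in> set r ==> f x y = g x y) ==> ssum r f = ssum r g"
 unfolding ssum_def by (intro arg_cong[of _ _ sum_list] map_cong) auto

text \<open>Contains the interchange of the two middle legs by which a tensor product of coalgebras
  or comodules is again one.\<close>

definition plist :: "('a \<times> 'b) list => ('c \<times> 'd) list => (('a \<times> 'c) \<times> ('b \<times> 'd)) list" where
 "plist r s = concat (map (%(a, b). map (%(c, d). ((a, c), (b, d))) s) r)"

lemma ssum_plist: "ssum (plist r s) f = ssum r (%a b. ssum s (%c d. f (a, c) (b, d)))"
proof (induction r)
 case (Cons p r)
 have "ssum (map (%(c, d). ((a, c), (b, d))) s) f = ssum s (%c d. f (a, c) (b, d))" for a b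
  by (induction s) (auto simp: ssum_def)
 then show ?case using Cons by (cases p) (simp add: plist_def ssum_append)
qed (simp add: plist_def)

section \<open>Spaces of forms and of multilinear forms\<close>

definition forms :: "('x => 'k::field) set => bool" where
 "forms F \<longleftrightarrow> (%_. 0) \<in> F \<and> (\<forall>f\<in>F. \<forall>g\<in>F. (%x. f x + g x) \<in> F) \<and>
   (\<forall>c. \<forall>f\<in>F. (%x. c * f x) \<in> F)"

lemma forms_zero: "forms F ==> (%_. 0) \<in> F"
 and forms_add: "forms F ==> f \<in> F ==> g \<in> F ==> (%x. f x + g x) \<in> F"
 and forms_mult: "forms F ==> f \<in> F ==> (%x. c * f x) \<in> F"
 by (auto simp: forms_def)

lemma forms_mult': "forms F ==> f \<in> F ==> (%x. f x * c) \<in> F"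
 using forms_mult[of F f c] by (simp add: mult.commute)

lemma forms_diff: "forms F ==> f \<in> F ==> g \<in> F ==> (%x. f x - g x) \<in> F"
 using forms_add[of F f "%x. - 1 * g x"] forms_mult[of F g "- 1"] by simp

lemma forms_ssum:
 assumes "forms F" and "!!a b. (%x. f x a b) \<in> F"
 shows "(%x. ssum r (f x)) \<in> F"
proof (induction r)
 case (Cons p r)
 obtain a b where p: "p = (a, b)" by (cases p)
 from forms_add[OF assms(1) assms(2)[of a b] Cons] show ?case
  by (simp add: p)
qed (simp add: forms_zero[OF assms(1)])

definition bi :: "('x => 'k) set => ('y => 'k) set => ('x => 'y => 'k) set" where
 "bi F G = {f. (\<forall>y. (%x. f x y) \<in> F) \<and> (\<forall>x. (%y. f x y) \<in> G)}"

definition tri :: "('x => 'k) set => ('y => 'k) set => ('z => 'k) set => ('x => 'y => 'z => 'k) set" where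
 "tri F G K = {f. (\<forall>y z. (%x. f x y z) \<in> F) \<and> (\<forall>x z. (%y. f x y z) \<in> G) \<and>
   (\<forall>x y. (%z. f x y z) \<in> K)}"

lemma biI: "(!!y. (%x. f x y) \<in> F) ==> (!!x. (%y. f x y) \<in> G) ==> f \<in> bi F G"
 and bi1: "f \<in> bi F G ==> (%x. f x y) \<in> F"
 and bi2: "f \<in> bi F G ==> (%y. f x y) \<in> G"
 by (auto simp: bi_def)

lemma triI: "(!!y z. (%x. f x y z) \<in> F) ==> (!!x z. (%y. f x y z) \<in> G) ==>
  (!!x y. (%z. f x y z) \<in> K) ==> f \<in> tri F G K"
 and tri1: "f \<in> tri F G K ==> (%x. f x y z) \<in> F"
 and tri2: "f \<in> tri F G K ==> (%y. f x y z) \<in> G"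
 and tri3: "f \<in> tri F G K ==> (%z. f x y z) \<in> K"
 by (auto simp: tri_def)

lemma tri_slice: "f \<in> tri F G K ==> (%x y. f x y z) \<in> bi F G"
 "f \<in> tri F G K ==> (%x z. f x y z) \<in> bi F K"
 "f \<in> tri F G K ==> (%y z. f x y z) \<in> bi G K"
 by (auto simp: tri_def bi_def)

definition pform :: "('x => 'k) set => ('y => 'k) set => ('x \<times> 'y => 'k) set" where
 "pform F G = {\<phi>. (%x y. \<phi> (x, y)) \<in> bi F G}"

lemma pformI: "(!!y. (%x. \<phi> (x, y)) \<in> F) ==> (!!x. (%y. \<phi> (x, y)) \<in> G) ==> \<phi> \<in> pform F G"
 and pform1: "\<phi> \<in> pform F G ==> (%x. \<phi> (x, y)) \<in> F"
 and pform2: "\<phi> \<in> pform F G ==> (%y. \<phi> (x, y)) \<in> G"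
 by (auto simp: pform_def bi_def)

lemma forms_pform: "forms F ==> forms G ==> forms (pform F G)"
 by (auto simp: forms_def pform_def bi_def)

section \<open>Coalgebras and bicomodules\<close>

text \<open>
 A space enters only through a set of forms on a type of generators.  Since the generators need
 not form a vector space, pairs with the bilinear forms are again such a space, namely the tensor
 product, and words with the balanced multilinear forms are a tensor algebra.
\<close>

record ('k, 'c) cog =
 cF :: "('c => 'k) set"
 cD :: "'c => ('c \<times> 'c) list"
 cE :: "'c => 'k"

record ('k, 'c, 'v) bcm =
 bF :: "('v => 'k) set"
 bL :: "'v => ('c \<times> 'v) list"
 bR :: "'v => ('v \<times> 'c) list"

text \<open>\<open>bL\<close> and \<open>bR\<close> give arbitrary representatives of the coactions,
  so each axiom is paired with multilinear forms: only such values are independent of the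
  representative. The conditions are, in order, linearity of the coactions, the two comodule laws,
  their compatibility, and the two counit laws.\<close>

definition is_bcm :: "('k::field, 'c) cog => ('k, 'c, 'v) bcm => bool" where
 "is_bcm C B \<longleftrightarrow> forms (bF B) \<and>
   (\<forall>f\<in>bi (cF C) (bF B). (%v. ssum (bL B v) f) \<in> bF B) \<and>
   (\<forall>f\<in>bi (bF B) (cF C). (%v. ssum (bR B v) f) \<in> bF B) \<and>
   (\<forall>f\<in>tri (cF C) (cF C) (bF B). \<forall>v.
    ssum (bL B v) (%c w. ssum (cD C c) (%x y. f x y w)) =
    ssum (bL B v) (%x w. ssum (bL B w) (%y z. f x y z))) \<and>
   (\<forall>f\<in>tri (bF B) (cF C) (cF C). \<forall>v.
    ssum (bR B v) (%w c. ssum (cD C c) (%x y. f w x y)) =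
    ssum (bR B v) (%w y. ssum (bR B w) (%z x. f z x y))) \<and>
   (\<forall>f\<in>tri (cF C) (bF B) (cF C). \<forall>v.
    ssum (bL B v) (%x w. ssum (bR B w) (%z y. f x z y)) =
    ssum (bR B v) (%w y. ssum (bL B w) (%x z. f x z y))) \<and>
   (\<forall>f\<in>bF B. \<forall>v. ssum (bL B v) (%c w. cE C c * f w) = f v) \<and>
   (\<forall>f\<in>bF B. \<forall>v. ssum (bR B v) (%w c. f w * cE C c) = f v)"

lemma
 assumes "is_bcm C B"
 shows bcm_forms: "forms (bF B)"
  and bcm_bL: "f \<in> bi (cF C) (bF B) ==> (%v. ssum (bL B v) f) \<in> bF B"
  and bcm_bR: "g \<in> bi (bF B) (cF C) ==> (%v. ssum (bR B v) g) \<in> bF B"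
  and bcm_LL: "h \<in> tri (cF C) (cF C) (bF B) ==>
    ssum (bL B v) (%c w. ssum (cD C c) (%x y. h x y w)) =
    ssum (bL B v) (%x w. ssum (bL B w) (%y z. h x y z))"
  and bcm_RR: "h' \<in> tri (bF B) (cF C) (cF C) ==>
    ssum (bR B v) (%w c. ssum (cD C c) (%x y. h' w x y)) =
    ssum (bR B v) (%w y. ssum (bR B w) (%z x. h' z x y))"
  and bcm_LR: "h'' \<in> tri (cF C) (bF B) (cF C) ==>
    ssum (bL B v) (%x w. ssum (bR B w) (%z y. h'' x z y)) =
    ssum (bR B v) (%w y. ssum (bL B w) (%x z. h'' x z y))"
  and bcm_counitL: "\<phi> \<in> bF B ==> ssum (bL B v) (%c w. cE C c * \<phi> w) = \<phi> v"
  and bcm_counitR: "\<phi> \<in> bF B ==> ssum (bR B v) (%w c. \<phi> w * cE C c) = \<phi> v"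
 using assms unfolding is_bcm_def by blast+

definition selfB :: "('k, 'c) cog => ('k, 'c, 'c) bcm" where
 "selfB C = \<lparr>bF = cF C, bL = cD C, bR = cD C\<rparr>"

text \<open>A coalgebra is a bicomodule over itself; the three laws with iterated coactions in
  \<open>is_bcm\<close> then all become coassociativity.\<close>

definition is_cog :: "('k::field, 'c) cog => bool" where
 "is_cog C \<longleftrightarrow> cE C \<in> cF C \<and> is_bcm C (selfB C)"

lemma selfB_simps [simp]: "bF (selfB C) = cF C" "bL (selfB C) = cD C" "bR (selfB C) = cD C"
 by (simp_all add: selfB_def)

lemma
 assumes "is_cog C"
 shows cog_bcm: "is_bcm C (selfB C)"
  and cog_forms: "forms (cF C)"
  and cog_cE: "cE C \<in> cF C"
  and cog_cD: "f \<in> bi (cF C) (cF C) ==> (%v. ssum (cD C v) f) \<in> cF C"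
  and cog_coassoc: "h \<in> tri (cF C) (cF C) (cF C) ==>
    ssum (cD C v) (%c w. ssum (cD C c) (%x y. h x y w)) =
    ssum (cD C v) (%x w. ssum (cD C w) (%y z. h x y z))"
  and cog_counitL: "\<phi> \<in> cF C ==> ssum (cD C v) (%c w. cE C c * \<phi> w) = \<phi> v"
  and cog_counitR: "\<phi> \<in> cF C ==> ssum (cD C v) (%w c. \<phi> w * cE C c) = \<phi> v"
proof -
 show 1: "is_bcm C (selfB C)" "cE C \<in> cF C" using assms by (auto simp: is_cog_def)
 show "forms (cF C)" using bcm_forms[OF 1(1)] by simp
 show "f \<in> bi (cF C) (cF C) ==> (%v. ssum (cD C v) f) \<in> cF C" using bcm_bL[OF 1(1)] by simp
 show "h \<in> tri (cF C) (cF C) (cF C) ==>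
    ssum (cD C v) (%c w. ssum (cD C c) (%x y. h x y w)) =
    ssum (cD C v) (%x w. ssum (cD C w) (%y z. h x y z))"
  using bcm_LL[OF 1(1)] by simp
 show "\<phi> \<in> cF C ==> ssum (cD C v) (%c w. cE C c * \<phi> w) = \<phi> v"
  "\<phi> \<in> cF C ==> ssum (cD C v) (%w c. \<phi> w * cE C c) = \<phi> v"
  using bcm_counitL[OF 1(1)] bcm_counitR[OF 1(1)] by simp_all
qed

definition prodC :: "('k::field, 'c) cog => ('k, 'd) cog => ('k, 'c \<times> 'd) cog" where
 "prodC C D = \<lparr>cF = pform (cF C) (cF D), cD = (%(c, d). plist (cD C c) (cD D d)),
   cE = (%(c, d). cE C c * cE D d)\<rparr>"

definition prodB :: "('k, 'c, 'v) bcm => ('k, 'd, 'w) bcm => ('k, 'c \<times> 'd, 'v \<times> 'w) bcm" where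
 "prodB A B = \<lparr>bF = pform (bF A) (bF B), bL = (%(a, b). plist (bL A a) (bL B b)),
   bR = (%(a, b). plist (bR A a) (bR B b))\<rparr>"

lemma prod_simps [simp]:
 "cF (prodC C D) = pform (cF C) (cF D)" "cD (prodC C D) (c, d) = plist (cD C c) (cD D d)"
 "cE (prodC C D) (c, d) = cE C c * cE D d"
 "bF (prodB A B) = pform (bF A) (bF B)" "bL (prodB A B) (a, b) = plist (bL A a) (bL B b)"
 "bR (prodB A B) (a, b) = plist (bR A a) (bR B b)"
 by (simp_all add: prodC_def prodB_def)

lemma selfB_prodC: "selfB (prodC C D) = prodB (selfB C) (selfB D)"
 by (simp add: selfB_def prodC_def prodB_def)

lemma ssum_swap_inner:
 "ssum r (%c w. ssum s (%d z. ssum (t c w) (%x y. f c w d z x y))) =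
  ssum r (%c w. ssum (t c w) (%x y. ssum s (%d z. f c w d z x y)))"
 by (rule ssum_cong, rule ssum_swap)

text \<open>Each axiom is applied one tensor factor at a time. The sums belonging to
  \<open>B\<close> are hidden inside the form \<open>?G\<close>, to which the axiom of
  \<open>A\<close> applies; afterwards the axiom of \<open>B\<close> is applied to the inner
  sums.\<close>

lemma prodB_is_bcm:
 fixes A :: "('k::field, 'c, 'v) bcm" and B :: "('k, 'd, 'w) bcm"
 assumes C: "is_cog C" and D: "is_cog D" and A: "is_bcm C A" and B: "is_bcm D B"
 shows "is_bcm (prodC C D) (prodB A B)"
proof -
 note fA = bcm_forms[OF A] and fB = bcm_forms[OF B] and fC = cog_forms[OF C] and fD = cog_forms[OF D]
 note slices = bi_def tri_def pform_def
 note closed = bcm_bL[OF A] bcm_bR[OF A] bcm_bL[OF B] bcm_bR[OF B] cog_cD[OF C] cog_cD[OF D]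
 note fs = forms_ssum[OF fA] forms_ssum[OF fB] forms_ssum[OF fC] forms_ssum[OF fD]
 show ?thesis
  unfolding is_bcm_def
 proof (intro conjI ballI allI)
  show "forms (bF (prodB A B))" using forms_pform[OF fA fB] by simp
 next
  fix f assume f: "f \<in> bi (cF (prodC C D)) (bF (prodB A B))"
  have "(%(a, b). ssum (bL A a) (%c w. ssum (bL B b) (%d z. f (c, d) (w, z)))) \<in> pform (bF A) (bF B)"
   by (intro pformI, unfold prod.case) (intro closed fs biI; use f in \<open>auto simp: slices\<close>)+
  then show "(%v. ssum (bL (prodB A B) v) f) \<in> bF (prodB A B)"
   by (simp add: case_prod_beta' ssum_plist prodB_def)
 next
  fix f assume f: "f \<in> bi (bF (prodB A B)) (cF (prodC C D))"
  have "(%(a, b). ssum (bR A a) (%w c. ssum (bR B b) (%z d. f (w, z) (c, d)))) \<in> pform (bF A) (bF B)"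
   by (intro pformI, unfold prod.case) (intro closed fs biI; use f in \<open>auto simp: slices\<close>)+
  then show "(%v. ssum (bR (prodB A B) v) f) \<in> bF (prodB A B)"
   by (simp add: case_prod_beta' ssum_plist prodB_def)
 next
  fix f and v :: "'v \<times> 'w" assume f: "f \<in> tri (cF (prodC C D)) (cF (prodC C D)) (bF (prodB A B))"
  obtain a b where v: "v = (a, b)" by (cases v)
  let ?G = "%x y w. ssum (bL B b) (%d z. ssum (cD D d) (%x' y'. f (x, x') (y, y') (w, z)))"
  have "?G \<in> tri (cF C) (cF C) (bF A)"
   by (intro triI fs) (use f in \<open>auto simp: slices\<close>)
  note A' = bcm_LL[OF A this]
  have "(%x' y' z. f (x, x') (y, y') (w, z)) \<in> tri (cF D) (cF D) (bF B)" for x y w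
   by (intro triI) (use f in \<open>auto simp: slices\<close>)
  note B' = bcm_LL[OF B this]
  show "ssum (bL (prodB A B) v) (%c w. ssum (cD (prodC C D) c) (%x y. f x y w)) =
    ssum (bL (prodB A B) v) (%x w. ssum (bL (prodB A B) w) (f x))"
   unfolding v prod_simps ssum_plist ssum_swap_inner[where s = "bL B b"] A'
   unfolding B' ..
 next
  fix f and v :: "'v \<times> 'w" assume f: "f \<in> tri (bF (prodB A B)) (cF (prodC C D)) (cF (prodC C D))"
  obtain a b where v: "v = (a, b)" by (cases v)
  let ?G = "%w x y. ssum (bR B b) (%z d. ssum (cD D d) (%x' y'. f (w, z) (x, x') (y, y')))"
  have "?G \<in> tri (bF A) (cF C) (cF C)"
   by (intro triI fs) (use f in \<open>auto simp: slices\<close>)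
  note A' = bcm_RR[OF A this]
  have "(%z x' y'. f (w, z) (x, x') (y, y')) \<in> tri (bF B) (cF D) (cF D)" for x y w
   by (intro triI) (use f in \<open>auto simp: slices\<close>)
  note B' = bcm_RR[OF B this]
  show "ssum (bR (prodB A B) v) (%w c. ssum (cD (prodC C D) c) (f w)) =
    ssum (bR (prodB A B) v) (%w y. ssum (bR (prodB A B) w) (%z x. f z x y))"
   unfolding v prod_simps ssum_plist ssum_swap_inner[where s = "bR B b"] A'
   unfolding B' ..
 next
  fix f and v :: "'v \<times> 'w" assume f: "f \<in> tri (cF (prodC C D)) (bF (prodB A B)) (cF (prodC C D))"
  obtain a b where v: "v = (a, b)" by (cases v)
  let ?G = "%x w y. ssum (bL B b) (%x' w'. ssum (bR B w') (%z' y'. f (x, x') (w, z') (y, y')))"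
  have "?G \<in> tri (cF C) (bF A) (cF C)"
   by (intro triI fs) (use f in \<open>auto simp: slices\<close>)
  note A' = bcm_LR[OF A this]
  have "(%x' z y'. f (x, x') (w, z) (y, y')) \<in> tri (cF D) (bF B) (cF D)" for x y w
   by (intro triI) (use f in \<open>auto simp: slices\<close>)
  note B' = bcm_LR[OF B this]
  show "ssum (bL (prodB A B) v) (%x w. ssum (bR (prodB A B) w) (f x)) =
    ssum (bR (prodB A B) v) (%w y. ssum (bL (prodB A B) w) (%x z. f x z y))"
   unfolding v prod_simps ssum_plist ssum_swap_inner[where s = "bL B b"]
    ssum_swap_inner[where s = "bR B b"] A'
   unfolding B' ..
 next
  fix f and v :: "'v \<times> 'w" assume f: "f \<in> bF (prodB A B)"
  obtain a b where v: "v = (a, b)" by (cases v)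
  have 1: "(%x. f (x, y)) \<in> bF A" "(%y. f (x, y)) \<in> bF B" for x y
   using f by (auto simp: slices)
  have "ssum (bL B b) (%d z. cE C c * cE D d * f (w, z)) = cE C c * f (w, b)" for c w
   using bcm_counitL[OF B 1(2)] by (simp add: mult.assoc ssum_mult_left)
  then show "ssum (bL (prodB A B) v) (%c w. cE (prodC C D) c * f w) = f v"
   using bcm_counitL[OF A 1(1)] by (simp add: v ssum_plist)
  have "ssum (bR B b) (%z d. f (w, z) * (cE C c * cE D d)) = f (w, b) * cE C c" for c w
   using bcm_counitR[OF B 1(2)] by (simp add: mult.assoc[symmetric] mult.commute[of _ "cE C c"] ssum_mult_left)
    (simp add: mult.assoc ssum_mult_left)
  then show "ssum (bR (prodB A B) v) (%w c. f w * cE (prodC C D) c) = f v"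
   using bcm_counitR[OF A 1(1)] by (simp add: v ssum_plist)
 qed
qed

lemma prodC_is_cog:
 assumes C: "is_cog C" and D: "is_cog D"
 shows "is_cog (prodC C D)"
 unfolding is_cog_def selfB_prodC
 using prodB_is_bcm[OF C D cog_bcm[OF C] cog_bcm[OF D]] cog_cE[OF C] cog_cE[OF D]
  forms_mult[OF cog_forms[OF D]] forms_mult'[OF cog_forms[OF C]]
 by (auto simp: pform_def bi_def)

section \<open>Convolution actions on forms\<close>

text \<open>\<open>Lo\<close> and \<open>Ro\<close> are the transposes of the two coactions: the
  convolution algebra of \<open>C\<close> acts on the forms of \<open>B\<close> from the left by
  \<open>Lo\<close> and from the right by \<open>Ro\<close>.\<close>

definition Lo :: "('k::field, 'c, 'v) bcm => ('c => 'k) => ('v => 'k) => 'v => 'k" where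
 "Lo B u \<phi> v = ssum (bL B v) (%c w. u c * \<phi> w)"

definition Ro :: "('k::field, 'c, 'v) bcm => ('c => 'k) => ('v => 'k) => 'v => 'k" where
 "Ro B u \<phi> v = ssum (bR B v) (%w c. \<phi> w * u c)"

definition cv :: "('k::field, 'c) cog => ('c => 'k) => ('c => 'k) => 'c => 'k" where
 "cv C u v c = ssum (cD C c) (%x y. u x * v y)"

text \<open>With \<chi> and \<xi> on pairs this is the twisted product seen by forms; with
  \<open>U\<close> and its convolution inverse it is the twisted antipode.\<close>

definition twf :: "('k::field, 'c, 'v) bcm => ('c => 'k) => ('c => 'k) => ('v => 'k) => 'v => 'k" where
 "twf B u v \<phi> = Ro B v (Lo B u \<phi>)"

text \<open>The comodule laws \<open>bcm_LL\<close> and \<open>bcm_RR\<close> give the two module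
  laws, and \<open>bcm_LR\<close> makes the actions commute. In \<open>Ro_Ro\<close> the order is
  reversed because \<open>Ro\<close> is a right action.\<close>

lemma
 assumes C: "is_cog C" and B: "is_bcm C B"
 shows Lo_form: "u \<in> cF C ==> \<phi> \<in> bF B ==> Lo B u \<phi> \<in> bF B"
  and Ro_form: "u \<in> cF C ==> \<phi> \<in> bF B ==> Ro B u \<phi> \<in> bF B"
  and Lo_Lo: "u \<in> cF C ==> v \<in> cF C ==> \<phi> \<in> bF B ==> Lo B u (Lo B v \<phi>) = Lo B (cv C u v) \<phi>"
  and Ro_Ro: "u \<in> cF C ==> v \<in> cF C ==> \<phi> \<in> bF B ==> Ro B u (Ro B v \<phi>) = Ro B (cv C v u) \<phi>"
  and Lo_Ro: "u \<in> cF C ==> v \<in> cF C ==> \<phi> \<in> bF B ==> Lo B u (Ro B v \<phi>) = Ro B v (Lo B u \<phi>)"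
  and Lo_counit: "\<phi> \<in> bF B ==> Lo B (cE C) \<phi> = \<phi>"
  and Ro_counit: "\<phi> \<in> bF B ==> Ro B (cE C) \<phi> = \<phi>"
proof -
 note fC = cog_forms[OF C] and fB = bcm_forms[OF B]
 note intros = biI triI forms_mult[OF fC] forms_mult'[OF fC] forms_mult[OF fB] forms_mult'[OF fB]
 show "Lo B u \<phi> \<in> bF B" if "u \<in> cF C" "\<phi> \<in> bF B"
  unfolding Lo_def using that by (intro bcm_bL[OF B] intros)
 show "Ro B u \<phi> \<in> bF B" if "u \<in> cF C" "\<phi> \<in> bF B"
  unfolding Ro_def using that by (intro bcm_bR[OF B] intros)
 show "Lo B u (Lo B v \<phi>) = Lo B (cv C u v) \<phi>" if "u \<in> cF C" "v \<in> cF C" "\<phi> \<in> bF B"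
 proof
  fix x
  have "(%a b c. u a * v b * \<phi> c) \<in> tri (cF C) (cF C) (bF B)"
   using that by (intro intros)
  from bcm_LL[OF B this, of x] show "Lo B u (Lo B v \<phi>) x = Lo B (cv C u v) \<phi> x"
   by (simp add: Lo_def cv_def ssum_mult_left[symmetric] ssum_mult_right[symmetric] mult.assoc)
 qed
 show "Ro B u (Ro B v \<phi>) = Ro B (cv C v u) \<phi>" if "u \<in> cF C" "v \<in> cF C" "\<phi> \<in> bF B"
 proof
  fix x
  have "(%a b c. \<phi> a * v b * u c) \<in> tri (bF B) (cF C) (cF C)"
   using that by (intro intros)
  from bcm_RR[OF B this, of x] show "Ro B u (Ro B v \<phi>) x = Ro B (cv C v u) \<phi> x"
   by (simp add: Ro_def cv_def ssum_mult_left[symmetric] ssum_mult_right[symmetric] mult.assoc)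
 qed
 show "Lo B u (Ro B v \<phi>) = Ro B v (Lo B u \<phi>)" if "u \<in> cF C" "v \<in> cF C" "\<phi> \<in> bF B"
 proof
  fix x
  have "(%a b c. u a * \<phi> b * v c) \<in> tri (cF C) (bF B) (cF C)"
   using that by (intro intros)
  from bcm_LR[OF B this, of x] show "Lo B u (Ro B v \<phi>) x = Ro B v (Lo B u \<phi>) x"
   by (simp add: Lo_def Ro_def ssum_mult_left[symmetric] ssum_mult_right[symmetric] mult.assoc)
 qed
 show "Lo B (cE C) \<phi> = \<phi>" "Ro B (cE C) \<phi> = \<phi>" if "\<phi> \<in> bF B"
  using bcm_counitL[OF B that] bcm_counitR[OF B that] by (auto simp: Lo_def Ro_def)
qed

lemma cv_Lo: "cv C u v = Lo (selfB C) u v"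
 by (simp add: cv_def Lo_def fun_eq_iff)

lemma
 assumes C: "is_cog C"
 shows cv_form: "u \<in> cF C ==> v \<in> cF C ==> cv C u v \<in> cF C"
  and cv_assoc: "u \<in> cF C ==> v \<in> cF C ==> w \<in> cF C ==> cv C (cv C u v) w = cv C u (cv C v w)"
  and cv_counitL: "u \<in> cF C ==> cv C (cE C) u = u"
  and cv_counitR: "u \<in> cF C ==> cv C u (cE C) = u"
 using Lo_form[OF C cog_bcm[OF C]] Lo_Lo[OF C cog_bcm[OF C]] Lo_counit[OF C cog_bcm[OF C]]
  cog_counitR[OF C] by (auto simp: cv_Lo) (auto simp: Lo_def)

lemma cv_inverse_unique:
 assumes C: "is_cog C" and "u \<in> cF C" "v \<in> cF C" "w \<in> cF C"
  and "cv C v u = cE C" "cv C u w = cE C"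
 shows "v = w"
 using assms cv_assoc[OF C, of v u w] cv_counitL[OF C] cv_counitR[OF C] by metis

lemma twf_form:
 assumes "is_cog C" "is_bcm C B" "u \<in> cF C" "v \<in> cF C" "\<phi> \<in> bF B"
 shows "twf B u v \<phi> \<in> bF B"
 unfolding twf_def using assms by (intro Ro_form[of C] Lo_form[of C])

text \<open>The right factors compose in the opposite order, as the inverses of the left factors do;
  so the double twist by \<chi> and \<xi> has the shape in which both the cocycle identity and its
  inverse \<open>xi_cocycle\<close> can be used.\<close>

lemma twf_twf:
 assumes C: "is_cog C" and B: "is_bcm C B" and u: "u \<in> cF C" "v \<in> cF C" "u' \<in> cF C" "v' \<in> cF C"
  and \<phi>: "\<phi> \<in> bF B"
 shows "twf B u v (twf B u' v' \<phi>) = twf B (cv C u u') (cv C v' v) \<phi>"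
proof -
 note Lf = Lo_form[OF C B] and Rf = Ro_form[OF C B]
 have "twf B u v (twf B u' v' \<phi>) = Ro B v (Ro B v' (Lo B u (Lo B u' \<phi>)))"
  unfolding twf_def using Lo_Ro[OF C B u(1) u(4) Lf[OF u(3) \<phi>]] by simp
 then show ?thesis
  unfolding twf_def using Ro_Ro[OF C B u(2) u(4) Lf[OF u(1) Lf[OF u(3) \<phi>]]] Lo_Lo[OF C B u(1) u(3) \<phi>] by simp
qed

lemma twf_counit:
 assumes "is_cog C" "is_bcm C B" "\<phi> \<in> bF B"
 shows "twf B (cE C) (cE C) \<phi> = \<phi>"
 using assms by (simp add: twf_def Lo_counit[of C B] Ro_counit[of C B])

section \<open>Morphisms\<close>

text \<open>\<open>\<theta>\<^sub>0\<close> acts on the coefficients and \<open>\<theta>\<close> on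
  the comodule. With the identity as \<open>\<theta>\<^sub>0\<close> this is bicolinearity; with
  \<open>case_prod mu\<close> it says that a product or an action is compatible with the diagonal
  coactions.\<close>

definition morph ::
 "('k::field, 'c) cog => ('k, 'd) cog => ('c => 'd) => ('v => 'w) => ('k, 'c, 'v) bcm => ('k, 'd, 'w) bcm => bool" where
 "morph C D \<theta>\<^sub>0 \<theta> A B \<longleftrightarrow>
   (\<forall>u\<in>cF D. (%c. u (\<theta>\<^sub>0 c)) \<in> cF C) \<and> (\<forall>\<phi>\<in>bF B. (%v. \<phi> (\<theta> v)) \<in> bF A) \<and>
   (\<forall>f\<in>bi (cF D) (bF B). \<forall>v. ssum (bL B (\<theta> v)) f = ssum (bL A v) (%c w. f (\<theta>\<^sub>0 c) (\<theta> w))) \<and>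
   (\<forall>f\<in>bi (bF B) (cF D). \<forall>v. ssum (bR B (\<theta> v)) f = ssum (bR A v) (%w c. f (\<theta> w) (\<theta>\<^sub>0 c)))"

abbreviation cmorph :: "('k::field, 'c) cog => ('k, 'd) cog => ('c => 'd) => bool" where
 "cmorph C D \<theta> \<equiv> morph C D \<theta> \<theta> (selfB C) (selfB D)"

lemma
 assumes "morph C D \<theta>\<^sub>0 \<theta> A B"
 shows morph_cF: "u \<in> cF D ==> (%c. u (\<theta>\<^sub>0 c)) \<in> cF C"
  and morph_bF: "\<phi> \<in> bF B ==> (%v. \<phi> (\<theta> v)) \<in> bF A"
  and morph_bL: "f \<in> bi (cF D) (bF B) ==> ssum (bL B (\<theta> v)) f = ssum (bL A v) (%c w. f (\<theta>\<^sub>0 c) (\<theta> w))"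
  and morph_bR: "g \<in> bi (bF B) (cF D) ==> ssum (bR B (\<theta> v)) g = ssum (bR A v) (%w c. g (\<theta> w) (\<theta>\<^sub>0 c))"
 using assms unfolding morph_def by blast+

lemma
 assumes D: "is_cog D" and B: "is_bcm D B" and m: "morph C D \<theta>\<^sub>0 \<theta> A B" and u: "u \<in> cF D" and \<phi>: "\<phi> \<in> bF B"
 shows Lo_morph: "Lo B u \<phi> (\<theta> v) = Lo A (%c. u (\<theta>\<^sub>0 c)) (%v. \<phi> (\<theta> v)) v"
  and Ro_morph: "Ro B u \<phi> (\<theta> v) = Ro A (%c. u (\<theta>\<^sub>0 c)) (%v. \<phi> (\<theta> v)) v"
proof -
 have "(%c w. u c * \<phi> w) \<in> bi (cF D) (bF B)" "(%w c. \<phi> w * u c) \<in> bi (bF B) (cF D)"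
  using u \<phi> bcm_forms[OF B] cog_forms[OF D] by (auto intro!: biI forms_mult forms_mult')
 then show "Lo B u \<phi> (\<theta> v) = Lo A (%c. u (\<theta>\<^sub>0 c)) (%v. \<phi> (\<theta> v)) v"
  "Ro B u \<phi> (\<theta> v) = Ro A (%c. u (\<theta>\<^sub>0 c)) (%v. \<phi> (\<theta> v)) v"
  unfolding Lo_def Ro_def using morph_bL[OF m] morph_bR[OF m] by blast+
qed

lemma twf_morph:
 assumes D: "is_cog D" and B: "is_bcm D B" and m: "morph C D \<theta>\<^sub>0 \<theta> A B"
  and u: "u \<in> cF D" "u' \<in> cF D" and \<phi>: "\<phi> \<in> bF B"
 shows "twf B u u' \<phi> (\<theta> v) = twf A (%c. u (\<theta>\<^sub>0 c)) (%c. u' (\<theta>\<^sub>0 c)) (%v. \<phi> (\<theta> v)) v"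
 unfolding twf_def Ro_morph[OF D B m u(2) Lo_form[OF D B u(1) \<phi>]] Lo_morph[OF D B m u(1) \<phi>] ..

lemma cv_morph:
 assumes D: "is_cog D" and m: "cmorph C D \<theta>" and u: "u \<in> cF D" "v \<in> cF D"
 shows "cv D u v (\<theta> c) = cv C (%c. u (\<theta> c)) (%c. v (\<theta> c)) c"
 unfolding cv_Lo using Lo_morph[OF D cog_bcm[OF D] m] u by simp

lemma morph_id: "morph C C (%x. x) (%x. x) A A"
 by (simp add: morph_def)

lemma morph_prod:
 assumes C': "is_cog C'" and D: "is_cog D" and B: "is_bcm D B" and A': "is_bcm C' A'"
  and m: "morph C D \<theta>\<^sub>0 \<theta> A B" and m': "morph C' D' \<eta>\<^sub>0 \<eta> A' B'"
 shows "morph (prodC C C') (prodC D D') (map_prod \<theta>\<^sub>0 \<eta>\<^sub>0) (map_prod \<theta> \<eta>) (prodB A A') (prodB B B')"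
proof -
 note slices = bi_def pform_def
 have 1: "\<forall>u\<in>cF (prodC D D'). (%c. u (map_prod \<theta>\<^sub>0 \<eta>\<^sub>0 c)) \<in> cF (prodC C C')"
  using morph_cF[OF m] morph_cF[OF m'] by (fastforce simp: slices)
 have 2: "\<forall>u\<in>bF (prodB B B'). (%c. u (map_prod \<theta> \<eta> c)) \<in> bF (prodB A A')"
  using morph_bF[OF m] morph_bF[OF m'] by (fastforce simp: slices)
 have 3: "ssum (bL (prodB B B') (map_prod \<theta> \<eta> v)) f = ssum (bL (prodB A A') v) (%c w. f (map_prod \<theta>\<^sub>0 \<eta>\<^sub>0 c) (map_prod \<theta> \<eta> w))"
  if f: "f \<in> bi (cF (prodC D D')) (bF (prodB B B'))" for f and v
 proof -
  obtain a b where v: "v = (a, b)" by (cases v)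
  have i: "(%d z. f (c, d) (w, z)) \<in> bi (cF D') (bF B')" for c w
   using f by (intro biI) (auto simp: slices)
  note e = morph_bL[OF m' i]
  have o: "(%c w. ssum (bL A' b) (%d z. f (c, \<eta>\<^sub>0 d) (w, \<eta> z))) \<in> bi (cF D) (bF B)"
   using f by (intro biI forms_ssum[OF bcm_forms[OF B]] forms_ssum[OF cog_forms[OF D]]) (auto simp: slices)
  show ?thesis using morph_bL[OF m o] by (simp add: v ssum_plist e)
 qed
 have 4: "ssum (bR (prodB B B') (map_prod \<theta> \<eta> v)) f = ssum (bR (prodB A A') v) (%w c. f (map_prod \<theta> \<eta> w) (map_prod \<theta>\<^sub>0 \<eta>\<^sub>0 c))"
  if f: "f \<in> bi (bF (prodB B B')) (cF (prodC D D'))" for f and v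
 proof -
  obtain a b where v: "v = (a, b)" by (cases v)
  have i: "(%z d. f (w, z) (c, d)) \<in> bi (bF B') (cF D')" for c w
   using f by (intro biI) (auto simp: slices)
  note e = morph_bR[OF m' i]
  have o: "(%w c. ssum (bR A' b) (%z d. f (w, \<eta> z) (c, \<eta>\<^sub>0 d))) \<in> bi (bF B) (cF D)"
   using f by (intro biI forms_ssum[OF bcm_forms[OF B]] forms_ssum[OF cog_forms[OF D]]) (auto simp: slices)
  show ?thesis using morph_bR[OF m o] by (simp add: v ssum_plist e)
 qed
 show ?thesis unfolding morph_def using 1 2 3 4 by blast
qed

definition assoc3 :: "('a \<times> 'b) \<times> 'c => 'a \<times> 'b \<times> 'c" where
 "assoc3 = (%((a, b), c). (a, b, c))"

lemma morph_assoc3: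
 "morph (prodC (prodC C D) E) (prodC C (prodC D E)) assoc3 assoc3
   (prodB (prodB A B) X) (prodB A (prodB B X))"
 unfolding morph_def
 by (auto simp: pform_def bi_def assoc3_def ssum_plist)

text \<open>The counit in one slot collapses the coaction of that slot. In this way a twist of a
  single factor becomes a twist of the pair and can be composed with others by
  \<open>twf_twf\<close>.\<close>

lemma
 assumes A: "is_bcm C A" and B: "is_bcm D B" and \<psi>: "\<psi> \<in> bF (prodB A B)"
 shows Lo_slice1: "Lo (prodB A B) (%(c, d). u c * cE D d) \<psi> (a, b) = Lo A u (%a. \<psi> (a, b)) a"
  and Ro_slice1: "Ro (prodB A B) (%(c, d). u c * cE D d) \<psi> (a, b) = Ro A u (%a. \<psi> (a, b)) a"
  and Lo_slice2: "Lo (prodB A B) (%(c, d). cE C c * u' d) \<psi> (a, b) = Lo B u' (%b. \<psi> (a, b)) b"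
  and Ro_slice2: "Ro (prodB A B) (%(c, d). cE C c * u' d) \<psi> (a, b) = Ro B u' (%b. \<psi> (a, b)) b"
proof -
 have 1: "(%x. \<psi> (x, y)) \<in> bF A" "(%y. \<psi> (x, y)) \<in> bF B" for x y
  using \<psi> by (auto simp: pform_def bi_def)
 have "ssum (bL B b) (%d z. u c * cE D d * \<psi> (w, z)) = u c * \<psi> (w, b)" for c w
  using bcm_counitL[OF B 1(2)] by (simp add: mult.assoc ssum_mult_left)
 then show "Lo (prodB A B) (%(c, d). u c * cE D d) \<psi> (a, b) = Lo A u (%a. \<psi> (a, b)) a"
  by (simp add: Lo_def ssum_plist)
 have "ssum (bR B b) (%z d. \<psi> (w, z) * (u c * cE D d)) = \<psi> (w, b) * u c" for c w
  using bcm_counitR[OF B 1(2)] by (simp add: mult.left_commute[of _ "u c"] ssum_mult_left mult.commute)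
 then show "Ro (prodB A B) (%(c, d). u c * cE D d) \<psi> (a, b) = Ro A u (%a. \<psi> (a, b)) a"
  by (simp add: Ro_def ssum_plist)
 have "ssum (bL A a) (%c w. cE C c * u' d * \<psi> (w, z)) = u' d * \<psi> (a, z)" for d z
  using bcm_counitL[OF A 1(1)] by (simp add: mult.assoc mult.left_commute[of _ "u' d"] ssum_mult_left)
 then show "Lo (prodB A B) (%(c, d). cE C c * u' d) \<psi> (a, b) = Lo B u' (%b. \<psi> (a, b)) b"
  by (simp add: Lo_def ssum_plist ssum_swap[of "bL A a"])
 have "ssum (bR A a) (%w c. \<psi> (w, z) * (cE C c * u' d)) = \<psi> (a, z) * u' d" for d z
  using bcm_counitR[OF A 1(1)] by (simp add: mult.assoc[symmetric] ssum_mult_right)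
 then show "Ro (prodB A B) (%(c, d). cE C c * u' d) \<psi> (a, b) = Ro B u' (%b. \<psi> (a, b)) b"
  by (simp add: Ro_def ssum_plist ssum_swap[of "bR A a"])
qed

lemma
 assumes C: "is_cog C" and D: "is_cog D" and A: "is_bcm C A" and B: "is_bcm D B" and \<psi>: "\<psi> \<in> bF (prodB A B)"
 shows twf_slice1: "u \<in> cF C ==> twf (prodB A B) (%(c, d). u c * cE D d) (%(c, d). u' c * cE D d) \<psi> (a, b) =
   twf A u u' (%a. \<psi> (a, b)) a"
  and twf_slice2: "v \<in> cF D ==> twf (prodB A B) (%(c, d). cE C c * v d) (%(c, d). cE C c * v' d) \<psi> (a, b) =
   twf B v v' (%b. \<psi> (a, b)) b"
proof -
 note P = prodC_is_cog[OF C D] prodB_is_bcm[OF C D A B]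
 note f = cog_cE[OF C] cog_cE[OF D] cog_forms[OF C] cog_forms[OF D]
 show "twf (prodB A B) (%(c, d). u c * cE D d) (%(c, d). u' c * cE D d) \<psi> (a, b) =
   twf A u u' (%a. \<psi> (a, b)) a" if "u \<in> cF C"
 proof -
  have "(%(c, d). u c * cE D d) \<in> cF (prodC C D)"
   using f that by (auto intro!: pformI forms_mult forms_mult')
  note Ro_slice1[OF A B Lo_form[OF P this \<psi>]]
  then show ?thesis by (simp add: twf_def Lo_slice1[OF A B \<psi>])
 qed
 show "twf (prodB A B) (%(c, d). cE C c * v d) (%(c, d). cE C c * v' d) \<psi> (a, b) =
   twf B v v' (%b. \<psi> (a, b)) b" if "v \<in> cF D"
 proof -
  have "(%(c, d). cE C c * v d) \<in> cF (prodC C D)"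
   using f that by (auto intro!: pformI forms_mult forms_mult')
  note Ro_slice2[OF A B Lo_form[OF P this \<psi>]]
  then show ?thesis by (simp add: twf_def Lo_slice2[OF A B \<psi>])
 qed
qed

lemma cv_tensor:
 "cv (prodC C D) (%(c, d). u c * v d) (%(c, d). u' c * v' d) = (%(c, d). cv C u u' c * cv D v v' d)"
proof -
 have "ssum r (%x y. ssum s (%a b. u x * v a * (u' y * v' b))) =
  ssum r (%x y. u x * u' y) * ssum s (%a b. v a * v' b)" for r s
  by (simp add: ssum_mult_right[symmetric]) (simp add: ssum_mult_left[symmetric] mult_ac)
 then show ?thesis by (auto simp: cv_def fun_eq_iff ssum_plist)
qed

section \<open>Splittings with a balanced middle leg\<close>

text \<open>
 \<open>D\<close> is a map \<open>V \<rightarrow> V' \<otimes> V''\<close> into the cotensor product over \<open>C\<close> that respects the outer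
 coactions.  Coproducts and coactions are of this kind; on them the two cocycle factors in the
 middle of a twisted product cancel.
\<close>

definition cosplit ::
 "('k::field, 'c) cog => ('k, 'c, 'v) bcm => ('k, 'c, 'x) bcm => ('k, 'c, 'y) bcm => ('v => ('x \<times> 'y) list) => bool" where
 "cosplit C V V' V'' D \<longleftrightarrow>
   (\<forall>f\<in>bi (bF V') (bF V''). (%v. ssum (D v) f) \<in> bF V) \<and>
   (\<forall>f\<in>tri (cF C) (bF V') (bF V''). \<forall>v.
    ssum (bL V v) (%c w. ssum (D w) (%x y. f c x y)) = ssum (D v) (%x y. ssum (bL V' x) (%c x'. f c x' y))) \<and>
   (\<forall>f\<in>tri (bF V') (bF V'') (cF C). \<forall>v.
    ssum (bR V v) (%w c. ssum (D w) (%x y. f x y c)) = ssum (D v) (%x y. ssum (bR V'' y) (%y' c. f x y' c))) \<and>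
   (\<forall>f\<in>tri (bF V') (cF C) (bF V''). \<forall>v.
    ssum (D v) (%x y. ssum (bR V' x) (%x' c. f x' c y)) = ssum (D v) (%x y. ssum (bL V'' y) (%c y'. f x c y')))"

lemma
 assumes "cosplit C V V' V'' D"
 shows cosplit_form: "f \<in> bi (bF V') (bF V'') ==> (%v. ssum (D v) f) \<in> bF V"
  and cosplit_L: "g \<in> tri (cF C) (bF V') (bF V'') ==>
    ssum (bL V v) (%c w. ssum (D w) (%x y. g c x y)) = ssum (D v) (%x y. ssum (bL V' x) (%c x'. g c x' y))"
  and cosplit_R: "g' \<in> tri (bF V') (bF V'') (cF C) ==>
    ssum (bR V v) (%w c. ssum (D w) (%x y. g' x y c)) = ssum (D v) (%x y. ssum (bR V'' y) (%y' c. g' x y' c))"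
  and cosplit_M: "g'' \<in> tri (bF V') (cF C) (bF V'') ==>
    ssum (D v) (%x y. ssum (bR V' x) (%x' c. g'' x' c y)) = ssum (D v) (%x y. ssum (bL V'' y) (%c y'. g'' x c y'))"
 using assms unfolding cosplit_def by blast+

text \<open>Both the outer left condition and the balancing in the middle are \<open>bcm_LL\<close>;
  the outer right condition is \<open>bcm_LR\<close>.\<close>

lemma cosplit_bL: "is_cog C ==> is_bcm C B ==> cosplit C B (selfB C) B (bL B)"
 unfolding cosplit_def
proof (intro conjI ballI allI)
 assume C: "is_cog C" and B: "is_bcm C B"
 show "(%v. ssum (bL B v) f) \<in> bF B" if "f \<in> bi (bF (selfB C)) (bF B)" for f
  using bcm_bL[OF B] that by simp
 show "ssum (bL B v) (%c w. ssum (bL B w) (f c)) = ssum (bL B v) (%x y. ssum (bL (selfB C) x) (%c x'. f c x' y))"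
  if "f \<in> tri (cF C) (bF (selfB C)) (bF B)" for f v
  using bcm_LL[OF B] that by simp
 show "ssum (bR B v) (%w c. ssum (bL B w) (%x y. f x y c)) = ssum (bL B v) (%x y. ssum (bR B y) (f x))"
  if "f \<in> tri (bF (selfB C)) (bF B) (cF C)" for f v
  using bcm_LR[OF B] that by simp
 show "ssum (bL B v) (%x y. ssum (bR (selfB C) x) (%x' c. f x' c y)) = ssum (bL B v) (%x y. ssum (bL B y) (f x))"
  if "f \<in> tri (bF (selfB C)) (cF C) (bF B)" for f v
  using bcm_LL[OF B] that by simp
qed

lemma cosplit_bR: "is_cog C ==> is_bcm C B ==> cosplit C B B (selfB C) (bR B)"
 unfolding cosplit_def
proof (intro conjI ballI allI)
 assume C: "is_cog C" and B: "is_bcm C B"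
 show "(%v. ssum (bR B v) f) \<in> bF B" if "f \<in> bi (bF B) (bF (selfB C))" for f
  using bcm_bR[OF B] that by simp
 show "ssum (bL B v) (%c w. ssum (bR B w) (f c)) = ssum (bR B v) (%x y. ssum (bL B x) (%c x'. f c x' y))"
  if "f \<in> tri (cF C) (bF B) (bF (selfB C))" for f v
  using bcm_LR[OF B] that by simp
 show "ssum (bR B v) (%w c. ssum (bR B w) (%x y. f x y c)) = ssum (bR B v) (%x y. ssum (bR (selfB C) y) (f x))"
  if "f \<in> tri (bF B) (bF (selfB C)) (cF C)" for f v
  using bcm_RR[OF B] that by simp
 show "ssum (bR B v) (%x y. ssum (bR B x) (%x' c. f x' c y)) = ssum (bR B v) (%x y. ssum (bL (selfB C) y) (f x))"
  if "f \<in> tri (bF B) (cF C) (bF (selfB C))" for f v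
  using bcm_RR[OF B] that by simp
qed

lemma cosplit_prod:
 fixes A :: "('k::field, 'c, 'v) bcm" and B :: "('k, 'd, 'w) bcm"
 assumes C: "is_cog C" and D: "is_cog D" and A: "is_bcm C A" and B: "is_bcm D B"
  and A1: "is_bcm C A1" and A2: "is_bcm C A2"
  and a: "cosplit C A A1 A2 dA" and b: "cosplit D B B1 B2 dB"
 shows "cosplit (prodC C D) (prodB A B) (prodB A1 B1) (prodB A2 B2) (%(x, y). plist (dA x) (dB y))"
proof -
 note slices = bi_def tri_def pform_def
 note fs = forms_ssum[OF bcm_forms[OF A]] forms_ssum[OF bcm_forms[OF B]] forms_ssum[OF bcm_forms[OF A1]]
  forms_ssum[OF bcm_forms[OF A2]] forms_ssum[OF cog_forms[OF C]]
 show ?thesis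
  unfolding cosplit_def
 proof (intro conjI ballI allI)
  fix f assume f: "f \<in> bi (bF (prodB A1 B1)) (bF (prodB A2 B2))"
  have "(%(a, b). ssum (dA a) (%c w. ssum (dB b) (%d z. f (c, d) (w, z)))) \<in> pform (bF A) (bF B)"
   by (intro pformI, unfold prod.case)
    (intro cosplit_form[OF a] cosplit_form[OF b] fs biI; use f in \<open>auto simp: slices\<close>)+
  then show "(%v. ssum (case v of (x, y) => plist (dA x) (dB y)) f) \<in> bF (prodB A B)"
   by (simp add: case_prod_beta' ssum_plist)
 next
  fix f and v :: "'v \<times> 'w" assume f: "f \<in> tri (cF (prodC C D)) (bF (prodB A1 B1)) (bF (prodB A2 B2))"
  obtain p q where v: "v = (p, q)" by (cases v)
  let ?G = "%x y w. ssum (bL B q) (%x' z. ssum (dB z) (%y' z'. f (x, x') (y, y') (w, z')))"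
  have "?G \<in> tri (cF C) (bF A1) (bF A2)"
   by (intro triI fs) (use f in \<open>auto simp: slices\<close>)
  note A' = cosplit_L[OF a this]
  have "(%x' y' z. f (x, x') (y, y') (w, z)) \<in> tri (cF D) (bF B1) (bF B2)" for x y w
   by (intro triI) (use f in \<open>auto simp: slices\<close>)
  note B' = cosplit_L[OF b this]
  show "ssum (bL (prodB A B) v) (%c w. ssum (case w of (x, y) => plist (dA x) (dB y)) (f c)) =
    ssum (case v of (x, y) => plist (dA x) (dB y)) (%x y. ssum (bL (prodB A1 B1) x) (%c x'. f c x' y))"
   unfolding v prod_simps ssum_plist prod.case ssum_swap_inner[where s = "bL B q"] A'
   unfolding B' ssum_swap_inner[where s = "dB q"] ..
 next
  fix f and v :: "'v \<times> 'w" assume f: "f \<in> tri (bF (prodB A1 B1)) (bF (prodB A2 B2)) (cF (prodC C D))"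
  obtain p q where v: "v = (p, q)" by (cases v)
  let ?G = "%x y w. ssum (bR B q) (%z z'. ssum (dB z) (%x' y'. f (x, x') (y, y') (w, z')))"
  have "?G \<in> tri (bF A1) (bF A2) (cF C)"
   by (intro triI fs) (use f in \<open>auto simp: slices\<close>)
  note A' = cosplit_R[OF a this]
  have "(%x' y' z. f (x, x') (y, y') (w, z)) \<in> tri (bF B1) (bF B2) (cF D)" for x y w
   by (intro triI) (use f in \<open>auto simp: slices\<close>)
  note B' = cosplit_R[OF b this]
  show "ssum (bR (prodB A B) v) (%w c. ssum (case w of (x, y) => plist (dA x) (dB y)) (%x y. f x y c)) =
    ssum (case v of (x, y) => plist (dA x) (dB y)) (%x y. ssum (bR (prodB A2 B2) y) (f x))"
   unfolding v prod_simps ssum_plist prod.case ssum_swap_inner[where s = "bR B q"] A'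
   unfolding B' ssum_swap_inner[where s = "dB q"] ..
 next
  fix f and v :: "'v \<times> 'w" assume f: "f \<in> tri (bF (prodB A1 B1)) (cF (prodC C D)) (bF (prodB A2 B2))"
  obtain p q where v: "v = (p, q)" by (cases v)
  let ?G = "%x y w. ssum (dB q) (%x' z'. ssum (bR B1 x') (%x' y'. f (x, x') (y, y') (w, z')))"
  have "?G \<in> tri (bF A1) (cF C) (bF A2)"
   by (intro triI fs) (use f in \<open>auto simp: slices\<close>)
  note A' = cosplit_M[OF a this]
  have "(%x' y' z. f (x, x') (y, y') (w, z)) \<in> tri (bF B1) (cF D) (bF B2)" for x y w
   by (intro triI) (use f in \<open>auto simp: slices\<close>)
  note B' = cosplit_M[OF b this]
  show "ssum (case v of (x, y) => plist (dA x) (dB y)) (%x y. ssum (bR (prodB A1 B1) x) (%x' c. f x' c y)) =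
    ssum (case v of (x, y) => plist (dA x) (dB y)) (%x y. ssum (bL (prodB A2 B2) y) (f x))"
   unfolding v prod_simps ssum_plist prod.case ssum_swap_inner[where s = "dB q"] A'
   unfolding B' ..
 qed
qed

text \<open>Twisting both factors puts \<open>u\<close> and \<open>v\<close> on the outside and, in
  the middle, \<open>v\<close> on the right of the first factor and \<open>u\<close> on the left of
  the second. Balancing moves that \<open>v\<close> across to the second factor, where it meets
  \<open>u\<close> and \<open>cv C v u = cE C\<close> removes both.\<close>

theorem twf_cosplit:
 fixes V' :: "('k::field, 'c, 'x) bcm" and V'' :: "('k, 'c, 'y) bcm"
 assumes C: "is_cog C" and V: "is_bcm C V" and V': "is_bcm C V'" and V'': "is_bcm C V''"
  and D: "cosplit C V V' V'' D" and u: "u \<in> cF C" and v: "v \<in> cF C" and vu: "cv C v u = cE C"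
  and F: "F \<in> bi (bF V') (bF V'')"
 shows "twf V u v (%x. ssum (D x) F) x =
  ssum (D x) (%y z. twf V' u v (%y. twf V'' u v (F y) z) y)"
proof -
 note fC = cog_forms[OF C] and f' = bcm_forms[OF V'] and f'' = bcm_forms[OF V'']
 \<comment> \<open>The digit names the factor and the letter the side on which a function on
   \<open>C\<close> acts; \<open>DF\<close> composes a form on pairs with the splitting.\<close>
 define L1 where "L1 w G = (%y z. Lo V' w (%y. G y z) y)" for w and G :: "'x => 'y => 'k"
 define R1 where "R1 w G = (%y z. Ro V' w (%y. G y z) y)" for w and G :: "'x => 'y => 'k"
 define L2 where "L2 w G = (%y z. Lo V'' w (G y) z)" for w and G :: "'x => 'y => 'k"
 define R2 where "R2 w G = (%y z. Ro V'' w (G y) z)" for w and G :: "'x => 'y => 'k"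
 define DF where "DF G = (%x. ssum (D x) G)" for G :: "'x => 'y => 'k"
 let ?B = "bi (bF V') (bF V'')"
 have L1b: "L1 w G \<in> ?B" if w: "w \<in> cF C" and G: "G \<in> ?B" for w G
  unfolding L1_def Lo_def
  by (intro biI forms_ssum[OF f''] forms_mult[OF f''] forms_mult'[OF f''] bi2[OF G],
   fold Lo_def, intro Lo_form[OF C V' w bi1[OF G]])
 have R1b: "R1 w G \<in> ?B" if w: "w \<in> cF C" and G: "G \<in> ?B" for w G
  unfolding R1_def Ro_def
  by (intro biI forms_ssum[OF f''] forms_mult[OF f''] forms_mult'[OF f''] bi2[OF G],
   fold Ro_def, intro Ro_form[OF C V' w bi1[OF G]])
 have L2b: "L2 w G \<in> ?B" if w: "w \<in> cF C" and G: "G \<in> ?B" for w G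
  unfolding L2_def Lo_def
  by (intro biI forms_ssum[OF f'] forms_mult[OF f'] forms_mult'[OF f'] bi1[OF G],
   fold Lo_def, intro Lo_form[OF C V'' w bi2[OF G]])
 have R2b: "R2 w G \<in> ?B" if w: "w \<in> cF C" and G: "G \<in> ?B" for w G
  unfolding R2_def Ro_def
  by (intro biI forms_ssum[OF f'] forms_mult[OF f'] forms_mult'[OF f'] bi1[OF G],
   fold Ro_def, intro Ro_form[OF C V'' w bi2[OF G]])
 have DL: "DF (L1 w G) = Lo V w (DF G)" if "w \<in> cF C" "G \<in> ?B" for w G
 proof
  fix x
  have "(%c x y. w c * G x y) \<in> tri (cF C) (bF V') (bF V'')"
   by (intro triI forms_mult[OF f'] forms_mult[OF f''] forms_mult'[OF fC] bi1[OF that(2)] bi2[OF that(2)] that(1))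
  from cosplit_L[OF D this, of x] show "DF (L1 w G) x = Lo V w (DF G) x"
   by (simp add: DF_def L1_def Lo_def ssum_mult_left)
 qed
 have DR: "DF (R2 w G) = Ro V w (DF G)" if "w \<in> cF C" "G \<in> ?B" for w G
 proof
  fix x
  have "(%x y c. G x y * w c) \<in> tri (bF V') (bF V'') (cF C)"
   by (intro triI forms_mult'[OF f'] forms_mult'[OF f''] forms_mult[OF fC] bi1[OF that(2)] bi2[OF that(2)] that(1))
  from cosplit_R[OF D this, of x] show "DF (R2 w G) x = Ro V w (DF G) x"
   by (simp add: DF_def R2_def Ro_def ssum_mult_right)
 qed
 \<comment> \<open>The balancing in the middle: a right action on the first factor equals a left
   action on the second.\<close>
 have DM: "DF (R1 w G) = DF (L2 w G)" if "w \<in> cF C" "G \<in> ?B" for w G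
 proof
  fix x
  have "(%x c y. G x y * w c) \<in> tri (bF V') (cF C) (bF V'')"
   by (intro triI forms_mult'[OF f'] forms_mult'[OF f''] forms_mult[OF fC] bi1[OF that(2)] bi2[OF that(2)] that(1))
  from cosplit_M[OF D this, of x] show "DF (R1 w G) x = DF (L2 w G) x"
   by (simp add: DF_def R1_def L2_def Ro_def Lo_def mult.commute)
 qed
 let ?G = "R2 v (L2 u F)"
 have G: "?G \<in> ?B" using u v F L2b R2b by simp
 \<comment> \<open>The cancellation: after commuting past \<open>R2\<close>, \<open>L2 v\<close>
   meets \<open>L2 u\<close>.\<close>
 have "L2 v ?G = R2 v (L2 v (L2 u F))"
  unfolding L2_def R2_def using Lo_Ro[OF C V'' v v Lo_form[OF C V'' u bi2[OF F]]] by simp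
 also have "L2 v (L2 u F) = F"
  unfolding L2_def using Lo_Lo[OF C V'' v u bi2[OF F]] Lo_counit[OF C V'' bi2[OF F]] vu by simp
 finally have *: "L2 v ?G = R2 v F" .
 have "R1 v (L1 u ?G) = L1 u (R1 v ?G)"
  unfolding L1_def R1_def using Lo_Ro[OF C V' u v bi1[OF G]] by (simp add: fun_eq_iff)
 then have "DF (R1 v (L1 u ?G)) = Lo V u (DF (L2 v ?G))"
  using DL[OF u R1b[OF v G]] DM[OF v G] by simp
 also have "... = Lo V u (Ro V v (DF F))"
  unfolding * using DR[OF v F] by simp
 also have "... = twf V u v (DF F)"
  unfolding twf_def by (rule Lo_Ro[OF C V u v]) (simp add: DF_def cosplit_form[OF D F])
 finally have "DF (R1 v (L1 u ?G)) = twf V u v (DF F)" .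
 from fun_cong[OF this, of x] show ?thesis
  by (simp add: DF_def twf_def R1_def L1_def R2_def L2_def)
qed

section \<open>Cocycle twists of bilinear maps\<close>

text \<open>\<open>mu_morph\<close> is multiplicativity of the coproduct. \<open>separating\<close>
  turns identities that were proved on forms back into equalities of elements.\<close>

locale bialg =
 fixes C :: "('k::field, 'c) cog" and mu :: "'c => 'c => 'c" and e :: 'c
 assumes cog: "is_cog C"
  and mu_morph: "cmorph (prodC C C) C (case_prod mu)"
  and mu_counit: "cE C (mu a b) = cE C a * cE C b"
  and mu_assoc: "mu (mu a b) c = mu a (mu b c)"
  and mu_unit: "mu e a = a" "mu a e = a"
  and unit_group: "f \<in> bi (cF C) (cF C) ==> ssum (cD C e) f = f e e"
  and unit_counit: "cE C e = 1"
  and separating: "(!!\<phi>. \<phi> \<in> cF C ==> \<phi> a = \<phi> b) ==> a = b"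
begin

abbreviation "CC \<equiv> prodC C C"
abbreviation "CCC \<equiv> prodC CC C"

lemmas CC = prodC_is_cog[OF cog cog]
lemmas CCC = prodC_is_cog[OF CC cog]

text \<open>Together with the next three definitions, the four ways to make a function of three
  arguments from one of two, as in a cochain complex. In the convolution algebra of
  \<open>CCC\<close> the cocycle identity reads \<open>cv CCC (c23 \<chi>) (c1m \<chi>) = cv CCC
  (c12 \<chi>) (cm1 \<chi>)\<close>.\<close>

definition c12 :: "('c \<times> 'c => 'k) => ('c \<times> 'c) \<times> 'c => 'k" where
 "c12 u = (%(p, c). u p * cE C c)"
definition c23 :: "('c \<times> 'c => 'k) => ('c \<times> 'c) \<times> 'c => 'k" where
 "c23 u = (%t. (%(a, p). cE C a * u p) (assoc3 t))"
definition cm1 :: "('c \<times> 'c => 'k) => ('c \<times> 'c) \<times> 'c => 'k" where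
 "cm1 u = (%t. u (map_prod (case_prod mu) (%x. x) t))"
definition c1m :: "('c \<times> 'c => 'k) => ('c \<times> 'c) \<times> 'c => 'k" where
 "c1m u = (%t. u (map_prod (%x. x) (case_prod mu) (assoc3 t)))"

lemma morph_m1: "cmorph CCC CC (map_prod (case_prod mu) (%x. x))"
 unfolding selfB_prodC[of CC] selfB_prodC[of C]
 using morph_prod[OF cog cog cog_bcm[OF cog] cog_bcm[OF cog] mu_morph[unfolded selfB_prodC] morph_id]
 by (simp add: selfB_prodC)

lemma morph_1m: "cmorph (prodC C CC) CC (map_prod (%x. x) (case_prod mu))"
 unfolding selfB_prodC[of C CC] selfB_prodC[of C C]
 using morph_prod[OF CC cog cog_bcm[OF cog] cog_bcm[OF CC] morph_id mu_morph]
 by (simp add: selfB_prodC)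

lemma morph_al: "cmorph CCC (prodC C CC) assoc3"
 unfolding selfB_prodC by (rule morph_assoc3)

lemma
 assumes u: "u \<in> cF CC"
 shows c12_form: "c12 u \<in> cF CCC" and c23_form: "c23 u \<in> cF CCC"
  and cm1_form: "cm1 u \<in> cF CCC" and c1m_form: "c1m u \<in> cF CCC"
proof -
 note f = cog_cE[OF cog] cog_forms[OF cog] cog_forms[OF CC]
 show "c12 u \<in> cF CCC" unfolding c12_def prod_simps(1)[of CC]
  using u f by (auto intro!: pformI[of _ "pform _ _"] forms_mult forms_mult')
 have "(%(a, p). cE C a * u p) \<in> cF (prodC C CC)" unfolding prod_simps(1)[of C CC]
  using u f by (auto intro!: pformI[of _ _ "pform _ _"] forms_mult forms_mult')
 then show "c23 u \<in> cF CCC" unfolding c23_def by (rule morph_cF[OF morph_al])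
 show "cm1 u \<in> cF CCC" unfolding cm1_def by (rule morph_cF[OF morph_m1 u])
 show "c1m u \<in> cF CCC" unfolding c1m_def
  by (rule morph_cF[OF morph_al morph_cF[OF morph_1m u]])
qed

lemma cE_CC_mu: "cE CC (map_prod (case_prod mu) (%x. x) t) = cE CCC t"
 "cE CC (map_prod (%x. x) (case_prod mu) (assoc3 t)) = cE CCC t"
 "(case assoc3 t of (a, p) => cE C a * cE CC p) = cE CCC t"
 by (cases t; cases "fst t"; simp add: mu_counit assoc3_def)+

text \<open>The four maps are unital homomorphisms of convolution algebras, being built from
  pullbacks along coalgebra maps and tensoring with the counit; hence they preserve
  inverses.\<close>

lemma
 assumes u: "u \<in> cF CC" "v \<in> cF CC" and inv: "cv CC u v = cE CC"
 shows c12_inv: "cv CCC (c12 u) (c12 v) = cE CCC"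
  and c23_inv: "cv CCC (c23 u) (c23 v) = cE CCC"
  and cm1_inv: "cv CCC (cm1 u) (cm1 v) = cE CCC"
  and c1m_inv: "cv CCC (c1m u) (c1m v) = cE CCC"
proof -
 note EE = cv_counitL[OF cog cog_cE[OF cog]]
 show "cv CCC (c12 u) (c12 v) = cE CCC"
  unfolding c12_def cv_tensor inv EE by (auto simp: fun_eq_iff)
 show "cv CCC (c23 u) (c23 v) = cE CCC"
 proof
  fix t
  have "(%(a, p). cE C a * u p) \<in> cF (prodC C CC)" if "u \<in> cF CC" for u
   unfolding prod_simps(1)[of C CC] using that cog_cE[OF cog] cog_forms[OF cog] cog_forms[OF CC]
   by (auto intro!: pformI[of _ _ "pform _ _"] forms_mult forms_mult')
  from cv_morph[OF prodC_is_cog[OF cog CC] morph_al this[OF u(1)] this[OF u(2)], of t]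
  show "cv CCC (c23 u) (c23 v) t = cE CCC t"
   unfolding c23_def cv_tensor inv EE cE_CC_mu by simp
 qed
 show "cv CCC (cm1 u) (cm1 v) = cE CCC"
  using cv_morph[OF CC morph_m1 u] unfolding cm1_def inv cE_CC_mu by (simp add: fun_eq_iff)
 show "cv CCC (c1m u) (c1m v) = cE CCC"
 proof
  fix t
  show "cv CCC (c1m u) (c1m v) t = cE CCC t"
   unfolding c1m_def cv_morph[OF prodC_is_cog[OF cog CC] morph_al morph_cF[OF morph_1m u(1)] morph_cF[OF morph_1m u(2)], symmetric]
    cv_morph[OF CC morph_1m u, symmetric] inv cE_CC_mu ..
 qed
qed

end

text \<open>\<open>t\<close> is the bilinear map \<open>m\<close> with the product twisted by \<open>u\<close> on the left and \<open>v\<close> on the right.\<close>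

definition is_tw ::
 "('c \<times> 'c => 'k) => ('c \<times> 'c => 'k) => ('k::field, 'c, 'a) bcm => ('k, 'c, 'b) bcm => ('p => 'k) set =>
  ('a => 'b => 'p) => ('a => 'b => 'p) => bool" where
 "is_tw u v A B F m t \<longleftrightarrow> (\<forall>\<phi>\<in>F. \<forall>a b. \<phi> (t a b) = twf (prodB A B) u v (%(a, b). \<phi> (m a b)) (a, b))"

lemma is_twD: "is_tw u v A B F m t ==> \<phi> \<in> F ==>
  \<phi> (t a b) = twf (prodB A B) u v (%(a, b). \<phi> (m a b)) (a, b)"
 by (auto simp: is_tw_def)

lemma is_tw_form:
 assumes C: "is_cog C" and A: "is_bcm C A" and B: "is_bcm C B" and u: "u \<in> cF (prodC C C)" "v \<in> cF (prodC C C)"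
  and t: "is_tw u v A B F m t" and \<phi>: "\<phi> \<in> F" and m: "(%(a, b). \<phi> (m a b)) \<in> pform (bF A) (bF B)"
 shows "(%(a, b). \<phi> (t a b)) \<in> pform (bF A) (bF B)"
proof -
 have "(%(a, b). \<phi> (t a b)) = twf (prodB A B) u v (%(a, b). \<phi> (m a b))"
  using is_twD[OF t \<phi>] by (auto simp: fun_eq_iff)
 then show ?thesis
  using twf_form[OF prodC_is_cog[OF C C] prodB_is_bcm[OF C C A B] u] m by simp
qed

text \<open>The cocycle factors see only the coefficients, which bicolinear maps leave alone. Hence
  maps that intertwine two bilinear maps also intertwine their twists; this is the action of the
  functor on morphisms.\<close>

lemma is_tw_natural:
 assumes C: "is_cog C" and A': "is_bcm C A'" and B: "is_bcm C B" and B': "is_bcm C B'"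
  and \<theta>: "morph C C (%x. x) \<theta> A A'" and \<eta>: "morph C C (%x. x) \<eta> B B'"
  and u: "u \<in> cF (prodC C C)" "v \<in> cF (prodC C C)"
  and t: "is_tw u v A B F m t" and t': "is_tw u v A' B' F' m' t'"
  and \<phi>: "\<phi> \<in> F'" "(%x. \<phi> (\<zeta> x)) \<in> F" and m': "(%(a, b). \<phi> (m' a b)) \<in> pform (bF A') (bF B')"
  and eq: "!!a b. \<zeta> (m a b) = m' (\<theta> a) (\<eta> b)"
 shows "\<phi> (\<zeta> (t a b)) = \<phi> (t' (\<theta> a) (\<eta> b))"
proof -
 note mm = morph_prod[OF C C A' B \<theta> \<eta>]
 have "\<phi> (\<zeta> (t a b)) = twf (prodB A B) u v (%(a, b). \<phi> (m' (\<theta> a) (\<eta> b))) (a, b)"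
  using is_twD[OF t \<phi>(2)] by (simp add: eq)
 also have "... = twf (prodB A' B') u v (%(a, b). \<phi> (m' a b)) (map_prod \<theta> \<eta> (a, b))"
  using twf_morph[OF prodC_is_cog[OF C C] prodB_is_bcm[OF C C A' B'] mm u, of "%(a, b). \<phi> (m' a b)" "(a, b)"] m'
  by (simp add: case_prod_beta' map_prod_def)
 also have "... = \<phi> (t' (\<theta> a) (\<eta> b))"
  using is_twD[OF t' \<phi>(1)] by simp
 finally show ?thesis .
qed

locale cocycle = bialg C mu e for C :: "('k::field, 'c) cog" and mu e +
 fixes \<chi> \<xi> :: "'c \<times> 'c => 'k"
 assumes chi: "\<chi> \<in> cF CC" and xi: "\<xi> \<in> cF CC"
  and chi_xi: "cv CC \<chi> \<xi> = cE CC" and xi_chi: "cv CC \<xi> \<chi> = cE CC"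
  and two_cocycle: "cv CCC (c23 \<chi>) (c1m \<chi>) = cv CCC (c12 \<chi>) (cm1 \<chi>)"
  and chi_unitL: "\<chi> (e, h) = cE C h"
begin

text \<open>Invert both sides of the cocycle identity in the convolution algebra: factors are
  inverted in reverse order, and inverses are unique.\<close>

lemma xi_cocycle: "cv CCC (c1m \<xi>) (c23 \<xi>) = cv CCC (cm1 \<xi>) (c12 \<xi>)"
proof (rule cv_inverse_unique[OF CCC, where u = "cv CCC (c23 \<chi>) (c1m \<chi>)"])
 note f = c12_form c23_form cm1_form c1m_form
 note fc = f[OF chi] f[OF xi]
 note i = c12_inv c23_inv cm1_inv c1m_inv
 note inv = i[OF chi xi chi_xi] i[OF xi chi xi_chi]
 show "cv CCC (c23 \<chi>) (c1m \<chi>) \<in> cF CCC" "cv CCC (c1m \<xi>) (c23 \<xi>) \<in> cF CCC" "cv CCC (cm1 \<xi>) (c12 \<xi>) \<in> cF CCC"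
  by (intro cv_form[OF CCC] fc)+
 have *: "cv CCC (cv CCC a b) (cv CCC b' a') = cE CCC"
  if "a \<in> cF CCC" "b \<in> cF CCC" "a' \<in> cF CCC" "b' \<in> cF CCC" "cv CCC b b' = cE CCC" "cv CCC a a' = cE CCC" for a b a' b'
 proof -
  have "cv CCC (cv CCC a b) (cv CCC b' a') = cv CCC a (cv CCC (cv CCC b b') a')"
   unfolding cv_assoc[OF CCC that(1,2) cv_form[OF CCC that(4,3)]] cv_assoc[OF CCC that(2,4,3)] ..
  then show ?thesis unfolding that(5) cv_counitL[OF CCC that(3)] that(6) .
 qed
 show "cv CCC (cv CCC (c1m \<xi>) (c23 \<xi>)) (cv CCC (c23 \<chi>) (c1m \<chi>)) = cE CCC"
  using *[OF fc(8,6,4,2)] inv by simp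
 show "cv CCC (cv CCC (c23 \<chi>) (c1m \<chi>)) (cv CCC (cm1 \<xi>) (c12 \<xi>)) = cE CCC"
  unfolding two_cocycle using *[OF fc(1,3,5,7)] inv by simp
qed

text \<open>At (e, h) the identity \<xi> * \<chi> = \<epsilon> keeps \<open>e\<close> in both first
  arguments, since \<open>e\<close> is grouplike, and \<chi>(e, -) is the counit.\<close>

lemma xi_unitL: "\<xi> (e, h) = cE C h"
proof -
 have x: "(%h. \<xi> (e, h)) \<in> cF C" and x': "(%c. \<xi> (c, h)) \<in> cF C" for h using xi by (auto simp: pform_def bi_def)
 have c: "(%h. \<chi> (h, a)) \<in> cF C" for a using chi by (auto simp: pform_def bi_def)
 have "cv CC \<xi> \<chi> (e, h) = ssum (cD C e) (%a b. ssum (cD C h) (%c d. \<xi> (a, c) * \<chi> (b, d)))"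
  by (simp add: cv_def ssum_plist)
 also have "... = ssum (cD C h) (%c d. \<xi> (e, c) * \<chi> (e, d))"
  using x' c by (intro unit_group biI forms_ssum[OF cog_forms[OF cog]] forms_mult[OF cog_forms[OF cog]]
    forms_mult'[OF cog_forms[OF cog]]) auto
 also have "... = \<xi> (e, h)"
  using cog_counitR[OF cog x] by (simp add: chi_unitL)
 finally show ?thesis by (simp add: xi_chi unit_counit)
qed

lemma two_cocycle_at:
 "ssum (cD C g) (%g1 g2. ssum (cD C f) (%f1 f2. \<chi> (g1, f1) * \<chi> (h, mu g2 f2))) =
  ssum (cD C h) (%h1 h2. ssum (cD C g) (%g1 g2. \<chi> (h1, g1) * \<chi> (mu h2 g2, f)))"
proof -
 have x: "(%h. \<chi> (h, a)) \<in> cF C" "(%a. \<chi> (h, a)) \<in> cF C" for h a using chi by (auto simp: pform_def bi_def)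
 have 1: "ssum (cD C h) (%h1 h2. cE C h1 * A * \<chi> (h2, a)) = A * \<chi> (h, a)" for A a
  using cog_counitL[OF cog x(1)] by (simp add: mult.assoc mult.left_commute[of _ A] ssum_mult_left)
 have 2: "ssum (cD C f) (%f1 f2. A * cE C f1 * \<chi> (a, f2)) = A * \<chi> (a, f)" for A a
  using cog_counitL[OF cog x(2)] by (simp add: mult.assoc ssum_mult_left)
 have "cv CCC (c23 \<chi>) (c1m \<chi>) ((h, g), f) =
  ssum (cD C g) (%g1 g2. ssum (cD C f) (%f1 f2. ssum (cD C h) (%h1 h2. cE C h1 * \<chi> (g1, f1) * \<chi> (h2, mu g2 f2))))"
  unfolding ssum_swap[of "cD C f" "cD C h"] ssum_swap[of "cD C g" "cD C h"]
  by (simp add: cv_def ssum_plist c23_def c1m_def assoc3_def)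
 moreover have "cv CCC (c12 \<chi>) (cm1 \<chi>) ((h, g), f) =
  ssum (cD C h) (%h1 h2. ssum (cD C g) (%g1 g2. ssum (cD C f) (%f1 f2. \<chi> (h1, g1) * cE C f1 * \<chi> (mu h2 g2, f2))))"
  by (simp add: cv_def ssum_plist c12_def cm1_def)
 ultimately show ?thesis
  unfolding 1 2 two_cocycle by simp
qed

text \<open>The cocycle identity at (h, e, f) gives \<chi>(h, f) = \<chi>(h1, e) \<chi>(h2, f). So
  the function \<chi>(-, e) \<otimes> \<epsilon> fixes \<chi> under convolution, and as \<chi> is
  invertible it must be the counit.\<close>

lemma chi_unitR: "\<chi> (h, e) = cE C h"
proof -
 have x: "(%h. \<chi> (h, a)) \<in> cF C" "(%a. \<chi> (h, a)) \<in> cF C" for h a using chi by (auto simp: pform_def bi_def)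
 note f = cog_forms[OF cog]
 have ue: "(%h. \<chi> (h, e)) \<in> cF C" by (rule x)
 have 1: "\<chi> (h, f) = ssum (cD C h) (%h1 h2. \<chi> (h1, e) * \<chi> (h2, f))" for h f
 proof -
  have m: "(%x. \<chi> (h, mu x f)) \<in> cF C" "(%x. \<chi> (h, mu e x)) \<in> cF C" "(%x. \<chi> (mu h x, f)) \<in> cF C" for f h
   using morph_cF[OF mu_morph x(2)] morph_cF[OF mu_morph x(1)] by (auto simp: pform_def bi_def)
  have "ssum (cD C e) (%g1 g2. ssum (cD C f) (%f1 f2. \<chi> (g1, f1) * \<chi> (h, mu g2 f2))) =
    ssum (cD C f) (%f1 f2. \<chi> (e, f1) * \<chi> (h, mu e f2))"
   by (intro unit_group biI forms_ssum[OF f] forms_mult[OF f] forms_mult'[OF f] x m)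
  also have "... = \<chi> (h, f)"
   using cog_counitL[OF cog x(2)] by (simp add: chi_unitL mu_unit)
  finally have "\<chi> (h, f) = ssum (cD C h) (%h1 h2. ssum (cD C e) (%g1 g2. \<chi> (h1, g1) * \<chi> (mu h2 g2, f)))"
   by (simp add: two_cocycle_at)
  moreover have "ssum (cD C e) (%g1 g2. \<chi> (h1, g1) * \<chi> (mu h2 g2, f)) = \<chi> (h1, e) * \<chi> (mu h2 e, f)" for h1 h2
   by (intro unit_group biI forms_mult[OF f] forms_mult'[OF f] x m)
  ultimately show ?thesis by (simp add: mu_unit)
 qed
 define u where "u = (%(a, b). \<chi> (a, e) * cE C b)"
 have u: "u \<in> cF CC" unfolding u_def using ue cog_cE[OF cog]
  by (auto intro!: pformI forms_mult forms_mult' f)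
 have "cv CC u \<chi> = \<chi>"
 proof (clarsimp simp: fun_eq_iff)
  fix a b
  have "ssum (cD C b) (%b1 b2. \<chi> (a1, e) * cE C b1 * \<chi> (a2, b2)) = \<chi> (a1, e) * \<chi> (a2, b)" for a1 a2
   using cog_counitL[OF cog x(2)] by (simp add: mult.assoc ssum_mult_left)
  then show "cv CC u \<chi> (a, b) = \<chi> (a, b)"
   by (simp add: cv_def ssum_plist u_def 1[of a b, symmetric])
 qed
 then have "cv CC (cv CC u \<chi>) \<xi> = cE CC" by (simp add: chi_xi)
 then have "u = cE CC" using cv_assoc[OF CC u chi xi] chi_xi cv_counitR[OF CC u] by simp
 from fun_cong[OF this, of "(h, e)"] show ?thesis by (simp add: u_def unit_counit)
qed

lemma xi_unitR: "\<xi> (h, e) = cE C h"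
proof -
 have x: "(%h. \<xi> (h, e)) \<in> cF C" and x': "(%c. \<xi> (h, c)) \<in> cF C" for h using xi by (auto simp: pform_def bi_def)
 have c: "(%h. \<chi> (a, h)) \<in> cF C" for a using chi by (auto simp: pform_def bi_def)
 have i: "ssum (cD C e) (%c d. \<xi> (a, c) * \<chi> (b, d)) = \<xi> (a, e) * \<chi> (b, e)" for a b
  using x' c by (intro unit_group biI forms_mult[OF cog_forms[OF cog]]
    forms_mult'[OF cog_forms[OF cog]]) auto
 have "cv CC \<xi> \<chi> (h, e) = \<xi> (h, e)"
  using cog_counitR[OF cog x] by (simp add: cv_def ssum_plist i chi_unitR)
 then show ?thesis by (simp add: xi_chi unit_counit)
qed

text \<open>Both sides are the double twist by the common value of the two sides of the cocycle identity.\<close>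

theorem tw_assoc:
 assumes A: "is_bcm C A" and B: "is_bcm C B" and X: "is_bcm C X" and P: "is_bcm C P" and Q: "is_bcm C Q"
  and m2: "morph CC C (case_prod mu) (case_prod m2) (prodB A B) P"
  and m4: "morph CC C (case_prod mu) (case_prod m4) (prodB B X) Q"
  and m1: "(%(p, x). \<phi> (m1 p x)) \<in> pform (bF P) (bF X)"
  and m3: "(%(a, q). \<phi> (m3 a q)) \<in> pform (bF A) (bF Q)"
  and eq: "!!a b x. m1 (m2 a b) x = m3 a (m4 b x)"
  and t1: "is_tw \<chi> \<xi> P X F m1 t1" and t2: "is_tw \<chi> \<xi> A B (bF P) m2 t2"
  and t3: "is_tw \<chi> \<xi> A Q F m3 t3" and t4: "is_tw \<chi> \<xi> B X (bF Q) m4 t4"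
  and \<phi>: "\<phi> \<in> F"
 shows "\<phi> (t1 (t2 a b) x) = \<phi> (t3 a (t4 b x))"
proof -
 note AB = prodB_is_bcm[OF cog cog A B] and BX = prodB_is_bcm[OF cog cog B X]
 note ABX = prodB_is_bcm[OF CC cog AB X] and ABX' = prodB_is_bcm[OF cog CC A BX]
 note PX = prodB_is_bcm[OF cog cog P X] and AQ = prodB_is_bcm[OF cog cog A Q]
 let ?ABX = "prodB (prodB A B) X" and ?ABX' = "prodB A (prodB B X)"
 let ?F = "%((a, b), x). \<phi> (m1 (m2 a b) x)"
 let ?F' = "%(a, (b, x)). \<phi> (m3 a (m4 b x))"
 note c1 = c12_form[OF chi] c12_form[OF xi] cm1_form[OF chi] cm1_form[OF xi]
 note c2 = c23_form[OF chi] c23_form[OF xi] c1m_form[OF chi] c1m_form[OF xi]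
 \<comment> \<open>The inner product contributes factors on the first two slots, the outer one
   factors that see these two slots multiplied.\<close>
 have left: "\<phi> (t1 (t2 a b) x) = twf ?ABX (cv CCC (c12 \<chi>) (cm1 \<chi>)) (cv CCC (cm1 \<xi>) (c12 \<xi>)) ?F ((a, b), x)"
 proof -
  let ?\<psi> = "twf (prodB P X) \<chi> \<xi> (%(p, x). \<phi> (m1 p x))"
  have \<psi>: "?\<psi> \<in> bF (prodB P X)"
   using twf_form[OF CC PX chi xi] m1 by simp
  note mm = morph_prod[OF cog cog P X m2 morph_id[of C X]]
  have "\<phi> (t1 (t2 a b) x) = ?\<psi> (t2 a b, x)"
   using is_twD[OF t1 \<phi>] by simp
  also have "... = twf (prodB A B) \<chi> \<xi> (%p. ?\<psi> (case_prod m2 p, x)) (a, b)"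
   using is_twD[OF t2, of "%p. ?\<psi> (p, x)"] pform1[of ?\<psi> "bF P"] \<psi> by (simp add: case_prod_beta')
  also have "... = twf ?ABX (c12 \<chi>) (c12 \<xi>) (%t. ?\<psi> (map_prod (case_prod m2) (%x. x) t)) ((a, b), x)"
   unfolding c12_def
   using twf_slice1[OF CC cog AB X morph_bF[OF mm \<psi>] chi] by simp
  also have "(%t. ?\<psi> (map_prod (case_prod m2) (%x. x) t)) = twf ?ABX (cm1 \<chi>) (cm1 \<xi>) ?F"
   using twf_morph[OF CC PX mm chi xi] m1 by (simp add: fun_eq_iff cm1_def case_prod_beta')
  also have "twf ?ABX (c12 \<chi>) (c12 \<xi>) (twf ?ABX (cm1 \<chi>) (cm1 \<xi>) ?F) =
    twf ?ABX (cv CCC (c12 \<chi>) (cm1 \<chi>)) (cv CCC (cm1 \<xi>) (c12 \<xi>)) ?F"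
   using twf_twf[OF CCC ABX c1] morph_bF[OF mm, of "%(p, x). \<phi> (m1 p x)"] m1 by (simp add: case_prod_beta')
  finally show ?thesis .
 qed
 have right: "\<phi> (t3 a (t4 b x)) = twf ?ABX (cv CCC (c23 \<chi>) (c1m \<chi>)) (cv CCC (c1m \<xi>) (c23 \<xi>)) ?F ((a, b), x)"
 proof -
  let ?\<psi> = "twf (prodB A Q) \<chi> \<xi> (%(a, q). \<phi> (m3 a q))"
  have \<psi>: "?\<psi> \<in> bF (prodB A Q)"
   using twf_form[OF CC AQ chi xi] m3 by simp
  note mm = morph_prod[OF CC cog A BX morph_id[of C A] m4]
  note al = morph_assoc3[of C C C A B X]
  let ?u = "%u. %(a, p). cE C a * u p"
  have u: "?u u \<in> cF (prodC C CC)" if "u \<in> cF CC" for u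
   unfolding prod_simps(1)[of C CC] using that cog_cE[OF cog] cog_forms[OF cog] cog_forms[OF CC]
   by (auto intro!: pformI[of _ _ "pform _ _"] forms_mult forms_mult')
  have F': "?F' \<in> bF ?ABX'"
   using morph_bF[OF mm, of "%(a, q). \<phi> (m3 a q)"] m3 by (simp add: case_prod_beta')
  have "\<phi> (t3 a (t4 b x)) = ?\<psi> (a, t4 b x)"
   using is_twD[OF t3 \<phi>] by simp
  also have "... = twf (prodB B X) \<chi> \<xi> (%p. ?\<psi> (a, case_prod m4 p)) (b, x)"
   using is_twD[OF t4, of "%p. ?\<psi> (a, p)"] pform2[of ?\<psi> "bF A"] \<psi> by (simp add: case_prod_beta')
  also have "... = twf ?ABX' (?u \<chi>) (?u \<xi>) (%t. ?\<psi> (map_prod (%x. x) (case_prod m4) t)) (a, b, x)"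
   using twf_slice2[OF cog CC A BX morph_bF[OF mm \<psi>] chi] by simp
  also have "(%t. ?\<psi> (map_prod (%x. x) (case_prod m4) t)) =
    twf ?ABX' (%t. \<chi> (map_prod (%x. x) (case_prod mu) t)) (%t. \<xi> (map_prod (%x. x) (case_prod mu) t)) ?F'"
   using twf_morph[OF CC AQ mm chi xi] m3 by (simp add: fun_eq_iff case_prod_beta')
  \<comment> \<open>From here on the bracketing a (b x) is pulled back along \<open>assoc3\<close>,
    so that both sides are twists of the same form on (a b) x.\<close>
  also have "twf ?ABX' (?u \<chi>) (?u \<xi>) ... (a, b, x) = twf ?ABX' (?u \<chi>) (?u \<xi>) ... (assoc3 ((a, b), x))"
   by (simp add: assoc3_def)
  also have "... = twf ?ABX (c23 \<chi>) (c23 \<xi>) (%t. twf ?ABX' (%t. \<chi> (map_prod (%x. x) (case_prod mu) t))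
    (%t. \<xi> (map_prod (%x. x) (case_prod mu) t)) ?F' (assoc3 t)) ((a, b), x)"
   unfolding c23_def
   using twf_morph[OF prodC_is_cog[OF cog CC] ABX' al u[OF chi] u[OF xi]
    twf_form[OF prodC_is_cog[OF cog CC] ABX' morph_cF[OF morph_1m chi] morph_cF[OF morph_1m xi] F']] by simp
  also have "(%t. twf ?ABX' (%t. \<chi> (map_prod (%x. x) (case_prod mu) t))
    (%t. \<xi> (map_prod (%x. x) (case_prod mu) t)) ?F' (assoc3 t)) = twf ?ABX (c1m \<chi>) (c1m \<xi>) (%t. ?F' (assoc3 t))"
   unfolding c1m_def using twf_morph[OF prodC_is_cog[OF cog CC] ABX' al morph_cF[OF morph_1m chi] morph_cF[OF morph_1m xi] F']
   by (simp add: fun_eq_iff)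
  also have "(%t. ?F' (assoc3 t)) = ?F"
   by (auto simp: fun_eq_iff assoc3_def eq)
  also have "twf ?ABX (c23 \<chi>) (c23 \<xi>) (twf ?ABX (c1m \<chi>) (c1m \<xi>) ?F) =
    twf ?ABX (cv CCC (c23 \<chi>) (c1m \<chi>)) (cv CCC (c1m \<xi>) (c23 \<xi>)) ?F"
  proof (rule twf_twf[OF CCC ABX c2])
   have "(%t. ?F' (assoc3 t)) = ?F"
    by (auto simp: fun_eq_iff assoc3_def eq)
   then show "?F \<in> bF ?ABX" using morph_bF[OF al F'] by simp
  qed
  finally show ?thesis .
 qed
 show ?thesis unfolding left right two_cocycle xi_cocycle ..
qed

text \<open>A coaction followed by the product is a form on the split pair, and the coaction of a
  pair is a balanced splitting. \<open>twf_cosplit\<close> then twists the coefficient leg and the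
  comodule leg separately, which yields \<open>mu'\<close> on the one and \<open>t\<close> on the
  other.\<close>

theorem tw_colinear:
 assumes A: "is_bcm C A" and B: "is_bcm C B" and P: "is_bcm C P"
  and m: "morph CC C (case_prod mu) (case_prod m) (prodB A B) P"
  and t: "is_tw \<chi> \<xi> A B (bF P) m t"
  and mu': "is_tw \<chi> \<xi> (selfB C) (selfB C) (cF C) mu mu'"
 shows "morph CC C (case_prod mu') (case_prod t) (prodB A B) P"
proof -
 note AB = prodB_is_bcm[OF cog cog A B]
 have tD: "\<phi> (case_prod t p) = twf (prodB A B) \<chi> \<xi> (%p. \<phi> (case_prod m p)) p" if "\<phi> \<in> bF P" for \<phi> p
  using is_twD[OF t that] by (cases p) (simp add: case_prod_beta')
 have muD: "\<phi> (case_prod mu' p) = twf (selfB CC) \<chi> \<xi> (%p. \<phi> (case_prod mu p)) p" if "\<phi> \<in> cF C" for \<phi> p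
  using is_twD[OF mu' that] by (cases p) (simp add: case_prod_beta' selfB_prodC)
 have 1: "(%c. u (case_prod mu' c)) \<in> cF CC" if "u \<in> cF C" for u
  using twf_form[OF CC cog_bcm[OF CC] chi xi, of "%p. u (case_prod mu p)"] morph_cF[OF mu_morph that]
  by (simp add: muD[OF that])
 have 2: "(%c. u (case_prod t c)) \<in> bF (prodB A B)" if "u \<in> bF P" for u
  using twf_form[OF CC AB chi xi, of "%p. u (case_prod m p)"] morph_bF[OF m that]
  by (simp add: tD[OF that])
 have 3: "ssum (bL P (case_prod t p)) f = ssum (bL (prodB A B) p) (%c w. f (case_prod mu' c) (case_prod t w))"
  if f: "f \<in> bi (cF C) (bF P)" for f p
 proof -
  let ?G = "%c w. f (case_prod mu c) (case_prod m w)"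
  have G: "?G \<in> bi (bF (selfB CC)) (bF (prodB A B))"
  proof (rule biI)
   show "(%x. ?G x y) \<in> bF (selfB CC)" for y using morph_cF[OF mu_morph bi1[OF f]] by simp
   show "(%y. ?G x y) \<in> bF (prodB A B)" for x by (rule morph_bF[OF m bi2[OF f]])
  qed
  have "ssum (bL P (case_prod t p)) f = twf (prodB A B) \<chi> \<xi> (%p. ssum (bL (prodB A B) p) ?G) p"
   using tD[OF bcm_bL[OF P f]] by (simp add: morph_bL[OF m f])
  also have "... = ssum (bL (prodB A B) p) (%y z. twf (selfB CC) \<chi> \<xi> (%y. twf (prodB A B) \<chi> \<xi> (?G y) z) y)"
   by (rule twf_cosplit[OF CC AB cog_bcm[OF CC] AB cosplit_bL[OF CC AB] chi xi xi_chi G])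
  also have "... = ssum (bL (prodB A B) p) (%y z. twf (selfB CC) \<chi> \<xi> (%y. f (case_prod mu y) (case_prod t z)) y)"
   using tD[OF bi2[OF f]] by simp
  also have "... = ssum (bL (prodB A B) p) (%c w. f (case_prod mu' c) (case_prod t w))"
   using muD[OF bi1[OF f]] by simp
  finally show ?thesis .
 qed
 have 4: "ssum (bR P (case_prod t p)) f = ssum (bR (prodB A B) p) (%w c. f (case_prod t w) (case_prod mu' c))"
  if f: "f \<in> bi (bF P) (cF C)" for f p
 proof -
  let ?G = "%w c. f (case_prod m w) (case_prod mu c)"
  have G: "?G \<in> bi (bF (prodB A B)) (bF (selfB CC))"
  proof (rule biI)
   show "(%x. ?G y x) \<in> bF (selfB CC)" for y using morph_cF[OF mu_morph bi2[OF f]] by simp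
   show "(%y. ?G y x) \<in> bF (prodB A B)" for x by (rule morph_bF[OF m bi1[OF f]])
  qed
  have "ssum (bR P (case_prod t p)) f = twf (prodB A B) \<chi> \<xi> (%p. ssum (bR (prodB A B) p) ?G) p"
   using tD[OF bcm_bR[OF P f]] by (simp add: morph_bR[OF m f])
  also have "... = ssum (bR (prodB A B) p) (%y z. twf (prodB A B) \<chi> \<xi> (%y. twf (selfB CC) \<chi> \<xi> (?G y) z) y)"
   by (rule twf_cosplit[OF CC AB AB cog_bcm[OF CC] cosplit_bR[OF CC AB] chi xi xi_chi G])
  also have "... = ssum (bR (prodB A B) p) (%y z. twf (prodB A B) \<chi> \<xi> (%y. f (case_prod m y) (case_prod mu' z)) y)"
   using muD[OF bi2[OF f]] by simp
  also have "... = ssum (bR (prodB A B) p) (%w c. f (case_prod t w) (case_prod mu' c))"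
   using tD[OF bi1[OF f]] by simp
  finally show ?thesis .
 qed
 show ?thesis unfolding morph_def using 1 2 3 4 by blast
qed

text \<open>The double twist has \<xi> * \<chi> on both sides, which is the counit.\<close>

lemma tw_inverse:
 assumes A: "is_bcm C A" and B: "is_bcm C B"
  and m: "!!\<phi>. \<phi> \<in> F ==> (%(a, b). \<phi> (m a b)) \<in> pform (bF A) (bF B)"
  and t: "is_tw \<chi> \<xi> A B F m t" and s: "is_tw \<xi> \<chi> A B F t s" and \<phi>: "\<phi> \<in> F"
 shows "\<phi> (s a b) = \<phi> (m a b)"
proof -
 note AB = prodB_is_bcm[OF cog cog A B]
 have e: "(%(a, b). \<phi> (t a b)) = twf (prodB A B) \<chi> \<xi> (%(a, b). \<phi> (m a b))"
  using is_twD[OF t \<phi>] by (auto simp: fun_eq_iff)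
 have p: "(%(a, b). \<phi> (m a b)) \<in> bF (prodB A B)" using m[OF \<phi>] by simp
 show ?thesis
  using is_twD[OF s \<phi>] twf_twf[OF CC AB xi chi chi xi p] twf_counit[OF CC AB p]
  by (simp add: e chi_xi xi_chi)
qed

text \<open>An element with trivial coactions offers only \<open>e\<close> to the cocycle, where
  \<chi> and \<xi> reduce to counits by unitality.\<close>

lemma tw_unit:
 assumes A: "is_bcm C A" and B: "is_bcm C B"
  and u: "!!f. f \<in> bi (cF C) (bF A) ==> ssum (bL A u) f = f e u"
   "!!f. f \<in> bi (bF A) (cF C) ==> ssum (bR A u) f = f u e"
 shows tw_unitL: "is_tw \<chi> \<xi> A B F m t ==> \<phi> \<in> F ==> (%(a, b). \<phi> (m a b)) \<in> pform (bF A) (bF B) ==> \<phi> (t u b) = \<phi> (m u b)"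
  and tw_unitR: "is_tw \<chi> \<xi> B A F m' t' ==> \<phi> \<in> F ==> (%(b, a). \<phi> (m' b a)) \<in> pform (bF B) (bF A) ==> \<phi> (t' b u) = \<phi> (m' b u)"
proof -
 note AB = prodB_is_bcm[OF cog cog A B] and BA = prodB_is_bcm[OF cog cog B A]
 note fs = forms_ssum[OF bcm_forms[OF A]] forms_ssum[OF cog_forms[OF cog]] forms_mult[OF bcm_forms[OF A]] forms_mult[OF cog_forms[OF cog]]
  forms_mult'[OF bcm_forms[OF A]] forms_mult'[OF cog_forms[OF cog]]
 have c: "(%h. \<chi> (h, a)) \<in> cF C" "(%h. \<chi> (a, h)) \<in> cF C" "(%h. \<xi> (h, a)) \<in> cF C" "(%h. \<xi> (a, h)) \<in> cF C" for a
  using chi xi by (auto simp: pform_def bi_def)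
 have L: "Lo (prodB A B) \<chi> \<psi> (u, z) = \<psi> (u, z)" "Ro (prodB A B) \<xi> \<psi> (u, z) = \<psi> (u, z)"
  if \<psi>: "\<psi> \<in> pform (bF A) (bF B)" for \<psi> z
 proof -
  have p: "(%a. \<psi> (a, b)) \<in> bF A" "(%b. \<psi> (a, b)) \<in> bF B" for a b using \<psi> by (auto simp: pform_def bi_def)
  have "Lo (prodB A B) \<chi> \<psi> (u, z) = ssum (bL A u) (%c w. ssum (bL B z) (%d y. \<chi> (c, d) * \<psi> (w, y)))"
   by (simp add: Lo_def ssum_plist)
  also have "... = ssum (bL B z) (%d y. \<chi> (e, d) * \<psi> (u, y))"
   by (intro u biI fs c p)
  finally show "Lo (prodB A B) \<chi> \<psi> (u, z) = \<psi> (u, z)" using bcm_counitL[OF B p(2)] by (simp add: chi_unitL)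
  have "Ro (prodB A B) \<xi> \<psi> (u, z) = ssum (bR A u) (%w c. ssum (bR B z) (%y d. \<psi> (w, y) * \<xi> (c, d)))"
   by (simp add: Ro_def ssum_plist)
  also have "... = ssum (bR B z) (%y d. \<psi> (u, y) * \<xi> (e, d))"
   by (intro u biI fs c p)
  finally show "Ro (prodB A B) \<xi> \<psi> (u, z) = \<psi> (u, z)" using bcm_counitR[OF B p(2)] by (simp add: xi_unitL)
 qed
 have R: "Lo (prodB B A) \<chi> \<psi> (z, u) = \<psi> (z, u)" "Ro (prodB B A) \<xi> \<psi> (z, u) = \<psi> (z, u)"
  if \<psi>: "\<psi> \<in> pform (bF B) (bF A)" for \<psi> z
 proof -
  have p: "(%b. \<psi> (a, b)) \<in> bF A" "(%a. \<psi> (a, b)) \<in> bF B" for a b using \<psi> by (auto simp: pform_def bi_def)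
  have "ssum (bL A u) (%c w. \<chi> (d, c) * \<psi> (y, w)) = \<chi> (d, e) * \<psi> (y, u)" for d y
   by (intro u biI fs c p)
  then show "Lo (prodB B A) \<chi> \<psi> (z, u) = \<psi> (z, u)" using bcm_counitL[OF B p(2)]
   by (simp add: Lo_def ssum_plist chi_unitR)
  have "ssum (bR A u) (%w c. \<psi> (y, w) * \<xi> (d, c)) = \<psi> (y, u) * \<xi> (d, e)" for d y
   by (intro u biI fs c p)
  then show "Ro (prodB B A) \<xi> \<psi> (z, u) = \<psi> (z, u)" using bcm_counitR[OF B p(2)]
   by (simp add: Ro_def ssum_plist xi_unitR)
 qed
 show "\<phi> (t u b) = \<phi> (m u b)"
  if "is_tw \<chi> \<xi> A B F m t" "\<phi> \<in> F" "(%(a, b). \<phi> (m a b)) \<in> pform (bF A) (bF B)"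
  using is_twD[OF that(1,2)] L(1)[OF that(3)] L(2)[OF Lo_form[OF CC AB chi, unfolded prod_simps, OF that(3)]]
  by (simp add: twf_def)
 show "\<phi> (t' b u) = \<phi> (m' b u)"
  if "is_tw \<chi> \<xi> B A F m' t'" "\<phi> \<in> F" "(%(a, b). \<phi> (m' a b)) \<in> pform (bF B) (bF A)"
  using is_twD[OF that(1,2)] R(1)[OF that(3)] R(2)[OF Lo_form[OF CC BA chi, unfolded prod_simps, OF that(3)]]
  by (simp add: twf_def)
qed

end

section \<open>Tensors as Sweedler sums\<close>

definition lin :: "('k::field => 'a::ab_group_add => 'a) => ('a => 'k) set" where
 "lin s = {\<phi>. linear_map (full s) ground \<phi>}"

abbreviation "hlin H \<equiv> lin (hscale H)"
abbreviation "vlin M \<equiv> lin (vscale M)"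

lemma elems_full [simp]: "elems (full s) = UNIV" and scl_full [simp]: "scl (full s) = s"
 by (simp_all add: full_def)

lemma lin_iff: "\<phi> \<in> lin s \<longleftrightarrow> (\<forall>x y. \<phi> (x + y) = \<phi> x + \<phi> y) \<and> (\<forall>c x. \<phi> (s c x) = c * \<phi> x)"
 by (simp add: lin_def linear_map_def)

lemma lin_add: "\<phi> \<in> lin s ==> \<phi> (x + y) = \<phi> x + \<phi> y"
 and lin_scale: "\<phi> \<in> lin s ==> \<phi> (s c x) = c * \<phi> x"
 by (simp_all add: lin_iff)

lemma lin_0: "\<phi> \<in> lin s ==> \<phi> 0 = 0"
 using lin_add[of \<phi> s 0 0] by (metis add_0 add_cancel_right_right)

lemma lin_uminus: "\<phi> \<in> lin s ==> \<phi> (- x) = - \<phi> x"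
 using lin_add[of \<phi> s x "- x"] by (simp add: lin_0 eq_neg_iff_add_eq_0 add.commute)

lemma lin_diff: "\<phi> \<in> lin s ==> \<phi> (x - y) = \<phi> x - \<phi> y"
 using lin_add[of \<phi> s x "- y"] by (simp add: lin_uminus)

lemma lin_ssum: "\<phi> \<in> lin s ==> \<phi> (ssum r f) = ssum r (%x y. \<phi> (f x y))"
 by (rule ssum_additive) (auto simp: lin_add lin_0)

lemma lin_sum: "\<phi> \<in> lin s ==> \<phi> (sum f A) = (\<Sum>a\<in>A. \<phi> (f a))"
 by (induction A rule: infinite_finite_induct) (auto simp: lin_add lin_0)

lemma forms_lin [simp]: "forms (lin s)"
 by (auto simp: forms_def lin_iff algebra_simps)

lemma lin_eqI:
 assumes "vector_space s" and "!!\<phi>. \<phi> \<in> lin s ==> \<phi> x = \<phi> y"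
 shows "x = y"
proof (rule ccontr)
 assume "x ~= y"
 then have "x - y ~= 0" by simp
 from separating_functional[OF assms(1) this] obtain \<psi> where \<psi>: "\<psi> \<in> lin s" "\<psi> (x - y) ~= 0"
  by (auto simp: lin_def)
 then show False using lin_add[OF \<psi>(1), of "x - y" y] assms(2)[OF \<psi>(1)] by simp
qed

lemma is_space_full: "is_space (full s) \<longleftrightarrow> vector_space s"
proof -
 have "module.subspace s UNIV" if "vector_space s"
 proof -
  interpret vector_space s by fact
  show ?thesis by (rule subspace_UNIV)
 qed
 then show ?thesis by (auto simp: is_space_def)
qed

lemma linear_mapI_lin:
 assumes "vector_space t" "!!\<phi>. \<phi> \<in> lin t ==> (%x. \<phi> (f x)) \<in> lin s"
 shows "linear_map (full s) (full t) f"
 unfolding linear_map_def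
proof (intro conjI ballI allI)
 fix x y c
 show "f (x + y) = f x + f y"
  by (rule lin_eqI[OF assms(1)]) (simp add: lin_add[OF assms(2)] lin_add)
 show "f (scl (full s) c x) = scl (full t) c (f x)"
  by (simp, rule lin_eqI[OF assms(1)]) (simp add: lin_scale[OF assms(2)] lin_scale)
qed simp

lemma linear_map_lin: "linear_map (full s) (full t) f ==> \<phi> \<in> lin t ==> (%x. \<phi> (f x)) \<in> lin s"
 by (simp add: linear_map_def lin_iff)

lemma bilinear_mapI_lin:
 assumes "vector_space t" "!!\<phi>. \<phi> \<in> lin t ==> (%x y. \<phi> (f x y)) \<in> bi (lin a) (lin b)"
 shows "bilinear_map (full a) (full b) (full t) f"
 unfolding bilinear_map_def using assms(2)
 by (auto intro!: linear_mapI_lin[OF assms(1)] simp: bi_def)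

lemma bilinear_map_lin:
 "bilinear_map (full a) (full b) (full t) f ==> \<phi> \<in> lin t ==> (%x y. \<phi> (f x y)) \<in> bi (lin a) (lin b)"
 by (auto simp: bilinear_map_def bi_def intro: linear_map_lin)

lemma bilinear_map_form: "bilinear_map (full a) (full b) ground f \<longleftrightarrow> f \<in> bi (lin a) (lin b)"
 by (auto simp: bilinear_map_def bi_def lin_def)

text \<open>An arbitrary choice of a sum of pure tensors. It is used only through
  \<open>ssum\<close> with maps that are bilinear, and such values depend on the tensor
  alone.\<close>

definition rp :: "('k::field, 'a::ab_group_add) space => ('k, 'b::ab_group_add) space => ('a \<times> 'b, 'k) quot => ('a \<times> 'b) list" where
 "rp A B t = (SOME ps. ps \<in> lists (elems A \<times> elems B) \<and> t = (SUM (a, b)<-ps. tens A B a b))"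

abbreviation "rp2 s \<equiv> rp (full s) (full s)"
abbreviation "tens2 s \<equiv> tens (full s) (full s)"

lemma rp:
 assumes "t \<in> elems (tensor A B)"
 shows "rp A B t \<in> lists (elems A \<times> elems B)" "t = ssum (rp A B t) (tens A B)"
proof -
 have "\<exists>ps. ps \<in> lists (elems A \<times> elems B) \<and> t = (SUM (a, b)<-ps. tens A B a b)"
  using assms by (auto simp: tensor_def gen_sums_def tens_def case_prod_beta')
 from someI_ex[OF this] show "rp A B t \<in> lists (elems A \<times> elems B)" "t = ssum (rp A B t) (tens A B)"
  by (auto simp: rp_def ssum_def)
qed

lemma tlift_rp:
 assumes "is_space C" "bilinear_map A B C f" "t \<in> elems (tensor A B)"
 shows "tlift A B f t = ssum (rp A B t) f"
 using tlift_sum[OF assms(1,2) rp(1)[OF assms(3)]] rp(2)[OF assms(3)] by (simp add: ssum_def)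

lemma is_space_ground: "is_space (ground :: ('k::field, 'k) space)"
proof -
 have "vector_space ((*) :: 'k => 'k => 'k)" by unfold_locales (auto simp: algebra_simps)
 then show ?thesis by (simp add: is_space_full)
qed

lemma tlift_form:
 "f \<in> bi (lin a) (lin b) ==> t \<in> elems (tensor (full a) (full b)) ==>
  tlift (full a) (full b) f t = ssum (rp (full a) (full b) t) f"
 by (rule tlift_rp[OF is_space_ground]) (simp_all add: bilinear_map_form)

lemma tlift_vec:
 assumes "vector_space s" "!!\<phi>. \<phi> \<in> lin s ==> (%x y. \<phi> (f x y)) \<in> bi (lin a) (lin b)"
  "t \<in> elems (tensor (full a) (full b))"
 shows "tlift (full a) (full b) f t = ssum (rp (full a) (full b) t) f"
 by (rule tlift_rp[of "full s"]) (auto simp: is_space_full assms bilinear_mapI_lin)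

lemma ssum_apply: "ssum r f \<phi> = ssum r (%x y. f x y \<phi>)"
 by (induction r) (auto simp: ssum_def)

lemma tens_apply: "tens A B a b \<phi> = (if \<phi> \<in> tensor_forms A B then \<phi> (a, b) else 0)"
 by (simp add: tens_def gen_def)

lemma tensor_forms_full: "\<phi> \<in> tensor_forms (full a) (full b) \<longleftrightarrow> curry \<phi> \<in> bi (lin a) (lin b)"
 by (simp add: tensor_forms_def bilinear_map_form)

text \<open>A tensor is by construction a functional on bilinear forms, and its value at a form is
  the Sweedler sum of that form; outside the bilinear forms \<open>gen\<close> has the default value
  0.\<close>

lemma tensor_apply:
 assumes "t \<in> elems (tensor A B)"
 shows "t \<phi> = (if \<phi> \<in> tensor_forms A B then ssum (rp A B t) (curry \<phi>) else 0)"
proof -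
 have "t \<phi> = ssum (rp A B t) (tens A B) \<phi>" using rp(2)[OF assms] by simp
 then show ?thesis by (simp add: ssum_apply tens_apply curry_def)
qed

lemma tlift_quot:
 fixes F :: "'a::ab_group_add => 'b::ab_group_add => ('x, 'k::field) quot"
 assumes "!!\<phi>. (%x y. F x y \<phi>) \<in> bi (lin a) (lin b)" "t \<in> elems (tensor (full a) (full b))"
 shows "tlift (full a) (full b) F t = ssum (rp (full a) (full b) t) F"
proof (rule tlift_rp[of "full fun_scale"])
 show "is_space (full fun_scale :: ('k, ('x, 'k) quot) space)"
  by (simp add: is_space_full vector_space_fun_scale)
 show "bilinear_map (full a) (full b) (full fun_scale) F"
  using assms(1) by (auto simp: bilinear_map_def linear_map_def bi_def lin_iff fun_eq_iff fun_scale_def)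
qed fact

lemma tensor_eqI:
 assumes "t \<in> elems (tensor (full a) (full b))" "u \<in> elems (tensor (full a) (full b))"
  and "!!f. f \<in> bi (lin a) (lin b) ==> ssum (rp (full a) (full b) t) f = ssum (rp (full a) (full b) u) f"
 shows "t = u"
 using assms by (auto simp: fun_eq_iff tensor_apply tensor_forms_full)

lemma tens_in_tensor: "a \<in> elems A ==> b \<in> elems B ==> tens A B a b \<in> elems (tensor A B)"
 by (auto simp: tensor_def gen_sums_def tens_def intro!: bexI[of _ "[(a, b)]"])

lemma tensor_add: "t \<in> elems (tensor A B) ==> u \<in> elems (tensor A B) ==> t + u \<in> elems (tensor A B)"
proof -
 assume "t \<in> elems (tensor A B)" "u \<in> elems (tensor A B)"
 then obtain ps qs where "ps \<in> lists (elems A \<times> elems B)" "qs \<in> lists (elems A \<times> elems B)"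
   "t = (SUM p<-ps. gen (tensor_forms A B) p)" "u = (SUM p<-qs. gen (tensor_forms A B) p)"
  by (auto simp: tensor_def gen_sums_def)
 then show ?thesis by (auto simp: tensor_def gen_sums_def intro!: bexI[of _ "ps @ qs"])
qed

lemma tensor_zero: "0 \<in> elems (tensor A B)"
 by (auto simp: tensor_def gen_sums_def intro!: bexI[of _ "[]"])

lemma ssum_in_tensor: "(!!x y. f x y \<in> elems (tensor A B)) ==> ssum r f \<in> elems (tensor A B)"
 by (induction r) (auto simp: ssum_def tensor_zero tensor_add)

lemma rp_tens: "f \<in> bi (lin a) (lin b) ==> ssum (rp (full a) (full b) (tens (full a) (full b) x y)) f = f x y"
 using tensor_apply[OF tens_in_tensor, of x "full a" y "full b" "case_prod f"]
 by (simp add: tens_apply tensor_forms_full)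

lemma rp_ssum:
 assumes f: "f \<in> bi (lin a) (lin b)" and F: "!!x y. F x y \<in> elems (tensor (full a) (full b))"
 shows "ssum (rp (full a) (full b) (ssum r F)) f = ssum r (%x y. ssum (rp (full a) (full b) (F x y)) f)"
proof -
 have *: "case_prod f \<in> tensor_forms (full a) (full b)" using f by (simp add: tensor_forms_full)
 show ?thesis
  using tensor_apply[OF ssum_in_tensor[of F "full a" "full b" r, OF F], of "case_prod f"]
  by (simp add: * ssum_apply tensor_apply[OF F])
qed

lemma rp_add:
 assumes f: "f \<in> bi (lin a) (lin b)" and "t \<in> elems (tensor (full a) (full b))" "u \<in> elems (tensor (full a) (full b))"
 shows "ssum (rp (full a) (full b) (t + u)) f = ssum (rp (full a) (full b) t) f + ssum (rp (full a) (full b) u) f"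
proof -
 have *: "case_prod f \<in> tensor_forms (full a) (full b)" using f by (simp add: tensor_forms_full)
 show ?thesis
  using tensor_apply[OF tensor_add[OF assms(2,3)], of "case_prod f"] assms(2,3)
  by (simp add: * tensor_apply)
qed

lemma rp_linear:
 assumes "linear_map (full s) (tensor (full a) (full b)) \<Delta>" and f: "f \<in> bi (lin a) (lin b)"
 shows "(%x. ssum (rp (full a) (full b) (\<Delta> x)) f) \<in> lin s"
proof -
 have *: "case_prod f \<in> tensor_forms (full a) (full b)" using f by (simp add: tensor_forms_full)
 have "(%x. ssum (rp (full a) (full b) (\<Delta> x)) f) = (%x. \<Delta> x (case_prod f))"
  using assms(1) by (subst tensor_apply[of _ "full a" "full b"]) (auto simp: * linear_map_def)
 moreover have "\<Delta> (x + y) = \<Delta> x + \<Delta> y" "\<Delta> (s c x) = fun_scale c (\<Delta> x)" for x y c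
  using assms(1) by (auto simp: linear_map_def tensor_def)
 ultimately show ?thesis by (simp add: lin_iff fun_scale_def)
qed

lemma linear_map_tensor: "linear_map (full s) (tensor A B) \<Delta> ==> \<Delta> x \<in> elems (tensor A B)"
 by (simp add: linear_map_def)

lemma tens_bi: "(%u v. tens (full x) (full y) u v \<phi>) \<in> bi (lin x) (lin y)"
proof (cases "curry \<phi> \<in> bi (lin x) (lin y)")
 case True
 then show ?thesis using bi1[OF True] bi2[OF True] by (auto simp: tens_apply tensor_forms_full intro!: biI)
next
 case False
 then have "(%u v. tens (full x) (full y) u v \<phi>) = (%u v. 0)" by (simp add: tens_apply tensor_forms_full)
 then show ?thesis by (simp, intro biI forms_zero[OF forms_lin])
qed

text \<open>All coassociativity conditions on coproducts and coactions have this shape.\<close>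

lemma coassoc_ssum:
 fixes \<delta> :: "'p::ab_group_add => ('x::ab_group_add \<times> 'y::ab_group_add, 'k::field) quot"
  and \<kappa> :: "'q::ab_group_add => ('y \<times> 'z::ab_group_add, 'k) quot"
 assumes eq: "tlift (full p) (full z) (%p c. tens (tensor (full x) (full y)) (full z) (\<delta> p) c) t =
   tlift (full x) (full q) (%a q. tlift (full y) (full z) (%b c.
    tens (tensor (full x) (full y)) (full z) (tens (full x) (full y) a b) c) (\<kappa> q)) t'"
  and \<delta>: "linear_map (full p) (tensor (full x) (full y)) \<delta>"
  and \<kappa>: "linear_map (full q) (tensor (full y) (full z)) \<kappa>"
  and t: "t \<in> elems (tensor (full p) (full z))" and t': "t' \<in> elems (tensor (full x) (full q))"
  and f: "f \<in> tri (lin x) (lin y) (lin z)"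
 shows "ssum (rp (full p) (full z) t) (%p c. ssum (rp (full x) (full y) (\<delta> p)) (%a b. f a b c)) =
   ssum (rp (full x) (full q) t') (%a q. ssum (rp (full y) (full z) (\<kappa> q)) (%b c. f a b c))"
proof -
 let ?X = "full x" and ?Y = "full y" and ?Z = "full z"
 let ?XY = "tensor ?X ?Y"
 have tf: "\<phi> (u + u', c) = \<phi> (u, c) + \<phi> (u', c)" "\<phi> (fun_scale r u, c) = r * \<phi> (u, c)" "(%c. \<phi> (u, c)) \<in> lin z"
  if "\<phi> \<in> tensor_forms ?XY ?Z" "u \<in> elems ?XY" "u' \<in> elems ?XY" for \<phi> u u' r c
 proof -
  have b: "bilinear_map ?XY ?Z ground (curry \<phi>)" using that(1) by (simp add: tensor_forms_def)
  have l: "linear_map ?XY ground (%u. \<phi> (u, c))" using b by (simp add: bilinear_map_def)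
  show "\<phi> (u + u', c) = \<phi> (u, c) + \<phi> (u', c)" using l that(2,3) by (simp only: linear_map_def)
  have "scl ?XY = fun_scale" by (simp add: tensor_def)
  then show "\<phi> (fun_scale r u, c) = r * \<phi> (u, c)" using l that(2) by (simp add: linear_map_def)
  have "linear_map ?Z ground (curry \<phi> u)" using b that(2) by (simp only: bilinear_map_def)
  then show "(%c. \<phi> (u, c)) \<in> lin z" by (simp add: lin_def curry_def)
 qed
 have \<delta>': "\<delta> (a + b) = \<delta> a + \<delta> b" "\<delta> (p s a) = fun_scale s (\<delta> a)" "\<delta> a \<in> elems ?XY" for a b s
  using \<delta> by (auto simp: linear_map_def tensor_def)
 have z0: "(%_. 0) \<in> lin e" for e using forms_zero[OF forms_lin] .
 have 1: "tlift (full p) ?Z (%p c. tens ?XY ?Z (\<delta> p) c) t = ssum (rp (full p) ?Z t) (%p c. tens ?XY ?Z (\<delta> p) c)"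
 proof (rule tlift_quot[OF _ t])
  fix \<phi>
  show "(%p c. tens ?XY ?Z (\<delta> p) c \<phi>) \<in> bi (lin p) (lin z)"
  proof (cases "\<phi> \<in> tensor_forms ?XY ?Z")
   case True
   have "(%a. \<phi> (\<delta> a, c)) \<in> lin p" for c
    unfolding lin_iff \<delta>' using tf(1)[OF True \<delta>'(3) \<delta>'(3)] tf(2)[OF True \<delta>'(3) \<delta>'(3)] by blast
   then show ?thesis
    unfolding tens_apply using True tf(3)[OF True \<delta>'(3) \<delta>'(3)] by (simp add: bi_def)
  qed (simp add: bi_def tens_apply z0)
 qed
 have tt: "(%b c. tens ?XY ?Z (tens ?X ?Y a b) c \<phi>) \<in> bi (lin y) (lin z)"
  "(%a. tens ?XY ?Z (tens ?X ?Y a b) c \<phi>) \<in> lin x" for a b c \<phi>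
 proof -
  have add: "tens ?X ?Y (a + a') b = tens ?X ?Y a b + tens ?X ?Y a' b" "tens ?X ?Y (x r a) b = fun_scale r (tens ?X ?Y a b)"
   "tens ?X ?Y a (b + b') = tens ?X ?Y a b + tens ?X ?Y a b'" "tens ?X ?Y a (y r b) = fun_scale r (tens ?X ?Y a b)" for a a' b b' r
   by (auto simp: fun_eq_iff tens_apply tensor_forms_full bi_def lin_iff fun_scale_def)
  have in': "tens ?X ?Y a b \<in> elems ?XY" for a b by (rule tens_in_tensor) auto
  have "(%b c. tens ?XY ?Z (tens ?X ?Y a b) c \<phi>) \<in> bi (lin y) (lin z) \<and>
   (%a. tens ?XY ?Z (tens ?X ?Y a b) c \<phi>) \<in> lin x"
  proof (cases "\<phi> \<in> tensor_forms ?XY ?Z")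
   case True
   have l: "(%b. \<phi> (tens ?X ?Y a b, c)) \<in> lin y" "(%a. \<phi> (tens ?X ?Y a b, c)) \<in> lin x" for a b c
    unfolding lin_iff add using tf(1)[OF True in' in'] tf(2)[OF True in' in'] by blast+
   show ?thesis unfolding tens_apply[of ?XY] using True l tf(3)[OF True in' in'] by (simp add: bi_def)
  qed (simp add: bi_def tens_apply[of ?XY] z0)
  then show "(%b c. tens ?XY ?Z (tens ?X ?Y a b) c \<phi>) \<in> bi (lin y) (lin z)"
   "(%a. tens ?XY ?Z (tens ?X ?Y a b) c \<phi>) \<in> lin x" by blast+
 qed
 have 2: "tlift ?Y ?Z (%b c. tens ?XY ?Z (tens ?X ?Y a b) c) (\<kappa> q) =
   ssum (rp ?Y ?Z (\<kappa> q)) (%b c. tens ?XY ?Z (tens ?X ?Y a b) c)" for a q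
  by (rule tlift_quot[OF tt(1) linear_map_tensor[OF \<kappa>]])
 have 3: "tlift ?X (full q) (%a q. ssum (rp ?Y ?Z (\<kappa> q)) (%b c. tens ?XY ?Z (tens ?X ?Y a b) c)) t' =
  ssum (rp ?X (full q) t') (%a q. ssum (rp ?Y ?Z (\<kappa> q)) (%b c. tens ?XY ?Z (tens ?X ?Y a b) c))"
 proof (rule tlift_quot[OF _ t'], rule biI)
  fix \<phi>
  show "(%a. ssum (rp ?Y ?Z (\<kappa> q)) (%b c. tens ?XY ?Z (tens ?X ?Y a b) c) \<phi>) \<in> lin x" for q
   unfolding ssum_apply by (intro forms_ssum[OF forms_lin] tt)
  show "(%q'. ssum (rp ?Y ?Z (\<kappa> q')) (%b c. tens ?XY ?Z (tens ?X ?Y a b) c) \<phi>) \<in> lin q" for a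
   unfolding ssum_apply by (rule rp_linear[OF \<kappa> tt(1)])
 qed
 \<comment> \<open>The trilinear form \<open>f\<close> as a bilinear form on the bracketed tensor
   product. Evaluating both sides of \<open>eq\<close> at it gives the claim.\<close>
 define \<Phi> where "\<Phi> = (%(u, c). ssum (rp ?X ?Y u) (%a b. f a b c))"
 have \<Phi>: "\<Phi> \<in> tensor_forms ?XY ?Z"
 proof -
  have add: "u + v \<in> elems ?XY \<and> ssum (rp ?X ?Y (u + v)) g = ssum (rp ?X ?Y u) g + ssum (rp ?X ?Y v) g"
   if "u \<in> elems ?XY" "v \<in> elems ?XY" "g \<in> bi (lin x) (lin y)" for u v g
   using rp_add[OF that(3,1,2)] tensor_add[OF that(1,2)] by simp
  have scale: "ssum (rp ?X ?Y (fun_scale c u)) g = c * ssum (rp ?X ?Y u) g"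
   if u: "u \<in> elems ?XY" and g: "g \<in> bi (lin x) (lin y)" for u g c
  proof -
   have *: "case_prod g \<in> tensor_forms ?X ?Y" using g by (simp add: tensor_forms_full)
   have "fun_scale c u = ssum (map (%(a, b). (x c a, b)) (rp ?X ?Y u)) (tens ?X ?Y)"
   proof
    fix \<phi>
    have "fun_scale c u \<phi> = c * ssum (rp ?X ?Y u) (tens ?X ?Y) \<phi>"
     using rp(2)[OF u] by (simp add: fun_scale_def)
    then show "fun_scale c u \<phi> = ssum (map (%(a, b). (x c a, b)) (rp ?X ?Y u)) (tens ?X ?Y) \<phi>"
     by (simp add: ssum_apply ssum_map lin_scale[OF bi1[OF tens_bi]] ssum_mult_left)
   qed
   then have "fun_scale c u \<in> elems ?XY" by (simp add: ssum_in_tensor tens_in_tensor)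
   from tensor_apply[OF this, of "case_prod g"] tensor_apply[OF u, of "case_prod g"] *
   show ?thesis by (simp add: fun_scale_def)
  qed
  have s: "(%a b. f a b c) \<in> bi (lin x) (lin y)" for c using f by (rule tri_slice)
  have l: "(%c. ssum r (%a b. f a b c)) \<in> lin z" for r
   by (intro forms_ssum[OF forms_lin] tri3[OF f])
  have "linear_map ?XY ground (%u. ssum (rp ?X ?Y u) (%a b. f a b c))" for c
   unfolding linear_map_def using add[OF _ _ s] scale[OF _ s] by (simp add: tensor_def)
  then show ?thesis
   using l by (simp add: tensor_forms_def bilinear_map_def \<Phi>_def curry_def lin_def)
 qed
 have "ssum (rp (full p) ?Z t) (%p c. tens ?XY ?Z (\<delta> p) c) \<Phi> =
   ssum (rp ?X (full q) t') (%a q. ssum (rp ?Y ?Z (\<kappa> q)) (%b c. tens ?XY ?Z (tens ?X ?Y a b) c)) \<Phi>"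
  using eq unfolding 1 2 3 by simp
 then show ?thesis
  by (simp add: ssum_apply tens_apply[of ?XY] \<Phi>) (simp add: \<Phi>_def rp_tens[OF tri_slice(1)[OF f]])
qed

section \<open>Hopf algebras and bicomodules as coalgebras and bicomodules with forms\<close>

definition HC :: "('k::field, 'h::ab_group_add) hopf => ('k, 'h) cog" where
 "HC H = \<lparr>cF = hlin H, cD = (%h. rp (hspace H) (hspace H) (hcomult H h)), cE = hcounit H\<rparr>"

definition VB :: "('k::field, 'h::ab_group_add) hopf => ('k, 'h, 'v::ab_group_add, 'z) bimod_scheme => ('k, 'h, 'v) bcm" where
 "VB H V = \<lparr>bF = vlin V, bL = (%v. rp (hspace H) (vspace V) (lcoact V v)),
   bR = (%v. rp (vspace V) (hspace H) (rcoact V v))\<rparr>"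

lemma HC_simps [simp]: "cF (HC H) = hlin H" "cE (HC H) = hcounit H"
  "cD (HC H) h = rp (hspace H) (hspace H) (hcomult H h)"
 and VB_simps [simp]: "bF (VB H V) = vlin V" "bL (VB H V) v = rp (hspace H) (vspace V) (lcoact V v)"
  "bR (VB H V) v = rp (vspace V) (hspace H) (rcoact V v)"
 by (simp_all add: HC_def VB_def)

lemma counit_ssum:
 assumes "vector_space s" and t: "t \<in> elems (tensor (full a) (full s))" and e: "e \<in> lin a"
  and "tlift (full a) (full s) (%h w. s (e h) w) t = v" and \<phi>: "\<phi> \<in> lin s"
 shows "ssum (rp (full a) (full s) t) (%h w. e h * \<phi> w) = \<phi> v"
proof -
 have "(%h w. \<phi> (s (e h) w)) \<in> bi (lin a) (lin s)" if "\<phi> \<in> lin s" for \<phi>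
  using that e by (auto simp: bi_def lin_scale intro!: forms_mult forms_mult')
 from tlift_vec[OF assms(1), where f = "%h w. s (e h) w", OF this t] assms(4) show ?thesis
  by (auto simp: lin_ssum[OF \<phi>] lin_scale[OF \<phi>])
qed

lemma counit_ssum':
 assumes "vector_space s" and t: "t \<in> elems (tensor (full s) (full a))" and e: "e \<in> lin a"
  and "tlift (full s) (full a) (%w h. s (e h) w) t = v" and \<phi>: "\<phi> \<in> lin s"
 shows "ssum (rp (full s) (full a) t) (%w h. \<phi> w * e h) = \<phi> v"
proof -
 have "(%w h. \<phi> (s (e h) w)) \<in> bi (lin s) (lin a)" if "\<phi> \<in> lin s" for \<phi>
  using that e by (auto simp: bi_def lin_scale intro!: forms_mult forms_mult')
 from tlift_vec[OF assms(1), where f = "%w h. s (e h) w", OF this t] assms(4) show ?thesis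
  by (auto simp: lin_ssum[OF \<phi>] lin_scale[OF \<phi>] mult.commute)
qed

lemma coalgebra_is_cog:
 assumes "is_coalgebra (hspace H) (hcomult H) (hcounit H)"
 shows "is_cog (HC H)"
proof -
 let ?A = "hspace H"
 have vs: "vector_space (hscale H)" using assms by (simp add: is_coalgebra_def is_space_full)
 have \<Delta>: "linear_map ?A (tensor ?A ?A) (hcomult H)" and e: "hcounit H \<in> hlin H"
  using assms by (auto simp: is_coalgebra_def lin_def)
 note t = linear_map_tensor[OF \<Delta>]
 have ca: "ssum (rp ?A ?A (hcomult H v)) (%c w. ssum (rp ?A ?A (hcomult H c)) (%x y. f x y w)) =
    ssum (rp ?A ?A (hcomult H v)) (%x w. ssum (rp ?A ?A (hcomult H w)) (%y z. f x y z))"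
  if "f \<in> tri (hlin H) (hlin H) (hlin H)" for f v
  by (rule coassoc_ssum[OF _ \<Delta> \<Delta> t t that]) (use assms in \<open>simp add: is_coalgebra_def\<close>)
 have "ssum (rp ?A ?A (hcomult H v)) (%c w. hcounit H c * \<phi> w) = \<phi> v" if "\<phi> \<in> hlin H" for \<phi> v
  by (rule counit_ssum[OF vs t e _ that]) (use assms in \<open>simp add: is_coalgebra_def\<close>)
 moreover have "ssum (rp ?A ?A (hcomult H v)) (%w c. \<phi> w * hcounit H c) = \<phi> v" if "\<phi> \<in> hlin H" for \<phi> v
  by (rule counit_ssum'[OF vs t e _ that]) (use assms in \<open>simp add: is_coalgebra_def\<close>)
 moreover have "(%v. ssum (rp ?A ?A (hcomult H v)) f) \<in> hlin H" if "f \<in> bi (hlin H) (hlin H)" for f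
  by (rule rp_linear[OF \<Delta> that])
 ultimately show ?thesis
  unfolding is_cog_def is_bcm_def using e by (auto simp: ca)
qed

lemma bicomodule_is_bcm:
 assumes H: "is_coalgebra (hspace H) (hcomult H) (hcounit H)" and V: "bicomodule H V" and vs: "vector_space (vscale V)"
 shows "is_bcm (HC H) (VB H V)"
proof -
 let ?A = "hspace H" and ?M = "vspace V"
 have \<Delta>: "linear_map ?A (tensor ?A ?A) (hcomult H)" and e: "hcounit H \<in> hlin H"
  using H by (auto simp: is_coalgebra_def lin_def)
 have l: "linear_map ?M (tensor ?A ?M) (lcoact V)" and r: "linear_map ?M (tensor ?M ?A) (rcoact V)"
  using V by (auto simp: bicomodule_def Let_def)
 note tl = linear_map_tensor[OF l] and tr = linear_map_tensor[OF r]
 have 1: "(%v. ssum (rp ?A ?M (lcoact V v)) f) \<in> vlin V" if "f \<in> bi (hlin H) (vlin V)" for f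
  by (rule rp_linear[OF l that])
 have 2: "(%v. ssum (rp ?M ?A (rcoact V v)) f) \<in> vlin V" if "f \<in> bi (vlin V) (hlin H)" for f
  by (rule rp_linear[OF r that])
 have 3: "ssum (rp ?A ?M (lcoact V v)) (%c w. ssum (rp ?A ?A (hcomult H c)) (%x y. f x y w)) =
    ssum (rp ?A ?M (lcoact V v)) (%x w. ssum (rp ?A ?M (lcoact V w)) (%y z. f x y z))"
  if "f \<in> tri (hlin H) (hlin H) (vlin V)" for f v
  by (rule coassoc_ssum[OF _ \<Delta> l tl tl that]) (use V in \<open>simp add: bicomodule_def Let_def\<close>)
 have 4: "ssum (rp ?M ?A (rcoact V v)) (%w y. ssum (rp ?M ?A (rcoact V w)) (%z x. f z x y)) =
   ssum (rp ?M ?A (rcoact V v)) (%w c. ssum (rp ?A ?A (hcomult H c)) (%x y. f w x y))"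
  if "f \<in> tri (vlin V) (hlin H) (hlin H)" for f v
  by (rule coassoc_ssum[OF _ r \<Delta> tr tr that]) (use V in \<open>simp add: bicomodule_def Let_def\<close>)
 have 5: "ssum (rp ?M ?A (rcoact V v)) (%w y. ssum (rp ?A ?M (lcoact V w)) (%x z. f x z y)) =
   ssum (rp ?A ?M (lcoact V v)) (%x w. ssum (rp ?M ?A (rcoact V w)) (%z y. f x z y))"
  if "f \<in> tri (hlin H) (vlin V) (hlin H)" for f v
  by (rule coassoc_ssum[OF _ l r tr tl that]) (use V in \<open>simp add: bicomodule_def Let_def\<close>)
 have 6: "ssum (rp ?A ?M (lcoact V v)) (%c w. hcounit H c * \<phi> w) = \<phi> v" if "\<phi> \<in> vlin V" for \<phi> v
  by (rule counit_ssum[OF vs tl e _ that]) (use V in \<open>simp add: bicomodule_def Let_def\<close>)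
 have 7: "ssum (rp ?M ?A (rcoact V v)) (%w c. \<phi> w * hcounit H c) = \<phi> v" if "\<phi> \<in> vlin V" for \<phi> v
  by (rule counit_ssum'[OF vs tr e _ that]) (use V in \<open>simp add: bicomodule_def Let_def\<close>)
 show ?thesis
  unfolding is_bcm_def using 1 2 6 7 by (auto simp: 3 4 5)
qed

lemma tlift2_tens:
 assumes t: "t \<in> elems (tensor (full a) (full b))" and u: "u \<in> elems (tensor (full c) (full d))"
  and m: "!!\<psi>. \<psi> \<in> lin x ==> (%p r. \<psi> (m p r)) \<in> bi (lin a) (lin c)"
  and n: "!!\<psi>. \<psi> \<in> lin y ==> (%q s. \<psi> (n q s)) \<in> bi (lin b) (lin d)"
 shows "tlift (full a) (full b) (%p q. tlift (full c) (full d) (%r s. tens (full x) (full y) (m p r) (n q s)) u) t =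
  ssum (rp (full a) (full b) t) (%p q. ssum (rp (full c) (full d) u) (%r s. tens (full x) (full y) (m p r) (n q s)))"
proof -
 have *: "(%p. f (m p r) k) \<in> lin a" "(%r. f (m p r) k) \<in> lin c" "(%q. f k' (n q s)) \<in> lin b" "(%s. f k' (n q s)) \<in> lin d"
  if "f \<in> bi (lin x) (lin y)" for f p q r s k k'
  using m[OF bi1[OF that]] n[OF bi2[OF that]] by (auto simp: bi_def)
 note ** = *[OF tens_bi[of x y]]
 have "tlift (full c) (full d) (%r s. tens (full x) (full y) (m p r) (n q s)) u =
   ssum (rp (full c) (full d) u) (%r s. tens (full x) (full y) (m p r) (n q s))" for p q
  by (intro tlift_quot[OF _ u] biI **)
 then show ?thesis
  by (simp, intro tlift_quot[OF _ t]) (unfold ssum_apply, intro biI forms_ssum[OF forms_lin] **)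
qed

text \<open>The bridge between multiplicativity of a coproduct or coaction, written with nested
  lifts in a tensor product, and the \<open>morph\<close> conditions on forms.\<close>

lemma tensor_eq_mult_iff:
 assumes t: "t \<in> elems (tensor (full a) (full b))" and u: "u \<in> elems (tensor (full c) (full d))"
  and m: "!!\<psi>. \<psi> \<in> lin x ==> (%p r. \<psi> (m p r)) \<in> bi (lin a) (lin c)"
  and n: "!!\<psi>. \<psi> \<in> lin y ==> (%q s. \<psi> (n q s)) \<in> bi (lin b) (lin d)"
  and w: "w \<in> elems (tensor (full x) (full y))"
 shows "w = tlift (full a) (full b) (%p q. tlift (full c) (full d) (%r s. tens (full x) (full y) (m p r) (n q s)) u) t
  \<longleftrightarrow> (\<forall>f\<in>bi (lin x) (lin y). ssum (rp (full x) (full y) w) f =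
   ssum (rp (full a) (full b) t) (%p q. ssum (rp (full c) (full d) u) (%r s. f (m p r) (n q s))))"
  (is "w = ?T \<longleftrightarrow> ?R")
proof -
 have e: "?T = ssum (rp (full a) (full b) t) (%p q. ssum (rp (full c) (full d) u) (%r s. tens (full x) (full y) (m p r) (n q s)))"
  by (rule tlift2_tens[OF t u]) (fact m n)+
 have in': "ssum (rp (full c) (full d) u) (%r s. tens (full x) (full y) (m p r) (n q s)) \<in> elems (tensor (full x) (full y))" for p q
  by (intro ssum_in_tensor tens_in_tensor) auto
 have T: "?T \<in> elems (tensor (full x) (full y))" unfolding e by (intro ssum_in_tensor in')
 have "ssum (rp (full x) (full y) ?T) f =
   ssum (rp (full a) (full b) t) (%p q. ssum (rp (full c) (full d) u) (%r s. f (m p r) (n q s)))"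
  if "f \<in> bi (lin x) (lin y)" for f
  unfolding e using that by (simp add: rp_ssum in' tens_in_tensor rp_tens)
 then show ?thesis using tensor_eqI[OF w T] by auto
qed

text \<open>The same bridge for colinear maps, where each leg is mapped separately.\<close>

lemma tensor_eq_map_iff:
 assumes t: "t \<in> elems (tensor (full a) (full b))"
  and m: "!!\<psi>. \<psi> \<in> lin x ==> (%p. \<psi> (m p)) \<in> lin a" and n: "!!\<psi>. \<psi> \<in> lin y ==> (%q. \<psi> (n q)) \<in> lin b"
  and w: "w \<in> elems (tensor (full x) (full y))"
 shows "w = tlift (full a) (full b) (%p q. tens (full x) (full y) (m p) (n q)) t
  \<longleftrightarrow> (\<forall>f\<in>bi (lin x) (lin y). ssum (rp (full x) (full y) w) f = ssum (rp (full a) (full b) t) (%p q. f (m p) (n q)))"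
  (is "w = ?T \<longleftrightarrow> ?R")
proof -
 have z: "(%_. 0) \<in> lin e" for e using forms_zero[OF forms_lin] .
 have e: "?T = ssum (rp (full a) (full b) t) (%p q. tens (full x) (full y) (m p) (n q))"
 proof (rule tlift_quot[OF _ t])
  show "(%p q. tens (full x) (full y) (m p) (n q) \<phi>) \<in> bi (lin a) (lin b)" for \<phi>
   by (intro biI m[OF bi1[OF tens_bi]] n[OF bi2[OF tens_bi]])
 qed
 have T: "?T \<in> elems (tensor (full x) (full y))" unfolding e by (intro ssum_in_tensor tens_in_tensor) auto
 have "ssum (rp (full x) (full y) ?T) f = ssum (rp (full a) (full b) t) (%p q. f (m p) (n q))"
  if "f \<in> bi (lin x) (lin y)" for f
  unfolding e using that by (simp add: rp_ssum tens_in_tensor rp_tens)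
 then show ?thesis using tensor_eqI[OF w T] by auto
qed

section \<open>Antipodes\<close>

text \<open>Regroups four legs so that the two inner ones come from a common element and can be
  contracted by an antipode axiom or a convolution inverse.\<close>

lemma cog_coassoc4:
 assumes C: "is_cog C" and f: "!!b c d. (%a. f a b c d) \<in> cF C" "!!a c d. (%b. f a b c d) \<in> cF C"
  "!!a b d. (%c. f a b c d) \<in> cF C" "!!a b c. (%d. f a b c d) \<in> cF C"
 shows "ssum (cD C x) (%p q. ssum (cD C p) (%a b. ssum (cD C q) (%c d. f a b c d))) =
  ssum (cD C x) (%a t. ssum (cD C t) (%w d. ssum (cD C w) (%b c. f a b c d)))"
proof -
 note fs = cog_forms[OF C]
 have "ssum (cD C x) (%p q. ssum (cD C p) (%a b. ssum (cD C q) (%c d. f a b c d))) =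
  ssum (cD C x) (%a t. ssum (cD C t) (%b q. ssum (cD C q) (%c d. f a b c d)))"
  by (rule cog_coassoc[OF C]) (intro triI forms_ssum[OF fs] cog_cD[OF C] biI f)
 also have "... = ssum (cD C x) (%a t. ssum (cD C t) (%w d. ssum (cD C w) (%b c. f a b c d)))"
  by (rule ssum_cong, rule cog_coassoc[OF C, symmetric]) (intro triI f)
 finally show ?thesis .
qed

text \<open>The target algebra of the convolution enters through its forms only.\<close>

lemma conv_unique:
 assumes X: "is_cog X"
  and n: "!!\<phi>. \<phi> \<in> F ==> (%a b. \<phi> (n a b)) \<in> bi F F"
  and assoc: "!!\<phi> a b c. \<phi> \<in> F ==> \<phi> (n (n a b) c) = \<phi> (n a (n b c))"
  and unit: "!!\<phi> a. \<phi> \<in> F ==> \<phi> (n u a) = \<phi> a" "!!\<phi> a. \<phi> \<in> F ==> \<phi> (n a u) = \<phi> a"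
  and P: "!!\<phi>. \<phi> \<in> F ==> (%x. \<phi> (P x)) \<in> cF X" and M: "!!\<phi>. \<phi> \<in> F ==> (%x. \<phi> (M x)) \<in> cF X"
  and N: "!!\<phi>. \<phi> \<in> F ==> (%x. \<phi> (N x)) \<in> cF X"
  and PM: "!!\<phi> x. \<phi> \<in> F ==> ssum (cD X x) (%a b. \<phi> (n (P a) (M b))) = cE X x * \<phi> u"
  and MN: "!!\<phi> x. \<phi> \<in> F ==> ssum (cD X x) (%a b. \<phi> (n (M a) (N b))) = cE X x * \<phi> u"
  and \<phi>: "\<phi> \<in> F"
 shows "\<phi> (P x) = \<phi> (N x)"
proof -
 note n1 = bi1[OF n[OF \<phi>]] and n2 = bi2[OF n[OF \<phi>]]
 have "\<phi> (P x) = ssum (cD X x) (%a b. cE X b * \<phi> (n (P a) u))"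
  using cog_counitR[OF X P[OF \<phi>]] unit(2)[OF \<phi>] by (simp add: mult.commute)
 also have "... = ssum (cD X x) (%a b. ssum (cD X b) (%c d. \<phi> (n (P a) (n (M c) (N d)))))"
  using MN[OF n2] by simp
 also have "... = ssum (cD X x) (%b d. ssum (cD X b) (%a c. \<phi> (n (P a) (n (M c) (N d)))))"
  using P[OF n1] M[OF bi1[OF n[OF n2]]] N[OF bi2[OF n[OF n2]]]
  by (intro cog_coassoc[OF X, symmetric] triI) auto
 also have "... = ssum (cD X x) (%b d. cE X b * \<phi> (n u (N d)))"
  using PM[OF n1] by (simp flip: assoc[OF \<phi>])
 also have "... = \<phi> (N x)"
  using cog_counitL[OF X N[OF \<phi>]] unit(1)[OF \<phi>] by simp
 finally show ?thesis .
qed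

text \<open>The co-opposite coalgebra. Over it the antipode, which reverses coproducts, is an
  ordinary morphism, and twists can be pulled back along it.\<close>

definition flipC :: "('k, 'c) cog => ('k, 'c) cog" where
 "flipC C = \<lparr>cF = cF C, cD = (%c. map (%(a, b). (b, a)) (cD C c)), cE = cE C\<rparr>"

definition flipB :: "('k, 'c, 'v) bcm => ('k, 'c, 'v) bcm" where
 "flipB B = \<lparr>bF = bF B, bL = (%v. map (%(a, b). (b, a)) (bR B v)), bR = (%v. map (%(a, b). (b, a)) (bL B v))\<rparr>"

lemma flip_simps [simp]: "cF (flipC C) = cF C" "cE (flipC C) = cE C" "bF (flipB B) = bF B"
 "ssum (cD (flipC C) c) f = ssum (cD C c) (%a b. f b a)"
 "ssum (bL (flipB B) v) g = ssum (bR B v) (%a b. g b a)"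
 "ssum (bR (flipB B) v) h = ssum (bL B v) (%a b. h b a)"
 by (simp_all add: flipC_def flipB_def ssum_map)

lemma flip_is_bcm:
 assumes "is_bcm C B"
 shows "is_bcm (flipC C) (flipB B)"
 unfolding is_bcm_def flip_simps
proof (intro conjI ballI allI)
 show "forms (bF B)" by (rule bcm_forms[OF assms])
 show "(%v. ssum (bR B v) (%a b. f b a)) \<in> bF B" if "f \<in> bi (cF C) (bF B)" for f
  using that by (intro bcm_bR[OF assms]) (auto simp: bi_def)
 show "(%v. ssum (bL B v) (%a b. f b a)) \<in> bF B" if "f \<in> bi (bF B) (cF C)" for f
  using that by (intro bcm_bL[OF assms]) (auto simp: bi_def)
 show "ssum (bR B v) (%a b. ssum (cD C b) (%aa ba. f ba aa a)) = ssum (bR B v) (%a b. ssum (bR B a) (%aa ba. f b ba aa))"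
  if "f \<in> tri (cF C) (cF C) (bF B)" for f v
  using that by (intro bcm_RR[OF assms]) (auto simp: tri_def)
 show "ssum (bL B v) (%a b. ssum (cD C a) (%aa ba. f b ba aa)) = ssum (bL B v) (%a b. ssum (bL B b) (%aa ba. f ba aa a))"
  if "f \<in> tri (bF B) (cF C) (cF C)" for f v
  using that by (intro bcm_LL[OF assms]) (auto simp: tri_def)
 show "ssum (bR B v) (%a b. ssum (bL B a) (%aa ba. f b ba aa)) = ssum (bL B v) (%a b. ssum (bR B b) (%aa ba. f ba aa a))"
  if "f \<in> tri (cF C) (bF B) (cF C)" for f v
  using that by (intro bcm_LR[OF assms, symmetric]) (auto simp: tri_def)
 show "ssum (bR B v) (%a b. cE C b * f a) = f v" if "f \<in> bF B" for f v
  using bcm_counitR[OF assms that] by (simp add: mult.commute)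
 show "ssum (bL B v) (%a b. f b * cE C a) = f v" if "f \<in> bF B" for f v
  using bcm_counitL[OF assms that] by (simp add: mult.commute)
qed

lemma flipB_selfB: "flipB (selfB C) = selfB (flipC C)"
 by (simp add: flipB_def selfB_def flipC_def)

lemma flip_is_cog: "is_cog C ==> is_cog (flipC C)"
 using flip_is_bcm[of C "selfB C"] by (simp add: is_cog_def flipB_selfB)

section \<open>Hopf algebras, and Hopf structures over them\<close>

locale hopf = bialg C mu e for C :: "('k::field, 'c) cog" and mu e +
 fixes S :: "'c => 'c"
 assumes S_form: "\<phi> \<in> cF C ==> (%x. \<phi> (S x)) \<in> cF C"
  and SL: "\<phi> \<in> cF C ==> ssum (cD C x) (%a b. \<phi> (mu (S a) b)) = cE C x * \<phi> e"
  and SR: "\<phi> \<in> cF C ==> ssum (cD C x) (%a b. \<phi> (mu a (S b))) = cE C x * \<phi> e"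
begin

lemma mu_form: "\<phi> \<in> cF C ==> (%a. \<phi> (mu a b)) \<in> cF C" "\<phi> \<in> cF C ==> (%b. \<phi> (mu a b)) \<in> cF C"
 using morph_cF[OF mu_morph, of \<phi>] by (auto simp: pform_def bi_def)

lemma S_counit: "cE C (S x) = cE C x"
proof -
 have 1: "(%x. cE C (S x)) \<in> cF C" by (rule S_form[OF cog_cE[OF cog]])
 show ?thesis
  using SL[OF cog_cE[OF cog], of x] cog_counitR[OF cog 1] by (simp add: mu_counit unit_counit)
qed

lemma S_unit: "S e = e"
proof (rule separating)
 fix \<phi> assume \<phi>: "\<phi> \<in> cF C"
 have "ssum (cD C e) (%a b. \<phi> (mu (S a) b)) = \<phi> (mu (S e) e)"
  by (intro unit_group biI mu_form[OF \<phi>] S_form[OF mu_form(1)[OF \<phi>]])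
 then show "\<phi> (S e) = \<phi> e" using SL[OF \<phi>, of e] by (simp add: mu_unit unit_counit)
qed

end

text \<open>
 A super-Hopf algebra \<open>W\<close> over the Hopf algebra in degree 0; \<open>pi\<close> is the projection to degree 0.
 The signs of the coproduct of \<open>W\<close> play no role for the properties assumed here.
\<close>

locale hopf_over = hopf C mu e S for C :: "('k::field, 'c) cog" and mu e S +
 fixes W :: "('k, 'w) cog" and m :: "'w => 'w => 'w" and one :: 'w and T :: "'w => 'w" and pi :: "'w => 'c"
  and BW :: "('k, 'c, 'w) bcm"
 defines "BW \<equiv> \<lparr>bF = cF W, bL = (%x. map (%(a, b). (pi a, b)) (cD W x)), bR = (%x. map (%(a, b). (a, pi b)) (cD W x))\<rparr>"
 assumes W: "is_cog W"
  and pi: "cmorph W C pi" and pi_counit: "cE W x = cE C (pi x)"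
  and m_morph: "morph (prodC C C) C (case_prod mu) (case_prod m) (prodB BW BW) BW"
  and m_assoc: "m (m a b) c = m a (m b c)"
  and m_unit: "m one a = a" "m a one = a"
  and one_L: "f \<in> bi (cF C) (cF W) ==> ssum (cD W one) (%a b. f (pi a) b) = f e one"
  and one_R: "f' \<in> bi (cF W) (cF C) ==> ssum (cD W one) (%a b. f' a (pi b)) = f' one e"
  and T_form: "\<phi> \<in> cF W ==> (%x. \<phi> (T x)) \<in> cF W"
  and TL: "\<phi> \<in> cF W ==> ssum (cD W x) (%a b. \<phi> (m (T a) b)) = cE W x * \<phi> one"
  and TR: "\<phi> \<in> cF W ==> ssum (cD W x) (%a b. \<phi> (m a (T b))) = cE W x * \<phi> one"
begin

lemma BW_simps [simp]: "bF BW = cF W" "ssum (bL BW x) f = ssum (cD W x) (%a b. f (pi a) b)"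
 "ssum (bR BW x) g = ssum (cD W x) (%a b. g a (pi b))"
 by (simp_all add: BW_def ssum_map)

lemma pi_form: "u \<in> cF C ==> (%x. u (pi x)) \<in> cF W"
 by (rule morph_cF[OF pi])

lemma pi_D: "f \<in> bi (cF C) (cF C) ==> ssum (cD C (pi x)) f = ssum (cD W x) (%a b. f (pi a) (pi b))"
 using morph_bL[OF pi] by simp

lemma BW_bcm: "is_bcm C BW"
 unfolding is_bcm_def BW_simps
proof (intro conjI ballI allI)
 show "forms (cF W)" by (rule cog_forms[OF W])
 show "(%v. ssum (cD W v) (%a. f (pi a))) \<in> cF W" if "f \<in> bi (cF C) (cF W)" for f
  by (intro cog_cD[OF W] biI pi_form[OF bi1[OF that]] bi2[OF that])
 show "(%v. ssum (cD W v) (%a b. f a (pi b))) \<in> cF W" if "f \<in> bi (cF W) (cF C)" for f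
  by (intro cog_cD[OF W] biI pi_form[OF bi2[OF that]] bi1[OF that])
 show "ssum (cD W v) (%a w. ssum (cD C (pi a)) (%x y. f x y w)) = ssum (cD W v) (%a b. ssum (cD W b) (%aa. f (pi a) (pi aa)))"
  if f: "f \<in> tri (cF C) (cF C) (cF W)" for f v
  unfolding pi_D[OF tri_slice(1)[OF f]]
  by (rule cog_coassoc[OF W]) (intro triI pi_form tri1[OF f] tri2[OF f] tri3[OF f])
 show "ssum (cD W v) (%a b. ssum (cD C (pi b)) (f a)) = ssum (cD W v) (%a b. ssum (cD W a) (%aa ba. f aa (pi ba) (pi b)))"
  if f: "f \<in> tri (cF W) (cF C) (cF C)" for f v
  unfolding pi_D[OF tri_slice(3)[OF f]]
  by (rule cog_coassoc[OF W, symmetric]) (intro triI pi_form tri1[OF f] tri2[OF f] tri3[OF f])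
 show "ssum (cD W v) (%a b. ssum (cD W b) (%aa b. f (pi a) aa (pi b))) = ssum (cD W v) (%a b. ssum (cD W a) (%a z. f (pi a) z (pi b)))"
  if f: "f \<in> tri (cF C) (cF W) (cF C)" for f v
  by (rule cog_coassoc[OF W, symmetric]) (intro triI pi_form tri1[OF f] tri2[OF f] tri3[OF f])
 show "ssum (cD W v) (%a b. cE C (pi a) * f b) = f v" "ssum (cD W v) (%a b. f a * cE C (pi b)) = f v"
  if "f \<in> cF W" for f v
  using cog_counitL[OF W that] cog_counitR[OF W that] by (simp_all add: pi_counit)
qed

text \<open>All conditions are coassociativity with \<open>pi\<close> applied to one leg. Therefore
  \<open>twf_cosplit\<close> applies not only to the coactions but to the full coproduct of
  \<open>W\<close>.\<close>

lemma cosplit_D: "cosplit C BW BW BW (cD W)"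
 unfolding cosplit_def BW_simps
proof (intro conjI ballI allI)
 show "(%v. ssum (cD W v) f) \<in> cF W" if "f \<in> bi (cF W) (cF W)" for f
  by (rule cog_cD[OF W that])
 show "ssum (cD W v) (%a b. ssum (cD W b) (f (pi a))) = ssum (cD W v) (%x y. ssum (cD W x) (%a x'. f (pi a) x' y))"
  if f: "f \<in> tri (cF C) (cF W) (cF W)" for f v
  by (rule cog_coassoc[OF W, symmetric]) (intro triI pi_form tri1[OF f] tri2[OF f] tri3[OF f])
 show "ssum (cD W v) (%a b. ssum (cD W a) (%x y. f x y (pi b))) = ssum (cD W v) (%x y. ssum (cD W y) (%a b. f x a (pi b)))"
  if f: "f \<in> tri (cF W) (cF W) (cF C)" for f v
  by (rule cog_coassoc[OF W]) (intro triI pi_form tri1[OF f] tri2[OF f] tri3[OF f])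
 show "ssum (cD W v) (%x y. ssum (cD W x) (%a b. f a (pi b) y)) = ssum (cD W v) (%x y. ssum (cD W y) (%a. f x (pi a)))"
  if f: "f \<in> tri (cF W) (cF C) (cF W)" for f v
  by (rule cog_coassoc[OF W]) (intro triI pi_form tri1[OF f] tri2[OF f] tri3[OF f])
qed

lemma m_form: "\<phi> \<in> cF W ==> (%a b. \<phi> (m a b)) \<in> bi (cF W) (cF W)"
 using morph_bF[OF m_morph, of \<phi>] by (simp add: pform_def)

lemma m_L: "f \<in> bi (cF C) (cF W) ==> ssum (bL BW (m a b)) f =
  ssum (cD W a) (%a1 a2. ssum (cD W b) (%b1 b2. f (mu (pi a1) (pi b1)) (m a2 b2)))"
 using morph_bL[OF m_morph, of f "(a, b)"] by (simp add: ssum_plist del: BW_simps(2)) simp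

lemma m_R: "f \<in> bi (cF W) (cF C) ==> ssum (bR BW (m a b)) f =
  ssum (cD W a) (%a1 a2. ssum (cD W b) (%b1 b2. f (m a1 b1) (mu (pi a2) (pi b2))))"
 using morph_bR[OF m_morph, of f "(a, b)"] by (simp add: ssum_plist del: BW_simps(3)) simp

text \<open>A left convolution inverse of the identity equals the right inverse
  \<open>T\<close>.\<close>

lemma T_unique:
 assumes T': "!!\<phi>. \<phi> \<in> cF W ==> (%x. \<phi> (T' x)) \<in> cF W"
  "!!\<phi> x. \<phi> \<in> cF W ==> ssum (cD W x) (%a b. \<phi> (m (T' a) b)) = cE W x * \<phi> one" and \<phi>: "\<phi> \<in> cF W"
 shows "\<phi> (T' x) = \<phi> (T x)"
 by (rule conv_unique[OF W, where F = "cF W" and n = m and u = one and M = "%x. x"])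
  (auto simp: m_form m_assoc m_unit T' T_form TR \<phi>)

text \<open>In the next two proofs the algebra of formal sums of pairs stands for \<open>H \<otimes> W\<close> and \<open>W \<otimes> H\<close>.\<close>

lemma T_anticolinear_L:
 assumes f: "f \<in> bi (cF C) (cF W)"
 shows "ssum (bL BW (T x)) f = ssum (bR BW x) (%w c. f (S c) (T w))"
proof -
 let ?F = "{%xs. ssum xs f | f. f \<in> bi (cF C) (cF W)}"
 let ?n = "%xs ys. map (%(p, q). (case_prod mu p, case_prod m q)) (plist xs ys)"
 have n: "ssum (?n xs ys) f = ssum xs (%h w. ssum ys (%g y. f (mu h g) (m w y)))" for xs ys and f :: "'c => 'w => 'k"
  unfolding ssum_map ssum_plist by simp
 have FI: "h \<in> ?F" if "g \<in> bi (cF C) (cF W)" "!!xs. h xs = ssum xs g" for g h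
  using that by (intro CollectI exI[of _ g] conjI) auto
 note fC = cog_forms[OF cog] and fW = cog_forms[OF W]
 have fm: "(%h. f (mu h g) z) \<in> cF C" "(%g. f (mu h g) z) \<in> cF C" "(%w. f c (m w y)) \<in> cF W" "(%y. f c (m w y)) \<in> cF W"
  if "f \<in> bi (cF C) (cF W)" for f :: "'c => 'w => 'k" and h g w y z c
  using mu_form[OF bi1[OF that]] m_form[OF bi2[OF that]] by (auto simp: bi_def)
 have inner: "(%h w. ssum ys (%g y. f (mu h g) (m w y))) \<in> bi (cF C) (cF W)"
   "(%g y. ssum xs (%h w. f (mu h g) (m w y))) \<in> bi (cF C) (cF W)"
  if "f \<in> bi (cF C) (cF W)" for xs ys and f :: "'c => 'w => 'k"
  by (intro biI forms_ssum[OF fC] forms_ssum[OF fW] fm[OF that])+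
 have TT: "(%y. f c (T y)) \<in> cF W" "(%g. f (S g) y) \<in> cF C" if "f \<in> bi (cF C) (cF W)" for f :: "'c => 'w => 'k" and c y
  using T_form[OF bi2[OF that]] S_form[OF bi1[OF that]] by auto
 \<comment> \<open>Both sides are convolution inverses of the left coaction, which is multiplicative
   into \<open>H \<otimes> W\<close>: the left side by the antipode axiom \<open>TL\<close>, the
   right side because \<open>TR\<close> contracts the \<open>W\<close> legs and then
   \<open>SR\<close> the \<open>H\<close> legs.\<close>
 have main: "ssum (bL BW (T x)) f = ssum (map (%(w, c). (S c, T w)) (bR BW x)) f"
 proof (rule conv_unique[OF W, where F = ?F and n = ?n and u = "[(e, one)]" and M = "bL BW"
   and P = "%x. bL BW (T x)" and N = "%x. map (%(w, c). (S c, T w)) (bR BW x)" and \<phi> = "%xs. ssum xs f" and x = x])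
  show "(%xs. ssum xs f) \<in> ?F" using f by blast
  fix \<phi> assume "\<phi> \<in> ?F"
  then obtain f where \<phi>: "\<phi> = (%xs. ssum xs f)" and f: "f \<in> bi (cF C) (cF W)" by blast
  show "(%xs ys. \<phi> (?n xs ys)) \<in> bi ?F ?F"
  proof (rule biI)
   show "(%xs. \<phi> (?n xs ys)) \<in> ?F" for ys by (rule FI[OF inner(1)[OF f]]) (simp add: \<phi> n)
   have "\<phi> (?n xs ys) = ssum ys (%g y. ssum xs (%h w. f (mu h g) (m w y)))" for xs ys
    by (simp add: \<phi> n ssum_swap[of xs])
   then show "(%ys. \<phi> (?n xs ys)) \<in> ?F" for xs by (intro FI[OF inner(2)[OF f]])
  qed
  show "\<phi> (?n (?n xs ys) zs) = \<phi> (?n xs (?n ys zs))" for xs ys zs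
   by (simp add: \<phi> n mu_assoc m_assoc)
  show "\<phi> (?n [(e, one)] xs) = \<phi> xs" "\<phi> (?n xs [(e, one)]) = \<phi> xs" for xs
   by (simp_all add: \<phi> n mu_unit m_unit)
  show "(%x. \<phi> (bL BW x)) \<in> cF W" using bcm_bL[OF BW_bcm, of f] f by (simp add: \<phi>)
  then show "(%x. \<phi> (bL BW (T x))) \<in> cF W" by (rule T_form)
  show "(%x. \<phi> (map (%(w, c). (S c, T w)) (bR BW x))) \<in> cF W"
   unfolding \<phi> ssum_map using bcm_bR[OF BW_bcm, of "%w c. f (S c) (T w)"] TT[OF f] by (simp add: biI)
  fix x
  have o: "ssum (bL BW one) f = f e one" using one_L[OF f] by simp
  have ml: "ssum (bL BW (m a b)) f = \<phi> (?n (bL BW a) (bL BW b))" for a b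
   unfolding \<phi> n m_L[OF f] by simp
  have bLf: "(%x. ssum (bL BW x) f) \<in> cF W" using bcm_bL[OF BW_bcm] f by simp
  show "ssum (cD W x) (%a b. \<phi> (?n (bL BW (T a)) (bL BW b))) = cE W x * \<phi> [(e, one)]"
   using TL[OF bLf, of x] unfolding ml[symmetric] o by (simp add: \<phi>)
  have "ssum (cD W x) (%a b. \<phi> (?n (bL BW a) (map (%(w, c). (S c, T w)) (bR BW b)))) =
    ssum (cD W x) (%a b. ssum (bL BW a) (%h w. ssum (bR BW b) (%y g. f (mu h (S g)) (m w (T y)))))"
   unfolding \<phi> n unfolding ssum_map ..
  also have "... = ssum (bL BW x) (%h v. ssum (cD W v) (%w b. ssum (bR BW b) (%y g. f (mu h (S g)) (m w (T y)))))"
   unfolding BW_simps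
   by (rule cog_coassoc[OF W], intro triI forms_ssum[OF fW] cog_cD[OF W] biI pi_form[OF S_form[OF mu_form(2)[OF bi1[OF f]]]]
    pi_form[OF mu_form(1)[OF bi1[OF f]]] T_form[OF fm(4)[OF f]] fm(3)[OF f])
  also have "... = ssum (bL BW x) (%h v. ssum (bR BW v) (%u g. ssum (cD W u) (%w y. f (mu h (S g)) (m w (T y)))))"
   unfolding BW_simps
   by (rule ssum_cong, rule cog_coassoc[OF W, symmetric], intro triI pi_form[OF S_form[OF mu_form(2)[OF bi1[OF f]]]]
    T_form[OF fm(4)[OF f]] fm(3)[OF f])
  also have "... = ssum (bL BW x) (%h v. f (mu h (S (pi v))) one)"
   using cog_counitL[OF W pi_form[OF S_form[OF mu_form(2)[OF bi1[OF f]]]]] by (simp add: TR[OF bi2[OF f]])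
  also have "... = cE W x * f e one"
   using SR[OF bi1[OF f], of "pi x"] pi_D[of "%a b. f (mu a (S b)) one" x]
    mu_form(1)[OF bi1[OF f]] S_form[OF mu_form(2)[OF bi1[OF f]]] by (simp add: biI pi_counit)
  finally show "ssum (cD W x) (%a b. \<phi> (?n (bL BW a) (map (%(w, c). (S c, T w)) (bR BW b)))) = cE W x * \<phi> [(e, one)]"
   by (simp add: \<phi>)
 qed
 show ?thesis unfolding main by (rule ssum_map)
qed

lemma T_anticolinear_R:
 assumes f: "f \<in> bi (cF W) (cF C)"
 shows "ssum (bR BW (T x)) f = ssum (bL BW x) (%c w. f (T w) (S c))"
proof -
 let ?F = "{%xs. ssum xs f | f. f \<in> bi (cF W) (cF C)}"
 let ?n = "%xs ys. map (%(p, q). (case_prod m p, case_prod mu q)) (plist xs ys)"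
 have n: "ssum (?n xs ys) f = ssum xs (%w h. ssum ys (%y g. f (m w y) (mu h g)))" for xs ys and f :: "'w => 'c => 'k"
  unfolding ssum_map ssum_plist by simp
 have FI: "h \<in> ?F" if "g \<in> bi (cF W) (cF C)" "!!xs. h xs = ssum xs g" for g h
  using that by (intro CollectI exI[of _ g] conjI) auto
 note fC = cog_forms[OF cog] and fW = cog_forms[OF W]
 have fm: "(%h. f z (mu h g)) \<in> cF C" "(%g. f z (mu h g)) \<in> cF C" "(%w. f (m w y) c) \<in> cF W" "(%y. f (m w y) c) \<in> cF W"
  if "f \<in> bi (cF W) (cF C)" for f :: "'w => 'c => 'k" and h g w y z c
  using mu_form[OF bi2[OF that]] m_form[OF bi1[OF that]] by (auto simp: bi_def)
 have inner: "(%w h. ssum ys (%y g. f (m w y) (mu h g))) \<in> bi (cF W) (cF C)"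
   "(%y g. ssum xs (%w h. f (m w y) (mu h g))) \<in> bi (cF W) (cF C)"
  if "f \<in> bi (cF W) (cF C)" for xs ys and f :: "'w => 'c => 'k"
  by (intro biI forms_ssum[OF fC] forms_ssum[OF fW] fm[OF that])+
 have TT: "(%y. f (T y) c) \<in> cF W" "(%g. f y (S g)) \<in> cF C" if "f \<in> bi (cF W) (cF C)" for f :: "'w => 'c => 'k" and c y
  using T_form[OF bi1[OF that]] S_form[OF bi2[OF that]] by auto
 have main: "ssum (bR BW (T x)) f = ssum (map (%(c, w). (T w, S c)) (bL BW x)) f"
 proof (rule conv_unique[OF W, where F = ?F and n = ?n and u = "[(one, e)]" and M = "bR BW"
   and P = "%x. bR BW (T x)" and N = "%x. map (%(c, w). (T w, S c)) (bL BW x)" and \<phi> = "%xs. ssum xs f" and x = x])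
  show "(%xs. ssum xs f) \<in> ?F" using f by blast
  fix \<phi> assume "\<phi> \<in> ?F"
  then obtain f where \<phi>: "\<phi> = (%xs. ssum xs f)" and f: "f \<in> bi (cF W) (cF C)" by blast
  show "(%xs ys. \<phi> (?n xs ys)) \<in> bi ?F ?F"
  proof (rule biI)
   show "(%xs. \<phi> (?n xs ys)) \<in> ?F" for ys by (rule FI[OF inner(1)[OF f]]) (simp add: \<phi> n)
   have "\<phi> (?n xs ys) = ssum ys (%y g. ssum xs (%w h. f (m w y) (mu h g)))" for xs ys
    by (simp add: \<phi> n ssum_swap[of xs])
   then show "(%ys. \<phi> (?n xs ys)) \<in> ?F" for xs by (intro FI[OF inner(2)[OF f]])
  qed
  show "\<phi> (?n (?n xs ys) zs) = \<phi> (?n xs (?n ys zs))" for xs ys zs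
   by (simp add: \<phi> n mu_assoc m_assoc)
  show "\<phi> (?n [(one, e)] xs) = \<phi> xs" "\<phi> (?n xs [(one, e)]) = \<phi> xs" for xs
   by (simp_all add: \<phi> n mu_unit m_unit)
  show "(%x. \<phi> (bR BW x)) \<in> cF W" using bcm_bR[OF BW_bcm, of f] f by (simp add: \<phi>)
  then show "(%x. \<phi> (bR BW (T x))) \<in> cF W" by (rule T_form)
  show "(%x. \<phi> (map (%(c, w). (T w, S c)) (bL BW x))) \<in> cF W"
   unfolding \<phi> ssum_map using bcm_bL[OF BW_bcm, of "%c w. f (T w) (S c)"] TT[OF f] by (simp add: biI)
  fix x
  have o: "ssum (bR BW one) f = f one e" using one_R[OF f] by simp
  have ml: "ssum (bR BW (m a b)) f = \<phi> (?n (bR BW a) (bR BW b))" for a b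
   unfolding \<phi> n m_R[OF f] by simp
  have bRf: "(%x. ssum (bR BW x) f) \<in> cF W" using bcm_bR[OF BW_bcm] f by simp
  show "ssum (cD W x) (%a b. \<phi> (?n (bR BW (T a)) (bR BW b))) = cE W x * \<phi> [(one, e)]"
   using TL[OF bRf, of x] unfolding ml[symmetric] o by (simp add: \<phi>)
  have "ssum (cD W x) (%a b. \<phi> (?n (bR BW a) (map (%(c, w). (T w, S c)) (bL BW b)))) =
    ssum (cD W x) (%a b. ssum (cD W a) (%w h. ssum (cD W b) (%g y. f (m w (T y)) (mu (pi h) (S (pi g))))))"
   unfolding \<phi> n unfolding ssum_map BW_simps ..
  \<comment> \<open>For the right coaction the \<open>C\<close> legs are the inner pair, so
    \<open>SR\<close> contracts first and \<open>TR\<close> last.\<close>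
  also have "... = ssum (cD W x) (%w t. ssum (cD W t) (%v y. ssum (cD W v) (%h g. f (m w (T y)) (mu (pi h) (S (pi g))))))"
   by (rule cog_coassoc4[OF W], intro pi_form[OF S_form[OF mu_form(2)[OF bi2[OF f]]]]
    pi_form[OF mu_form(1)[OF bi2[OF f]]] T_form[OF fm(4)[OF f]] fm(3)[OF f])
    (intro T_form[OF fm(4)[OF f]] fm(3)[OF f] pi_form[OF S_form[OF mu_form(2)[OF bi2[OF f]]]]
    pi_form[OF mu_form(1)[OF bi2[OF f]]])+
  also have "... = ssum (cD W x) (%w t. ssum (cD W t) (%v y. cE W v * f (m w (T y)) e))"
   using SR[OF bi2[OF f]] pi_D[of "%a b. f k (mu a (S b))" for k]
    mu_form(1)[OF bi2[OF f]] S_form[OF mu_form(2)[OF bi2[OF f]]] by (simp add: biI pi_counit)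
  also have "... = ssum (cD W x) (%w y. f (m w (T y)) e)"
   using cog_counitL[OF W T_form[OF fm(4)[OF f]]] by simp
  also have "... = cE W x * f one e" by (rule TR[OF bi1[OF f]])
  finally show "ssum (cD W x) (%a b. \<phi> (?n (bR BW a) (map (%(c, w). (T w, S c)) (bL BW b)))) = cE W x * \<phi> [(one, e)]"
   by (simp add: \<phi>)
 qed
 show ?thesis unfolding main by (rule ssum_map)
qed

lemma T_morph: "morph (flipC C) C S T (flipB BW) BW"
 unfolding morph_def flip_simps BW_simps(1)
 using S_form T_form T_anticolinear_L T_anticolinear_R by blast

end

text \<open>The degree 0 case \<open>W = H\<close> with the identity as projection; facts on the
  antipode of \<open>W\<close> thus specialise to \<open>S\<close>.\<close>

lemma (in hopf) hopf_over_self: "hopf_over C mu e S C mu e S (%x. x)"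
proof -
 have "\<lparr>bF = cF C, bL = %x. map (%(a, b). (a, b)) (cD C x), bR = %x. map (%(a, b). (a, b)) (cD C x)\<rparr> = selfB C"
  by (simp add: selfB_def)
 note eq = this
 show ?thesis
  by (intro hopf_over.intro hopf_over_axioms.intro, unfold eq)
   (rule hopf_axioms cog morph_id refl mu_morph[unfolded selfB_prodC] mu_assoc mu_unit unit_group S_form SL SR | assumption)+
qed

lemma (in hopf) S_antimorph: "f \<in> bi (cF C) (cF C) ==> ssum (cD C (S x)) f = ssum (cD C x) (%a b. f (S b) (S a))"
 using hopf_over.T_anticolinear_L[OF hopf_over_self, of f x] by (simp add: ssum_map)

lemma (in hopf) S_morph: "morph (flipC C) C S S (flipB (selfB C)) (selfB C)"
 using hopf_over.T_morph[OF hopf_over_self] by (simp add: selfB_def)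

section \<open>The twisted antipode\<close>

locale hopf_cocycle = hopf C mu e S + cocycle C mu e \<chi> \<xi>
 for C :: "('k::field, 'c) cog" and mu e S \<chi> \<xi>
begin

definition U :: "'c => 'k" where "U h = ssum (cD C h) (%a b. \<chi> (a, S b))"
text \<open>The closed formula for the convolution inverse of \<open>U\<close>, established in
  \<open>UV\<close> and \<open>VU\<close>.\<close>

definition V :: "'c => 'k" where "V h = ssum (cD C h) (%a b. \<xi> (S a, b))"

lemmas fC = cog_forms[OF cog]

lemma cocycle_forms:
 "(%a. \<chi> (a, b)) \<in> cF C" "(%b. \<chi> (a, b)) \<in> cF C" "(%a. \<xi> (a, b)) \<in> cF C" "(%b. \<xi> (a, b)) \<in> cF C"
 using chi xi by (auto simp: pform_def bi_def)

lemmas cfs = cocycle_forms S_form[OF cocycle_forms(1)] S_form[OF cocycle_forms(2)] S_form[OF cocycle_forms(3)] S_form[OF cocycle_forms(4)]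
lemmas muf = mu_form[OF cocycle_forms(1)] mu_form[OF cocycle_forms(2)] mu_form[OF cocycle_forms(3)] mu_form[OF cocycle_forms(4)]
lemmas muSf = muf[THEN S_form]
lemmas fintros = forms_ssum[OF fC] forms_mult[OF fC] forms_mult'[OF fC] cfs muf muSf

lemma U_form: "U \<in> cF C" and V_form: "V \<in> cF C"
 unfolding U_def[abs_def] V_def[abs_def] by (intro cog_cD[OF cog] biI cfs)+

text \<open>The cocycle identity with \<open>c23 \<chi>\<close> cancelled on the left and
  \<open>cm1 \<chi>\<close> on the right. It trades a shared middle argument of \<xi> and \<chi> for
  products inside the arguments, which antipodes can then contract.\<close>

lemma inverse_id1: "ssum (cD C g) (%g1 g2. \<xi> (g1, f) * \<chi> (h, g2)) =
 ssum (cD C h) (%h1 h2. ssum (cD C g) (%g1 g2. ssum (cD C f) (%f1 f2. \<chi> (h1, mu g1 f1) * \<xi> (mu h2 g2, f2))))"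
proof -
 note f = c23_form[OF chi] c1m_form[OF chi] c12_form[OF chi] cm1_form[OF chi]
  c23_form[OF xi] c1m_form[OF xi] c12_form[OF xi] cm1_form[OF xi]
 let ?c = "cv CCC"
 have "?c (c23 \<xi>) (?c (?c (c23 \<chi>) (c1m \<chi>)) (cm1 \<xi>)) = ?c (c1m \<chi>) (cm1 \<xi>)"
  using cv_assoc[OF CCC f(5) f(1) cv_form[OF CCC f(2) f(8)]] cv_assoc[OF CCC f(1,2,8)]
   cv_counitL[OF CCC cv_form[OF CCC f(2) f(8)]] c23_inv[OF xi chi xi_chi] by simp
 moreover have "?c (c23 \<xi>) (?c (?c (c12 \<chi>) (cm1 \<chi>)) (cm1 \<xi>)) = ?c (c23 \<xi>) (c12 \<chi>)"
  using cv_assoc[OF CCC f(3,4,8)] cv_counitR[OF CCC f(3)] cm1_inv[OF chi xi chi_xi] by simp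
 ultimately have id: "?c (c23 \<xi>) (c12 \<chi>) = ?c (c1m \<chi>) (cm1 \<xi>)" unfolding two_cocycle by simp
 have 1: "ssum (cD C h) (%h1 h2. cE C h1 * A * (\<chi> (h2, a) * B)) = A * (\<chi> (h, a) * B)" for A B a
  using cog_counitL[OF cog cocycle_forms(1), of h a]
  by (simp add: mult.assoc mult.left_commute[of _ A] ssum_mult_left)
   (simp add: mult.assoc[symmetric] ssum_mult_right)
 have 2: "ssum (cD C f) (%f1 f2. \<xi> (a, f1) * (A * cE C f2)) = \<xi> (a, f) * A" for A a
  using cog_counitR[OF cog cocycle_forms(4), of f a]
  by (simp add: mult.left_commute[of _ A] ssum_mult_left)
 have "?c (c23 \<xi>) (c12 \<chi>) ((h, g), f) = ssum (cD C g) (%g1 g2. ssum (cD C f) (%f1 f2.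
   ssum (cD C h) (%h1 h2. cE C h1 * \<xi> (g1, f1) * (\<chi> (h2, g2) * cE C f2))))"
  unfolding ssum_swap[of "cD C f" "cD C h"] ssum_swap[of "cD C g" "cD C h"]
  by (simp add: cv_def ssum_plist c23_def c12_def assoc3_def)
 also have "... = ssum (cD C g) (%g1 g2. \<xi> (g1, f) * \<chi> (h, g2))"
  unfolding 1 2 ..
 finally show ?thesis unfolding id
  by (simp add: cv_def ssum_plist c1m_def cm1_def assoc3_def)
qed

text \<open>The companion identity, with \<open>c12 \<chi>\<close> cancelled on the left and
  \<open>c1m \<chi>\<close> on the right.\<close>

lemma inverse_id2: "ssum (cD C g) (%g1 g2. \<xi> (h, g1) * \<chi> (g2, f)) =
 ssum (cD C h) (%h1 h2. ssum (cD C g) (%g1 g2. ssum (cD C f) (%f1 f2. \<chi> (mu h1 g1, f1) * \<xi> (h2, mu g2 f2))))"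
proof -
 note f = c23_form[OF chi] c1m_form[OF chi] c12_form[OF chi] cm1_form[OF chi]
  c23_form[OF xi] c1m_form[OF xi] c12_form[OF xi] cm1_form[OF xi]
 let ?c = "cv CCC"
 have "?c (c12 \<xi>) (?c (?c (c12 \<chi>) (cm1 \<chi>)) (c1m \<xi>)) = ?c (cm1 \<chi>) (c1m \<xi>)"
  using cv_assoc[OF CCC f(7) f(3) cv_form[OF CCC f(4) f(6)]] cv_assoc[OF CCC f(3,4,6)]
   cv_counitL[OF CCC cv_form[OF CCC f(4) f(6)]] c12_inv[OF xi chi xi_chi] by simp
 moreover have "?c (c12 \<xi>) (?c (?c (c23 \<chi>) (c1m \<chi>)) (c1m \<xi>)) = ?c (c12 \<xi>) (c23 \<chi>)"
  using cv_assoc[OF CCC f(1,2,6)] cv_counitR[OF CCC f(1)] c1m_inv[OF chi xi chi_xi] by simp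
 ultimately have id: "?c (c12 \<xi>) (c23 \<chi>) = ?c (cm1 \<chi>) (c1m \<xi>)" unfolding two_cocycle by simp
 have 1: "ssum (cD C h) (%h1 h2. \<xi> (h1, a) * A * (cE C h2 * B)) = \<xi> (h, a) * A * B" for A B a
  using cog_counitR[OF cog cocycle_forms(3), of h a]
  by (simp add: mult.assoc[symmetric] ssum_mult_right mult.assoc[of _ A] mult.commute[of A])
 have 2: "ssum (cD C f) (%f1 f2. A * cE C f1 * \<chi> (a, f2)) = A * \<chi> (a, f)" for A a
  using cog_counitL[OF cog cocycle_forms(2), of f a]
  by (simp add: mult.assoc ssum_mult_left)
 have "?c (c12 \<xi>) (c23 \<chi>) ((h, g), f) = ssum (cD C g) (%g1 g2. ssum (cD C f) (%f1 f2.
   ssum (cD C h) (%h1 h2. \<xi> (h1, g1) * cE C f1 * (cE C h2 * \<chi> (g2, f2)))))"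
  unfolding ssum_swap[of "cD C f" "cD C h"] ssum_swap[of "cD C g" "cD C h"]
  by (simp add: cv_def ssum_plist c23_def c12_def assoc3_def)
 also have "... = ssum (cD C g) (%g1 g2. \<xi> (h, g1) * \<chi> (g2, f))"
  unfolding 1 2 ..
 finally show ?thesis unfolding id
  by (simp add: cv_def ssum_plist c1m_def cm1_def assoc3_def)
qed

lemma S_D: "f \<in> bi (cF C) (cF C) ==> ssum (cD C (S x)) f = ssum (cD C x) (%a b. f (S b) (S a))"
 by (rule S_antimorph)

text \<open>In U(x1) V(x2) the values of \<open>S\<close> at the two inner legs form the coproduct
  of one element \<open>S w\<close>, so \<open>inverse_id1\<close> applies with middle argument
  \<open>S w\<close>. Then a product a2 S(g) contracts inside \<xi> and leaves \<xi>(e, -), and S(g)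
  d contracts inside \<chi> and leaves \<chi>(-, e); both are counits.\<close>

lemma UV: "cv C U V = cE C"
proof
 fix x
 let ?K = "%d a1 a2 g g'. ssum (cD C d) (%d1 d2. \<chi> (a1, mu (S g') d1) * \<xi> (mu a2 (S g), d2))"
 have A: "ssum (cD C w) (%b c. \<chi> (a, S b) * \<xi> (S c, d)) =
   ssum (cD C a) (%a1 a2. ssum (cD C w) (%g g'. ?K d a1 a2 g g'))" for a w d
 proof -
  have "ssum (cD C w) (%b c. \<chi> (a, S b) * \<xi> (S c, d)) = ssum (cD C (S w)) (%g1 g2. \<xi> (g1, d) * \<chi> (a, g2))"
   by (subst S_D) (auto intro!: biI fintros simp: mult.commute)
  also have "... = ssum (cD C a) (%a1 a2. ssum (cD C (S w)) (%g1 g2. ssum (cD C d) (%f1 f2. \<chi> (a1, mu g1 f1) * \<xi> (mu a2 g2, f2))))"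
   by (rule inverse_id1)
  also have "... = ssum (cD C a) (%a1 a2. ssum (cD C w) (%g g'. ?K d a1 a2 g g'))"
   by (rule ssum_cong, rule S_D) (intro biI fintros)
  finally show ?thesis .
 qed
 have B: "ssum (cD C s) (%a w. ssum (cD C a) (%a1 a2. ssum (cD C w) (%g g'. ?K d a1 a2 g g'))) =
   ssum (cD C s) (%a g. \<chi> (a, mu (S g) d))" for s d
 proof -
  have "ssum (cD C s) (%a w. ssum (cD C a) (%a1 a2. ssum (cD C w) (%g g'. ?K d a1 a2 g g'))) =
    ssum (cD C s) (%a1 t. ssum (cD C t) (%w g'. ssum (cD C w) (%a2 g. ?K d a1 a2 g g')))"
   by (rule cog_coassoc4[OF cog]) (intro fintros)+
  also have "... = ssum (cD C s) (%a1 t. ssum (cD C t) (%w g'. cE C w * \<chi> (a1, mu (S g') d)))"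
  proof (intro ssum_cong)
   fix a1 t w g'
   have "ssum (cD C w) (%a2 g. ?K d a1 a2 g g') = ssum (cD C d) (%d1 d2. \<chi> (a1, mu (S g') d1) * ssum (cD C w) (%a2 g. \<xi> (mu a2 (S g), d2)))"
    by (simp add: ssum_swap[of "cD C w" "cD C d"] ssum_mult_left)
   also have "... = ssum (cD C d) (%d1 d2. cE C w * (\<chi> (a1, mu (S g') d1) * cE C d2))"
    by (simp add: SR[OF cocycle_forms(3)] xi_unitL mult_ac)
   also have "... = cE C w * \<chi> (a1, mu (S g') d)"
    unfolding ssum_mult_left using cog_counitR[OF cog muf(4)] by simp
   finally show "ssum (cD C w) (%a2 g. ?K d a1 a2 g g') = cE C w * \<chi> (a1, mu (S g') d)" .
  qed
  also have "... = ssum (cD C s) (%a g. \<chi> (a, mu (S g) d))"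
   using cog_counitL[OF cog muSf(3)] by simp
  finally show ?thesis .
 qed
 have "cv C U V x = ssum (cD C x) (%p q. ssum (cD C p) (%a b. ssum (cD C q) (%c d. \<chi> (a, S b) * \<xi> (S c, d))))"
  by (simp add: cv_def U_def V_def ssum_mult_left ssum_mult_right[symmetric])
 also have "... = ssum (cD C x) (%a t. ssum (cD C t) (%w d. ssum (cD C w) (%b c. \<chi> (a, S b) * \<xi> (S c, d))))"
  by (rule cog_coassoc4[OF cog]) (intro fintros)+
 also have "... = ssum (cD C x) (%a t. ssum (cD C t) (%w d. ssum (cD C a) (%a1 a2. ssum (cD C w) (%g g'. ?K d a1 a2 g g'))))"
  unfolding A ..
 also have "... = ssum (cD C x) (%s d. ssum (cD C s) (%a w. ssum (cD C a) (%a1 a2. ssum (cD C w) (%g g'. ?K d a1 a2 g g'))))"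
  by (rule cog_coassoc[OF cog, symmetric]) (intro triI fintros cog_cD[OF cog] biI)
 also have "... = ssum (cD C x) (%a t. ssum (cD C t) (%g d. \<chi> (a, mu (S g) d)))"
  unfolding B by (rule cog_coassoc[OF cog]) (intro triI fintros)
 also have "... = cE C x"
  using cog_counitR[OF cog cog_cE[OF cog]] by (simp add: SL[OF cocycle_forms(2)] chi_unitR mult.commute)
 finally show "cv C U V x = cE C x" .
qed

text \<open>Now the outer arguments carry antipodes, so \<open>inverse_id2\<close> is used at (S a,
  w, S d). First S(h') g1 contracts inside \<chi>, then g S(d) inside \<xi>.\<close>

lemma VU: "cv C V U = cE C"
proof
 fix x
 let ?K = "%d h h' g1 g2. ssum (cD C d) (%f f'. \<chi> (mu (S h') g1, S f') * \<xi> (S h, mu g2 (S f)))"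
 have Sf: "(%f. \<xi> (a, mu b (S f))) \<in> cF C" for a b by (rule S_form[OF muf(8)])
 have A: "ssum (cD C w) (%b c. \<xi> (S a, b) * \<chi> (c, S d)) =
   ssum (cD C a) (%h h'. ssum (cD C w) (%g1 g2. ?K d h h' g1 g2))" for a w d
 proof -
  have "ssum (cD C w) (%b c. \<xi> (S a, b) * \<chi> (c, S d)) = ssum (cD C (S a)) (%h1 h2. ssum (cD C w) (%g1 g2. ssum (cD C (S d)) (%f1 f2. \<chi> (mu h1 g1, f1) * \<xi> (h2, mu g2 f2))))"
   by (rule inverse_id2)
  also have "... = ssum (cD C (S a)) (%h1 h2. ssum (cD C w) (%g1 g2. ssum (cD C d) (%f f'. \<chi> (mu h1 g1, S f') * \<xi> (h2, mu g2 (S f)))))"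
   by (intro ssum_cong S_D) (intro biI fintros)
  also have "... = ssum (cD C a) (%h h'. ssum (cD C w) (%g1 g2. ?K d h h' g1 g2))"
   by (rule S_D) (intro biI fintros)
  finally show ?thesis .
 qed
 have B: "ssum (cD C s) (%a w. ssum (cD C a) (%a1 a2. ssum (cD C w) (%g g'. ?K d a1 a2 g g'))) =
   ssum (cD C s) (%h g. \<xi> (S h, mu g (S d)))" for s d
 proof -
  have "ssum (cD C s) (%a w. ssum (cD C a) (%a1 a2. ssum (cD C w) (%g g'. ?K d a1 a2 g g'))) =
    ssum (cD C s) (%h t. ssum (cD C t) (%w g2. ssum (cD C w) (%h' g1. ?K d h h' g1 g2)))"
   by (rule cog_coassoc4[OF cog]) (intro fintros)+
  also have "... = ssum (cD C s) (%h t. ssum (cD C t) (%w g2. cE C w * \<xi> (S h, mu g2 (S d))))"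
  proof (intro ssum_cong)
   fix h t w g2
   have "ssum (cD C w) (%h' g1. ?K d h h' g1 g2) = ssum (cD C d) (%f f'. ssum (cD C w) (%h' g1. \<chi> (mu (S h') g1, S f')) * \<xi> (S h, mu g2 (S f)))"
    by (simp add: ssum_swap[of "cD C w" "cD C d"] ssum_mult_right)
   also have "... = ssum (cD C d) (%f f'. cE C w * (\<xi> (S h, mu g2 (S f)) * cE C f'))"
    by (simp add: SL[OF cocycle_forms(1)] chi_unitL S_counit mult_ac)
   also have "... = cE C w * \<xi> (S h, mu g2 (S d))"
    unfolding ssum_mult_left using cog_counitR[OF cog Sf] by simp
   finally show "ssum (cD C w) (%h' g1. ?K d h h' g1 g2) = cE C w * \<xi> (S h, mu g2 (S d))" .
  qed
  also have "... = ssum (cD C s) (%h g. \<xi> (S h, mu g (S d)))"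
   using cog_counitL[OF cog muf(7)] by simp
  finally show ?thesis .
 qed
 have "cv C V U x = ssum (cD C x) (%p q. ssum (cD C p) (%a b. ssum (cD C q) (%c d. \<xi> (S a, b) * \<chi> (c, S d))))"
  by (simp add: cv_def U_def V_def ssum_mult_left ssum_mult_right[symmetric])
 also have "... = ssum (cD C x) (%a t. ssum (cD C t) (%w d. ssum (cD C w) (%b c. \<xi> (S a, b) * \<chi> (c, S d))))"
  by (rule cog_coassoc4[OF cog]) (intro fintros)+
 also have "... = ssum (cD C x) (%a t. ssum (cD C t) (%w d. ssum (cD C a) (%a1 a2. ssum (cD C w) (%g g'. ?K d a1 a2 g g'))))"
  unfolding A ..
 also have "... = ssum (cD C x) (%s d. ssum (cD C s) (%a w. ssum (cD C a) (%a1 a2. ssum (cD C w) (%g g'. ?K d a1 a2 g g'))))"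
  by (rule cog_coassoc[OF cog, symmetric]) (intro triI fintros cog_cD[OF cog] biI)
 also have "... = ssum (cD C x) (%h t. ssum (cD C t) (%g d. \<xi> (S h, mu g (S d))))"
  unfolding B by (rule cog_coassoc[OF cog]) (intro triI fintros)
 also have "... = cE C x"
  using cog_counitR[OF cog cog_cE[OF cog]] by (simp add: SR[OF cocycle_forms(4)] xi_unitR S_counit mult.commute)
 finally show "cv C V U x = cE C x" .
qed

end

section \<open>Cancellation of the cocycle factors in the twisted antipode axioms\<close>

locale hopf_over_cocycle = hopf_over C mu e S W m one T pi BW + hopf_cocycle C mu e S \<chi> \<xi>
 for C :: "('k::field, 'c) cog" and mu e S and W :: "('k, 'w) cog" and m one T pi BW \<chi> \<xi>
begin

lemmas fW = cog_forms[OF W]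

text \<open>The two arguments of \<open>k\<close> are adjacent inner legs of a fourfold coproduct;
  after regrouping they are the coproduct of one leg, which the counit removes.\<close>

lemma inner_cancel:
 assumes k: "k \<in> cF CC" "!!h. ssum (cD C h) (%a b. k (a, b)) = cE C h" and F: "F \<in> pform (cF W) (cF W)"
 shows "ssum (cD W x) (%a b. ssum (cD W a) (%a' c. ssum (cD W b) (%d b'. k (pi c, pi d) * F (a', b')))) =
  ssum (cD W x) (%a b. F (a, b))"
proof -
 have k1: "(%a. k (a, b)) \<in> cF C" "(%b. k (a, b)) \<in> cF C" for a b using k(1) by (auto simp: pform_def bi_def)
 have kd: "ssum (cD W w) (%c d. k (pi c, pi d)) = cE W w" for w
  using pi_D[of "%a b. k (a, b)" w] k1 by (simp add: biI k(2) pi_counit)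
 note i = forms_mult[OF fW] forms_mult'[OF fW] pi_form[OF k1(1)] pi_form[OF k1(2)] pform1[OF F] pform2[OF F]
 have "ssum (cD W x) (%a b. ssum (cD W a) (%a' c. ssum (cD W b) (%d b'. k (pi c, pi d) * F (a', b')))) =
  ssum (cD W x) (%a' t. ssum (cD W t) (%w b'. ssum (cD W w) (%c d. k (pi c, pi d) * F (a', b'))))"
  by (rule cog_coassoc4[OF W]) (intro i)+
 then show ?thesis
  using cog_counitL[OF W pform2[OF F]] by (simp add: ssum_mult_right kd)
qed

text \<open>Here the arguments of \<open>k\<close> are the first and the last leg. They become
  adjacent only after the form on the inner pair has been contracted to a scalar, which is why
  \<gamma> is assumed.\<close>

lemma outer_cancel:
 assumes k: "k \<in> cF CC" "!!h. ssum (cD C h) (%a b. k (a, b)) = cE C h" and F: "F \<in> pform (cF W) (cF W)"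
  and \<gamma>: "!!x. ssum (cD W x) (%a b. F (a, b)) = cE W x * \<gamma>"
 shows "ssum (cD W x) (%a b. ssum (cD W a) (%c a'. ssum (cD W b) (%b' d. k (pi c, pi d) * F (a', b')))) = cE W x * \<gamma>"
proof -
 have k1: "(%a. k (a, b)) \<in> cF C" "(%b. k (a, b)) \<in> cF C" for a b using k(1) by (auto simp: pform_def bi_def)
 have kd: "ssum (cD W w) (%c d. k (pi c, pi d)) = cE W w" for w
  using pi_D[of "%a b. k (a, b)" w] k1 by (simp add: biI k(2) pi_counit)
 note i = forms_mult[OF fW] forms_mult'[OF fW] pi_form[OF k1(1)] pi_form[OF k1(2)] pform1[OF F] pform2[OF F]
 have "ssum (cD W x) (%a b. ssum (cD W a) (%c a'. ssum (cD W b) (%b' d. k (pi c, pi d) * F (a', b')))) =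
  ssum (cD W x) (%c t. ssum (cD W t) (%w d. ssum (cD W w) (%a' b'. k (pi c, pi d) * F (a', b'))))"
  by (rule cog_coassoc4[OF W]) (intro i)+
 also have "... = ssum (cD W x) (%c t. ssum (cD W t) (%w d. cE W w * (k (pi c, pi d) * \<gamma>)))"
  unfolding ssum_mult_left \<gamma> by (simp add: mult_ac)
 also have "... = ssum (cD W x) (%c t. k (pi c, pi t) * \<gamma>)"
  using cog_counitL[OF W forms_mult'[OF fW pi_form[OF k1(2)]]] by simp
 finally show ?thesis by (simp add: ssum_mult_right kd)
qed

lemma twf_flip:
 assumes "\<phi> \<in> cF W"
 shows "twf BW U V \<phi> = twf (flipB BW) V U \<phi>"
proof -
 have "Ro (flipB BW) u \<phi> = Lo BW u \<phi>" "Lo (flipB BW) u \<phi> = Ro BW u \<phi>" for u \<phi>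
  unfolding Lo_def[abs_def] Ro_def[abs_def] flip_simps by (simp_all add: mult.commute)
 then show ?thesis
  unfolding twf_def using Lo_Ro[OF cog BW_bcm U_form V_form] assms by simp
qed

text \<open>This and the next three lemmas evaluate, along the coproduct, the factors that arise
  when the twist of the antipode and that of the product are combined. Those on adjacent legs reduce
  to \<xi> * \<chi> = \<epsilon>, those on the outer legs to \<open>U\<close> * \<open>V\<close> =
  \<epsilon>.\<close>

lemma xi_chi_flip1: "ssum (cD C h) (%a b. cv (prodC (flipC C) C) (%(c, d). V c * cE C d) (%p. \<chi> (map_prod S (%x. x) p)) (a, b)) = cE C h"
proof -
 have "cv (prodC (flipC C) C) (%(c, d). V c * cE C d) (%p. \<chi> (map_prod S (%x. x) p)) (a, b) =
   ssum (cD C a) (%c1 c2. V c2 * \<chi> (S c1, b))" for a b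
  using cog_counitL[OF cog cocycle_forms(2)] by (simp add: cv_def ssum_plist mult.assoc ssum_mult_left)
 then have "?thesis \<longleftrightarrow> ssum (cD C h) (%a b. ssum (cD C a) (%c1 c2. V c2 * \<chi> (S c1, b))) = cE C h" by simp
 also have "ssum (cD C h) (%a b. ssum (cD C a) (%c1 c2. V c2 * \<chi> (S c1, b))) =
   ssum (cD C h) (%c1 t. ssum (cD C t) (%w d. ssum (cD C w) (%p q. \<xi> (S p, q) * \<chi> (S c1, d))))"
  unfolding V_def ssum_mult_right[symmetric]
  by (rule cog_coassoc[OF cog]) (intro triI fintros cog_cD[OF cog] biI)
 also have "... = ssum (cD C h) (%a b. ssum (cD C a) (%c1 p. ssum (cD C b) (%q d. \<xi> (S p, q) * \<chi> (S c1, d))))"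
  by (rule cog_coassoc4[OF cog, symmetric]) (intro fintros)+
 also have "... = ssum (cD C h) (%a b. cv CC \<xi> \<chi> (S a, b))"
  unfolding cv_def prod_simps ssum_plist by (subst S_D) (auto intro!: biI fintros)
 also have "... = cE C h"
  unfolding xi_chi using cog_counitL[OF cog cog_cE[OF cog]] by (simp add: S_counit)
 finally show ?thesis by simp
qed

lemma UV_flip1: "ssum (cD C h) (%a b. cv (prodC (flipC C) C) (%p. \<xi> (map_prod S (%x. x) p)) (%(c, d). U c * cE C d) (a, b)) = cE C h"
proof -
 have "cv (prodC (flipC C) C) (%p. \<xi> (map_prod S (%x. x) p)) (%(c, d). U c * cE C d) (a, b) =
   ssum (cD C a) (%c1 c2. U c1 * \<xi> (S c2, b))" for a b
  using cog_counitR[OF cog cocycle_forms(4)]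
  by (simp add: cv_def ssum_plist mult.left_commute[of _ "U _"] ssum_mult_left)
 then have "?thesis \<longleftrightarrow> ssum (cD C h) (%a b. ssum (cD C a) (%c1 c2. U c1 * \<xi> (S c2, b))) = cE C h" by simp
 also have "ssum (cD C h) (%a b. ssum (cD C a) (%c1 c2. U c1 * \<xi> (S c2, b))) =
   ssum (cD C h) (%c1 t. ssum (cD C t) (%c2 d. U c1 * \<xi> (S c2, d)))"
  by (rule cog_coassoc[OF cog]) (intro triI fintros U_form)
 also have "... = cv C U V h" by (simp add: cv_def V_def ssum_mult_left)
 finally show ?thesis by (simp add: UV)
qed

lemma UV_flip2: "ssum (cD C h) (%a b. cv (prodC C (flipC C)) (%(c, d). cE C c * V d) (%p. \<chi> (map_prod (%x. x) S p)) (a, b)) = cE C h"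
proof -
 have "ssum (cD C a) (%c1 c2. cE C c1 * v * \<chi> (c2, d)) = v * \<chi> (a, d)" for a v d
  using cog_counitL[OF cog cocycle_forms(1)] by (simp add: mult.assoc mult.left_commute[of _ v] ssum_mult_left)
 then have "cv (prodC C (flipC C)) (%(c, d). cE C c * V d) (%p. \<chi> (map_prod (%x. x) S p)) (a, b) =
   ssum (cD C b) (%d1 d2. V d2 * \<chi> (a, S d1))" for a b
  by (simp add: cv_def ssum_plist ssum_swap[of "cD C a" "cD C b"])
 then have "?thesis \<longleftrightarrow> ssum (cD C h) (%a b. ssum (cD C b) (%d1 d2. V d2 * \<chi> (a, S d1))) = cE C h" by simp
 also have "ssum (cD C h) (%a b. ssum (cD C b) (%d1 d2. V d2 * \<chi> (a, S d1))) =
   ssum (cD C h) (%a b. ssum (cD C a) (%a d1. V b * \<chi> (a, S d1)))"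
  by (rule cog_coassoc[OF cog, symmetric]) (intro triI fintros V_form)
 also have "... = cv C U V h" by (simp add: cv_def U_def ssum_mult_left mult.commute)
 finally show ?thesis by (simp add: UV)
qed

lemma xi_chi_flip2: "ssum (cD C h) (%a b. cv (prodC C (flipC C)) (%p. \<xi> (map_prod (%x. x) S p)) (%(c, d). cE C c * U d) (a, b)) = cE C h"
proof -
 have "ssum (cD C a) (%c1 c2. \<xi> (c1, d) * (cE C c2 * u)) = \<xi> (a, d) * u" for a u d
  using cog_counitR[OF cog cocycle_forms(3)] by (simp add: mult.assoc[symmetric] ssum_mult_right)
 then have "cv (prodC C (flipC C)) (%p. \<xi> (map_prod (%x. x) S p)) (%(c, d). cE C c * U d) (a, b) =
   ssum (cD C b) (%d1 d2. \<xi> (a, S d2) * U d1)" for a b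
  by (simp add: cv_def ssum_plist ssum_swap[of "cD C a" "cD C b"])
 then have "?thesis \<longleftrightarrow> ssum (cD C h) (%a b. ssum (cD C b) (%d1 d2. \<xi> (a, S d2) * U d1)) = cE C h" by simp
 also have "ssum (cD C h) (%a b. ssum (cD C b) (%d1 d2. \<xi> (a, S d2) * U d1)) =
   ssum (cD C h) (%c t. ssum (cD C t) (%w d. ssum (cD C w) (%p q. \<xi> (c, S d) * \<chi> (p, S q))))"
  by (simp add: U_def ssum_mult_left)
 also have "... = ssum (cD C h) (%a b. ssum (cD C a) (%c p. ssum (cD C b) (%q d. \<xi> (c, S d) * \<chi> (p, S q))))"
  by (rule cog_coassoc4[OF cog, symmetric]) (intro fintros)+
 also have "... = ssum (cD C h) (%a b. cv CC \<xi> \<chi> (a, S b))"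
  unfolding cv_def prod_simps ssum_plist by (subst S_D) (auto intro!: biI fintros)
 also have "... = cE C h"
  unfolding xi_chi using cog_counitL[OF cog cog_cE[OF cog]] by (simp add: S_counit)
 finally show ?thesis by simp
qed

context
 fixes t :: "'w => 'w => 'w" and T' :: "'w => 'w"
 assumes t: "is_tw \<chi> \<xi> BW BW (cF W) m t" and T': "!!\<phi> x. \<phi> \<in> cF W ==> \<phi> (T' x) = twf BW U V (%x. \<phi> (T x)) x"
begin

lemma tw_antipode_form: "\<phi> \<in> cF W ==> (%x. \<phi> (T' x)) \<in> cF W"
 using twf_form[OF cog BW_bcm U_form V_form, of "%x. \<phi> (T x)"] T_form[of \<phi>] by (simp add: T')

text \<open>The twist of the product, pulled back along \<open>T_morph\<close>, lives on the
  co-opposite structure in the first argument, and so does the twist of \<open>T\<close>;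
  \<open>twf_twf\<close> merges them into factors \<open>?k\<close> and \<open>?k'\<close>. Then
  \<open>?k\<close> sits on the adjacent legs and cancels first, the old axiom \<open>TL\<close>
  contracts the middle, and \<open>?k'\<close> on the outer legs cancels last.\<close>

lemma tw_antipode_L:
 assumes \<phi>: "\<phi> \<in> cF W"
 shows "ssum (cD W x) (%a b. \<phi> (t (T' a) b)) = cE W x * \<phi> one"
proof -
 let ?P = "prodB (flipB BW) BW" and ?C = "prodC (flipC C) C"
 note fl = flip_is_cog[OF cog] flip_is_bcm[OF BW_bcm]
 note PC = prodC_is_cog[OF fl(1) cog] and PB = prodB_is_bcm[OF fl(1) cog fl(2) BW_bcm]
 note BB = prodB_is_bcm[OF cog cog BW_bcm BW_bcm]
 note mm = morph_prod[OF cog cog BW_bcm BW_bcm T_morph morph_id[of C BW]]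
 let ?m = "%(a, b). \<phi> (m a b)"
 let ?\<psi> = "twf (prodB BW BW) \<chi> \<xi> ?m"
 let ?F = "%(a, b). \<phi> (m (T a) b)"
 have m: "?m \<in> bF (prodB BW BW)" using m_form[OF \<phi>] by (simp add: pform_def)
 have \<psi>: "?\<psi> \<in> bF (prodB BW BW)" by (rule twf_form[OF CC BB chi xi m])
 have F: "?F \<in> bF ?P" using morph_bF[OF mm m] by (simp add: case_prod_beta')
 note cS = morph_cF[OF morph_prod[OF cog cog cog_bcm[OF cog] cog_bcm[OF cog] S_morph morph_id[of C "selfB C"]]]
 let ?u = "%v. %(c, d). v c * cE C d"
 have u: "?u v \<in> cF ?C" if "v \<in> cF C" for v
  using that cog_cE[OF cog] by (auto intro!: pformI forms_mult forms_mult' fC)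
 let ?k = "cv ?C (?u V) (%p. \<chi> (map_prod S (%x. x) p))" and ?k' = "cv ?C (%p. \<xi> (map_prod S (%x. x) p)) (?u U)"
 have k: "?k \<in> cF ?C" "?k' \<in> cF ?C"
  by (intro cv_form[OF PC] u U_form V_form cS chi xi)+
 \<comment> \<open>Over the flipped coactions left and right exchange, so the antipode contributes
   \<open>V\<close> on the left and \<open>U\<close> on the right.\<close>
 have "\<phi> (t (T' a) b) = twf ?P ?k ?k' ?F (a, b)" for a b
 proof -
  have \<psi>b: "(%a. ?\<psi> (a, b)) \<in> cF W" using pform1[of ?\<psi> "bF BW"] \<psi> by simp
  have "\<phi> (t (T' a) b) = ?\<psi> (T' a, b)" using is_twD[OF t \<phi>] by simp
  also have "... = twf (flipB BW) V U (%a. ?\<psi> (T a, b)) a"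
   using T'[OF \<psi>b] twf_flip[OF T_form[OF \<psi>b]] by simp
  also have "... = twf ?P (?u V) (?u U) (%p. ?\<psi> (map_prod T (%x. x) p)) (a, b)"
   using twf_slice1[OF fl(1) cog fl(2) BW_bcm morph_bF[OF mm \<psi>], of V U a b] V_form by simp
  also have "(%p. ?\<psi> (map_prod T (%x. x) p)) = twf ?P (%p. \<chi> (map_prod S (%x. x) p)) (%p. \<xi> (map_prod S (%x. x) p)) ?F"
   using twf_morph[OF CC BB mm chi xi m] by (simp add: fun_eq_iff case_prod_beta')
  also have "twf ?P (?u V) (?u U) ... = twf ?P ?k ?k' ?F"
   by (rule twf_twf[OF PC PB u[OF V_form] u[OF U_form] cS[OF chi] cS[OF xi] F])
  finally show ?thesis .
 qed
 note eq = this
 have G: "Lo ?P ?k ?F \<in> pform (cF W) (cF W)" using Lo_form[OF PC PB k(1) F] by simp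
 have "ssum (cD W y) (%a b. ?F (a, b)) = cE W y * \<phi> one" for y
  using TL[OF \<phi>] by simp
 then have i: "ssum (cD W y) (%a b. Lo ?P ?k ?F (a, b)) = cE W y * \<phi> one" for y
  using inner_cancel[of ?k ?F y, OF _ xi_chi_flip1] k(1) F by (simp add: Lo_def ssum_plist)
 show ?thesis
  unfolding eq twf_def Ro_def[of ?P]
  using outer_cancel[of ?k' "Lo ?P ?k ?F", OF _ UV_flip1 G i] k(2) by (simp add: ssum_plist mult.commute)
qed

lemma tw_antipode_R:
 assumes \<phi>: "\<phi> \<in> cF W"
 shows "ssum (cD W x) (%a b. \<phi> (t a (T' b))) = cE W x * \<phi> one"
proof -
 let ?P = "prodB BW (flipB BW)" and ?C = "prodC C (flipC C)"
 note fl = flip_is_cog[OF cog] flip_is_bcm[OF BW_bcm]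
 note PC = prodC_is_cog[OF cog fl(1)] and PB = prodB_is_bcm[OF cog fl(1) BW_bcm fl(2)]
 note BB = prodB_is_bcm[OF cog cog BW_bcm BW_bcm]
 note mm = morph_prod[OF fl(1) cog BW_bcm fl(2) morph_id[of C BW] T_morph]
 let ?m = "%(a, b). \<phi> (m a b)"
 let ?\<psi> = "twf (prodB BW BW) \<chi> \<xi> ?m"
 let ?F = "%(a, b). \<phi> (m a (T b))"
 have m: "?m \<in> bF (prodB BW BW)" using m_form[OF \<phi>] by (simp add: pform_def)
 have \<psi>: "?\<psi> \<in> bF (prodB BW BW)" by (rule twf_form[OF CC BB chi xi m])
 have F: "?F \<in> bF ?P" using morph_bF[OF mm m] by (simp add: case_prod_beta')
 note cS = morph_cF[OF morph_prod[OF fl(1) cog cog_bcm[OF cog] flip_is_bcm[OF cog_bcm[OF cog]] morph_id[of C "selfB C"] S_morph]]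
 let ?u = "%v. %(c, d). cE C c * v d"
 have u: "?u v \<in> cF ?C" if "v \<in> cF C" for v
  using that cog_cE[OF cog] by (auto intro!: pformI forms_mult forms_mult' fC)
 let ?k = "cv ?C (?u V) (%p. \<chi> (map_prod (%x. x) S p))" and ?k' = "cv ?C (%p. \<xi> (map_prod (%x. x) S p)) (?u U)"
 have k: "?k \<in> cF ?C" "?k' \<in> cF ?C"
  by (intro cv_form[OF PC] u U_form V_form cS chi xi)+
 have "\<phi> (t a (T' b)) = Lo ?P ?k (Ro ?P ?k' ?F) (a, b)" for a b
 proof -
  have \<psi>b: "(%b. ?\<psi> (a, b)) \<in> cF W" using pform2[of ?\<psi> "bF BW"] \<psi> by simp
  have "\<phi> (t a (T' b)) = ?\<psi> (a, T' b)" using is_twD[OF t \<phi>] by simp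
  also have "... = twf (flipB BW) V U (%b. ?\<psi> (a, T b)) b"
   using T'[OF \<psi>b] twf_flip[OF T_form[OF \<psi>b]] by simp
  also have "... = twf ?P (?u V) (?u U) (%p. ?\<psi> (map_prod (%x. x) T p)) (a, b)"
   using twf_slice2[OF cog fl(1) BW_bcm fl(2) morph_bF[OF mm \<psi>], of V U a b] V_form by simp
  also have "(%p. ?\<psi> (map_prod (%x. x) T p)) = twf ?P (%p. \<chi> (map_prod (%x. x) S p)) (%p. \<xi> (map_prod (%x. x) S p)) ?F"
   using twf_morph[OF CC BB mm chi xi m] by (simp add: fun_eq_iff case_prod_beta')
  also have "twf ?P (?u V) (?u U) ... = twf ?P ?k ?k' ?F"
   by (rule twf_twf[OF PC PB u[OF V_form] u[OF U_form] cS[OF chi] cS[OF xi] F])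
  \<comment> \<open>On this side it is the right factor \<open>?k'\<close> that sits on the adjacent
    legs; the commuting actions are reordered so that it is cancelled first.\<close>
  also have "... = Lo ?P ?k (Ro ?P ?k' ?F)"
   unfolding twf_def by (rule Lo_Ro[OF PC PB k F, symmetric])
  finally show ?thesis by simp
 qed
 note eq = this
 have G: "Ro ?P ?k' ?F \<in> pform (cF W) (cF W)" using Ro_form[OF PC PB k(2) F] by simp
 have "ssum (cD W y) (%a b. ?F (a, b)) = cE W y * \<phi> one" for y
  using TR[OF \<phi>] by simp
 then have i: "ssum (cD W y) (%a b. Ro ?P ?k' ?F (a, b)) = cE W y * \<phi> one" for y
  using inner_cancel[of ?k' ?F y, OF _ xi_chi_flip2] k(2) F by (simp add: Ro_def ssum_plist mult.commute)
 show ?thesis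
  unfolding eq Lo_def[of ?P]
  using outer_cancel[of ?k "Ro ?P ?k' ?F", OF _ UV_flip2 G i] k(1) by (simp add: ssum_plist)
qed

end

end

section \<open>The twisted Hopf algebra\<close>

context bialg
begin

lemma cv_c23_c1m:
 assumes \<chi>: "\<chi> \<in> cF CC"
 shows "cv CCC (c23 \<chi>) (c1m \<chi>) ((h, g), f) =
  ssum (cD C g) (%g1 g2. ssum (cD C f) (%f1 f2. \<chi> (g1, f1) * \<chi> (h, mu g2 f2)))"
proof -
 have x: "(%h. \<chi> (h, a)) \<in> cF C" for a using \<chi> by (auto simp: pform_def bi_def)
 have 1: "ssum (cD C h) (%h1 h2. cE C h1 * A * \<chi> (h2, a)) = A * \<chi> (h, a)" for A a
  using cog_counitL[OF cog x] by (simp add: mult.assoc mult.left_commute[of _ A] ssum_mult_left)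
 have "cv CCC (c23 \<chi>) (c1m \<chi>) ((h, g), f) =
  ssum (cD C g) (%g1 g2. ssum (cD C f) (%f1 f2. ssum (cD C h) (%h1 h2. cE C h1 * \<chi> (g1, f1) * \<chi> (h2, mu g2 f2))))"
  unfolding ssum_swap[of "cD C f" "cD C h"] ssum_swap[of "cD C g" "cD C h"]
  by (simp add: cv_def ssum_plist c23_def c1m_def assoc3_def)
 then show ?thesis unfolding 1 .
qed

lemma cv_c12_cm1:
 assumes \<chi>: "\<chi> \<in> cF CC"
 shows "cv CCC (c12 \<chi>) (cm1 \<chi>) ((h, g), f) =
  ssum (cD C h) (%h1 h2. ssum (cD C g) (%g1 g2. \<chi> (h1, g1) * \<chi> (mu h2 g2, f)))"
proof -
 have x: "(%a. \<chi> (h, a)) \<in> cF C" for h using \<chi> by (auto simp: pform_def bi_def)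
 have 2: "ssum (cD C f) (%f1 f2. A * cE C f1 * \<chi> (a, f2)) = A * \<chi> (a, f)" for A a
  using cog_counitL[OF cog x] by (simp add: mult.assoc ssum_mult_left)
 have "cv CCC (c12 \<chi>) (cm1 \<chi>) ((h, g), f) =
  ssum (cD C h) (%h1 h2. ssum (cD C g) (%g1 g2. ssum (cD C f) (%f1 f2. \<chi> (h1, g1) * cE C f1 * \<chi> (mu h2 g2, f2))))"
  by (simp add: cv_def ssum_plist c12_def cm1_def)
 then show ?thesis unfolding 2 .
qed

end

lemma twf_self: "twf (selfB C) u v \<phi> = cv C (cv C u \<phi>) v"
 by (simp add: twf_def cv_Lo Ro_def[abs_def] Lo_def[abs_def])

context cocycle
begin

context
 fixes mu' :: "'c => 'c => 'c"
 assumes mu': "is_tw \<chi> \<xi> (selfB C) (selfB C) (cF C) mu mu'"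
begin

lemma twisted_bialg: "bialg C mu' e"
proof
 note cb = cog_bcm[OF cog]
 note mm = mu_morph[unfolded selfB_prodC]
 have mf: "(%(a, b). \<phi> (mu a b)) \<in> pform (cF C) (cF C)" if "\<phi> \<in> cF C" for \<phi>
  using morph_cF[OF mu_morph that] by (simp add: case_prod_beta')
 show "is_cog C" by (rule cog)
 show "cmorph CC C (case_prod mu')"
  unfolding selfB_prodC using tw_colinear[OF cb cb cb mm, of mu' mu'] mu' by simp
 \<comment> \<open>The counit form of the pair twists to \<chi> * \<xi>, which is the counit
   again.\<close>
 show "cE C (mu' a b) = cE C a * cE C b" for a b
 proof -
  have "cE C (mu' a b) = twf (selfB CC) \<chi> \<xi> (cE CC) (a, b)"
   using is_twD[OF mu' cog_cE[OF cog], of a b] unfolding selfB_prodC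
   by (simp add: mu_counit prodC_def[of C C])
  then show ?thesis by (simp add: twf_self cv_counitR[OF CC chi] chi_xi)
 qed
 show "mu' (mu' a b) c = mu' a (mu' b c)" for a b c
  by (rule separating, rule tw_assoc[OF cb cb cb cb cb mm mm, where F = "cF C" and ?m1.0 = mu and ?m3.0 = mu])
   (auto simp: mu' mu_assoc mf)
 have "\<phi> (mu' e a) = \<phi> (mu e a)" "\<phi> (mu' a e) = \<phi> (mu a e)" if "\<phi> \<in> cF C" for \<phi> a
  using tw_unitL[OF cb cb _ _ mu' that, of e a] tw_unitR[OF cb cb _ _ mu' that, of e a] mf[OF that] unit_group by simp_all
 then show "mu' e a = a" "mu' a e = a" for a
  using separating[of "mu' e a" a] separating[of "mu' a e" a] by (simp_all add: mu_unit)
 show "f \<in> bi (cF C) (cF C) ==> ssum (cD C e) f = f e e" for f by (rule unit_group)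
 show "cE C e = 1" by (rule unit_counit)
 show "a = b" if "!!\<phi>. \<phi> \<in> cF C ==> \<phi> a = \<phi> b" for a b by (rule separating[OF that])
qed

text \<open>On a coalgebra over itself a twist is conjugation in the convolution algebra
  (\<open>twf_self\<close>); replacing \<open>mu\<close> by \<open>mu'\<close> in the first two
  slots conjugates by \<open>c12 \<chi>\<close>.\<close>

lemma twisted_cm1: "u \<in> cF CC ==> bialg.cm1 mu' u = cv CCC (cv CCC (c12 \<chi>) (cm1 u)) (c12 \<xi>)"
proof
 fix t :: "('c \<times> 'c) \<times> 'c" assume u: "u \<in> cF CC"
 obtain a b c where t: "t = ((a, b), c)" by (metis surj_pair)
 note cb = cog_bcm[OF cog] and cb2 = cog_bcm[OF CC]
 have "bialg.cm1 mu' u t = u (mu' a b, c)"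
  using bialg.cm1_def[OF twisted_bialg] by (simp add: t)
 also have "... = twf (selfB CC) \<chi> \<xi> (%p. u (map_prod (case_prod mu) (%x. x) (p, c))) (a, b)"
  using is_twD[OF mu', of "%a. u (a, c)"] u by (simp add: pform_def bi_def selfB_prodC case_prod_beta')
 also have "... = twf (selfB CCC) (c12 \<chi>) (c12 \<xi>) (cm1 u) ((a, b), c)"
  unfolding c12_def selfB_prodC[of CC]
  using twf_slice1[OF CC cog cb2 cb, of "cm1 u" \<chi>] cm1_form[OF u] chi by (simp add: cm1_def)
 finally show "bialg.cm1 mu' u t = cv CCC (cv CCC (c12 \<chi>) (cm1 u)) (c12 \<xi>) t"
  by (simp add: t twf_self)
qed

lemma twisted_c1m: "u \<in> cF CC ==> bialg.c1m mu' u = cv CCC (cv CCC (c23 \<chi>) (c1m u)) (c23 \<xi>)"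
proof
 fix t :: "('c \<times> 'c) \<times> 'c" assume u: "u \<in> cF CC"
 obtain a b c where t: "t = ((a, b), c)" by (metis surj_pair)
 note cb = cog_bcm[OF cog] and cb2 = cog_bcm[OF CC] and X = prodC_is_cog[OF cog CC]
 let ?v = "%u. %(a, p). cE C a * u p"
 let ?w = "%p. u (map_prod (%x. x) (case_prod mu) p)"
 have v: "?v u \<in> cF (prodC C CC)" if "u \<in> cF CC" for u
  unfolding prod_simps(1)[of C CC] using that cog_cE[OF cog] cog_forms[OF cog] cog_forms[OF CC]
  by (auto intro!: pformI[of _ _ "pform _ _"] forms_mult forms_mult')
 have w: "?w \<in> cF (prodC C CC)" by (rule morph_cF[OF morph_1m u])
 have "bialg.c1m mu' u t = u (a, mu' b c)"
  using bialg.c1m_def[OF twisted_bialg] by (simp add: t assoc3_def)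
 also have "... = twf (selfB CC) \<chi> \<xi> (%p. u (map_prod (%x. x) (case_prod mu) (a, p))) (b, c)"
  using is_twD[OF mu', of "%c. u (a, c)"] u by (simp add: pform_def bi_def selfB_prodC case_prod_beta')
 also have "... = twf (selfB (prodC C CC)) (?v \<chi>) (?v \<xi>) ?w (assoc3 t)"
  unfolding selfB_prodC[of C CC]
  using twf_slice2[OF cog CC cb cb2, of ?w \<chi>] w chi by (simp add: t assoc3_def)
 also have "... = cv CCC (cv CCC (c23 \<chi>) (c1m u)) (c23 \<xi>) t"
  unfolding twf_self cv_morph[OF X morph_al cv_form[OF X v[OF chi] w] v[OF xi]]
   cv_morph[OF X morph_al v[OF chi] w] c23_def c1m_def ..
 finally show "bialg.c1m mu' u t = cv CCC (cv CCC (c23 \<chi>) (c1m u)) (c23 \<xi>) t" .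
qed

text \<open>With the conjugated maps each side telescopes, for instance \<open>c23 \<xi>\<close>
  cancels the leading \<open>c23 \<chi>\<close>, and what remains is
  \<open>xi_cocycle\<close>.\<close>

lemma twisted_cocycle: "cocycle C mu' e \<xi> \<chi>"
proof (rule cocycle.intro[OF twisted_bialg], unfold_locales)
 show "\<xi> \<in> cF CC" "\<chi> \<in> cF CC" "cv CC \<xi> \<chi> = cE CC" "cv CC \<chi> \<xi> = cE CC" "\<xi> (e, h) = cE C h" for h
  by (rule xi chi xi_chi chi_xi xi_unitL)+
 note f = c23_form[OF chi] c1m_form[OF xi] c12_form[OF chi] cm1_form[OF xi] c23_form[OF xi] c12_form[OF xi]
 let ?c = "cv CCC"
 have *: "?c x (?c (?c y z) x) = ?c z x" if "?c x y = cE CCC" "x \<in> cF CCC" "y \<in> cF CCC" "z \<in> cF CCC" for x y z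
  unfolding cv_assoc[OF CCC that(3,4,2)] cv_assoc[OF CCC that(2,3) cv_form[OF CCC that(4,2)], symmetric] that(1)
  by (rule cv_counitL[OF CCC cv_form[OF CCC that(4,2)]])
 show "?c (bialg.c23 C \<xi>) (bialg.c1m mu' \<xi>) = ?c (bialg.c12 C \<xi>) (bialg.cm1 mu' \<xi>)"
  unfolding twisted_c1m[OF xi] twisted_cm1[OF xi]
   *[OF c23_inv[OF xi chi xi_chi] f(5) f(1) f(2)] *[OF c12_inv[OF xi chi xi_chi] f(6) f(3) f(4)]
  by (rule xi_cocycle)
qed

end

end

context hopf_cocycle
begin

lemma hopf_over_cocycle_self: "hopf_over_cocycle C mu e S C mu e S (%x. x) \<chi> \<xi>"
 using hopf_over_self hopf_cocycle_axioms by (simp add: hopf_over_cocycle_def)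

lemma BW_self: "\<lparr>bF = cF C, bL = %x. map (%(a, b). (a, b)) (cD C x), bR = %x. map (%(a, b). (a, b)) (cD C x)\<rparr> = selfB C"
 by (simp add: selfB_def)

lemma twisted_hopf:
 assumes mu': "is_tw \<chi> \<xi> (selfB C) (selfB C) (cF C) mu mu'"
  and S': "!!\<phi> x. \<phi> \<in> cF C ==> \<phi> (S' x) = twf (selfB C) U V (%x. \<phi> (S x)) x"
 shows "hopf C mu' e S'"
proof (rule hopf.intro[OF twisted_bialg[OF mu']], unfold_locales)
 note h = hopf_over_cocycle_self
 show "\<phi> \<in> cF C ==> (%x. \<phi> (S' x)) \<in> cF C" for \<phi>
  by (rule hopf_over_cocycle.tw_antipode_form[OF h, unfolded BW_self, OF mu' S'])
 show "\<phi> \<in> cF C ==> ssum (cD C x) (%a b. \<phi> (mu' (S' a) b)) = cE C x * \<phi> e" for \<phi> x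
  by (rule hopf_over_cocycle.tw_antipode_L[OF h, unfolded BW_self, OF mu' S'])
 show "\<phi> \<in> cF C ==> ssum (cD C x) (%a b. \<phi> (mu' a (S' b))) = cE C x * \<phi> e" for \<phi> x
  by (rule hopf_over_cocycle.tw_antipode_R[OF h, unfolded BW_self, OF mu' S'])
qed

end

section \<open>The Hopf algebra axioms in terms of forms\<close>

lemma is_algebra_full: "is_algebra (full s) m e \<longleftrightarrow> vector_space s \<and>
  (\<forall>\<phi>\<in>lin s. (%a b. \<phi> (m a b)) \<in> bi (lin s) (lin s)) \<and> (\<forall>x y z. m (m x y) z = m x (m y z)) \<and> (\<forall>x. m e x = x \<and> m x e = x)"
 unfolding is_algebra_def is_space_full
 by (auto simp: bilinear_map_lin intro!: bilinear_mapI_lin)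

lemma is_antipode_full:
 assumes s: "vector_space s" and \<Delta>: "linear_map (full s) (tensor (full s) (full s)) \<Delta>"
  and m: "!!\<phi>. \<phi> \<in> lin s ==> (%a b. \<phi> (m a b)) \<in> bi (lin s) (lin s)"
 shows "is_antipode (full s) m e \<Delta> \<epsilon> T \<longleftrightarrow>
  (\<forall>\<phi>\<in>lin s. (%x. \<phi> (T x)) \<in> lin s) \<and>
  (\<forall>\<phi>\<in>lin s. \<forall>x. ssum (rp2 s (\<Delta> x)) (%a b. \<phi> (m (T a) b)) = \<epsilon> x * \<phi> e) \<and>
  (\<forall>\<phi>\<in>lin s. \<forall>x. ssum (rp2 s (\<Delta> x)) (%a b. \<phi> (m a (T b))) = \<epsilon> x * \<phi> e)"
proof -
 note t = linear_map_tensor[OF \<Delta>]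
 have T: "linear_map (full s) (full s) T \<longleftrightarrow> (\<forall>\<phi>\<in>lin s. (%x. \<phi> (T x)) \<in> lin s)"
  using linear_map_lin linear_mapI_lin[OF s] by blast
 have eq: "F = s c e \<longleftrightarrow> (\<forall>\<phi>\<in>lin s. \<phi> F = c * \<phi> e)" for F c
  using lin_eqI[OF s, of F "s c e"] by (auto simp: lin_scale)
 have "tlift (full s) (full s) (%a b. m (T a) b) (\<Delta> x) = ssum (rp2 s (\<Delta> x)) (%a b. m (T a) b)"
  "tlift (full s) (full s) (%a b. m a (T b)) (\<Delta> x) = ssum (rp2 s (\<Delta> x)) (%a b. m a (T b))"
  if T: "\<forall>\<phi>\<in>lin s. (%x. \<phi> (T x)) \<in> lin s" for x
  using bi1[OF m] bi2[OF m] T by (auto intro!: tlift_vec[OF s _ t] biI)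
 then show ?thesis
  unfolding is_antipode_def T by (auto simp: eq lin_ssum)
qed

lemma is_antipodeD:
 assumes s: "vector_space s" and \<Delta>: "linear_map (full s) (tensor (full s) (full s)) \<Delta>"
  and m: "!!\<phi>. \<phi> \<in> lin s ==> (%a b. \<phi> (m a b)) \<in> bi (lin s) (lin s)"
  and T: "is_antipode (full s) m e \<Delta> \<epsilon> T" and \<phi>: "\<phi> \<in> lin s"
 shows "(%x. \<phi> (T x)) \<in> lin s"
  and "ssum (rp2 s (\<Delta> x)) (%a b. \<phi> (m (T a) b)) = \<epsilon> x * \<phi> e"
  and "ssum (rp2 s (\<Delta> x)) (%a b. \<phi> (m a (T b))) = \<epsilon> x * \<phi> e"
proof -
 have "(\<forall>\<phi>\<in>lin s. (%x. \<phi> (T x)) \<in> lin s) \<and>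
  (\<forall>\<phi>\<in>lin s. \<forall>x. ssum (rp2 s (\<Delta> x)) (%a b. \<phi> (m (T a) b)) = \<epsilon> x * \<phi> e) \<and>
  (\<forall>\<phi>\<in>lin s. \<forall>x. ssum (rp2 s (\<Delta> x)) (%a b. \<phi> (m a (T b))) = \<epsilon> x * \<phi> e)"
  by (rule iffD1[OF is_antipode_full[OF s \<Delta>] T]) (rule m)
 then show "(%x. \<phi> (T x)) \<in> lin s"
  "ssum (rp2 s (\<Delta> x)) (%a b. \<phi> (m (T a) b)) = \<epsilon> x * \<phi> e"
  "ssum (rp2 s (\<Delta> x)) (%a b. \<phi> (m a (T b))) = \<epsilon> x * \<phi> e"
  using \<phi> by blast+
qed

lemma cmorph_mult_iff:
 assumes H: "is_coalgebra (hspace H) (hcomult H) (hcounit H)"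
  and m: "!!\<phi>. \<phi> \<in> hlin H ==> (%a b. \<phi> (hmult H a b)) \<in> bi (hlin H) (hlin H)"
 shows "cmorph (prodC (HC H) (HC H)) (HC H) (case_prod (hmult H)) \<longleftrightarrow>
   (\<forall>h g. hcomult H (hmult H h g) =
    tlift (hspace H) (hspace H) (%h1 h2.
     tlift (hspace H) (hspace H) (%g1 g2.
      tens (hspace H) (hspace H) (hmult H h1 g1) (hmult H h2 g2))
     (hcomult H g)) (hcomult H h))"
proof -
 let ?s = "hlin H"
 have t: "hcomult H x \<in> elems (tensor (hspace H) (hspace H))" for x
  using H by (auto simp: is_coalgebra_def linear_map_def)
 have mf: "(%c. u (case_prod (hmult H) c)) \<in> pform ?s ?s" if "u \<in> ?s" for u
  using m[OF that] by (simp add: pform_def)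
 have eq: "hcomult H (hmult H h g) = tlift (hspace H) (hspace H) (%h1 h2.
     tlift (hspace H) (hspace H) (%g1 g2.
      tens (hspace H) (hspace H) (hmult H h1 g1) (hmult H h2 g2)) (hcomult H g)) (hcomult H h) \<longleftrightarrow>
   (\<forall>f\<in>bi ?s ?s. ssum (rp (hspace H) (hspace H) (hcomult H (hmult H h g))) f =
   ssum (rp (hspace H) (hspace H) (hcomult H h)) (%p q. ssum (rp (hspace H) (hspace H) (hcomult H g)) (%r s. f (hmult H p r) (hmult H q s))))" for h g
  by (rule tensor_eq_mult_iff[OF t t _ _ t]) (fact m)+
 show ?thesis
  unfolding eq morph_def selfB_prodC
  using mf by (auto simp: ssum_plist)
qed

theorem hopf_algebra_iff:
 "hopf_algebra H \<longleftrightarrow> is_coalgebra (hspace H) (hcomult H) (hcounit H) \<and>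
   hopf (HC H) (hmult H) (hone H) (hantipode H) \<and> bij (hantipode H)"
proof (cases "is_coalgebra (hspace H) (hcomult H) (hcounit H)")
 case co: True
 let ?s = "hlin H" and ?A = "hspace H"
 have vs: "vector_space (hscale H)" and \<Delta>: "linear_map ?A (tensor ?A ?A) (hcomult H)"
  using co by (auto simp: is_coalgebra_def is_space_full)
 note t = linear_map_tensor[OF \<Delta>]
 note cog = coalgebra_is_cog[OF co]
 have sep: "a = b" if "!!\<phi>. \<phi> \<in> ?s ==> \<phi> a = \<phi> b" for a b by (rule lin_eqI[OF vs that])
 have one: "hcomult H (hone H) = tens ?A ?A (hone H) (hone H) \<longleftrightarrow>
   (\<forall>f\<in>bi ?s ?s. ssum (rp ?A ?A (hcomult H (hone H))) f = f (hone H) (hone H))"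
  using tensor_eqI[OF t tens_in_tensor, of "hone H" "hone H" "hone H"] by (auto simp: rp_tens)
 show ?thesis
 proof
  assume H: "hopf_algebra H"
  then have m: "(%a b. \<phi> (hmult H a b)) \<in> bi ?s ?s" if "\<phi> \<in> ?s" for \<phi>
   using that by (simp add: hopf_algebra_def is_algebra_full)
  have cm: "cmorph (prodC (HC H) (HC H)) (HC H) (case_prod (hmult H))"
   by (rule iffD2[OF cmorph_mult_iff[OF co m]]) (use H in \<open>simp_all add: hopf_algebra_def\<close>)
  have b: "bialg (HC H) (hmult H) (hone H)"
   by (rule bialg.intro[OF cog cm])
    (use H one sep in \<open>auto simp: hopf_algebra_def is_algebra_full\<close>)
  have this': "is_antipode ?A (hmult H) (hone H) (hcomult H) (hcounit H) (hantipode H)"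
   using H by (simp add: hopf_algebra_def)
  have "hopf (HC H) (hmult H) (hone H) (hantipode H)"
   using is_antipodeD[OF vs \<Delta> _ this'] m by (intro hopf.intro[OF b] hopf_axioms.intro) auto
  then show "is_coalgebra ?A (hcomult H) (hcounit H) \<and> hopf (HC H) (hmult H) (hone H) (hantipode H) \<and> bij (hantipode H)"
   using H co by (simp add: hopf_algebra_def)
 next
  assume *: "is_coalgebra ?A (hcomult H) (hcounit H) \<and> hopf (HC H) (hmult H) (hone H) (hantipode H) \<and> bij (hantipode H)"
  then interpret hopf "HC H" "hmult H" "hone H" "hantipode H" by simp
  have m: "(%a b. \<phi> (hmult H a b)) \<in> bi ?s ?s" if "\<phi> \<in> ?s" for \<phi>
   using morph_cF[OF mu_morph, of \<phi>] that by (simp add: pform_def)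
  have alg: "is_algebra ?A (hmult H) (hone H)"
   unfolding is_algebra_full using vs m mu_assoc mu_unit by blast
  have ap: "is_antipode ?A (hmult H) (hone H) (hcomult H) (hcounit H) (hantipode H)"
   by (rule iffD2[OF is_antipode_full[OF vs \<Delta>]]) (use m S_form SL SR in auto)
  show "hopf_algebra H"
   unfolding hopf_algebra_def
  proof (intro conjI)
   show "\<forall>h g. hcomult H (hmult H h g) = tlift ?A ?A (%h1 h2. tlift ?A ?A (%g1 g2.
     tens ?A ?A (hmult H h1 g1) (hmult H h2 g2)) (hcomult H g)) (hcomult H h)"
    by (rule iffD1[OF cmorph_mult_iff[OF co m] mu_morph])
   show "hcomult H (hone H) = tens ?A ?A (hone H) (hone H)" using one unit_group by simp
  qed (use * alg ap mu_counit unit_counit in auto)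
 qed
qed (simp add: hopf_algebra_def)

lemma hopf_vector_space: "hopf_algebra H ==> vector_space (hscale H)"
 by (simp add: hopf_algebra_def is_algebra_full)

section \<open>Convolution inverses and cocycles in terms of forms\<close>

lemma conv2_cv:
 assumes H: "is_coalgebra (hspace H) (hcomult H) (hcounit H)"
  and \<chi>: "\<chi> \<in> bi (hlin H) (hlin H)" and \<xi>: "\<xi> \<in> bi (hlin H) (hlin H)"
 shows "conv2 H \<chi> \<xi> h g = cv (prodC (HC H) (HC H)) (case_prod \<chi>) (case_prod \<xi>) (h, g)"
proof -
 have t: "hcomult H x \<in> elems (tensor (hspace H) (hspace H))" for x
  using H by (auto simp: is_coalgebra_def linear_map_def)
 note i = biI forms_ssum[OF forms_lin] forms_mult[OF forms_lin] forms_mult'[OF forms_lin] bi1[OF \<chi>] bi2[OF \<chi>] bi1[OF \<xi>] bi2[OF \<xi>]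
 have "tlift (hspace H) (hspace H) (%g1 g2. \<chi> h1 g1 * \<xi> h2 g2) (hcomult H g) =
   ssum (rp (hspace H) (hspace H) (hcomult H g)) (%g1 g2. \<chi> h1 g1 * \<xi> h2 g2)" for h1 h2
  by (rule tlift_form[OF _ t]) (intro i)
 then show ?thesis
  unfolding conv2_def by (simp, subst tlift_form[OF _ t]) (intro i, simp add: cv_def ssum_plist)
qed

lemma conv1_cv:
 assumes H: "is_coalgebra (hspace H) (hcomult H) (hcounit H)"
  and u: "u \<in> hlin H" and v: "v \<in> hlin H"
 shows "conv1 H u v = cv (HC H) u v"
proof
 fix h
 have t: "hcomult H x \<in> elems (tensor (hspace H) (hspace H))" for x
  using H by (auto simp: is_coalgebra_def linear_map_def)
 show "conv1 H u v h = cv (HC H) u v h"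
  unfolding conv1_def cv_def HC_simps
  by (rule tlift_form[OF _ t]) (intro biI forms_mult[OF forms_lin] forms_mult'[OF forms_lin] u v)
qed

lemma conv_inverse1_eq:
 assumes H: "is_coalgebra (hspace H) (hcomult H) (hcounit H)" and u: "u \<in> hlin H" and v: "v \<in> hlin H"
  and "cv (HC H) u v = hcounit H" "cv (HC H) v u = hcounit H"
 shows "conv_inverse1 H u = v"
 unfolding conv_inverse1_def
proof (rule the_equality)
 show "is_conv_inverse1 H u v"
  using assms by (simp add: is_conv_inverse1_def conv1_cv lin_def[symmetric]) (simp add: lin_def)
 fix w assume "is_conv_inverse1 H u w"
 then have w: "w \<in> hlin H" "cv (HC H) w u = hcounit H"
  using conv1_cv[OF H _ u] by (auto simp: is_conv_inverse1_def lin_def)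
 then show "w = v"
  using cv_inverse_unique[OF coalgebra_is_cog[OF H], of u w v] u v assms(4) by simp
qed

lemma is_conv_inverse2_iff:
 assumes H: "is_coalgebra (hspace H) (hcomult H) (hcounit H)" and \<chi>: "\<chi> \<in> bi (hlin H) (hlin H)"
 shows "is_conv_inverse2 H \<chi> \<xi> \<longleftrightarrow> \<xi> \<in> bi (hlin H) (hlin H) \<and>
  cv (prodC (HC H) (HC H)) (case_prod \<chi>) (case_prod \<xi>) = cE (prodC (HC H) (HC H)) \<and>
  cv (prodC (HC H) (HC H)) (case_prod \<xi>) (case_prod \<chi>) = cE (prodC (HC H) (HC H))"
 unfolding is_conv_inverse2_def bilinear_map_form
 using conv2_cv[OF H \<chi>] conv2_cv[OF H _ \<chi>] by (auto simp: fun_eq_iff)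

lemma conv_inverse2_eq:
 assumes H: "is_coalgebra (hspace H) (hcomult H) (hcounit H)" and \<chi>: "\<chi> \<in> bi (hlin H) (hlin H)"
  and \<xi>: "is_conv_inverse2 H \<chi> \<xi>"
 shows "conv_inverse2 H \<chi> = \<xi>"
 unfolding conv_inverse2_def
proof (rule the_equality, rule \<xi>)
 note c = coalgebra_is_cog[OF H]
 fix w assume "is_conv_inverse2 H \<chi> w"
 then have "case_prod w = case_prod \<xi>"
  using cv_inverse_unique[OF prodC_is_cog[OF c c], of "case_prod \<chi>" "case_prod w" "case_prod \<xi>"] \<chi> \<xi>
  unfolding is_conv_inverse2_iff[OF H \<chi>] by (simp add: pform_def)
 then show "w = \<xi>" by (simp add: fun_eq_iff)
qed

text \<open>Uniqueness of convolution inverses guarantees that the description in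
  \<open>conv_inverse2\<close> denotes the inverse; existence is part of
  \<open>two_cocycle\<close>.\<close>

lemma hopf_cocycle_iff:
 assumes H: "hopf_algebra H"
 shows "hopf_cocycle (HC H) (hmult H) (hone H) (hantipode H) (case_prod \<chi>) (case_prod \<xi>) \<longleftrightarrow>
  two_cocycle H \<chi> \<and> conv_inverse2 H \<chi> = \<xi>"
proof -
 have co: "is_coalgebra (hspace H) (hcomult H) (hcounit H)" and hp: "hopf (HC H) (hmult H) (hone H) (hantipode H)"
  using H by (auto simp: hopf_algebra_iff)
 interpret hopf "HC H" "hmult H" "hone H" "hantipode H" by fact
 have t: "hcomult H x \<in> elems (tensor (hspace H) (hspace H))" for x
  using co by (auto simp: is_coalgebra_def linear_map_def)
 have eqs: "tlift (hspace H) (hspace H) (%g1 g2.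
     tlift (hspace H) (hspace H) (%f1 f2. \<chi> g1 f1 * \<chi> h (hmult H g2 f2))
     (hcomult H f)) (hcomult H g) = cv CCC (c23 (case_prod \<chi>)) (c1m (case_prod \<chi>)) ((h, g), f)"
   "tlift (hspace H) (hspace H) (%h1 h2.
     tlift (hspace H) (hspace H) (%g1 g2. \<chi> h1 g1 * \<chi> (hmult H h2 g2) f)
     (hcomult H g)) (hcomult H h) = cv CCC (c12 (case_prod \<chi>)) (cm1 (case_prod \<chi>)) ((h, g), f)"
  if \<chi>: "\<chi> \<in> bi (hlin H) (hlin H)" for h g f
 proof -
  have x: "case_prod \<chi> \<in> cF CC" using \<chi> by (simp add: pform_def)
  note mf = mu_form[unfolded HC_simps]
  note i = biI forms_ssum[OF forms_lin] forms_mult[OF forms_lin] forms_mult'[OF forms_lin] bi1[OF \<chi>] bi2[OF \<chi>]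
   mf[OF bi1[OF \<chi>]] mf[OF bi2[OF \<chi>]]
  have 1: "tlift (hspace H) (hspace H) (%f1 f2. \<chi> g1 f1 * \<chi> h (hmult H g2 f2)) (hcomult H f) =
    ssum (rp (hspace H) (hspace H) (hcomult H f)) (%f1 f2. \<chi> g1 f1 * \<chi> h (hmult H g2 f2))" for g1 g2
   by (rule tlift_form[OF _ t]) (intro i)
  have 2: "tlift (hspace H) (hspace H) (%g1 g2. \<chi> h1 g1 * \<chi> (hmult H h2 g2) f) (hcomult H g) =
    ssum (rp (hspace H) (hspace H) (hcomult H g)) (%g1 g2. \<chi> h1 g1 * \<chi> (hmult H h2 g2) f)" for h1 h2
   by (rule tlift_form[OF _ t]) (intro i)
  show "tlift (hspace H) (hspace H) (%g1 g2.
     tlift (hspace H) (hspace H) (%f1 f2. \<chi> g1 f1 * \<chi> h (hmult H g2 f2))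
     (hcomult H f)) (hcomult H g) = cv CCC (c23 (case_prod \<chi>)) (c1m (case_prod \<chi>)) ((h, g), f)"
   unfolding 1 cv_c23_c1m[OF x] HC_simps prod.case by (rule tlift_form[OF _ t]) (intro i)
  show "tlift (hspace H) (hspace H) (%h1 h2.
     tlift (hspace H) (hspace H) (%g1 g2. \<chi> h1 g1 * \<chi> (hmult H h2 g2) f)
     (hcomult H g)) (hcomult H h) = cv CCC (c12 (case_prod \<chi>)) (cm1 (case_prod \<chi>)) ((h, g), f)"
   unfolding 2 cv_c12_cm1[OF x] HC_simps prod.case by (rule tlift_form[OF _ t]) (intro i)
 qed
 show ?thesis
 proof
  assume "hopf_cocycle (HC H) (hmult H) (hone H) (hantipode H) (case_prod \<chi>) (case_prod \<xi>)"
  then interpret hopf_cocycle "HC H" "hmult H" "hone H" "hantipode H" "case_prod \<chi>" "case_prod \<xi>" .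
  have \<chi>: "\<chi> \<in> bi (hlin H) (hlin H)" and \<xi>: "\<xi> \<in> bi (hlin H) (hlin H)"
   using chi xi by (simp_all add: pform_def)
  have inv: "is_conv_inverse2 H \<chi> \<xi>"
   unfolding is_conv_inverse2_iff[OF co \<chi>] using \<xi> chi_xi xi_chi by simp
  show "two_cocycle H \<chi> \<and> conv_inverse2 H \<chi> = \<xi>"
   unfolding two_cocycle_def eqs[OF \<chi>] bilinear_map_form using \<chi> inv conv_inverse2_eq[OF co \<chi> inv] two_cocycle chi_unitL
   by auto
 next
  assume *: "two_cocycle H \<chi> \<and> conv_inverse2 H \<chi> = \<xi>"
  then have \<chi>: "\<chi> \<in> bi (hlin H) (hlin H)" by (simp add: two_cocycle_def bilinear_map_form)
  obtain \<xi>' where "is_conv_inverse2 H \<chi> \<xi>'" using * by (auto simp: two_cocycle_def)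
  then have inv: "is_conv_inverse2 H \<chi> \<xi>" using conv_inverse2_eq[OF co \<chi>] * by metis
  have c: "cv CCC (c23 (case_prod \<chi>)) (c1m (case_prod \<chi>)) = cv CCC (c12 (case_prod \<chi>)) (cm1 (case_prod \<chi>))"
   using * unfolding two_cocycle_def eqs[OF \<chi>] by (auto simp: fun_eq_iff)
  show "hopf_cocycle (HC H) (hmult H) (hone H) (hantipode H) (case_prod \<chi>) (case_prod \<xi>)"
   using inv \<chi> c * unfolding is_conv_inverse2_iff[OF co \<chi>]
   by unfold_locales (simp_all add: pform_def two_cocycle_def)
 qed
qed

text \<open>\<open>sw\<close> is a threefold Sweedler expression over the two coactions of \<open>A\<close>.\<close>

definition is_sw :: "('k::field, 'h) cog => ('k => 'p::ab_group_add => 'p) => ('k, 'h, 'a) bcm =>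
  (('h => 'a => 'h => 'p) => 'a => 'p) => bool" where
 "is_sw C s A sw \<longleftrightarrow> (\<forall>f a. (\<forall>\<phi>\<in>lin s. (%x y z. \<phi> (f x y z)) \<in> tri (cF C) (bF A) (cF C)) \<longrightarrow>
   sw f a = ssum (bR A a) (%w z. ssum (bL A w) (%x y. f x y z)))"

text \<open>\<open>sweedler3\<close>, \<open>bicoact3\<close> and \<open>ext_coact3\<close> all
  satisfy \<open>is_sw\<close>, so this one computation shows that the twisted products of
  \<open>twist_hopf\<close>, \<open>twist_calculus\<close> and \<open>twist_exterior\<close> are
  twists in the sense of \<open>is_tw\<close>.\<close>

lemma is_tw_sw:
 assumes C: "is_cog C" and A: "is_bcm C A" and B: "is_bcm C B"
  and swA: "is_sw C s A swA" and swB: "is_sw C s B swB"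
  and \<chi>: "case_prod \<chi> \<in> pform (cF C) (cF C)" and \<xi>: "case_prod \<xi> \<in> pform (cF C) (cF C)"
  and m: "!!\<phi>. \<phi> \<in> lin s ==> (%a b. \<phi> (m a b)) \<in> bi (bF A) (bF B)"
 shows "is_tw (case_prod \<chi>) (case_prod \<xi>) A B (lin s) m
  (%a b. swA (%a1 a2 a3. swB (%b1 b2 b3. s (\<chi> a1 b1 * \<xi> a3 b3) (m a2 b2)) b) a)"
 unfolding is_tw_def
proof (intro ballI allI)
 fix \<phi> a b assume \<phi>: "\<phi> \<in> lin s"
 note fC = cog_forms[OF C] and fA = bcm_forms[OF A] and fB = bcm_forms[OF B]
 have x: "(%a. \<chi> a b) \<in> cF C" "(%b. \<chi> a b) \<in> cF C" "(%a. \<xi> a b) \<in> cF C" "(%b. \<xi> a b) \<in> cF C" for a b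
  using \<chi> \<xi> by (auto simp: pform_def bi_def)
 note i = triI forms_mult[OF fC] forms_mult[OF fA] forms_mult[OF fB] forms_mult'[OF fC] forms_mult'[OF fA] forms_mult'[OF fB]
  forms_ssum[OF fC] forms_ssum[OF fA] x bi1[OF m] bi2[OF m]
 have inner: "swB (%b1 b2 b3. s (\<chi> a1 b1 * \<xi> a3 b3) (m a2 b2)) b =
   ssum (bR B b) (%w b3. ssum (bL B w) (%b1 b2. s (\<chi> a1 b1 * \<xi> a3 b3) (m a2 b2)))" for a1 a2 a3
 proof (rule swB[unfolded is_sw_def, rule_format])
  fix \<phi> assume \<phi>: "\<phi> \<in> lin s"
  show "(%x y z. \<phi> (s (\<chi> a1 x * \<xi> a3 z) (m a2 y))) \<in> tri (cF C) (bF B) (cF C)"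
   unfolding lin_scale[OF \<phi>] by (intro i \<phi>)
 qed
 have "swA (%a1 a2 a3. swB (%b1 b2 b3. s (\<chi> a1 b1 * \<xi> a3 b3) (m a2 b2)) b) a =
  ssum (bR A a) (%w a3. ssum (bL A w) (%a1 a2. ssum (bR B b) (%w b3. ssum (bL B w) (%b1 b2. s (\<chi> a1 b1 * \<xi> a3 b3) (m a2 b2)))))"
  unfolding inner
 proof (rule swA[unfolded is_sw_def, rule_format])
  fix \<phi> assume \<phi>: "\<phi> \<in> lin s"
  show "(%x y z. \<phi> (ssum (bR B b) (%w b3. ssum (bL B w) (%b1 b2. s (\<chi> x b1 * \<xi> z b3) (m y b2))))) \<in> tri (cF C) (bF A) (cF C)"
   unfolding lin_ssum[OF \<phi>] lin_scale[OF \<phi>] by (intro i \<phi>)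
 qed
 then have "\<phi> (swA (%a1 a2 a3. swB (%b1 b2 b3. s (\<chi> a1 b1 * \<xi> a3 b3) (m a2 b2)) b) a) =
  ssum (bR A a) (%w a3. ssum (bL A w) (%a1 a2. ssum (bR B b) (%w b3. ssum (bL B w) (%b1 b2. \<chi> a1 b1 * \<xi> a3 b3 * \<phi> (m a2 b2)))))"
  by (simp add: lin_ssum[OF \<phi>] lin_scale[OF \<phi>])
 also have "... = ssum (bR A a) (%w a3. ssum (bR B b) (%w' b3. ssum (bL A w) (%a1 a2. ssum (bL B w') (%b1 b2. \<chi> a1 b1 * \<phi> (m a2 b2) * \<xi> a3 b3))))"
  by (rule ssum_cong, subst ssum_swap) (simp add: mult_ac)
 also have "... = twf (prodB A B) (case_prod \<chi>) (case_prod \<xi>) (%(a, b). \<phi> (m a b)) (a, b)"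
  by (simp add: twf_def Ro_def Lo_def ssum_plist ssum_mult_right)
 finally show "\<phi> (swA (%a1 a2 a3. swB (%b1 b2 b3. s (\<chi> a1 b1 * \<xi> a3 b3) (m a2 b2)) b) a) =
  twf (prodB A B) (case_prod \<chi>) (case_prod \<xi>) (%(a, b). \<phi> (m a b)) (a, b)" .
qed

lemma twf_sw:
 assumes C: "is_cog C" and A: "is_bcm C A" and sw: "is_sw C s A sw" and u: "u \<in> cF C" and v: "v \<in> cF C"
  and T: "!!\<phi>. \<phi> \<in> lin s ==> (%x. \<phi> (T x)) \<in> bF A" and \<phi>: "\<phi> \<in> lin s"
 shows "\<phi> (sw (%x y z. s (u x * v z) (T y)) a) = twf A u v (%x. \<phi> (T x)) a"
proof -
 note fC = cog_forms[OF C] and fA = bcm_forms[OF A]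
 have "sw (%x y z. s (u x * v z) (T y)) a = ssum (bR A a) (%w z. ssum (bL A w) (%x y. s (u x * v z) (T y)))"
 proof (rule sw[unfolded is_sw_def, rule_format])
  fix \<phi> assume \<phi>: "\<phi> \<in> lin s"
  show "(%x y z. \<phi> (s (u x * v z) (T y))) \<in> tri (cF C) (bF A) (cF C)"
   unfolding lin_scale[OF \<phi>]
   by (intro triI forms_mult[OF fC] forms_mult[OF fA] forms_mult'[OF fC] u v T \<phi>)
 qed
 then show ?thesis
  by (simp add: lin_ssum[OF \<phi>] lin_scale[OF \<phi>] twf_def Ro_def Lo_def ssum_mult_left[symmetric] mult_ac)
qed

lemma tlift_nested:
 assumes s: "vector_space s" and t: "t \<in> elems (tensor (full n) (full z))"
  and \<kappa>: "linear_map (full n) (tensor (full x) (full y)) \<kappa>"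
  and f: "!!\<phi>. \<phi> \<in> lin s ==> (%a b c. \<phi> (f a b c)) \<in> tri (lin x) (lin y) (lin z)"
 shows "tlift (full n) (full z) (%w c. tlift (full x) (full y) (%a b. f a b c) (\<kappa> w)) t =
  ssum (rp (full n) (full z) t) (%w c. ssum (rp (full x) (full y) (\<kappa> w)) (%a b. f a b c))"
proof -
 have "tlift (full x) (full y) (%a b. f a b c) (\<kappa> w) = ssum (rp (full x) (full y) (\<kappa> w)) (%a b. f a b c)" for c w
  by (rule tlift_vec[OF s tri_slice(1)[OF f] linear_map_tensor[OF \<kappa>]])
 moreover have "tlift (full n) (full z) (%w c. ssum (rp (full x) (full y) (\<kappa> w)) (%a b. f a b c)) t =
  ssum (rp (full n) (full z) t) (%w c. ssum (rp (full x) (full y) (\<kappa> w)) (%a b. f a b c))"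
 proof (rule tlift_vec[OF s _ t])
  fix \<phi> assume \<phi>: "\<phi> \<in> lin s"
  show "(%w c. \<phi> (ssum (rp (full x) (full y) (\<kappa> w)) (%a b. f a b c))) \<in> bi (lin n) (lin z)"
   unfolding lin_ssum[OF \<phi>]
   by (rule biI) (intro rp_linear[OF \<kappa>] tri_slice(1)[OF f[OF \<phi>]] forms_ssum[OF forms_lin] tri3[OF f[OF \<phi>]])+
 qed
 ultimately show ?thesis by simp
qed

lemma sweedler3_sw:
 assumes H: "is_coalgebra (hspace H) (hcomult H) (hcounit H)" and s: "vector_space s"
 shows "is_sw (HC H) s (selfB (HC H)) (sweedler3 (hspace H) (hcomult H))"
 unfolding is_sw_def sweedler3_def
proof (intro allI impI)
 have \<Delta>: "linear_map (hspace H) (tensor (hspace H) (hspace H)) (hcomult H)"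
  using H by (auto simp: is_coalgebra_def)
 fix f :: "'b => 'b => 'b => 'c" and a
 assume "\<forall>\<phi>\<in>lin s. (%x y z. \<phi> (f x y z)) \<in> tri (cF (HC H)) (bF (selfB (HC H))) (cF (HC H))"
 then show "tlift (hspace H) (hspace H) (%y x3. tlift (hspace H) (hspace H) (%x1 x2. f x1 x2 x3) (hcomult H y)) (hcomult H a) =
   ssum (bR (selfB (HC H)) a) (%w z. ssum (bL (selfB (HC H)) w) (%x y. f x y z))"
  using tlift_nested[OF s linear_map_tensor[OF \<Delta>] \<Delta>, of f] by simp
qed

lemma bicoact3_sw:
 assumes V: "bicomodule H V" and s: "vector_space s"
 shows "is_sw (HC H) s (VB H V) (bicoact3 H V)"
 unfolding is_sw_def bicoact3_def
proof (intro allI impI)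
 have l: "linear_map (vspace V) (tensor (hspace H) (vspace V)) (lcoact V)"
  and r: "linear_map (vspace V) (tensor (vspace V) (hspace H)) (rcoact V)"
  using V by (auto simp: bicomodule_def Let_def)
 fix f :: "'b => 'c => 'b => 'e" and a
 assume "\<forall>\<phi>\<in>lin s. (%x y z. \<phi> (f x y z)) \<in> tri (cF (HC H)) (bF (VB H V)) (cF (HC H))"
 then show "tlift (vspace V) (hspace H) (%w v3. tlift (hspace H) (vspace V) (%v1 v2. f v1 v2 v3) (lcoact V w)) (rcoact V a) =
   ssum (bR (VB H V) a) (%w z. ssum (bL (VB H V) w) (%x y. f x y z))"
  using tlift_nested[OF s linear_map_tensor[OF r] l, of f] by simp
qed

section \<open>The Hopf algebra \<open>twist_hopf\<close> and the inverse twist\<close>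

lemma twist_hopf_simps [simp]:
 "hscale (twist_hopf H \<chi>) = hscale H" "hone (twist_hopf H \<chi>) = hone H" "hcomult (twist_hopf H \<chi>) = hcomult H"
 "hcounit (twist_hopf H \<chi>) = hcounit H" "HC (twist_hopf H \<chi>) = HC H"
 "hspace (twist_hopf H \<chi>) = hspace H"
 by (simp_all add: twist_hopf_def HC_def)

lemma
 assumes H: "hopf_algebra H" and \<chi>: "two_cocycle H \<chi>"
 shows twist_hopf_mult: "is_tw (case_prod \<chi>) (case_prod (conv_inverse2 H \<chi>)) (selfB (HC H)) (selfB (HC H)) (hlin H)
   (hmult H) (hmult (twist_hopf H \<chi>))"
  and twist_hopf_antipode: "\<phi> \<in> hlin H ==> \<phi> (hantipode (twist_hopf H \<chi>) x) =
   twf (selfB (HC H)) (hopf_cocycle.U (HC H) (hantipode H) (case_prod \<chi>))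
    (hopf_cocycle.V (HC H) (hantipode H) (case_prod (conv_inverse2 H \<chi>))) (%x. \<phi> (hantipode H x)) x"
  and twist_U_eq: "twist_U H \<chi> = hopf_cocycle.U (HC H) (hantipode H) (case_prod \<chi>)"
  and conv_inverse_U: "conv_inverse1 H (twist_U H \<chi>) = hopf_cocycle.V (HC H) (hantipode H) (case_prod (conv_inverse2 H \<chi>))"
proof -
 interpret hopf_cocycle "HC H" "hmult H" "hone H" "hantipode H" "case_prod \<chi>" "case_prod (conv_inverse2 H \<chi>)"
  using hopf_cocycle_iff[OF H] \<chi> by blast
 have co: "is_coalgebra (hspace H) (hcomult H) (hcounit H)" using H by (simp add: hopf_algebra_iff)
 note s = hopf_vector_space[OF H]
 note sw = sweedler3_sw[OF co s] and cb = cog_bcm[OF cog]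
 have m: "(%a b. \<phi> (hmult H a b)) \<in> bi (bF (selfB (HC H))) (bF (selfB (HC H)))" if "\<phi> \<in> hlin H" for \<phi>
  using mu_form[of \<phi>] that by (auto intro!: biI)
 show "is_tw (case_prod \<chi>) (case_prod (conv_inverse2 H \<chi>)) (selfB (HC H)) (selfB (HC H)) (hlin H)
   (hmult H) (hmult (twist_hopf H \<chi>))"
  using is_tw_sw[OF cog cb cb sw sw, of \<chi> "conv_inverse2 H \<chi>" "hmult H"] chi xi m
  by (simp add: twist_hopf_def)
 have t: "hcomult H x \<in> elems (tensor (hspace H) (hspace H))" for x
  using co by (auto simp: is_coalgebra_def linear_map_def)
 show U: "twist_U H \<chi> = U"
 proof
  fix h
  show "twist_U H \<chi> h = U h"
   unfolding twist_U_def U_def HC_simps prod.case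
   by (rule tlift_form[OF _ t]) (use cfs in \<open>auto intro!: biI\<close>)
 qed
 show V: "conv_inverse1 H (twist_U H \<chi>) = V"
  unfolding U using conv_inverse1_eq[OF co, of U V] U_form V_form UV VU by simp
 show "\<phi> (hantipode (twist_hopf H \<chi>) x) = twf (selfB (HC H)) U V (%x. \<phi> (hantipode H x)) x" if "\<phi> \<in> hlin H"
  using twf_sw[OF cog cb sw U_form V_form, of "hantipode H" \<phi> x] S_form that
  by (simp add: twist_hopf_def U V[unfolded U])
qed

text \<open>The twisted antipode is the original one composed with \<open>R U V\<close>, where
  \<open>R u v\<close> sends x to u(x1) x2 v(x3); since \<open>U\<close> and \<open>V\<close> are
  mutually inverse, \<open>R V U\<close> is inverse to \<open>R U V\<close>.\<close>

lemma twist_hopf_bij: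
 assumes H: "hopf_algebra H" and \<chi>: "two_cocycle H \<chi>"
 shows "bij (hantipode (twist_hopf H \<chi>))"
proof -
 interpret hopf_cocycle "HC H" "hmult H" "hone H" "hantipode H" "case_prod \<chi>" "case_prod (conv_inverse2 H \<chi>)"
  using hopf_cocycle_iff[OF H] \<chi> by blast
 have co: "is_coalgebra (hspace H) (hcomult H) (hcounit H)" using H by (simp add: hopf_algebra_iff)
 note s = hopf_vector_space[OF H]
 note sw = sweedler3_sw[OF co s] and cb = cog_bcm[OF cog]
 define R where "R u v x = sweedler3 (hspace H) (hcomult H) (%x y z. hscale H (u x * v z) y) x" for u v x
 have R: "\<phi> (R u v x) = twf (selfB (HC H)) u v \<phi> x" if "u \<in> cF (HC H)" "v \<in> cF (HC H)" "\<phi> \<in> hlin H" for u v x \<phi>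
  unfolding R_def using twf_sw[OF cog cb sw that(1,2), of "%x. x" \<phi> x] that(3) by simp
 have RR: "R u v (R u' v' x) = x" if "u \<in> cF (HC H)" "v \<in> cF (HC H)" "u' \<in> cF (HC H)" "v' \<in> cF (HC H)"
   "cv (HC H) u' u = cE (HC H)" "cv (HC H) v v' = cE (HC H)" for u v u' v' x
 proof (rule separating)
  fix \<phi> assume \<phi>: "\<phi> \<in> cF (HC H)"
  then have "\<phi> (R u v (R u' v' x)) = twf (selfB (HC H)) u' v' (twf (selfB (HC H)) u v \<phi>) x"
   using that twf_form[OF cog cb that(1,2), of \<phi>] by (simp add: R)
  also have "... = \<phi> x"
   using twf_twf[OF cog cb that(3,4,1,2), of \<phi>] twf_counit[OF cog cb, of \<phi>] \<phi> that(5,6) by simp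
  finally show "\<phi> (R u v (R u' v' x)) = \<phi> x" .
 qed
 have "bij (R U V)"
  by (rule o_bij[of "R V U"])
   (simp_all add: fun_eq_iff RR[OF U_form V_form V_form U_form VU VU] RR[OF V_form U_form U_form V_form UV UV])
 moreover have "bij (hantipode H)" using H by (simp add: hopf_algebra_iff)
 moreover have "hantipode (twist_hopf H \<chi>) = hantipode H \<circ> R U V"
 proof
  fix x
  show "hantipode (twist_hopf H \<chi>) x = (hantipode H \<circ> R U V) x"
  proof (rule separating)
   fix \<phi> assume \<phi>: "\<phi> \<in> cF (HC H)"
   then show "\<phi> (hantipode (twist_hopf H \<chi>) x) = \<phi> ((hantipode H \<circ> R U V) x)"
    using twist_hopf_antipode[OF H \<chi>, of \<phi> x] R[OF U_form V_form, of "%x. \<phi> (hantipode H x)" x] S_form[OF \<phi>] by simp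
  qed
 qed
 ultimately show ?thesis by (simp add: bij_comp)
qed

text \<open>The product returns by \<open>tw_inverse\<close>. The doubly twisted antipode is an
  antipode for that same product, so uniqueness identifies it with the original one.\<close>

theorem
 assumes H: "hopf_algebra H" and \<chi>: "two_cocycle H \<chi>"
 shows twist_hopf_algebra: "hopf_algebra (twist_hopf H \<chi>)"
  and twist_cocycle: "two_cocycle (twist_hopf H \<chi>) (conv_inverse2 H \<chi>)"
  and twist_conv_inverse: "conv_inverse2 (twist_hopf H \<chi>) (conv_inverse2 H \<chi>) = \<chi>"
  and twist_twist_hopf: "twist_hopf (twist_hopf H \<chi>) (conv_inverse2 H \<chi>) = H"
proof -
 let ?\<xi> = "conv_inverse2 H \<chi>" and ?H' = "twist_hopf H \<chi>"
 interpret hopf_cocycle "HC H" "hmult H" "hone H" "hantipode H" "case_prod \<chi>" "case_prod ?\<xi>"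
  using hopf_cocycle_iff[OF H] \<chi> by blast
 have co: "is_coalgebra (hspace H) (hcomult H) (hcounit H)" using H by (simp add: hopf_algebra_iff)
 note mu' = twist_hopf_mult[OF H \<chi>, folded HC_simps(1)]
 have hp: "hopf (HC H) (hmult ?H') (hone H) (hantipode ?H')"
  by (rule twisted_hopf[OF mu']) (use twist_hopf_antipode[OF H \<chi>] in simp)
 show H': "hopf_algebra ?H'"
  unfolding hopf_algebra_iff using co hp twist_hopf_bij[OF H \<chi>] by simp
 have "hopf_cocycle (HC ?H') (hmult ?H') (hone ?H') (hantipode ?H') (case_prod ?\<xi>) (case_prod \<chi>)"
  using hp twisted_cocycle[OF mu'] by (simp add: hopf_cocycle_def)
 then show c': "two_cocycle ?H' ?\<xi>" and i': "conv_inverse2 ?H' ?\<xi> = \<chi>"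
  unfolding hopf_cocycle_iff[OF H'] by auto
 have mm: "hmult (twist_hopf ?H' ?\<xi>) = hmult H"
 proof (intro ext)
  fix a b
  note cb = cog_bcm[OF cog]
  have mf: "(%(a, b). \<phi> (hmult H a b)) \<in> pform (bF (selfB (HC H))) (bF (selfB (HC H)))" if "\<phi> \<in> cF (HC H)" for \<phi>
   using morph_cF[OF mu_morph that] by (simp add: case_prod_beta')
  have s: "is_tw (case_prod ?\<xi>) (case_prod \<chi>) (selfB (HC H)) (selfB (HC H)) (cF (HC H)) (hmult ?H') (hmult (twist_hopf ?H' ?\<xi>))"
   using twist_hopf_mult[OF H' c'] by (simp add: i')
  show "hmult (twist_hopf ?H' ?\<xi>) a b = hmult H a b"
   by (rule separating, rule tw_inverse[OF cb cb mf mu' s])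
 qed
 interpret H'': hopf "HC H" "hmult ?H'" "hone H" "hantipode ?H'" by (rule hp)
 have hp'': "hopf (HC H) (hmult H) (hone H) (hantipode (twist_hopf ?H' ?\<xi>))"
 proof -
  interpret c: hopf_cocycle "HC H" "hmult ?H'" "hone H" "hantipode ?H'" "case_prod ?\<xi>" "case_prod \<chi>"
   using hopf_cocycle_iff[OF H', of ?\<xi> \<chi>] c' i' by simp
  have "is_tw (case_prod ?\<xi>) (case_prod \<chi>) (selfB (HC H)) (selfB (HC H)) (cF (HC H)) (hmult ?H') (hmult H)"
   using twist_hopf_mult[OF H' c'] by (simp add: i' mm)
  then show ?thesis
   by (rule c.twisted_hopf) (use twist_hopf_antipode[OF H' c'] in \<open>simp add: i'\<close>)
 qed
 have "hantipode (twist_hopf ?H' ?\<xi>) = hantipode H"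
 proof
  fix x
  interpret c: hopf "HC H" "hmult H" "hone H" "hantipode (twist_hopf ?H' ?\<xi>)" by (rule hp'')
  show "hantipode (twist_hopf ?H' ?\<xi>) x = hantipode H x"
   by (rule separating, rule hopf_over.T_unique[OF hopf_over_self c.S_form c.SL])
 qed
 with mm show "twist_hopf ?H' ?\<xi> = H"
  by (simp add: twist_hopf_def)
qed

section \<open>First order calculi\<close>

lemma twf_add: "twf B u v (%x. \<phi> x + \<psi> x) x = twf B u v \<phi> x + twf B u v \<psi> x"
 by (simp add: twf_def Lo_def Ro_def algebra_simps ssum_add)

text \<open>Reads the original product as a twist of the twisted one; spanning sets are carried over
  to the twisted structure in this way.\<close>

lemma (in cocycle) is_tw_inverse:
 assumes A: "is_bcm C A" and B: "is_bcm C B"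
  and m: "!!\<phi>. \<phi> \<in> F ==> (%(a, b). \<phi> (m a b)) \<in> pform (bF A) (bF B)"
  and t: "is_tw \<chi> \<xi> A B F m t"
 shows "is_tw \<xi> \<chi> A B F t m"
 unfolding is_tw_def
proof (intro ballI allI)
 note AB = prodB_is_bcm[OF cog cog A B]
 fix \<phi> a b assume \<phi>: "\<phi> \<in> F"
 have e: "(%(a, b). \<phi> (t a b)) = twf (prodB A B) \<chi> \<xi> (%(a, b). \<phi> (m a b))"
  using is_twD[OF t \<phi>] by (auto simp: fun_eq_iff)
 have p: "(%(a, b). \<phi> (m a b)) \<in> bF (prodB A B)" using m[OF \<phi>] by simp
 show "\<phi> (m a b) = twf (prodB A B) \<xi> \<chi> (%(a, b). \<phi> (t a b)) (a, b)"
  unfolding e twf_twf[OF CC AB xi chi chi xi p] xi_chi twf_counit[OF CC AB p] by simp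
qed

section \<open>Colinear maps and bicovariant bimodules in terms of forms\<close>

context
 fixes H :: "('k::field, 'h::ab_group_add) hopf"
 assumes H: "hopf_algebra H"
begin

interpretation hopf "HC H" "hmult H" "hone H" "hantipode H"
 using H by (simp add: hopf_algebra_iff)

lemma H_tensor: "hcomult H x \<in> elems (tensor (hspace H) (hspace H))"
 using H by (auto simp: hopf_algebra_def is_coalgebra_def linear_map_def)

lemma H_bilinear: "\<phi> \<in> hlin H ==> (%a b. \<phi> (hmult H a b)) \<in> bi (hlin H) (hlin H)"
 using mu_form[of \<phi>] by (auto intro!: biI)

lemma colinear_iff:
 assumes V: "bicomodule H V" and V': "bicomodule H V'" and f: "!!\<phi>. \<phi> \<in> lin (vscale V') ==> (%x. \<phi> (f x)) \<in> vlin V"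
 shows "morph (HC H) (HC H) (%x. x) f (VB H V) (VB H V') \<longleftrightarrow>
   (\<forall>v. lcoact V' (f v) = tlift (hspace H) (vspace V) (%h w. tens (hspace H) (vspace V') h (f w)) (lcoact V v)) \<and>
   (\<forall>v. rcoact V' (f v) = tlift (vspace V) (hspace H) (%w h. tens (vspace V') (hspace H) (f w) h) (rcoact V v))"
proof -
 have t: "lcoact V v \<in> elems (tensor (hspace H) (vspace V))" "rcoact V v \<in> elems (tensor (vspace V) (hspace H))"
  "lcoact V' v' \<in> elems (tensor (hspace H) (vspace V'))" "rcoact V' v' \<in> elems (tensor (vspace V') (hspace H))" for v v'
  using V V' by (auto simp: bicomodule_def Let_def linear_map_def)
 have 1: "lcoact V' (f v) = tlift (hspace H) (vspace V) (%h w. tens (hspace H) (vspace V') h (f w)) (lcoact V v) \<longleftrightarrow>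
  (\<forall>g\<in>bi (hlin H) (lin (vscale V')). ssum (rp (hspace H) (vspace V') (lcoact V' (f v))) g = ssum (rp (hspace H) (vspace V) (lcoact V v)) (%p q. g p (f q)))" for v
  by (rule tensor_eq_map_iff[OF t(1) _ f t(3)])
 have 2: "rcoact V' (f v) = tlift (vspace V) (hspace H) (%w h. tens (vspace V') (hspace H) (f w) h) (rcoact V v) \<longleftrightarrow>
  (\<forall>g\<in>bi (lin (vscale V')) (hlin H). ssum (rp (vspace V') (hspace H) (rcoact V' (f v))) g = ssum (rp (vspace V) (hspace H) (rcoact V v)) (%p q. g (f p) q))" for v
  by (rule tensor_eq_map_iff[OF t(2) f _ t(4)])
 show ?thesis unfolding 1 2 morph_def using f by auto
qed

lemma dif_colinear_iff:
 assumes V: "bicomodule H V" and f: "!!\<phi>. \<phi> \<in> vlin V ==> (%x. \<phi> (f x)) \<in> hlin H"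
 shows "morph (HC H) (HC H) (%x. x) f (selfB (HC H)) (VB H V) \<longleftrightarrow>
   (\<forall>h. lcoact V (f h) = tlift (hspace H) (hspace H) (%h1 h2. tens (hspace H) (vspace V) h1 (f h2)) (hcomult H h)) \<and>
   (\<forall>h. rcoact V (f h) = tlift (hspace H) (hspace H) (%h1 h2. tens (vspace V) (hspace H) (f h1) h2) (hcomult H h))"
proof -
 have t: "lcoact V v \<in> elems (tensor (hspace H) (vspace V))" "rcoact V v \<in> elems (tensor (vspace V) (hspace H))" for v
  using V by (auto simp: bicomodule_def Let_def linear_map_def)
 have 1: "lcoact V (f v) = tlift (hspace H) (hspace H) (%h w. tens (hspace H) (vspace V) h (f w)) (hcomult H v) \<longleftrightarrow>
  (\<forall>g\<in>bi (hlin H) (vlin V). ssum (rp (hspace H) (vspace V) (lcoact V (f v))) g = ssum (rp (hspace H) (hspace H) (hcomult H v)) (%p q. g p (f q)))" for v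
  by (rule tensor_eq_map_iff[OF H_tensor _ f t(1)])
 have 2: "rcoact V (f v) = tlift (hspace H) (hspace H) (%w h. tens (vspace V) (hspace H) (f w) h) (hcomult H v) \<longleftrightarrow>
  (\<forall>g\<in>bi (vlin V) (hlin H). ssum (rp (vspace V) (hspace H) (rcoact V (f v))) g = ssum (rp (hspace H) (hspace H) (hcomult H v)) (%p q. g (f p) q))" for v
  by (rule tensor_eq_map_iff[OF H_tensor f _ t(2)])
 show ?thesis unfolding 1 2 morph_def using f by auto
qed

lemma lact_colinear_iff:
 assumes V: "bicomodule H V" and m: "!!\<phi>. \<phi> \<in> vlin V ==> (%a b. \<phi> (lact V a b)) \<in> bi (hlin H) (vlin V)"
 shows "morph CC (HC H) (case_prod (hmult H)) (case_prod (lact V)) (prodB (selfB (HC H)) (VB H V)) (VB H V) \<longleftrightarrow>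
  (\<forall>h v. lcoact V (lact V h v) =
    tlift (hspace H) (hspace H) (%h1 h2. tlift (hspace H) (vspace V) (%g w. tens (hspace H) (vspace V) (hmult H h1 g) (lact V h2 w)) (lcoact V v))
     (hcomult H h)) \<and>
  (\<forall>h v. rcoact V (lact V h v) =
    tlift (hspace H) (hspace H) (%h1 h2. tlift (vspace V) (hspace H) (%w g. tens (vspace V) (hspace H) (lact V h1 w) (hmult H h2 g)) (rcoact V v))
     (hcomult H h))"
proof -
 have t: "lcoact V v \<in> elems (tensor (hspace H) (vspace V))" "rcoact V v \<in> elems (tensor (vspace V) (hspace H))" for v
  using V by (auto simp: bicomodule_def Let_def linear_map_def)
 have 1: "lcoact V (lact V h v) =
    tlift (hspace H) (hspace H) (%h1 h2. tlift (hspace H) (vspace V) (%g w. tens (hspace H) (vspace V) (hmult H h1 g) (lact V h2 w)) (lcoact V v))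
     (hcomult H h) \<longleftrightarrow> (\<forall>f\<in>bi (hlin H) (vlin V).
   ssum (rp (hspace H) (vspace V) (lcoact V (lact V h v))) f = ssum (rp (hspace H) (hspace H) (hcomult H h)) (%p q.
    ssum (rp (hspace H) (vspace V) (lcoact V v)) (%r s. f (hmult H p r) (lact V q s))))" for h v
  by (rule tensor_eq_mult_iff[OF H_tensor t(1) _ _ t(1)]) (rule H_bilinear m, assumption)+
 have 2: "rcoact V (lact V h v) =
    tlift (hspace H) (hspace H) (%h1 h2. tlift (vspace V) (hspace H) (%w g. tens (vspace V) (hspace H) (lact V h1 w) (hmult H h2 g)) (rcoact V v))
     (hcomult H h) \<longleftrightarrow> (\<forall>f\<in>bi (vlin V) (hlin H).
   ssum (rp (vspace V) (hspace H) (rcoact V (lact V h v))) f = ssum (rp (hspace H) (hspace H) (hcomult H h)) (%p q.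
    ssum (rp (vspace V) (hspace H) (rcoact V v)) (%r s. f (lact V p r) (hmult H q s))))" for h v
  by (rule tensor_eq_mult_iff[OF H_tensor t(2) _ _ t(2)]) (rule H_bilinear m, assumption)+
 have "(%c. u (case_prod (hmult H) c)) \<in> pform (hlin H) (hlin H)" if "u \<in> hlin H" for u
  using H_bilinear[OF that] by (simp add: pform_def)
 moreover have "(%c. u (case_prod (lact V) c)) \<in> pform (hlin H) (vlin V)" if "u \<in> vlin V" for u
  using m[OF that] by (simp add: pform_def)
 ultimately show ?thesis unfolding 1 2 morph_def by (auto simp: ssum_plist)
qed

lemma ract_colinear_iff:
 assumes V: "bicomodule H V" and m: "!!\<phi>. \<phi> \<in> vlin V ==> (%a b. \<phi> (ract V a b)) \<in> bi (vlin V) (hlin H)"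
 shows "morph CC (HC H) (case_prod (hmult H)) (case_prod (ract V)) (prodB (VB H V) (selfB (HC H))) (VB H V) \<longleftrightarrow>
  (\<forall>h v. lcoact V (ract V v h) =
    tlift (hspace H) (hspace H) (%h1 h2. tlift (hspace H) (vspace V) (%g w. tens (hspace H) (vspace V) (hmult H g h1) (ract V w h2)) (lcoact V v))
     (hcomult H h)) \<and>
  (\<forall>h v. rcoact V (ract V v h) =
    tlift (hspace H) (hspace H) (%h1 h2. tlift (vspace V) (hspace H) (%w g. tens (vspace V) (hspace H) (ract V w h1) (hmult H g h2)) (rcoact V v))
     (hcomult H h))"
proof -
 have t: "lcoact V v \<in> elems (tensor (hspace H) (vspace V))" "rcoact V v \<in> elems (tensor (vspace V) (hspace H))" for v
  using V by (auto simp: bicomodule_def Let_def linear_map_def)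
 have H': "(%b a. \<phi> (hmult H a b)) \<in> bi (hlin H) (hlin H)" if "\<phi> \<in> hlin H" for \<phi>
  using H_bilinear[OF that] by (auto simp: bi_def)
 have m': "(%b a. \<phi> (ract V a b)) \<in> bi (hlin H) (vlin V)" if "\<phi> \<in> vlin V" for \<phi>
  using m[OF that] by (auto simp: bi_def)
 have 1: "lcoact V (ract V v h) =
    tlift (hspace H) (hspace H) (%h1 h2. tlift (hspace H) (vspace V) (%g w. tens (hspace H) (vspace V) (hmult H g h1) (ract V w h2)) (lcoact V v))
     (hcomult H h) \<longleftrightarrow> (\<forall>f\<in>bi (hlin H) (vlin V).
   ssum (rp (hspace H) (vspace V) (lcoact V (ract V v h))) f = ssum (rp (hspace H) (hspace H) (hcomult H h)) (%p q.
    ssum (rp (hspace H) (vspace V) (lcoact V v)) (%r s. f (hmult H r p) (ract V s q))))" for h v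
  by (rule tensor_eq_mult_iff[OF H_tensor t(1) _ _ t(1)]) (rule H' m', assumption)+
 have 2: "rcoact V (ract V v h) =
    tlift (hspace H) (hspace H) (%h1 h2. tlift (vspace V) (hspace H) (%w g. tens (vspace V) (hspace H) (ract V w h1) (hmult H g h2)) (rcoact V v))
     (hcomult H h) \<longleftrightarrow> (\<forall>f\<in>bi (vlin V) (hlin H).
   ssum (rp (vspace V) (hspace H) (rcoact V (ract V v h))) f = ssum (rp (hspace H) (hspace H) (hcomult H h)) (%p q.
    ssum (rp (vspace V) (hspace H) (rcoact V v)) (%r s. f (ract V r p) (hmult H s q))))" for h v
  by (rule tensor_eq_mult_iff[OF H_tensor t(2) _ _ t(2)]) (rule H' m', assumption)+
 have "(%c. u (case_prod (hmult H) c)) \<in> pform (hlin H) (hlin H)" if "u \<in> hlin H" for u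
  using H_bilinear[OF that] by (simp add: pform_def)
 moreover have "(%c. u (case_prod (ract V) c)) \<in> pform (vlin V) (hlin H)" if "u \<in> vlin V" for u
  using m[OF that] by (simp add: pform_def)
 ultimately show ?thesis unfolding 1 2 morph_def
  by (auto simp: ssum_plist ssum_swap[of "rp (hspace H) (hspace H) (hcomult H _)"])
qed

text \<open>Bilinearity of the actions is contained in the two \<open>morph\<close> conditions:
  pulling back a form along an action must give a form on pairs.\<close>

lemma bicovariant_bimodule_iff:
 "bicovariant_bimodule H V \<longleftrightarrow> vector_space (vscale V) \<and> bicomodule H V \<and>
   morph CC (HC H) (case_prod (hmult H)) (case_prod (lact V)) (prodB (selfB (HC H)) (VB H V)) (VB H V) \<and>
   morph CC (HC H) (case_prod (hmult H)) (case_prod (ract V)) (prodB (VB H V) (selfB (HC H))) (VB H V) \<and>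
   (\<forall>h g v. lact V (hmult H h g) v = lact V h (lact V g v)) \<and>
   (\<forall>v. lact V (hone H) v = v) \<and>
   (\<forall>h g v. ract V v (hmult H h g) = ract V (ract V v h) g) \<and>
   (\<forall>v. ract V v (hone H) = v) \<and>
   (\<forall>h g v. ract V (lact V h v) g = lact V h (ract V v g))"
  (is "?L \<longleftrightarrow> ?vs \<and> ?co \<and> ?ml \<and> ?mr \<and> ?alg")
proof -
 have l: "\<forall>\<phi>\<in>vlin V. (%a b. \<phi> (lact V a b)) \<in> bi (hlin H) (vlin V)" if ?ml
 proof
  fix \<phi> assume "\<phi> \<in> vlin V"
  then show "(%a b. \<phi> (lact V a b)) \<in> bi (hlin H) (vlin V)"
   using morph_bF[OF that, of \<phi>] by (simp add: pform_def)
 qed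
 have r: "\<forall>\<phi>\<in>vlin V. (%a b. \<phi> (ract V a b)) \<in> bi (vlin V) (hlin H)" if ?mr
 proof
  fix \<phi> assume "\<phi> \<in> vlin V"
  then show "(%a b. \<phi> (ract V a b)) \<in> bi (vlin V) (hlin H)"
   using morph_bF[OF that, of \<phi>] by (simp add: pform_def)
 qed
 have bl: "bilinear_map (hspace H) (vspace V) (vspace V) (lact V) \<longleftrightarrow>
   (\<forall>\<phi>\<in>vlin V. (%a b. \<phi> (lact V a b)) \<in> bi (hlin H) (vlin V))"
  "bilinear_map (vspace V) (hspace H) (vspace V) (ract V) \<longleftrightarrow>
   (\<forall>\<phi>\<in>vlin V. (%a b. \<phi> (ract V a b)) \<in> bi (vlin V) (hlin H))" if ?vs
  using that by (auto intro!: bilinear_mapI_lin intro: bilinear_map_lin)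
 show ?thesis
 proof
  assume L: ?L
  then have bm: "bimodule H V" and co: ?co and vs: ?vs by (auto simp: bicovariant_bimodule_def Let_def bimodule_def is_space_full)
  have b: "\<forall>\<phi>\<in>vlin V. (%a b. \<phi> (lact V a b)) \<in> bi (hlin H) (vlin V)"
   "\<forall>\<phi>\<in>vlin V. (%a b. \<phi> (ract V a b)) \<in> bi (vlin V) (hlin H)"
   using bm unfolding bimodule_def bl[OF vs] by auto
  have ml: ?ml
   by (rule iffD2[OF lact_colinear_iff[OF co]]) (use b L in \<open>auto simp: bicovariant_bimodule_def Let_def\<close>)
  have mr: ?mr
   by (rule iffD2[OF ract_colinear_iff[OF co]]) (use b L in \<open>auto simp: bicovariant_bimodule_def Let_def\<close>)
  show "?vs \<and> ?co \<and> ?ml \<and> ?mr \<and> ?alg"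
   using vs co ml mr bm by (auto simp: bimodule_def)
 next
  assume R: "?vs \<and> ?co \<and> ?ml \<and> ?mr \<and> ?alg"
  then have vs: ?vs and co: ?co and ml: ?ml and mr: ?mr by auto
  have "bimodule H V"
   unfolding bimodule_def bl[OF vs] is_space_full using R l[OF ml] r[OF mr] by blast
  moreover have "(\<forall>h v. lcoact V (lact V h v) =
    tlift (hspace H) (hspace H) (%h1 h2. tlift (hspace H) (vspace V) (%g w. tens (hspace H) (vspace V) (hmult H h1 g) (lact V h2 w)) (lcoact V v))
     (hcomult H h)) \<and>
  (\<forall>h v. rcoact V (lact V h v) =
    tlift (hspace H) (hspace H) (%h1 h2. tlift (vspace V) (hspace H) (%w g. tens (vspace V) (hspace H) (lact V h1 w) (hmult H h2 g)) (rcoact V v))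
     (hcomult H h))"
   by (rule iffD1[OF lact_colinear_iff[OF co]]) (use l[OF ml] ml in auto)
  moreover have "(\<forall>h v. lcoact V (ract V v h) =
    tlift (hspace H) (hspace H) (%h1 h2. tlift (hspace H) (vspace V) (%g w. tens (hspace H) (vspace V) (hmult H g h1) (ract V w h2)) (lcoact V v))
     (hcomult H h)) \<and>
  (\<forall>h v. rcoact V (ract V v h) =
    tlift (hspace H) (hspace H) (%h1 h2. tlift (vspace V) (hspace H) (%w g. tens (vspace V) (hspace H) (ract V w h1) (hmult H g h2)) (rcoact V v))
     (hcomult H h))"
   by (rule iffD1[OF ract_colinear_iff[OF co]]) (use r[OF mr] mr in auto)
  ultimately show ?L unfolding bicovariant_bimodule_def Let_def using co by blast
 qed
qed

end

section \<open>Twisting first order calculi\<close>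

lemma twist_calculus_simps [simp]:
 "vscale (twist_calculus H \<chi> M) = vscale M" "lcoact (twist_calculus H \<chi> M) = lcoact M"
 "rcoact (twist_calculus H \<chi> M) = rcoact M" "dif (twist_calculus H \<chi> M) = dif M"
 "VB H' (twist_calculus H \<chi> M) = VB H' M" "VB (twist_hopf H \<chi>) V = VB H V"
 by (simp_all add: twist_calculus_def VB_def)

lemma bicomodule_twist [simp]:
 "bicomodule (twist_hopf H \<chi>) (twist_calculus H \<chi> M) \<longleftrightarrow> bicomodule H M"
 by (simp add: bicomodule_def)

lemma twist_calculus_tw:
 assumes H: "hopf_algebra H" and \<chi>: "two_cocycle H \<chi>" and M: "bicovariant_bimodule H M"
 shows "is_tw (case_prod \<chi>) (case_prod (conv_inverse2 H \<chi>)) (selfB (HC H)) (VB H M) (vlin M)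
   (lact M) (lact (twist_calculus H \<chi> M))"
  and "is_tw (case_prod \<chi>) (case_prod (conv_inverse2 H \<chi>)) (VB H M) (selfB (HC H)) (vlin M)
   (ract M) (ract (twist_calculus H \<chi> M))"
proof -
 interpret hopf_cocycle "HC H" "hmult H" "hone H" "hantipode H" "case_prod \<chi>" "case_prod (conv_inverse2 H \<chi>)"
  using hopf_cocycle_iff[OF H] \<chi> by blast
 have co: "is_coalgebra (hspace H) (hcomult H) (hcounit H)" using H by (simp add: hopf_algebra_iff)
 note * = M[unfolded bicovariant_bimodule_iff[OF H]]
 have vs: "vector_space (vscale M)" and bc: "bicomodule H M" using * by auto
 have ml: "morph CC (HC H) (case_prod (hmult H)) (case_prod (lact M)) (prodB (selfB (HC H)) (VB H M)) (VB H M)"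
  and mr: "morph CC (HC H) (case_prod (hmult H)) (case_prod (ract M)) (prodB (VB H M) (selfB (HC H))) (VB H M)"
  using * by auto
 note swH = sweedler3_sw[OF co vs] and swV = bicoact3_sw[OF bc vs]
 note cb = cog_bcm[OF cog] and V = bicomodule_is_bcm[OF co bc vs]
 have l: "(%a b. \<phi> (lact M a b)) \<in> bi (bF (selfB (HC H))) (bF (VB H M))"
  and r: "(%a b. \<phi> (ract M a b)) \<in> bi (bF (VB H M)) (bF (selfB (HC H)))" if "\<phi> \<in> vlin M" for \<phi>
  using morph_bF[OF ml, of \<phi>] morph_bF[OF mr, of \<phi>] that by (simp_all add: pform_def)
 show "is_tw (case_prod \<chi>) (case_prod (conv_inverse2 H \<chi>)) (selfB (HC H)) (VB H M) (vlin M)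
   (lact M) (lact (twist_calculus H \<chi> M))"
  using is_tw_sw[OF cog cb V swH swV, of \<chi> "conv_inverse2 H \<chi>" "lact M"] chi xi l by (simp add: twist_calculus_def)
 show "is_tw (case_prod \<chi>) (case_prod (conv_inverse2 H \<chi>)) (VB H M) (selfB (HC H)) (vlin M)
   (ract M) (ract (twist_calculus H \<chi> M))"
  using is_tw_sw[OF cog V cb swV swH, of \<chi> "conv_inverse2 H \<chi>" "ract M"] chi xi r by (simp add: twist_calculus_def)
qed

lemma (in vector_space) span_ssum: "(!!x y. f x y \<in> span A) ==> ssum r f \<in> span A"
 by (induction r) (auto simp: ssum_def span_zero span_add)

text \<open>The module laws are instances of \<open>tw_assoc\<close> with one of the three factors
  equal to the bimodule. The calculus axioms rest on the bicolinearity of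
  \<open>dif\<close>.\<close>

theorem twist_calculus_bicovariant:
 fixes H :: "('k::field, 'h::ab_group_add) hopf" and M :: "('k, 'h, 'v::ab_group_add) calculus"
 assumes H: "hopf_algebra H" and \<chi>: "two_cocycle H \<chi>" and M: "bicovariant_calculus H M"
 shows "bicovariant_calculus (twist_hopf H \<chi>) (twist_calculus H \<chi> M)"
proof -
 let ?\<xi> = "conv_inverse2 H \<chi>" and ?H' = "twist_hopf H \<chi>" and ?M' = "twist_calculus H \<chi> M"
 interpret hopf_cocycle "HC H" "hmult H" "hone H" "hantipode H" "case_prod \<chi>" "case_prod ?\<xi>"
  using hopf_cocycle_iff[OF H] \<chi> by blast
 have co: "is_coalgebra (hspace H) (hcomult H) (hcounit H)" using H by (simp add: hopf_algebra_iff)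
 have bb: "bicovariant_bimodule H M" using M by (simp add: bicovariant_calculus_def Let_def)
 note * = bb[unfolded bicovariant_bimodule_iff[OF H]]
 have vs: "vector_space (vscale M)" and bc: "bicomodule H M" using * by auto
 have ml: "morph CC (HC H) (case_prod (hmult H)) (case_prod (lact M)) (prodB (selfB (HC H)) (VB H M)) (VB H M)"
  and mr: "morph CC (HC H) (case_prod (hmult H)) (case_prod (ract M)) (prodB (VB H M) (selfB (HC H))) (VB H M)"
  using * by auto
 note cb = cog_bcm[OF cog] and V = bicomodule_is_bcm[OF co bc vs]
 note mm = mu_morph[unfolded selfB_prodC]
 note tl = twist_calculus_tw(1)[OF H \<chi> bb] and tr = twist_calculus_tw(2)[OF H \<chi> bb]
 note th = twist_hopf_mult[OF H \<chi>]
 have lf: "(%(a, b). \<phi> (lact M a b)) \<in> pform (bF (selfB (HC H))) (bF (VB H M))"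
  and rf: "(%(a, b). \<phi> (ract M a b)) \<in> pform (bF (VB H M)) (bF (selfB (HC H)))" if "\<phi> \<in> vlin M" for \<phi>
  using morph_bF[OF ml, of \<phi>] morph_bF[OF mr, of \<phi>] that by (simp_all add: pform_def)
 have sep: "a = b" if "!!\<phi>. \<phi> \<in> vlin M ==> \<phi> a = \<phi> b" for a b by (rule lin_eqI[OF vs that])
 have bimod: "bicovariant_bimodule ?H' ?M'"
  unfolding bicovariant_bimodule_iff[OF twist_hopf_algebra[OF H \<chi>]] twist_hopf_simps twist_calculus_simps
 proof (intro conjI allI)
  show "vector_space (vscale M)" by fact
  show "bicomodule ?H' ?M'" using bc by simp
  show "morph CC (HC H) (case_prod (hmult ?H')) (case_prod (lact ?M')) (prodB (selfB (HC H)) (VB H M)) (VB H M)"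
   by (rule tw_colinear[OF cb V V ml]) (use tl th in simp_all)
  show "morph CC (HC H) (case_prod (hmult ?H')) (case_prod (ract ?M')) (prodB (VB H M) (selfB (HC H))) (VB H M)"
   by (rule tw_colinear[OF V cb V mr]) (use tr th in simp_all)
  fix h g v
  show "lact ?M' (hmult ?H' h g) v = lact ?M' h (lact ?M' g v)"
   by (rule sep, rule tw_assoc[OF cb cb V cb V mm ml lf lf _ tl _ tl]) (use * tl th in auto)
  show "ract ?M' v (hmult ?H' h g) = ract ?M' (ract ?M' v h) g"
   by (rule sep, rule tw_assoc[OF V cb cb V cb mr mm rf rf _ tr _ tr, symmetric]) (use * tr th in auto)
  show "ract ?M' (lact ?M' h v) g = lact ?M' h (ract ?M' v g)"
   by (rule sep, rule tw_assoc[OF cb V cb V V ml mr rf lf _ tr _ tl]) (use * tl tr in auto)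
  have "\<phi> (lact ?M' (hone H) v) = \<phi> v" if "\<phi> \<in> vlin M" for \<phi>
   using tw_unitL[OF cb V _ _ tl that, of "hone H" v] lf[OF that] unit_group * by simp
  then show "lact ?M' (hone H) v = v" by (rule sep)
  have "\<phi> (ract ?M' v (hone H)) = \<phi> v" if "\<phi> \<in> vlin M" for \<phi>
   using tw_unitR[OF cb V _ _ tr that, of "hone H" v] rf[OF that] unit_group * by simp
  then show "ract ?M' v (hone H) = v" by (rule sep)
 qed
 have dl: "(%x. \<phi> (dif M x)) \<in> hlin H" if "\<phi> \<in> vlin M" for \<phi>
  using M that linear_map_lin by (auto simp: bicovariant_calculus_def Let_def)
 have dm: "morph (HC H) (HC H) (%x. x) (dif M) (selfB (HC H)) (VB H M)"
  by (rule iffD2[OF dif_colinear_iff[OF H bc dl]]) (use M in \<open>auto simp: bicovariant_calculus_def Let_def\<close>)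
 \<comment> \<open>Twist the Leibniz rule of \<open>H\<close>: as \<open>dif\<close> is bicolinear,
   each term is natural along \<open>dif\<close> in one of the two arguments.\<close>
 have leibniz: "dif M (hmult ?H' h g) = ract ?M' (dif M h) g + lact ?M' h (dif M g)" for h g
 proof (rule sep)
  fix \<phi> assume \<phi>: "\<phi> \<in> vlin M"
  note VS = prodB_is_bcm[OF cog cog V cb] and SV = prodB_is_bcm[OF cog cog cb V]
  have d: "dif M (hmult H h g) = ract M (dif M h) g + lact M h (dif M g)" for h g
   using M by (simp add: bicovariant_calculus_def Let_def)
  have "\<phi> (dif M (hmult ?H' h g)) =
    twf (prodB (selfB (HC H)) (selfB (HC H))) (case_prod \<chi>) (case_prod ?\<xi>) (%p. \<phi> (case_prod (ract M) (map_prod (dif M) (%x. x) p)) +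
     \<phi> (case_prod (lact M) (map_prod (%x. x) (dif M) p))) (h, g)"
   using is_twD[OF th dl[OF \<phi>], of h g] by (simp add: d lin_add[OF \<phi>] case_prod_beta')
  also have "... = twf (prodB (VB H M) (selfB (HC H))) (case_prod \<chi>) (case_prod ?\<xi>) (%p. \<phi> (case_prod (ract M) p)) (dif M h, g) +
    twf (prodB (selfB (HC H)) (VB H M)) (case_prod \<chi>) (case_prod ?\<xi>) (%p. \<phi> (case_prod (lact M) p)) (h, dif M g)"
   unfolding twf_add
   using twf_morph[OF CC VS morph_prod[OF cog cog V cb dm morph_id[of "HC H" "selfB (HC H)"]] chi xi, of "%p. \<phi> (case_prod (ract M) p)" "(h, g)"] rf[OF \<phi>]
    twf_morph[OF CC SV morph_prod[OF cog cog cb cb morph_id[of "HC H" "selfB (HC H)"] dm] chi xi, of "%p. \<phi> (case_prod (lact M) p)" "(h, g)"] lf[OF \<phi>]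
   by (simp add: case_prod_beta')
  also have "... = \<phi> (ract ?M' (dif M h) g + lact ?M' h (dif M g))"
   using is_twD[OF tl \<phi>, of h "dif M g"] is_twD[OF tr \<phi>, of "dif M h" g] by (simp add: lin_add[OF \<phi>] case_prod_beta')
  finally show "\<phi> (dif M (hmult ?H' h g)) = \<phi> (ract ?M' (dif M h) g + lact ?M' h (dif M g))" .
 qed
 interpret V: vector_space "vscale M" by fact
 let ?D = "%h g. lact ?M' h (dif M g)"
 \<comment> \<open>The old products span, so it suffices to express them by new ones: twisting back
   writes h dg as a sum of scalar multiples of twisted products.\<close>
 have "{lact M h (dif M g) | h g. True} \<subseteq> V.span {?D h g | h g. True}"
 proof safe
  fix h g
  note sw = sweedler3_sw[OF co vs]
  let ?sw = "sweedler3 (hspace H) (hcomult H) :: ('h => 'h => 'h => 'v) => _"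
  let ?t = "%a b. ?sw (%a1 a2 a3. ?sw (%b1 b2 b3. vscale M (?\<xi> a1 b1 * \<chi> a3 b3) (?D a2 b2)) b) a"
  have tl': "is_tw (case_prod ?\<xi>) (case_prod \<chi>) (selfB (HC H)) (VB H M) (vlin M) (lact ?M') (lact M)"
   by (rule is_tw_inverse[OF cb V lf tl])
  have lf': "(%(a, b). \<phi> (lact ?M' a b)) \<in> pform (hlin H) (vlin M)" if "\<phi> \<in> vlin M" for \<phi>
   using is_tw_form[OF cog cb V chi xi tl that] lf[OF that] by simp
  have Df: "(%a b. \<phi> (?D a b)) \<in> bi (hlin H) (hlin H)" if "\<phi> \<in> vlin M" for \<phi>
   using lf'[OF that] dl[of "%v. \<phi> (lact ?M' _ v)"] by (auto simp: pform_def bi_def)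
  have tt: "is_tw (case_prod ?\<xi>) (case_prod \<chi>) (selfB (HC H)) (selfB (HC H)) (vlin M) ?D ?t"
   by (rule is_tw_sw[OF cog cb cb sw sw]) (use chi xi Df in simp_all)
  \<comment> \<open>\<open>?t\<close> is the inverse twist of \<open>?D\<close> taken over
    \<open>H\<close> in both arguments; naturality along the identity and \<open>dif\<close>
    identifies it with the inverse twist over the bimodule.\<close>
  have "lact M h (dif M g) = ?t h g"
  proof (rule sep)
   fix \<phi> assume \<phi>: "\<phi> \<in> vlin M"
   show "\<phi> (lact M h (dif M g)) = \<phi> (?t h g)"
    by (rule is_tw_natural[OF cog cb cb V morph_id dm xi chi tt tl' \<phi>, where \<zeta> = "%x. x", symmetric])
     (use \<phi> lf' in auto)
  qed
  also have "... \<in> V.span {?D h g | h g. True}"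
  proof -
   note * = sw[unfolded is_sw_def, rule_format]
   note i = triI forms_ssum[OF forms_lin] forms_mult[OF forms_lin] forms_mult'[OF forms_lin] cocycle_forms[unfolded HC_simps prod.case]
    bi1[OF Df] bi2[OF Df]
   have 1: "?sw (%b1 b2 b3. vscale M (?\<xi> a1 b1 * \<chi> a3 b3) (?D a2 b2)) b =
     ssum (bR (selfB (HC H)) b) (%w b3. ssum (bL (selfB (HC H)) w) (%b1 b2. vscale M (?\<xi> a1 b1 * \<chi> a3 b3) (?D a2 b2)))" for a1 a2 a3 b
    by (rule *, unfold selfB_simps HC_simps) (simp only: lin_scale, intro i)
   have "?t h g = ssum (bR (selfB (HC H)) h) (%w a3. ssum (bL (selfB (HC H)) w) (%a1 a2.
     ssum (bR (selfB (HC H)) g) (%w b3. ssum (bL (selfB (HC H)) w) (%b1 b2. vscale M (?\<xi> a1 b1 * \<chi> a3 b3) (?D a2 b2)))))"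
    unfolding 1 by (rule *, unfold selfB_simps HC_simps) (simp only: lin_scale lin_ssum, intro i)
   then show ?thesis by (simp only:) (intro V.span_ssum V.span_scale V.span_base, blast)
  qed
  finally show "lact M h (dif M g) \<in> V.span {?D h g | h g. True}" .
 qed
 then have "V.span {lact M h (dif M g) | h g. True} \<subseteq> V.span {?D h g | h g. True}"
  by (rule V.span_minimal) simp
 moreover have "V.span {lact M h (dif M g) | h g. True} = UNIV"
  using M by (simp add: bicovariant_calculus_def Let_def)
 ultimately have span: "V.span {?D h g | h g. True} = UNIV" by auto
 show ?thesis
  unfolding bicovariant_calculus_def Let_def
  using bimod leibniz span M by (auto simp: bicovariant_calculus_def Let_def)
qed

lemma twist_twist_calculus:
 assumes H: "hopf_algebra H" and \<chi>: "two_cocycle H \<chi>" and M: "bicovariant_calculus H M"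
 shows "twist_calculus (twist_hopf H \<chi>) (conv_inverse2 H \<chi>) (twist_calculus H \<chi> M) = M"
proof -
 let ?\<xi> = "conv_inverse2 H \<chi>" and ?H' = "twist_hopf H \<chi>" and ?M' = "twist_calculus H \<chi> M"
 interpret hopf_cocycle "HC H" "hmult H" "hone H" "hantipode H" "case_prod \<chi>" "case_prod ?\<xi>"
  using hopf_cocycle_iff[OF H] \<chi> by blast
 have co: "is_coalgebra (hspace H) (hcomult H) (hcounit H)" using H by (simp add: hopf_algebra_iff)
 have bb: "bicovariant_bimodule H M" using M by (simp add: bicovariant_calculus_def Let_def)
 have bb': "bicovariant_bimodule ?H' ?M'"
  using twist_calculus_bicovariant[OF H \<chi> M] by (simp add: bicovariant_calculus_def Let_def)
 note * = bb[unfolded bicovariant_bimodule_iff[OF H]]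
 have vs: "vector_space (vscale M)" and bc: "bicomodule H M" using * by auto
 note cb = cog_bcm[OF cog] and V = bicomodule_is_bcm[OF co bc vs]
 note tw = twist_calculus_tw[OF H \<chi> bb]
 note tw' = twist_calculus_tw[OF twist_hopf_algebra[OF H \<chi>] twist_cocycle[OF H \<chi>] bb',
  unfolded twist_conv_inverse[OF H \<chi>] twist_hopf_simps twist_calculus_simps]
 have f: "(%(a, b). \<phi> (lact M a b)) \<in> pform (bF (selfB (HC H))) (bF (VB H M))"
  "(%(a, b). \<phi> (ract M a b)) \<in> pform (bF (VB H M)) (bF (selfB (HC H)))" if "\<phi> \<in> vlin M" for \<phi>
  using * morph_bF[where B = "VB H M" and \<phi> = \<phi>] that by (fastforce simp: pform_def)+
 have "lact (twist_calculus ?H' ?\<xi> ?M') = lact M"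
  by (intro ext lin_eqI[OF vs]) (rule tw_inverse[OF cb V f(1) tw(1) tw'(1)])
 moreover have "ract (twist_calculus ?H' ?\<xi> ?M') = ract M"
  by (intro ext lin_eqI[OF vs]) (rule tw_inverse[OF V cb f(2) tw(2) tw'(2)])
 ultimately show ?thesis
  by (simp add: twist_calculus_def)
qed

lemma twist_calculus_bij:
 assumes H: "hopf_algebra H" and \<chi>: "two_cocycle H \<chi>"
 shows "bij_betw (twist_calculus H \<chi>) {M. bicovariant_calculus H M} {M. bicovariant_calculus (twist_hopf H \<chi>) M}"
proof (rule bij_betw_byWitness[where f' = "twist_calculus (twist_hopf H \<chi>) (conv_inverse2 H \<chi>)"])
 note H' = twist_hopf_algebra[OF H \<chi>] and \<chi>' = twist_cocycle[OF H \<chi>]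
 note tb = twist_twist_hopf[OF H \<chi>] twist_conv_inverse[OF H \<chi>]
 show "\<forall>a\<in>{M. bicovariant_calculus H M}. twist_calculus (twist_hopf H \<chi>) (conv_inverse2 H \<chi>) (twist_calculus H \<chi> a) = a"
  using twist_twist_calculus[OF H \<chi>] by blast
 show "\<forall>a'\<in>{M. bicovariant_calculus (twist_hopf H \<chi>) M}. twist_calculus H \<chi> (twist_calculus (twist_hopf H \<chi>) (conv_inverse2 H \<chi>) a') = a'"
  using twist_twist_calculus[OF H' \<chi>', unfolded tb] by blast
 show "twist_calculus H \<chi> ` {M. bicovariant_calculus H M} \<subseteq> {M. bicovariant_calculus (twist_hopf H \<chi>) M}"
  using twist_calculus_bicovariant[OF H \<chi>] by blast
 show "twist_calculus (twist_hopf H \<chi>) (conv_inverse2 H \<chi>) ` {M. bicovariant_calculus (twist_hopf H \<chi>) M} \<subseteq> {M. bicovariant_calculus H M}"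
  using twist_calculus_bicovariant[OF H' \<chi>', unfolded tb] by blast
qed

lemma twist_calculus_hom:
 assumes H: "hopf_algebra H" and \<chi>: "two_cocycle H \<chi>"
  and M: "bicovariant_calculus H M" and M': "bicovariant_calculus H M'" and f: "calculus_hom H M M' f"
 shows "calculus_hom (twist_hopf H \<chi>) (twist_calculus H \<chi> M) (twist_calculus H \<chi> M') f"
proof -
 let ?\<xi> = "conv_inverse2 H \<chi>"
 interpret hopf_cocycle "HC H" "hmult H" "hone H" "hantipode H" "case_prod \<chi>" "case_prod ?\<xi>"
  using hopf_cocycle_iff[OF H] \<chi> by blast
 have co: "is_coalgebra (hspace H) (hcomult H) (hcounit H)" using H by (simp add: hopf_algebra_iff)
 have bb: "bicovariant_bimodule H M" "bicovariant_bimodule H M'" using M M' by (simp_all add: bicovariant_calculus_def Let_def)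
 note * = bb[unfolded bicovariant_bimodule_iff[OF H]]
 have vs: "vector_space (vscale M)" "vector_space (vscale M')" and bc: "bicomodule H M" "bicomodule H M'" using * by auto
 note cb = cog_bcm[OF cog] and V = bicomodule_is_bcm[OF co bc(1) vs(1)] and V' = bicomodule_is_bcm[OF co bc(2) vs(2)]
 have fl: "(%x. \<phi> (f x)) \<in> vlin M" if "\<phi> \<in> lin (vscale M')" for \<phi>
  using f that linear_map_lin by (auto simp: calculus_hom_def Let_def)
 have fm: "morph (HC H) (HC H) (%x. x) f (VB H M) (VB H M')"
  by (rule iffD2[OF colinear_iff[OF H bc fl]]) (use f in \<open>auto simp: calculus_hom_def Let_def\<close>)
 note tw = twist_calculus_tw[OF H \<chi> bb(1)] and tw' = twist_calculus_tw[OF H \<chi> bb(2)]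
 have m': "(%(a, b). \<phi> (lact M' a b)) \<in> pform (bF (selfB (HC H))) (bF (VB H M'))"
  "(%(a, b). \<phi> (ract M' a b)) \<in> pform (bF (VB H M')) (bF (selfB (HC H)))" if "\<phi> \<in> lin (vscale M')" for \<phi>
  using *(2) morph_bF[where B = "VB H M'" and \<phi> = \<phi>] that by (fastforce simp: pform_def)+
 have "f (lact (twist_calculus H \<chi> M) h v) = lact (twist_calculus H \<chi> M') h (f v)" for h v
 proof (rule lin_eqI[OF vs(2)])
  fix \<phi> assume \<phi>: "\<phi> \<in> lin (vscale M')"
  show "\<phi> (f (lact (twist_calculus H \<chi> M) h v)) = \<phi> (lact (twist_calculus H \<chi> M') h (f v))"
   by (rule is_tw_natural[OF cog cb V V' morph_id fm chi xi tw(1) tw'(1) \<phi> fl[OF \<phi>] m'(1)[OF \<phi>]])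
    (use f in \<open>auto simp: calculus_hom_def Let_def\<close>)
 qed
 moreover have "f (ract (twist_calculus H \<chi> M) v h) = ract (twist_calculus H \<chi> M') (f v) h" for h v
 proof (rule lin_eqI[OF vs(2)])
  fix \<phi> assume \<phi>: "\<phi> \<in> lin (vscale M')"
  show "\<phi> (f (ract (twist_calculus H \<chi> M) v h)) = \<phi> (ract (twist_calculus H \<chi> M') (f v) h)"
   by (rule is_tw_natural[OF cog V' cb cb fm morph_id chi xi tw(2) tw'(2) \<phi> fl[OF \<phi>] m'(2)[OF \<phi>]])
    (use f in \<open>auto simp: calculus_hom_def Let_def\<close>)
 qed
 ultimately show ?thesis
  using f by (simp add: calculus_hom_def Let_def)
qed

text \<open>The converse is the forward direction for the inverse twist.\<close>

lemma twist_calculus_hom_iff: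
 assumes H: "hopf_algebra H" and \<chi>: "two_cocycle H \<chi>"
  and M: "bicovariant_calculus H M" and M': "bicovariant_calculus H M'"
 shows "calculus_hom H M M' f \<longleftrightarrow>
  calculus_hom (twist_hopf H \<chi>) (twist_calculus H \<chi> M) (twist_calculus H \<chi> M') f"
 using twist_calculus_hom[OF H \<chi> M M', of f]
  twist_calculus_hom[OF twist_hopf_algebra[OF H \<chi>] twist_cocycle[OF H \<chi>]
   twist_calculus_bicovariant[OF H \<chi> M] twist_calculus_bicovariant[OF H \<chi> M'], of f]
 unfolding twist_twist_hopf[OF H \<chi>] twist_twist_calculus[OF H \<chi> M] twist_twist_calculus[OF H \<chi> M'] by blast

section \<open>Graded spaces and super-Hopf algebras\<close>

locale graded_full =
 fixes s :: "'k::field => 'a::ab_group_add => 'a" and G :: "nat => 'a set"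
 assumes vs: "vector_space s" and sub: "module.subspace s (G n)" and dec: "\<exists>!f. is_decomposition G x f"
begin

sublocale V: vector_space s by (rule vs)

lemma hp_dec: "is_decomposition G x (hparts G x)"
 unfolding hparts_def by (rule theI'[OF dec])

lemma hp_unique: "is_decomposition G x f ==> hparts G x = f"
 using dec hp_dec by blast

lemma hp_in: "hparts G x n \<in> G n" and hp_finite: "finite {n. hparts G x n ~= 0}"
 and hp_sum: "x = (\<Sum>n | hparts G x n ~= 0. hparts G x n)"
 using hp_dec[of x] by (auto simp: is_decomposition_def)

lemma hp_superset: "finite N ==> {n. hparts G x n ~= 0} \<subseteq> N ==> x = (\<Sum>n\<in>N. hparts G x n)"
 by (subst hp_sum[of x]) (rule sum.mono_neutral_left, auto)

lemma decI:
 assumes "!!n. f n \<in> G n" "finite N" "{n. f n ~= 0} \<subseteq> N" "x = (\<Sum>n\<in>N. f n)"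
 shows "is_decomposition G x f"
 unfolding is_decomposition_def using assms finite_subset[OF assms(3,2)]
 by (auto intro: sum.mono_neutral_right)

lemma G_zero: "0 \<in> G n" and G_add: "x \<in> G n ==> y \<in> G n ==> x + y \<in> G n" and G_scale: "x \<in> G n ==> s c x \<in> G n"
 using sub[of n] by (auto simp: V.subspace_def)

lemma hp_grade: "x \<in> G n ==> hparts G x m = (if m = n then x else 0)"
 by (subst hp_unique[of x "%m. if m = n then x else 0"], rule decI[of _ "{n}"]) (auto simp: G_zero)

lemma hp_add: "hparts G (x + y) n = hparts G x n + hparts G y n"
proof -
 let ?N = "{n. hparts G x n ~= 0} \<union> {n. hparts G y n ~= 0}"
 have N: "finite ?N" using hp_finite by blast
 have "x + y = (\<Sum>n\<in>?N. hparts G x n + hparts G y n)"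
  unfolding sum.distrib using hp_superset[OF N, of x] hp_superset[OF N, of y] by auto
 then have "is_decomposition G (x + y) (%n. hparts G x n + hparts G y n)"
  by (intro decI[OF _ N]) (auto simp: G_add hp_in)
 from hp_unique[OF this] show ?thesis by simp
qed

lemma hp_scale: "hparts G (s c x) n = s c (hparts G x n)"
proof -
 have "s c x = (\<Sum>n | hparts G x n ~= 0. s c (hparts G x n))"
  by (subst hp_sum[of x]) (rule V.scale_sum_right)
 then have "is_decomposition G (s c x) (%n. s c (hparts G x n))"
  by (intro decI[OF _ hp_finite]) (auto simp: G_scale hp_in)
 from hp_unique[OF this] show ?thesis by simp
qed

lemma lin_hp: "\<phi> \<in> lin s ==> (%x. \<phi> (hparts G x n)) \<in> lin s"
 by (auto simp: lin_iff hp_add hp_scale)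

lemma lin_homogeneous:
 assumes "\<phi> \<in> lin s" "\<psi> \<in> lin s" "!!n x. x \<in> G n ==> \<phi> x = \<psi> x"
 shows "\<phi> x = \<psi> x"
 by (subst (1 2) hp_sum[of x]) (simp add: lin_sum[OF assms(1)] lin_sum[OF assms(2)] assms(3)[OF hp_in])

text \<open>Multiplication by \<open>c n\<close> in degree \<open>n\<close>. Projections to one
  degree, the projection to odd degrees and the parity sign are all of this form, so their
  bicolinearity is proved once, in \<open>dm_morph\<close>.\<close>

definition dm :: "(nat => 'k) => 'a => 'a" where
 "dm c x = (\<Sum>n | hparts G x n ~= 0. s (c n) (hparts G x n))"

lemma dm_superset: "finite N ==> {n. hparts G x n ~= 0} \<subseteq> N ==> dm c x = (\<Sum>n\<in>N. s (c n) (hparts G x n))"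
 unfolding dm_def by (rule sum.mono_neutral_left) auto

lemma dm_add: "dm c (x + y) = dm c x + dm c y"
proof -
 let ?N = "{n. hparts G x n ~= 0} \<union> {n. hparts G y n ~= 0}"
 have N: "finite ?N" using hp_finite by blast
 have "{n. hparts G (x + y) n ~= 0} \<subseteq> ?N" by (auto simp: hp_add)
 then show ?thesis
  using dm_superset[OF N, of x] dm_superset[OF N, of y] dm_superset[OF N, of "x + y"]
  by (simp add: hp_add V.scale_right_distrib sum.distrib)
qed

lemma dm_scale: "dm c (s a x) = s a (dm c x)"
proof -
 have "dm c (s a x) = (\<Sum>n | hparts G x n ~= 0. s (c n) (s a (hparts G x n)))"
  by (subst dm_superset[OF hp_finite[of x]]) (auto simp: hp_scale)
 then show ?thesis by (simp add: dm_def V.scale_sum_right mult.commute)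
qed

lemma lin_dm: "\<phi> \<in> lin s ==> (%x. \<phi> (dm c x)) \<in> lin s"
 by (auto simp: lin_iff dm_add dm_scale)

lemma lin_dm_eq: "\<phi> \<in> lin s ==> \<phi> (dm c x) = (\<Sum>n | hparts G x n ~= 0. c n * \<phi> (hparts G x n))"
 by (simp add: dm_def lin_sum lin_scale)

lemma lin_hp_eq: "\<phi> \<in> lin s ==> \<phi> x = (\<Sum>n | hparts G x n ~= 0. \<phi> (hparts G x n))"
 by (subst hp_sum[of x]) (simp add: lin_sum)

lemma dm_grade: "x \<in> G n ==> dm c x = s (c n) x"
 by (subst dm_superset[of "{n}"]) (auto simp: hp_grade)

lemma hp_dm: "hparts G x k = dm (%n. if n = k then 1 else 0) x"
proof (cases "hparts G x k = 0")
 case True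
 then have "dm (%n. if n = k then 1 else 0) x = (\<Sum>n | hparts G x n ~= 0. 0)"
  unfolding dm_def by (intro sum.cong) auto
 then show ?thesis using True by simp
next
 case False
 have "dm (%n. if n = k then 1 else 0) x = (\<Sum>n | hparts G x n ~= 0. if n = k then hparts G x n else 0)"
  unfolding dm_def by (intro sum.cong) auto
 then show ?thesis using False hp_finite by simp
qed

definition odd_part :: "'a => 'a" where
 "odd_part = dm (%n. if odd n then 1 else 0)"

text \<open>Separates the sign into a product of the two parities, so that the sums over homogeneous
  parts collapse to \<open>odd_part\<close>. In characteristic 2 both sides are 1.\<close>

lemma minus_one_power: "(- 1 :: 'k) ^ (i * j) = 1 - 2 * ((if odd i then 1 else 0) * (if odd j then 1 else 0))"
 by (cases "even i"; cases "even j"; auto simp: power_mult)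

lemma super_tensor_mult_term:
 assumes f: "f \<in> bi (lin s) (lin s)" and m: "!!\<phi>. \<phi> \<in> lin s ==> (%a b. \<phi> (m a b)) \<in> bi (lin s) (lin s)"
 shows "(\<Sum>i | hparts G b i ~= 0. \<Sum>j | hparts G c j ~= 0.
    fun_scale ((- 1) ^ (i * j)) (tens2 s (m a (hparts G c j)) (m (hparts G b i) e))) (case_prod f) =
  f (m a c) (m b e) - 2 * f (m a (odd_part c)) (m (odd_part b) e)"
proof -
 let ?o = "%n::nat. if odd n then 1 else 0 :: 'k" and ?I = "{i. hparts G b i ~= 0}" and ?J = "{j. hparts G c j ~= 0}"
 let ?g = "%c b. f (m a c) (m b e)"
 have g: "(%c. ?g c b) \<in> lin s" "(%b. ?g c b) \<in> lin s" for b c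
  using m[OF bi1[OF f]] m[OF bi2[OF f]] by (auto simp: bi_def)
 have *: "case_prod f \<in> tensor_forms (full s) (full s)" using f by (simp add: tensor_forms_full)
 have sum_apply: "(sum F A) \<phi> = (\<Sum>x\<in>A. F x \<phi>)" for F :: "nat => ('a \<times> 'a, 'k) quot" and A \<phi>
  by (induction A rule: infinite_finite_induct) auto
 have "(\<Sum>i\<in>?I. \<Sum>j\<in>?J. fun_scale ((- 1) ^ (i * j)) (tens2 s (m a (hparts G c j)) (m (hparts G b i) e))) (case_prod f) =
   (\<Sum>i\<in>?I. \<Sum>j\<in>?J. (- 1) ^ (i * j) * ?g (hparts G c j) (hparts G b i))"
  by (simp add: sum_apply fun_scale_def tens_apply *)
 also have "... = (\<Sum>i\<in>?I. \<Sum>j\<in>?J. ?g (hparts G c j) (hparts G b i)) -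
   2 * (\<Sum>i\<in>?I. ?o i * (\<Sum>j\<in>?J. ?o j * ?g (hparts G c j) (hparts G b i)))"
  unfolding minus_one_power by (simp add: algebra_simps sum_subtractf sum_distrib_left)
 also have "(\<Sum>i\<in>?I. ?o i * (\<Sum>j\<in>?J. ?o j * ?g (hparts G c j) (hparts G b i))) = ?g (odd_part c) (odd_part b)"
  unfolding odd_part_def lin_dm_eq[OF g(2)] lin_dm_eq[OF g(1)] ..
 also have "(\<Sum>i\<in>?I. \<Sum>j\<in>?J. ?g (hparts G c j) (hparts G b i)) = ?g c b"
  using lin_hp_eq[OF g(2), of c b] lin_hp_eq[OF g(1), of c] by simp
 finally show ?thesis .
qed

lemma super_tensor_mult_apply:
 assumes f: "f \<in> bi (lin s) (lin s)" and m: "!!\<phi>. \<phi> \<in> lin s ==> (%a b. \<phi> (m a b)) \<in> bi (lin s) (lin s)"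
  and t: "t \<in> elems (tensor (full s) (full s))" and u: "u \<in> elems (tensor (full s) (full s))"
 shows "super_tensor_mult (full s) G m t u (case_prod f) =
  ssum (rp2 s t) (%a b. ssum (rp2 s u) (%c e.
   f (m a c) (m b e) - 2 * f (m a (odd_part c)) (m (odd_part b) e)))" (is ?A)
  and "\<phi> \<notin> tensor_forms (full s) (full s) ==> super_tensor_mult (full s) G m t u \<phi> = 0"
proof -
 let ?F = "%a b c e. \<Sum>i | hparts G b i ~= 0. \<Sum>j | hparts G c j ~= 0.
    fun_scale ((- 1) ^ (i * j)) (tens2 s (m a (hparts G c j)) (m (hparts G b i) e))"
 have sum_apply: "(sum F A) \<phi> = (\<Sum>x\<in>A. F x \<phi>)" for F :: "nat => ('a \<times> 'a, 'k) quot" and A \<phi>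
  by (induction A rule: infinite_finite_induct) auto
 have z: "?F a b c e \<phi> = 0" if "\<phi> \<notin> tensor_forms (full s) (full s)" for \<phi> a b c e
  using that by (simp add: sum_apply fun_scale_def tens_apply)
 have F: "(%a. ?F a b c e \<phi>) \<in> lin s" "(%b. ?F a b c e \<phi>) \<in> lin s" "(%c. ?F a b c e \<phi>) \<in> lin s" "(%e. ?F a b c e \<phi>) \<in> lin s"
  for a b c e \<phi>
 proof -
  have "(%a. ?F a b c e \<phi>) \<in> lin s \<and> (%b. ?F a b c e \<phi>) \<in> lin s \<and> (%c. ?F a b c e \<phi>) \<in> lin s \<and> (%e. ?F a b c e \<phi>) \<in> lin s"
  proof (cases "\<phi> \<in> tensor_forms (full s) (full s)")
   case True
   define f where "f = curry \<phi>"
   have f: "f \<in> bi (lin s) (lin s)" and \<phi>: "\<phi> = case_prod f" using True by (auto simp: f_def tensor_forms_full)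
   have g: "(%a. f (m a c) z) \<in> lin s" "(%c. f (m a c) z) \<in> lin s" "(%b. f z (m b e)) \<in> lin s" "(%e. f z (m b e)) \<in> lin s" for a b c e z
    using m[OF bi1[OF f]] m[OF bi2[OF f]] by (auto simp: bi_def)
   have e: "?F a b c e (case_prod f) = f (m a c) (m b e) - 2 * f (m a (odd_part c)) (m (odd_part b) e)" for a b c e
    by (rule super_tensor_mult_term[OF f]) (rule m)
   show ?thesis
    unfolding \<phi> e odd_part_def
    by (intro conjI forms_diff[OF forms_lin] forms_mult[OF forms_lin] g lin_dm[OF g(2)] lin_dm[OF g(3)])
  qed (simp add: z forms_zero[OF forms_lin])
  then show "(%a. ?F a b c e \<phi>) \<in> lin s" "(%b. ?F a b c e \<phi>) \<in> lin s" "(%c. ?F a b c e \<phi>) \<in> lin s" "(%e. ?F a b c e \<phi>) \<in> lin s"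
   by blast+
 qed
 have 1: "tlift (full s) (full s) (?F a b) u = ssum (rp2 s u) (?F a b)" for a b
  by (rule tlift_quot[OF _ u]) (intro biI F)
 have "super_tensor_mult (full s) G m t u = ssum (rp2 s t) (%a b. ssum (rp2 s u) (?F a b))"
  unfolding super_tensor_mult_def 1
  by (rule tlift_quot[OF _ t]) (unfold ssum_apply, intro biI forms_ssum[OF forms_lin] F)
 note eq = fun_cong[OF this]
 have e: "?F a b c e (case_prod f) = f (m a c) (m b e) - 2 * f (m a (odd_part c)) (m (odd_part b) e)" for a b c e
  by (rule super_tensor_mult_term[OF f]) (rule m)
 show ?A unfolding eq ssum_apply e ..
 show "super_tensor_mult (full s) G m t u \<phi> = 0" if "\<phi> \<notin> tensor_forms (full s) (full s)"
  unfolding eq ssum_apply z[OF that] by simp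
qed

lemma super_tensor_mult_eq_iff:
 assumes m: "!!\<phi>. \<phi> \<in> lin s ==> (%a b. \<phi> (m a b)) \<in> bi (lin s) (lin s)"
  and t: "t \<in> elems (tensor (full s) (full s))" and u: "u \<in> elems (tensor (full s) (full s))"
  and w: "w \<in> elems (tensor (full s) (full s))"
 shows "w = super_tensor_mult (full s) G m t u \<longleftrightarrow> (\<forall>f\<in>bi (lin s) (lin s). ssum (rp2 s w) f =
  ssum (rp2 s t) (%a b. ssum (rp2 s u) (%c e.
   f (m a c) (m b e) - 2 * f (m a (odd_part c)) (m (odd_part b) e))))" (is "_ \<longleftrightarrow> ?R")
proof -
 have app: "super_tensor_mult (full s) G m t u (case_prod f) =
  ssum (rp2 s t) (%a b. ssum (rp2 s u) (%c e.
   f (m a c) (m b e) - 2 * f (m a (odd_part c)) (m (odd_part b) e)))" if "f \<in> bi (lin s) (lin s)" for f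
  by (rule super_tensor_mult_apply(1)[OF that _ t u]) (rule m)
 have z: "super_tensor_mult (full s) G m t u \<phi> = 0" if "\<phi> \<notin> tensor_forms (full s) (full s)" for \<phi>
  by (rule super_tensor_mult_apply(2)[OF _ _ t u that, of "%_ _. 0"]) (rule biI forms_zero[OF forms_lin] m, assumption?)+
 show ?thesis
 proof
  assume eq: "w = super_tensor_mult (full s) G m t u"
  show ?R
   using app tensor_apply[OF w] by (simp add: eq[symmetric] tensor_forms_full)
 next
  assume R: ?R
  show "w = super_tensor_mult (full s) G m t u"
  proof
   fix \<phi>
   show "w \<phi> = super_tensor_mult (full s) G m t u \<phi>"
   proof (cases "\<phi> \<in> tensor_forms (full s) (full s)")
    case True
    then have f: "curry \<phi> \<in> bi (lin s) (lin s)" by (simp add: tensor_forms_full)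
    show ?thesis
     using app[OF f] bspec[OF R f] tensor_apply[OF w, of \<phi>] True by simp
   next
    case False
    then show ?thesis using z[OF False] tensor_apply[OF w, of \<phi>] by simp
   qed
  qed
 qed
qed

end

text \<open>The chosen representative of \<open>t\<close> may leave \<open>X\<close>, but the value
  at a form can be computed from any representative, in particular from one inside \<open>X\<close>.
  This makes the grading of a coproduct usable.\<close>

lemma gen_sums_ssum:
 assumes t: "t \<in> gen_sums X (tensor_forms (full a) (full b))" and t': "t \<in> elems (tensor (full a) (full b))"
  and f: "f \<in> bi (lin a) (lin b)" and g: "g \<in> bi (lin a) (lin b)" and eq: "!!x y. (x, y) \<in> X ==> f x y = g x y"
 shows "ssum (rp (full a) (full b) t) f = ssum (rp (full a) (full b) t) g"
proof -
 obtain xs where xs: "xs \<in> lists X" "t = (SUM x<-xs. gen (tensor_forms (full a) (full b)) x)"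
  using t by (auto simp: gen_sums_def)
 have e: "ssum (rp (full a) (full b) t) f = (SUM x<-xs. case_prod f x)" if "f \<in> bi (lin a) (lin b)" for f
  using tensor_apply[OF t', of "case_prod f"] that xs(2) by (simp add: tensor_forms_full sum_list_gen)
 have "(SUM x<-xs. case_prod f x) = (SUM x<-xs. case_prod g x)"
  using xs(1) eq by (intro arg_cong[of _ _ sum_list] map_cong) auto
 then show ?thesis by (simp add: e f g)
qed

text \<open>
 The conditions on \<open>W\<close> that amount to being a quotient of the tensor algebra of \<open>M\<close>, without
 reference to that algebra.
\<close>

locale ext_core =
 fixes H :: "('k::field, 'h::ab_group_add) hopf" and M :: "('k, 'h, 'v::ab_group_add) calculus"
  and W :: "('k, 'h, 'v, 'w::ab_group_add) ext_alg"
 assumes H: "hopf_algebra H" and M: "bicovariant_bimodule H M"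
  and super: "super_hopf_algebra W" and elems: "elems (sspace W) = UNIV"
  and bij0: "bij_betw (inc0 W) UNIV (grade W 0)" and bij1: "bij_betw (inc1 W) UNIV (grade W 1)"
  and inc0_linear: "linear_map (hspace H) (full (sscale W)) (inc0 W)"
  and inc0_mult: "inc0 W (hmult H h g) = smult W (inc0 W h) (inc0 W g)"
  and inc0_one: "inc0 W (hone H) = sone W"
  and inc0_comult: "scomult W (inc0 W h) = tlift (hspace H) (hspace H)
    (%h1 h2. tens (full (sscale W)) (full (sscale W)) (inc0 W h1) (inc0 W h2)) (hcomult H h)"
  and inc0_counit: "scounit W (inc0 W h) = hcounit H h"
  and inc0_antipode: "santipode W (inc0 W h) = inc0 W (hantipode H h)"
  and inc1_linear: "linear_map (vspace M) (full (sscale W)) (inc1 W)"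
  and inc1_left: "inc1 W (lact M h v) = smult W (inc0 W h) (inc1 W v)"
  and inc1_right: "inc1 W (ract M v h) = smult W (inc1 W v) (inc0 W h)"
  and inc1_comult: "scomult W (inc1 W v) =
    tlift (hspace H) (vspace M) (%h w. tens (full (sscale W)) (full (sscale W)) (inc0 W h) (inc1 W w)) (lcoact M v) +
    tlift (vspace M) (hspace H) (%w h. tens (full (sscale W)) (full (sscale W)) (inc1 W w) (inc0 W h)) (rcoact M v)"
  and generated: "grade W (Suc n) \<subseteq> module.span (sscale W) {smult W (inc1 W v) y | v y. y \<in> grade W n}"
begin

abbreviation "s \<equiv> sscale W"
abbreviation "hp n x \<equiv> hparts (grade W) x n"
abbreviation "pr \<equiv> ext_proj0 W"

lemma sspace: "sspace W = full s"
 using elems by (simp add: graded_space_def full_def)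

lemmas sup = super[unfolded super_hopf_algebra_def Let_def sspace elems_full ball_UNIV]
lemmas sup_sub = sup[THEN conjunct1] and sup1 = sup[THEN conjunct2]
lemmas sup_dec = sup1[THEN conjunct1] and sup2 = sup1[THEN conjunct2]
lemmas sup_alg = sup2[THEN conjunct1] and sup3 = sup2[THEN conjunct2]
lemmas sup_one = sup3[THEN conjunct1] and sup4 = sup3[THEN conjunct2]
lemmas sup_mult = sup4[THEN conjunct1] and sup5 = sup4[THEN conjunct2]
lemmas sup_coalg = sup5[THEN conjunct1] and sup6 = sup5[THEN conjunct2]
lemmas sup_comult = sup6[THEN conjunct1] and sup7 = sup6[THEN conjunct2]
lemmas sup_counit0 = sup7[THEN conjunct1] and sup8 = sup7[THEN conjunct2]
lemmas sup_mult_comult = sup8[THEN conjunct1] and sup9 = sup8[THEN conjunct2]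
lemmas sup_one_comult = sup9[THEN conjunct1] and sup10 = sup9[THEN conjunct2]
lemmas sup_counit_mult = sup10[THEN conjunct1] and sup11 = sup10[THEN conjunct2]
lemmas sup_counit_one = sup11[THEN conjunct1] and sup12 = sup11[THEN conjunct2]
lemmas sup_antipode = sup12[THEN conjunct1] and sup_antipode_grade = sup12[THEN conjunct2]

sublocale hopf "HC H" "hmult H" "hone H" "hantipode H"
 using H by (simp add: hopf_algebra_iff)

lemma is_alg: "is_algebra (full s) (smult W) (sone W)" by (rule sup_alg)
lemma vsW: "vector_space s" using is_alg by (simp add: is_algebra_full)

sublocale graded_full s "grade W"
 by (rule graded_full.intro[OF vsW sup_sub[THEN spec] sup_dec[THEN spec]])

lemma is_coalg: "is_coalgebra (full s) (scomult W) (scounit W)" by (rule sup_coalg)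

definition WC :: "('k, 'w) cog" where
 "WC = \<lparr>cF = lin s, cD = (%x. rp2 s (scomult W x)), cE = scounit W\<rparr>"

lemma WC_simps [simp]: "cF WC = lin s" "cE WC = scounit W" "cD WC x = rp2 s (scomult W x)"
 by (simp_all add: WC_def)

lemma comult_linear: "linear_map (full s) (tensor (full s) (full s)) (scomult W)"
 using is_coalg by (simp add: is_coalgebra_def)

lemmas tW = linear_map_tensor[OF comult_linear]

text \<open>Presents the coalgebra of \<open>W\<close> through a record of type \<open>hopf\<close>,
  to which \<open>coalgebra_is_cog\<close> applies; only the coalgebra axioms are claimed for it,
  since the product of \<open>W\<close> obeys a super rule.\<close>

lemma WC_HC: "WC = HC \<lparr>hscale = s, hmult = smult W, hone = sone W, hcomult = scomult W, hcounit = scounit W, hantipode = santipode W\<rparr>"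
 by (simp add: WC_def HC_def)

lemma cogW: "is_cog WC"
 unfolding WC_HC by (rule coalgebra_is_cog) (use is_coalg in simp)

lemma coH: "is_coalgebra (hspace H) (hcomult H) (hcounit H)" using H by (simp add: hopf_algebra_iff)
lemma bcV: "bicomodule H M" and vsV: "vector_space (vscale M)"
 using M by (auto simp: bicovariant_bimodule_iff[OF H])
lemmas bcmV = bicomodule_is_bcm[OF coH bcV vsV]
lemma tH: "hcomult H h \<in> elems (tensor (hspace H) (hspace H))"
 using coH by (auto simp: is_coalgebra_def linear_map_def)
lemma tV: "lcoact M v \<in> elems (tensor (hspace H) (vspace M))" "rcoact M v \<in> elems (tensor (vspace M) (hspace H))"
 using bcV by (auto simp: bicomodule_def Let_def linear_map_def)

lemma inc0_lin: "\<phi> \<in> lin s ==> (%x. \<phi> (inc0 W x)) \<in> hlin H"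
 by (rule linear_map_lin[OF inc0_linear])
lemma inc1_lin: "\<phi> \<in> lin s ==> (%x. \<phi> (inc1 W x)) \<in> vlin M"
 by (rule linear_map_lin[OF inc1_linear])

lemma m_bi: "\<phi> \<in> lin s ==> (%a b. \<phi> (smult W a b)) \<in> bi (lin s) (lin s)"
 using is_alg by (simp add: is_algebra_full)

lemma inc0_D: "f \<in> bi (lin s) (lin s) ==>
  ssum (cD WC (inc0 W h)) f = ssum (cD (HC H) h) (%a b. f (inc0 W a) (inc0 W b))"
 using iffD1[OF tensor_eq_map_iff[OF tH inc0_lin inc0_lin tW] inc0_comult] by simp

lemma inc1_D:
 assumes f: "f \<in> bi (lin s) (lin s)"
 shows "ssum (cD WC (inc1 W v)) f = ssum (bL (VB H M) v) (%h w. f (inc0 W h) (inc1 W w)) +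
   ssum (bR (VB H M) v) (%w h. f (inc1 W w) (inc0 W h))"
proof -
 let ?l = "tlift (hspace H) (vspace M) (%h w. tens2 s (inc0 W h) (inc1 W w)) (lcoact M v)"
 let ?r = "tlift (vspace M) (hspace H) (%w h. tens2 s (inc1 W w) (inc0 W h)) (rcoact M v)"
 have l: "?l = ssum (bL (VB H M) v) (%h w. tens2 s (inc0 W h) (inc1 W w))"
  unfolding VB_simps by (rule tlift_quot[OF _ tV(1)]) (intro biI inc0_lin[OF bi1[OF tens_bi]] inc1_lin[OF bi2[OF tens_bi]])
 have r: "?r = ssum (bR (VB H M) v) (%h w. tens2 s (inc1 W h) (inc0 W w))"
  unfolding VB_simps by (rule tlift_quot[OF _ tV(2)]) (intro biI inc1_lin[OF bi1[OF tens_bi]] inc0_lin[OF bi2[OF tens_bi]])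
 have "scomult W (inc1 W v) = ?l + ?r" by (rule inc1_comult)
 moreover have "?l \<in> elems (tensor (full s) (full s))" "?r \<in> elems (tensor (full s) (full s))"
  unfolding l r by (intro ssum_in_tensor tens_in_tensor; simp)+
 ultimately show ?thesis
  using rp_add[OF f, of ?l ?r] by (simp add: l r rp_ssum[OF f] tens_in_tensor rp_tens[OF f])
qed

section \<open>The projection to degree 0\<close>

lemma pi_inc0 [simp]: "pr (inc0 W h) = h"
proof -
 have "inc0 W h \<in> grade W 0" and i: "inj (inc0 W)" using bij0 by (auto simp: bij_betw_def)
 then show ?thesis by (simp add: ext_proj0_def hp_grade the_inv_f_f)
qed

lemma inc0_pi:
 assumes "x \<in> grade W 0"
 shows "inc0 W (pr x) = x"
proof -
 have "x \<in> range (inc0 W)" using assms bij0 by (simp add: bij_betw_def)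
 then show ?thesis by auto
qed

lemma inc0_pi': "inc0 W (pr x) = hp 0 x"
 using inc0_pi[OF hp_in[of x 0]] by (simp add: ext_proj0_def hp_grade[OF hp_in])

lemma inc0_inj: "inc0 W a = inc0 W b ==> a = b"
 by (metis pi_inc0)

lemma inc0_in: "inc0 W h \<in> grade W 0" and inc1_in: "inc1 W v \<in> grade W 1"
 using bij0 bij1 by (auto simp: bij_betw_def)

lemma inc0_add: "inc0 W (a + b) = inc0 W a + inc0 W b" and inc0_scale: "inc0 W (hscale H c a) = s c (inc0 W a)"
 using inc0_linear by (auto simp: linear_map_def)

lemma pi_add: "pr (x + y) = pr x + pr y" and pi_scale: "pr (s c x) = hscale H c (pr x)"
 by (rule inc0_inj, simp add: inc0_pi' hp_add inc0_add hp_scale inc0_scale)+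

lemma pi_lin: "u \<in> hlin H ==> (%x. u (pr x)) \<in> lin s"
 by (simp add: lin_iff pi_add pi_scale)

lemma pi_zero: "x \<in> grade W n ==> n > 0 ==> pr x = 0"
 using inc0_add[of 0 0] by (intro inc0_inj) (simp add: inc0_pi' hp_grade)

lemma pi_0 [simp]: "pr 0 = 0"
 by (rule pi_zero[OF G_zero[of 1]]) simp

lemma pi_inc1 [simp]: "pr (inc1 W v) = 0"
 by (rule pi_zero[OF inc1_in]) simp

lemma pi_one [simp]: "pr (sone W) = hone H"
 using pi_inc0[of "hone H"] by (simp add: inc0_one)

lemma comult_grade: "x \<in> grade W n ==>
  scomult W x \<in> gen_sums (\<Union>i\<le>n. grade W i \<times> grade W (n - i)) (tensor_forms (full s) (full s))"
 using sup_comult by blast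

lemma comult_homogeneous:
 assumes x: "x \<in> grade W n" and f: "f \<in> bi (lin s) (lin s)" and g: "g \<in> bi (lin s) (lin s)"
  and eq: "!!i a b. i \<le> n ==> a \<in> grade W i ==> b \<in> grade W (n - i) ==> f a b = g a b"
 shows "ssum (cD WC x) f = ssum (cD WC x) g"
 unfolding WC_simps by (rule gen_sums_ssum[OF comult_grade[OF x] tW f g]) (use eq in auto)

lemma comult_form: "f \<in> bi (lin s) (lin s) ==> (%x. ssum (cD WC x) f) \<in> lin s"
 using cog_cD[OF cogW, of f] by simp

text \<open>In degree n > 0 the two legs have degrees that add up to n, so one of them is positive
  and is killed by \<open>pr\<close>; in degree 0 the claim is \<open>inc0_comult\<close>.\<close>

lemma pi_D': assumes f: "f \<in> bi (hlin H) (hlin H)"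
 shows "ssum (cD (HC H) (pr x)) f = ssum (cD WC x) (%a b. f (pr a) (pr b))"
proof (rule lin_homogeneous)
 have f': "(%a b. f (pr a) (pr b)) \<in> bi (lin s) (lin s)"
  using f by (auto simp: bi_def intro: pi_lin)
 have cf: "(%x. ssum (cD (HC H) x) f) \<in> hlin H" using cog_cD[OF cog, of f] f by simp
 show "(%x. ssum (cD (HC H) (pr x)) f) \<in> lin s" by (rule pi_lin[OF cf])
 show "(%x. ssum (cD WC x) (%a b. f (pr a) (pr b))) \<in> lin s" by (rule comult_form[OF f'])
 fix n x assume x: "x \<in> grade W n"
 show "ssum (cD (HC H) (pr x)) f = ssum (cD WC x) (%a b. f (pr a) (pr b))"
 proof (cases "n = 0")
  case True
  then have "x = inc0 W (pr x)" using x inc0_pi by simp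
  then show ?thesis using inc0_D[OF f', of "pr x"] by simp
 next
  case False
  have z: "(%_ _. 0) \<in> bi (lin s) (lin s)" by (intro biI forms_zero[OF forms_lin])
  have "ssum (cD WC x) (%a b. f (pr a) (pr b)) = ssum (cD WC x) (%_ _. 0)"
  proof (rule comult_homogeneous[OF x f' z])
   fix i a b assume "i \<le> n" "a \<in> grade W i" "b \<in> grade W (n - i)"
   then show "f (pr a) (pr b) = 0"
    using pi_zero[of a i] pi_zero[of b "n - i"] False lin_0[OF bi1[OF f]] lin_0[OF bi2[OF f]] by (cases "i = 0") auto
  qed
  then show ?thesis using pi_zero[OF x] False lin_0[OF cf] by simp
 qed
qed

lemma pi_cmorph: "cmorph WC (HC H) pr"
 unfolding morph_def using pi_lin pi_D' by simp

lemma pi_counit': "scounit W x = hcounit H (pr x)"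
proof (rule lin_homogeneous)
 show "scounit W \<in> lin s" using cog_cE[OF cogW] by simp
 show "(%x. hcounit H (pr x)) \<in> lin s" using pi_lin cog_cE[OF cog] by simp
 fix n x assume x: "x \<in> grade W n"
 show "scounit W x = hcounit H (pr x)"
 proof (cases "n = 0")
  case True
  then show ?thesis using x inc0_pi inc0_counit[of "pr x"] by simp
 next
  case False
  then have "scounit W x = 0" using sup_counit0 x by blast
  then show ?thesis using pi_zero[OF x] False lin_0[of "hcounit H" "hscale H"] cog_cE[OF cog] by simp
 qed
qed

lemma smult_grade: "x \<in> grade W m ==> y \<in> grade W n ==> smult W x y \<in> grade W (m + n)"
 using sup_mult by blast

text \<open>Degrees add under multiplication, so the part of positive degree is an ideal, and on
  degree 0 the product is that of \<open>H\<close>.\<close>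

lemma pi_mult: "pr (smult W x y) = hmult H (pr x) (pr y)"
proof (rule separating)
 fix u assume u: "u \<in> cF (HC H)"
 note m1 = bi1[OF m_bi[OF pi_lin[OF u[unfolded HC_simps]]]] and m2 = bi2[OF m_bi[OF pi_lin[OF u[unfolded HC_simps]]]]
 note h1 = mu_form(1)[OF u, unfolded HC_simps] and h2 = mu_form(2)[OF u, unfolded HC_simps]
 have "u (pr (smult W x y)) = u (hmult H (pr x) (pr y))"
 proof (rule lin_homogeneous[where \<phi> = "%x. u (pr (smult W x y))"])
  show "(%x. u (pr (smult W x y))) \<in> lin s" by (rule m1)
  show "(%x. u (hmult H (pr x) (pr y))) \<in> lin s" by (rule pi_lin[OF h1])
  fix i x assume x: "x \<in> grade W i"
  show "u (pr (smult W x y)) = u (hmult H (pr x) (pr y))"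
  proof (rule lin_homogeneous[where \<phi> = "%y. u (pr (smult W x y))"])
   show "(%y. u (pr (smult W x y))) \<in> lin s" by (rule m2)
   show "(%y. u (hmult H (pr x) (pr y))) \<in> lin s" by (rule pi_lin[OF h2])
   fix j y assume y: "y \<in> grade W j"
   show "u (pr (smult W x y)) = u (hmult H (pr x) (pr y))"
   proof (cases "i = 0 \<and> j = 0")
    case True
    then have "smult W x y = inc0 W (hmult H (pr x) (pr y))" using x y by (simp add: inc0_mult inc0_pi)
    then show ?thesis by simp
   next
    case False
    then have "pr (smult W x y) = 0" by (intro pi_zero[OF smult_grade[OF x y]]) auto
    moreover have "u (hmult H (pr x) (pr y)) = 0"
     using False pi_zero[OF x] pi_zero[OF y] lin_0[OF h1] lin_0[OF h2] by (cases "i = 0") auto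
    ultimately show ?thesis using lin_0 u by simp
   qed
  qed
 qed
 then show "u (pr (smult W x y)) = u (hmult H (pr x) (pr y))" .
qed

lemma dm_pi: "c 0 = 0 ==> pr (dm c x) = 0"
proof (rule separating)
 fix u assume u: "u \<in> cF (HC H)" and c: "c 0 = 0"
 have z: "u 0 = 0" using u lin_0 by simp
 have "u (pr (dm c x)) = 0"
 proof (rule lin_homogeneous[where \<phi> = "%x. u (pr (dm c x))" and \<psi> = "%_. 0"])
  show "(%x. u (pr (dm c x))) \<in> lin s" using u by (intro lin_dm[OF pi_lin]) simp
  show "(%_. 0) \<in> lin s" by (rule forms_zero[OF forms_lin])
  fix n x assume x: "x \<in> grade W n"
  show "u (pr (dm c x)) = 0"
   using pi_zero[OF x] c u z lin_scale[of u "hscale H"] by (cases "n = 0") (auto simp: dm_grade[OF x] pi_scale)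
 qed
 then show "u (pr (dm c x)) = u 0" by (simp add: z)
qed

lemma odd_pi [simp]: "pr (odd_part x) = 0"
 unfolding odd_part_def by (rule dm_pi) simp

lemma comult_mult: "f \<in> bi (lin s) (lin s) ==> ssum (cD WC (smult W x y)) f =
  ssum (cD WC x) (%a b. ssum (cD WC y) (%c e. f (smult W a c) (smult W b e) -
   2 * f (smult W a (odd_part c)) (smult W (odd_part b) e)))"
proof -
 have "scomult W (smult W x y) = super_tensor_mult (full s) (grade W) (smult W) (scomult W x) (scomult W y)"
  using sup_mult_comult by blast
 from iffD1[OF super_tensor_mult_eq_iff[OF m_bi tW tW tW] this]
 show "f \<in> bi (lin s) (lin s) ==> ?thesis" by simp
qed

lemma comult_one: "f \<in> bi (lin s) (lin s) ==> ssum (cD WC (sone W)) f = f (sone W) (sone W)"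
proof -
 have "scomult W (sone W) = tens2 s (sone W) (sone W)" by (rule sup_one_comult)
 then show "f \<in> bi (lin s) (lin s) ==> ?thesis" by (simp add: rp_tens)
qed

lemma antipode_full: "is_antipode (full s) (smult W) (sone W) (scomult W) (scounit W) (santipode W)"
 by (rule sup_antipode)

lemmas antipodeD = is_antipodeD[OF vsW comult_linear m_bi antipode_full]

section \<open>\<open>W\<close> as a bicomodule algebra over \<open>H\<close>\<close>

definition WB :: "('k, 'h, 'w) bcm" where
 "WB = \<lparr>bF = cF WC, bL = (%x. map (%(a, b). (pr a, b)) (cD WC x)), bR = (%x. map (%(a, b). (a, pr b)) (cD WC x))\<rparr>"

lemma WB_ssum: "ssum (bL WB x) f = ssum (cD WC x) (%a b. f (pr a) b)"
 "ssum (bR WB x) g = ssum (cD WC x) (%a b. g a (pr b))" and bF_WB [simp]: "bF WB = lin s"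
 by (simp_all add: WB_def ssum_map)

text \<open>The sign term of \<open>comult_mult\<close> contains an odd part in each leg, and
  \<open>pr\<close> annihilates odd parts. Projecting either leg therefore leaves the unsigned rule
  of a comodule algebra.\<close>

lemma m_morph': "morph CC (HC H) (case_prod (hmult H)) (case_prod (smult W)) (prodB WB WB) WB"
 unfolding morph_def
proof (intro conjI ballI allI)
 show "u \<in> cF (HC H) ==> (%c. u (case_prod (hmult H) c)) \<in> cF CC" for u by (rule morph_cF[OF mu_morph])
 show "\<phi> \<in> bF WB ==> (%v. \<phi> (case_prod (smult W) v)) \<in> bF (prodB WB WB)" for \<phi>
  using m_bi[of \<phi>] by (simp add: pform_def)
 fix v :: "'w \<times> 'w"
 obtain a b where v: "v = (a, b)" by (cases v)
 show "ssum (bL WB (case_prod (smult W) v)) f = ssum (bL (prodB WB WB) v) (%c w. f (case_prod (hmult H) c) (case_prod (smult W) w))"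
  if f: "f \<in> bi (cF (HC H)) (bF WB)" for f
 proof -
  have f': "(%a b. f (pr a) b) \<in> bi (lin s) (lin s)"
   by (intro biI pi_lin[OF bi1[OF f[unfolded HC_simps bF_WB]]] bi2[OF f[unfolded HC_simps bF_WB]])
  have h0: "hmult H a 0 = 0" for a
  proof (rule separating)
   fix u assume u: "u \<in> cF (HC H)"
   show "u (hmult H a 0) = u 0"
    using lin_0[OF mu_form(2)[OF u, unfolded HC_simps]] lin_0[OF u[unfolded HC_simps]] by simp
  qed
  have z: "f 0 y = 0" for y using lin_0 bi1[OF f] by fastforce
  show ?thesis
   using comult_mult[OF f', of a b] by (simp add: v WB_ssum ssum_plist pi_mult h0 z)
 qed
 show "ssum (bR WB (case_prod (smult W) v)) f = ssum (bR (prodB WB WB) v) (%w c. f (case_prod (smult W) w) (case_prod (hmult H) c))"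
  if f: "f \<in> bi (bF WB) (cF (HC H))" for f
 proof -
  have f': "(%a b. f a (pr b)) \<in> bi (lin s) (lin s)"
   by (intro biI pi_lin[OF bi2[OF f[unfolded HC_simps bF_WB]]] bi1[OF f[unfolded HC_simps bF_WB]])
  have h0: "hmult H 0 a = 0" for a
  proof (rule separating)
   fix u assume u: "u \<in> cF (HC H)"
   show "u (hmult H 0 a) = u 0"
    using lin_0[OF mu_form(1)[OF u, unfolded HC_simps]] lin_0[OF u[unfolded HC_simps]] by simp
  qed
  have z: "f y 0 = 0" for y using lin_0 bi2[OF f] by fastforce
  show ?thesis
   using comult_mult[OF f', of a b] by (simp add: v WB_ssum ssum_plist pi_mult h0 z)
 qed
qed

sublocale over: hopf_over "HC H" "hmult H" "hone H" "hantipode H" WC "smult W" "sone W" "santipode W" pr WB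
proof (intro hopf_over.intro hopf_over_axioms.intro, unfold WC_simps(1,2))
 show "hopf (HC H) (hmult H) (hone H) (hantipode H)" by (rule hopf_axioms)
 show "WB \<equiv> \<lparr>bF = lin s, bL = %x. map (%(a, b). (pr a, b)) (cD WC x), bR = %x. map (%(a, b). (a, pr b)) (cD WC x)\<rparr>"
  unfolding WB_def WC_simps(1) .
 show "is_cog WC" by (rule cogW)
 show "cmorph WC (HC H) pr" by (rule pi_cmorph)
 show "scounit W x = cE (HC H) (pr x)" for x by (simp add: pi_counit')
 let ?B = "\<lparr>bF = lin s, bL = %x. map (%(a, b). (pr a, b)) (cD WC x), bR = %x. map (%(a, b). (a, pr b)) (cD WC x)\<rparr>"
 show "morph CC (HC H) (case_prod (hmult H)) (case_prod (smult W)) (prodB ?B ?B) ?B"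
  by (rule m_morph'[unfolded WB_def WC_simps(1)])
 show "smult W (smult W a b) c = smult W a (smult W b c)" "smult W (sone W) a = a" "smult W a (sone W) = a" for a b c
  using is_alg by (auto simp: is_algebra_full)
 show "ssum (cD WC (sone W)) (%a b. f (pr a) b) = f (hone H) (sone W)" if "f \<in> bi (cF (HC H)) (lin s)" for f
  using comult_one[OF biI[OF pi_lin[OF bi1[OF that[unfolded HC_simps]]] bi2[OF that[unfolded HC_simps]]]] by simp
 show "ssum (cD WC (sone W)) (%a b. f a (pr b)) = f (sone W) (hone H)" if "f \<in> bi (lin s) (cF (HC H))" for f
  using comult_one[OF biI[OF bi1[OF that[unfolded HC_simps]] pi_lin[OF bi2[OF that[unfolded HC_simps]]]]] by simp
 show "(%x. \<phi> (santipode W x)) \<in> lin s" if "\<phi> \<in> lin s" for \<phi> by (rule antipodeD(1)[OF _ that])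
 show "ssum (cD WC x) (%a b. \<phi> (smult W (santipode W a) b)) = scounit W x * \<phi> (sone W)" if "\<phi> \<in> lin s" for \<phi> x
  unfolding WC_simps by (rule antipodeD(2)[OF _ that])
 show "ssum (cD WC x) (%a b. \<phi> (smult W a (santipode W b))) = scounit W x * \<phi> (sone W)" if "\<phi> \<in> lin s" for \<phi> x
  unfolding WC_simps by (rule antipodeD(3)[OF _ that])
qed

lemmas bcmW = over.BW_bcm
lemmas cbH = cog_bcm[OF cog]

lemma morphI:
 assumes "!!\<phi>. \<phi> \<in> lin s ==> (%x. \<phi> (\<theta> x)) \<in> bF A"
  and "!!f x. f \<in> bi (hlin H) (lin s) ==> ssum (cD WC (\<theta> x)) (%a b. f (pr a) b) = ssum (bL A x) (%c w. f c (\<theta> w))"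
  and "!!f x. f \<in> bi (lin s) (hlin H) ==> ssum (cD WC (\<theta> x)) (%a b. f a (pr b)) = ssum (bR A x) (%w c. f (\<theta> w) c)"
 shows "morph (HC H) (HC H) (%x. x) \<theta> A WB"
 unfolding morph_def WB_ssum bF_WB using assms by simp

lemma inc0_morph: "morph (HC H) (HC H) (%x. x) (inc0 W) (selfB (HC H)) WB"
proof (rule morphI)
 show "ssum (cD WC (inc0 W x)) (%a b. f (pr a) b) = ssum (bL (selfB (HC H)) x) (%c w. f c (inc0 W w))"
  if f: "f \<in> bi (hlin H) (lin s)" for f x
  using inc0_D[OF biI[OF pi_lin[OF bi1[OF f]] bi2[OF f]], of x] by simp
 show "ssum (cD WC (inc0 W x)) (%a b. f a (pr b)) = ssum (bR (selfB (HC H)) x) (%w c. f (inc0 W w) c)"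
  if f: "f \<in> bi (lin s) (hlin H)" for f x
  using inc0_D[OF biI[OF bi1[OF f] pi_lin[OF bi2[OF f]]], of x] by simp
qed (simp add: inc0_lin)

text \<open>The coproduct of \<open>inc1 W v\<close> has a summand for each coaction, and projecting
  a leg to degree 0 keeps exactly one of them.\<close>

lemma inc1_morph: "morph (HC H) (HC H) (%x. x) (inc1 W) (VB H M) WB"
proof (rule morphI)
 show "ssum (cD WC (inc1 W x)) (%a b. f (pr a) b) = ssum (bL (VB H M) x) (%c w. f c (inc1 W w))"
  if f: "f \<in> bi (hlin H) (lin s)" for f x
  using inc1_D[OF biI[OF pi_lin[OF bi1[OF f]] bi2[OF f]], of x] lin_0[OF bi1[OF f]] by simp
 show "ssum (cD WC (inc1 W x)) (%a b. f a (pr b)) = ssum (bR (VB H M) x) (%w c. f (inc1 W w) c)"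
  if f: "f \<in> bi (lin s) (hlin H)" for f x
  using inc1_D[OF biI[OF bi1[OF f] pi_lin[OF bi2[OF f]]], of x] lin_0[OF bi2[OF f]] by simp
qed (simp add: inc1_lin)

lemma pi_morph: "morph (HC H) (HC H) (%x. x) pr WB (selfB (HC H))"
 unfolding morph_def WB_ssum using pi_lin pi_D' by (simp add: WB_ssum)

text \<open>If the leg projected by \<open>pr\<close> has degree 0, the other leg carries the whole
  degree n, so scaling by \<open>c n\<close> commutes with both coactions.\<close>

lemma dm_morph: "morph (HC H) (HC H) (%x. x) (dm c) WB WB"
proof (rule morphI, unfold bF_WB WB_ssum)
 show "(%x. \<phi> (dm c x)) \<in> lin s" if "\<phi> \<in> lin s" for \<phi> by (rule lin_dm[OF that])
 show "ssum (cD WC (dm c x)) (%a b. f (pr a) b) = ssum (cD WC x) (%a b. f (pr a) (dm c b))"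
  if f: "f \<in> bi (hlin H) (lin s)" for f x
 proof (rule lin_homogeneous[where \<phi> = "%x. ssum (cD WC (dm c x)) (%a b. f (pr a) b)"])
  have f': "(%a b. f (pr a) b) \<in> bi (lin s) (lin s)" "(%a b. f (pr a) (dm c b)) \<in> bi (lin s) (lin s)"
   by (intro biI pi_lin[OF bi1[OF f]] bi2[OF f] lin_dm[OF bi2[OF f]])+
  show "(%x. ssum (cD WC (dm c x)) (%a b. f (pr a) b)) \<in> lin s" by (rule lin_dm[OF comult_form[OF f'(1)]])
  show "(%x. ssum (cD WC x) (%a b. f (pr a) (dm c b))) \<in> lin s" by (rule comult_form[OF f'(2)])
  fix n x assume x: "x \<in> grade W n"
  have "ssum (cD WC (dm c x)) (%a b. f (pr a) b) = ssum (cD WC x) (%a b. c n * f (pr a) b)"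
   using lin_scale[OF comult_form[OF f'(1)], of "c n" x] by (simp add: dm_grade[OF x] ssum_mult_left)
  also have "... = ssum (cD WC x) (%a b. f (pr a) (dm c b))"
  proof (rule comult_homogeneous[OF x _ f'(2)])
   show "(%a b. c n * f (pr a) b) \<in> bi (lin s) (lin s)"
    by (intro biI forms_mult[OF forms_lin] bi1[OF f'(1)] bi2[OF f'(1)])
   fix i a b assume "i \<le> n" "a \<in> grade W i" "b \<in> grade W (n - i)"
   then show "c n * f (pr a) b = f (pr a) (dm c b)"
    using pi_zero[of a i] lin_0[OF bi1[OF f]] lin_scale[OF bi2[OF f]] by (cases "i = 0") (auto simp: dm_grade)
  qed
  finally show "ssum (cD WC (dm c x)) (%a b. f (pr a) b) = ssum (cD WC x) (%a b. f (pr a) (dm c b))" .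
 qed
 show "ssum (cD WC (dm c x)) (%a b. f a (pr b)) = ssum (cD WC x) (%a b. f (dm c a) (pr b))"
  if f: "f \<in> bi (lin s) (hlin H)" for f x
 proof (rule lin_homogeneous[where \<phi> = "%x. ssum (cD WC (dm c x)) (%a b. f a (pr b))"])
  have f': "(%a b. f a (pr b)) \<in> bi (lin s) (lin s)" "(%a b. f (dm c a) (pr b)) \<in> bi (lin s) (lin s)"
   by (intro biI pi_lin[OF bi2[OF f]] bi1[OF f] lin_dm[OF bi1[OF f]])+
  show "(%x. ssum (cD WC (dm c x)) (%a b. f a (pr b))) \<in> lin s" by (rule lin_dm[OF comult_form[OF f'(1)]])
  show "(%x. ssum (cD WC x) (%a b. f (dm c a) (pr b))) \<in> lin s" by (rule comult_form[OF f'(2)])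
  fix n x assume x: "x \<in> grade W n"
  have "ssum (cD WC (dm c x)) (%a b. f a (pr b)) = ssum (cD WC x) (%a b. c n * f a (pr b))"
   using lin_scale[OF comult_form[OF f'(1)], of "c n" x] by (simp add: dm_grade[OF x] ssum_mult_left)
  also have "... = ssum (cD WC x) (%a b. f (dm c a) (pr b))"
  proof (rule comult_homogeneous[OF x _ f'(2)])
   show "(%a b. c n * f a (pr b)) \<in> bi (lin s) (lin s)"
    by (intro biI forms_mult[OF forms_lin] bi1[OF f'(1)] bi2[OF f'(1)])
   fix i a b assume "i \<le> n" "a \<in> grade W i" "b \<in> grade W (n - i)"
   then show "c n * f a (pr b) = f (dm c a) (pr b)"
    using pi_zero[of b "n - i"] lin_0[OF bi2[OF f]] lin_scale[OF bi1[OF f]] by (cases "i = n") (auto simp: dm_grade)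
  qed
  finally show "ssum (cD WC (dm c x)) (%a b. f a (pr b)) = ssum (cD WC x) (%a b. f (dm c a) (pr b))" .
 qed
qed

lemma hp_morph: "morph (HC H) (HC H) (%x. x) (%x. hp n x) WB WB"
 unfolding hp_dm by (rule dm_morph)

lemma ext_sw:
 fixes r :: "'k => 'z::ab_group_add => 'z"
 assumes r: "vector_space r"
 shows "is_sw (HC H) r WB (ext_coact3 W)"
 unfolding is_sw_def WB_ssum
proof (intro allI impI)
 fix f :: "'h => 'w => 'h => 'z" and x
 assume f: "\<forall>\<phi>\<in>lin r. (%x y z. \<phi> (f x y z)) \<in> tri (cF (HC H)) (bF WB) (cF (HC H))"
 have f': "(%x y z. \<phi> (f (pr x) y (pr z))) \<in> tri (lin s) (lin s) (lin s)" if "\<phi> \<in> lin r" for \<phi>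
  using f that by (auto simp: tri_def intro: pi_lin)
 show "ext_coact3 W f x = ssum (cD WC x) (%a b. ssum (cD WC a) (%aa ba. f (pr aa) ba (pr b)))"
  unfolding ext_coact3_def sweedler3_def sspace WC_simps
  by (rule tlift_nested[OF r tW comult_linear f'])
qed

end

section \<open>Twisted exterior algebras\<close>

lemma twist_exterior_simps [simp]:
 "sscale (twist_exterior H \<chi> W) = sscale W" "grade (twist_exterior H \<chi> W) = grade W"
 "sone (twist_exterior H \<chi> W) = sone W" "scomult (twist_exterior H \<chi> W) = scomult W"
 "scounit (twist_exterior H \<chi> W) = scounit W" "inc0 (twist_exterior H \<chi> W) = inc0 W"
 "inc1 (twist_exterior H \<chi> W) = inc1 W" "ext_dif (twist_exterior H \<chi> W) = ext_dif W"
 "sspace (twist_exterior H \<chi> W) = sspace W"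
 by (simp_all add: twist_exterior_def graded_space_def)

lemma ext_proj0_twist [simp]: "ext_proj0 (twist_exterior H \<chi> W) = ext_proj0 W"
 by (simp add: ext_proj0_def fun_eq_iff)

lemma ext_coact3_twist [simp]: "ext_coact3 (twist_exterior H \<chi> W) = ext_coact3 W"
 by (simp add: ext_coact3_def fun_eq_iff)

lemma twf_diff2: "twf B u v (%x. \<phi> x - c * \<psi> x) x = twf B u v \<phi> x - c * twf B u v \<psi> x"
 by (simp add: twf_def Lo_def Ro_def algebra_simps ssum_diff ssum_mult_left[symmetric])

locale ext_twist = ext_core H M W
 for H :: "('k::field, 'h::ab_group_add) hopf" and M :: "('k, 'h, 'v::ab_group_add) calculus"
  and W :: "('k, 'h, 'v, 'w::ab_group_add) ext_alg" +
 fixes \<chi> :: "'h => 'h => 'k"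
 assumes \<chi>: "two_cocycle H \<chi>"
begin

abbreviation "\<xi> \<equiv> conv_inverse2 H \<chi>"
abbreviation "H' \<equiv> twist_hopf H \<chi>"
abbreviation "M' \<equiv> twist_calculus H \<chi> M"
abbreviation "W' \<equiv> twist_exterior H \<chi> W"

sublocale hopf_cocycle "HC H" "hmult H" "hone H" "hantipode H" "case_prod \<chi>" "case_prod \<xi>"
 using hopf_cocycle_iff[OF H] \<chi> by blast

lemma oc: "hopf_over_cocycle (HC H) (hmult H) (hone H) (hantipode H) WC (smult W) (sone W) (santipode W) pr (case_prod \<chi>) (case_prod \<xi>)"
 by (rule hopf_over_cocycle.intro[OF over.hopf_over_axioms hopf_cocycle_axioms])

lemma m_pform: "\<phi> \<in> lin s ==> (%(a, b). \<phi> (smult W a b)) \<in> pform (lin s) (lin s)"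
 using m_bi[of \<phi>] by (simp add: pform_def)

lemma tw: "is_tw (case_prod \<chi>) (case_prod \<xi>) WB WB (lin s) (smult W) (smult W')"
 unfolding twist_exterior_def
 using is_tw_sw[OF cog bcmW bcmW ext_sw[OF vsW] ext_sw[OF vsW], of \<chi> \<xi> "smult W"] chi xi m_bi by simp

lemma tw_lin: "\<phi> \<in> lin s ==> (%(a, b). \<phi> (smult W' a b)) \<in> pform (lin s) (lin s)"
 using is_tw_form[OF cog bcmW bcmW chi xi tw, of \<phi>] m_pform[of \<phi>] by simp

lemma tw_bi: "\<phi> \<in> lin s ==> (%a b. \<phi> (smult W' a b)) \<in> bi (lin s) (lin s)"
 using tw_lin[of \<phi>] by (simp add: pform_def)

lemma twD: "\<phi> \<in> lin s ==> \<phi> (case_prod (smult W') p) = twf (prodB WB WB) (case_prod \<chi>) (case_prod \<xi>) (%p. \<phi> (case_prod (smult W) p)) p"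
 using is_twD[OF tw, of \<phi> "fst p" "snd p"] by (simp add: case_prod_beta')

lemma T'_twf: "\<phi> \<in> lin s ==> \<phi> (santipode W' x) = twf WB U V (%x. \<phi> (santipode W x)) x"
 using twf_sw[OF cog bcmW ext_sw[OF vsW] U_form V_form, of "santipode W" \<phi> x] over.T_form
 by (simp add: twist_exterior_def conv_inverse_U[OF H \<chi>, unfolded twist_U_eq[OF H \<chi>]] twist_U_eq[OF H \<chi>])

lemmas sepW = lin_eqI[OF vsW]

lemmas thH = twist_hopf_mult[OF H \<chi>]
lemmas mmW = prodB_is_bcm[OF cog cog bcmW bcmW]

lemma tw_algebra: "is_algebra (full s) (smult W') (sone W)"
 unfolding is_algebra_full
proof (intro conjI ballI allI)
 show "vector_space s" by (rule vsW)
 show "\<phi> \<in> lin s ==> (%a b. \<phi> (smult W' a b)) \<in> bi (lin s) (lin s)" for \<phi> by (rule tw_bi)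
 fix x y z
 show "smult W' (smult W' x y) z = smult W' x (smult W' y z)"
  by (rule sepW, rule tw_assoc[OF bcmW bcmW bcmW bcmW bcmW m_morph' m_morph', where F = "lin s" and ?m1.0 = "smult W" and ?m3.0 = "smult W"])
   (use tw m_pform over.m_assoc in auto)
 have o1: "ssum (bL WB (sone W)) f = f (hone H) (sone W)" if "f \<in> bi (cF (HC H)) (bF WB)" for f
  using over.one_L[of f] that by (simp add: WB_ssum)
 have o2: "ssum (bR WB (sone W)) g = g (sone W) (hone H)" if "g \<in> bi (bF WB) (cF (HC H))" for g
  using over.one_R[of g] that by (simp add: WB_ssum)
 show "smult W' (sone W) x = x"
 proof (rule sepW)
  fix \<phi> assume \<phi>: "\<phi> \<in> lin s"
  show "\<phi> (smult W' (sone W) x) = \<phi> x"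
   using tw_unitL[OF bcmW bcmW o1 o2 tw \<phi>, of x] m_pform[OF \<phi>] over.m_unit by simp
 qed
 show "smult W' x (sone W) = x"
 proof (rule sepW)
  fix \<phi> assume \<phi>: "\<phi> \<in> lin s"
  show "\<phi> (smult W' x (sone W)) = \<phi> x"
   using tw_unitR[OF bcmW bcmW o1 o2 tw \<phi>, of x] m_pform[OF \<phi>] over.m_unit by simp
 qed
qed

lemma twf_mult_morph:
 assumes "\<phi> \<in> lin s" "morph (HC H) (HC H) (%x. x) \<theta> WB WB" "morph (HC H) (HC H) (%x. x) \<eta> WB WB"
 shows "twf (prodB WB WB) (case_prod \<chi>) (case_prod \<xi>) (%(a, b). \<phi> (smult W (\<theta> a) (\<eta> b))) (x, y) = \<phi> (smult W' (\<theta> x) (\<eta> y))"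
 using twf_morph[OF CC mmW morph_prod[OF cog cog bcmW bcmW assms(2,3)] chi xi, of "%(a, b). \<phi> (smult W a b)" "(x, y)"]
  m_pform[OF assms(1)] is_twD[OF tw assms(1), of "\<theta> x" "\<eta> y"] by (simp add: case_prod_beta')

text \<open>Homogeneity is invariance under the projection \<open>hp\<close>, which is bicolinear
  and hence passes through the twist.\<close>

lemma tw_grade: assumes x: "x \<in> grade W i" and y: "y \<in> grade W j" shows "smult W' x y \<in> grade W (i + j)"
proof -
 have "smult W' x y = hp (i + j) (smult W' x y)"
 proof (rule sepW)
  fix \<phi> assume \<phi>: "\<phi> \<in> lin s"
  have "\<phi> (hp (i + j) (smult W' (hp i x) (hp j y))) =
    twf (prodB WB WB) (case_prod \<chi>) (case_prod \<xi>) (%(a, b). \<phi> (hp (i + j) (smult W (hp i a) (hp j b)))) (x, y)"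
   by (rule twf_mult_morph[OF lin_hp[OF \<phi>] hp_morph hp_morph, symmetric])
  also have "... = twf (prodB WB WB) (case_prod \<chi>) (case_prod \<xi>) (%(a, b). \<phi> (smult W (hp i a) (hp j b))) (x, y)"
   by (simp add: hp_grade[OF smult_grade[OF hp_in hp_in]])
  also have "... = \<phi> (smult W' (hp i x) (hp j y))" by (rule twf_mult_morph[OF \<phi> hp_morph hp_morph])
  finally show "\<phi> (smult W' x y) = \<phi> (hp (i + j) (smult W' x y))"
   using x y by (simp add: hp_grade)
 qed
 then show ?thesis using hp_in[of "smult W' x y" "i + j"] by simp
qed

text \<open>The counit factors through \<open>pr\<close>, and by naturality \<open>pr\<close> is
  multiplicative from \<open>W'\<close> to \<open>H'\<close>, where the counit is known to be
  multiplicative.\<close>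

lemma tw_counit: "scounit W (smult W' x y) = scounit W x * scounit W y"
proof -
 have p: "pr (smult W' x y) = hmult H' (pr x) (pr y)"
 proof (rule separating)
  fix u assume u: "u \<in> cF (HC H)"
  show "u (pr (smult W' x y)) = u (hmult H' (pr x) (pr y))"
   by (rule is_tw_natural[OF cog cbH bcmW cbH pi_morph pi_morph chi xi tw thH])
    (use u pi_lin pi_mult H_bilinear[OF H] in \<open>auto simp: pform_def\<close>)
 qed
 interpret t: bialg "HC H" "hmult H'" "hone H" by (rule twisted_bialg) (use thH in simp)
 show ?thesis using t.mu_counit by (simp add: pi_counit' p)
qed

text \<open>The coproducts of two elements form a balanced splitting of pairs, so
  \<open>twf_cosplit\<close> distributes the twist over the two products in the super rule. The sign
  correction survives because \<open>odd_part\<close> is bicolinear and twisting is linear.\<close>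

lemma tw_comult: "scomult W (smult W' x y) = super_tensor_mult (full s) (grade W) (smult W') (scomult W x) (scomult W y)"
proof (rule iffD2[OF super_tensor_mult_eq_iff[OF _ tW tW tW]], rule tw_bi, assumption, rule ballI, fold WC_simps(3))
 fix f assume f: "f \<in> bi (lin s) (lin s)"
 let ?m = "case_prod (smult W)" and ?t = "case_prod (smult W')"
 let ?F = "%p q. f (?m (fst p, fst q)) (?m (snd p, snd q))"
 let ?o1 = "map_prod (%x. x) odd_part" and ?o2 = "map_prod odd_part (%x. x)"
 let ?G = "%p q. f (?m p) (?m q) - 2 * f (?m (?o1 p)) (?m (?o2 q))"
 let ?T = "twf (prodB WB WB) (case_prod \<chi>) (case_prod \<xi>)"
 let ?Dp = "%(x, y). plist (cD WC x) (cD WC y)"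
 note ot = morph_prod[OF cog cog bcmW bcmW morph_id dm_morph] morph_prod[OF cog cog bcmW bcmW dm_morph morph_id]
 have mL: "(%p. \<phi> (?m p)) \<in> bF (prodB WB WB)" if "\<phi> \<in> lin s" for \<phi>
  using m_pform[OF that] by (simp add: case_prod_beta')
 have mo: "(%p. \<phi> (?m (?o1 p))) \<in> bF (prodB WB WB)" "(%p. \<phi> (?m (?o2 p))) \<in> bF (prodB WB WB)" if "\<phi> \<in> lin s" for \<phi>
  unfolding odd_part_def by (rule morph_bF[OF ot(1) mL[OF that]] morph_bF[OF ot(2) mL[OF that]])+
 have G: "?G \<in> bi (bF (prodB WB WB)) (bF (prodB WB WB))"
  by (intro biI forms_diff[OF bcm_forms[OF mmW]] forms_mult[OF bcm_forms[OF mmW]] mL mo bi1[OF f] bi2[OF f])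
 have T: "?T (%p. \<phi> (?m p)) p = \<phi> (?t p)" "?T (%p. \<phi> (?m (?o1 p))) p = \<phi> (?t (?o1 p))" "?T (%p. \<phi> (?m (?o2 p))) p = \<phi> (?t (?o2 p))"
  if "\<phi> \<in> lin s" for \<phi> p
  using twD[OF that] twf_morph[OF CC mmW ot(1) chi xi mL[OF that], of _ p] twf_morph[OF CC mmW ot(2) chi xi mL[OF that], of _ p]
  by (simp_all add: odd_part_def)
 have cs: "cosplit CC (prodB WB WB) (prodB WB WB) (prodB WB WB) ?Dp"
  by (rule cosplit_prod[OF cog cog bcmW bcmW bcmW bcmW over.cosplit_D over.cosplit_D])
 have "ssum (cD WC (smult W' x y)) f = ?T (%p. ssum (cD WC (?m p)) f) (x, y)"
  using twD[OF comult_form[OF f], of "(x, y)"] by simp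
 also have "(%p. ssum (cD WC (?m p)) f) = (%p. ssum (?Dp p) ?G)"
  by (auto simp: fun_eq_iff comult_mult[OF f, unfolded WC_simps] ssum_plist)
 also have "?T ... (x, y) = ssum (?Dp (x, y)) (%p q. ?T (%p. ?T (?G p) q) p)"
  by (rule twf_cosplit[OF CC mmW mmW mmW cs chi xi xi_chi G])
 also have "... = ssum (?Dp (x, y)) (%p q. f (?t p) (?t q) - 2 * f (?t (?o1 p)) (?t (?o2 q)))"
  by (simp add: twf_diff2 T[OF bi2[OF f]] T[OF bi1[OF f]])
 finally show "ssum (cD WC (smult W' x y)) f = ssum (cD WC x) (%a b. ssum (cD WC y) (%c e. f (smult W' a c) (smult W' b e) -
   2 * f (smult W' a (odd_part c)) (smult W' (odd_part b) e)))"
  by (simp add: ssum_plist)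
qed

lemma tw_antipode: "is_antipode (full s) (smult W') (sone W) (scomult W) (scounit W) (santipode W')"
proof (rule iffD2[OF is_antipode_full[OF vsW comult_linear]], rule tw_bi, assumption, intro conjI ballI allI, fold WC_simps(1,2,3))
 fix \<phi> x assume \<phi>: "\<phi> \<in> cF WC"
 note tT = tw[folded WC_simps(1)] T'_twf[folded WC_simps(1)]
 show "(%x. \<phi> (santipode W' x)) \<in> cF WC"
  by (rule hopf_over_cocycle.tw_antipode_form[OF oc, folded WB_def, OF tT \<phi>])
 show "ssum (cD WC x) (%a b. \<phi> (smult W' (santipode W' a) b)) = cE WC x * \<phi> (sone W)"
  by (rule hopf_over_cocycle.tw_antipode_L[OF oc, folded WB_def, OF tT \<phi>])
 show "ssum (cD WC x) (%a b. \<phi> (smult W' a (santipode W' b))) = cE WC x * \<phi> (sone W)"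
  by (rule hopf_over_cocycle.tw_antipode_R[OF oc, folded WB_def, OF tT \<phi>])
qed

lemma tw_antipode_grade: assumes x: "x \<in> grade W n" shows "santipode W' x \<in> grade W n"
proof -
 have "santipode W' x = hp n (santipode W' x)"
 proof (rule sepW)
  fix \<phi> assume \<phi>: "\<phi> \<in> lin s"
  have g: "hp n (santipode W (hp n y)) = santipode W (hp n y)" for y
   using sup_antipode_grade hp_in by (simp add: hp_grade[of _ n])
  note m = twf_morph[OF cog bcmW hp_morph U_form V_form, unfolded bF_WB]
  have "\<phi> (hp n (santipode W' (hp n x))) = twf WB U V (%x. \<phi> (hp n (santipode W (hp n x)))) x"
   unfolding T'_twf[OF lin_hp[OF \<phi>]] using m[of "%x. \<phi> (hp n (santipode W x))"] antipodeD(1)[OF _ lin_hp[OF \<phi>]] by simp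
  also have "... = \<phi> (santipode W' (hp n x))"
   unfolding T'_twf[OF \<phi>] g using m[of "%x. \<phi> (santipode W x)"] antipodeD(1)[OF _ \<phi>] by simp
  finally show "\<phi> (santipode W' x) = \<phi> (hp n (santipode W' x))" using x by (simp add: hp_grade)
 qed
 then show ?thesis using hp_in[of "santipode W' x" n] by simp
qed

lemma tw_super: "super_hopf_algebra W'"
 unfolding super_hopf_algebra_def Let_def twist_exterior_simps sspace elems_full ball_UNIV
 using sup_sub sup_dec tw_algebra sup_one tw_grade sup_coalg sup_comult sup_counit0 tw_comult sup_one_comult
  tw_counit sup_counit_one tw_antipode tw_antipode_grade by (intro conjI) blast+

text \<open>As for the span of a calculus, the old generators are rewritten by the inverse twist as
  sums of scalar multiples of the new ones.\<close>

lemma tw_generated: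
 "grade W (Suc n) \<subseteq> V.span {smult W' (inc1 W v) y | v y. y \<in> grade W n}"
proof -
 \<comment> \<open>The projection \<open>hp n\<close> makes \<open>?D\<close> bilinear on all of
   \<open>W\<close> while keeping each value in \<open>?S\<close>, whatever legs the coactions
   produce.\<close>
 let ?D = "%v y. smult W' (inc1 W v) (hp n y)"
 let ?S = "{smult W' (inc1 W v) y | v y. y \<in> grade W n}"
 have swV: "is_sw (HC H) s (VB H M) (bicoact3 H M)" by (rule bicoact3_sw[OF bcV vsW])
 note swW = ext_sw[OF vsW]
 let ?t = "%a b. bicoact3 H M (%a1 a2 a3. ext_coact3 W (%b1 b2 b3. s (\<xi> a1 b1 * \<chi> a3 b3) (?D a2 b2)) b) a"
 have Df: "(%a b. \<phi> (?D a b)) \<in> bi (vlin M) (lin s)" if "\<phi> \<in> lin s" for \<phi>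
  by (intro biI lin_hp[OF bi2[OF tw_bi[OF that]]] inc1_lin[OF bi1[OF tw_bi[OF that]]])
 have tt: "is_tw (case_prod \<xi>) (case_prod \<chi>) (VB H M) WB (lin s) ?D ?t"
  by (rule is_tw_sw[OF cog bcmV bcmW swV swW]) (use chi xi Df in simp_all)
 have tw': "is_tw (case_prod \<xi>) (case_prod \<chi>) WB WB (lin s) (smult W') (smult W)"
  by (rule is_tw_inverse[OF bcmW bcmW _ tw]) (use m_pform in simp)
 have eq: "smult W (inc1 W v) (hp n y) = ?t v y" for v y
 proof (rule sepW)
  fix \<phi> assume \<phi>: "\<phi> \<in> lin s"
  show "\<phi> (smult W (inc1 W v) (hp n y)) = \<phi> (?t v y)"
   by (rule is_tw_natural[OF cog bcmW bcmW bcmW inc1_morph hp_morph xi chi tt tw' \<phi>, where \<zeta> = "%x. x", symmetric])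
    (use \<phi> tw_lin in auto)
 qed
 have mem: "?t v y \<in> V.span ?S" for v y
 proof -
  note * = swV[unfolded is_sw_def, rule_format] swW[unfolded is_sw_def, rule_format]
  note i = triI forms_ssum[OF forms_lin] forms_mult[OF forms_lin] forms_mult'[OF forms_lin] cocycle_forms[unfolded HC_simps prod.case]
   bi1[OF Df] bi2[OF Df]
  have 1: "ext_coact3 W (%b1 b2 b3. s (\<xi> a1 b1 * \<chi> a3 b3) (?D a2 b2)) b =
    ssum (bR WB b) (%w b3. ssum (bL WB w) (%b1 b2. s (\<xi> a1 b1 * \<chi> a3 b3) (?D a2 b2)))" for a1 a2 a3 b
   by (rule *(2), unfold bF_WB HC_simps) (simp only: lin_scale, intro i)
  have "?t v y = ssum (bR (VB H M) v) (%w a3. ssum (bL (VB H M) w) (%a1 a2.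
    ssum (bR WB y) (%w b3. ssum (bL WB w) (%b1 b2. s (\<xi> a1 b1 * \<chi> a3 b3) (?D a2 b2)))))"
   unfolding 1 by (rule *(1), unfold VB_simps HC_simps) (simp only: lin_scale lin_ssum, intro i)
  moreover have "?D a b \<in> V.span ?S" for a b by (rule V.span_base) (use hp_in in blast)
  ultimately show ?thesis by (simp only:) (intro V.span_ssum V.span_scale)
 qed
 have "{smult W (inc1 W v) y | v y. y \<in> grade W n} \<subseteq> V.span ?S"
 proof safe
  fix v y assume "y \<in> grade W n"
  then have "smult W (inc1 W v) y = ?t v y" using eq[of v y] by (simp add: hp_grade)
  then show "smult W (inc1 W v) y \<in> V.span ?S" using mem by simp
 qed
 then have "V.span {smult W (inc1 W v) y | v y. y \<in> grade W n} \<subseteq> V.span ?S"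
  by (rule V.span_minimal) simp
 then show ?thesis using generated by blast
qed

lemma tw_inc0_mult: "inc0 W (hmult H' h g) = smult W' (inc0 W h) (inc0 W g)"
proof (rule sepW)
 fix \<phi> assume \<phi>: "\<phi> \<in> lin s"
 show "\<phi> (inc0 W (hmult H' h g)) = \<phi> (smult W' (inc0 W h) (inc0 W g))"
  by (rule is_tw_natural[OF cog bcmW cbH bcmW inc0_morph inc0_morph chi xi thH tw \<phi>])
   (use inc0_lin[OF \<phi>] m_pform[OF \<phi>] inc0_mult in simp_all)
qed

lemma tw_inc1_left: "inc1 W (lact M' h v) = smult W' (inc0 W h) (inc1 W v)"
proof (rule sepW)
 fix \<phi> assume \<phi>: "\<phi> \<in> lin s"
 show "\<phi> (inc1 W (lact M' h v)) = \<phi> (smult W' (inc0 W h) (inc1 W v))"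
  by (rule is_tw_natural[OF cog bcmW bcmV bcmW inc0_morph inc1_morph chi xi twist_calculus_tw(1)[OF H \<chi> M] tw \<phi>])
   (use inc1_lin[OF \<phi>] m_pform[OF \<phi>] inc1_left in simp_all)
qed

lemma tw_inc1_right: "inc1 W (ract M' v h) = smult W' (inc1 W v) (inc0 W h)"
proof (rule sepW)
 fix \<phi> assume \<phi>: "\<phi> \<in> lin s"
 show "\<phi> (inc1 W (ract M' v h)) = \<phi> (smult W' (inc1 W v) (inc0 W h))"
  by (rule is_tw_natural[OF cog bcmW cbH bcmW inc1_morph inc0_morph chi xi twist_calculus_tw(2)[OF H \<chi> M] tw \<phi>])
   (use inc1_lin[OF \<phi>] m_pform[OF \<phi>] inc1_right in simp_all)
qed

lemma tw_inc0_antipode: "santipode W' (inc0 W h) = inc0 W (hantipode H' h)"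
proof (rule sepW)
 fix \<phi> assume \<phi>: "\<phi> \<in> lin s"
 have "\<phi> (santipode W' (inc0 W h)) = twf (selfB (HC H)) U V (%x. \<phi> (inc0 W (hantipode H x))) h"
  unfolding T'_twf[OF \<phi>]
  using twf_morph[OF cog bcmW inc0_morph U_form V_form, of "%x. \<phi> (santipode W x)" h] antipodeD(1)[OF _ \<phi>]
  by (simp add: inc0_antipode)
 also have "... = \<phi> (inc0 W (hantipode H' h))"
  using twist_hopf_antipode[OF H \<chi> inc0_lin[OF \<phi>], of h] by simp
 finally show "\<phi> (santipode W' (inc0 W h)) = \<phi> (inc0 W (hantipode H' h))" .
qed

theorem tw_ext_core:
 assumes "bicovariant_bimodule H' M'"
 shows "ext_core H' M' W'"
 by (rule ext_core.intro[OF twist_hopf_algebra[OF H \<chi>] assms tw_super])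
  (unfold twist_exterior_simps twist_hopf_simps twist_calculus_simps,
   (rule elems bij0 bij1 inc0_linear inc1_linear inc0_comult inc1_comult inc0_one inc0_counit
    tw_inc0_mult tw_inc0_antipode tw_inc1_left tw_inc1_right tw_generated)+)

end

section \<open>The differential\<close>

text \<open>The clauses of \<open>exterior_algebra\<close> that concern the differential; the others
  are equivalent to \<open>ext_core\<close>.\<close>

definition ext_differential :: "('k::field, 'h::ab_group_add, 'v::ab_group_add) calculus => ('k, 'h, 'v, 'w::ab_group_add) ext_alg => bool" where
 "ext_differential M W \<longleftrightarrow> (let A = sspace W; d = ext_dif W in
   linear_map A A d \<and>
   (\<forall>n. \<forall>x\<in>grade W n. d x \<in> grade W (Suc n)) \<and>
   (\<forall>x. d (d x) = 0) \<and>
   (\<forall>n. \<forall>x\<in>grade W n. \<forall>y.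
    d (smult W x y) = smult W (d x) y + sscale W ((- 1) ^ n) (smult W x (d y))) \<and>
   (\<forall>h. d (inc0 W h) = inc1 W (dif M h)) \<and>
   (\<forall>x. scomult W (d x) =
    tlift A A (%y z. tens A A (d y) z +
     (\<Sum>n | hparts (grade W) y n ~= 0.
       fun_scale ((- 1) ^ n) (tens A A (hparts (grade W) y n) (d z)))) (scomult W x)) \<and>
   (\<forall>x. santipode W (d x) = d (santipode W x)))"

context ext_core
begin

text \<open>Of the two terms in the coproduct of dx, the one in which d acts on the projected leg
  vanishes, since d raises the degree; in the other the sign is 1, since a projected leg counts only
  in degree 0.\<close>

lemma differential_morph:
 assumes d: "ext_differential M W"
 shows "morph (HC H) (HC H) (%x. x) (ext_dif W) WB WB"
proof -
 let ?d = "ext_dif W"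
 have dlin: "linear_map (full s) (full s) ?d" and dgr: "!!n x. x \<in> grade W n ==> ?d x \<in> grade W (Suc n)"
  and dco: "!!x. scomult W (?d x) =
    tlift (full s) (full s) (%y z. tens2 s (?d y) z +
     (\<Sum>n | hp n y ~= 0. fun_scale ((- 1) ^ n) (tens2 s (hp n y) (?d z)))) (scomult W x)"
  using d unfolding ext_differential_def Let_def sspace by blast+
 note dl = linear_map_lin[OF dlin]
 have pd: "pr (?d x) = 0" for x
 proof (rule separating)
  fix u assume u: "u \<in> cF (HC H)"
  have "u (pr (?d x)) = 0"
  proof (rule lin_homogeneous[where \<phi> = "%x. u (pr (?d x))" and \<psi> = "%_. 0"])
   show "(%x. u (pr (?d x))) \<in> lin s" using u by (intro dl pi_lin) simp
   show "(%_. 0) \<in> lin s" by (rule forms_zero[OF forms_lin])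
   show "u (pr (?d x)) = 0" if "x \<in> grade W n" for n x
    using pi_zero[OF dgr[OF that]] u lin_0 by simp
  qed
  then show "u (pr (?d x)) = u 0" using u lin_0 by simp
 qed
 \<comment> \<open>The sign \<open>(-1)^n\<close> on degree n, which \<open>pr\<close> does not
   see.\<close>
 let ?J = "dm (%n. (- 1) ^ n)"
 have pJ: "pr (?J x) = pr x" for x
 proof (rule separating)
  fix u assume u: "u \<in> cF (HC H)"
  show "u (pr (?J x)) = u (pr x)"
  proof (rule lin_homogeneous[where \<phi> = "%x. u (pr (?J x))" and \<psi> = "%x. u (pr x)"])
   show "(%x. u (pr (?J x))) \<in> lin s" "(%x. u (pr x)) \<in> lin s" using u by (auto intro: lin_dm pi_lin)
   show "u (pr (?J x)) = u (pr x)" if "x \<in> grade W n" for n x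
    using pi_zero[OF that] u lin_0[of u "hscale H"] lin_scale[of u "hscale H"] by (cases "n = 0") (auto simp: dm_grade[OF that] pi_scale)
  qed
 qed
 have sum_apply: "(sum F A) \<phi> = (\<Sum>x\<in>A. F x \<phi>)" for F :: "nat => ('w \<times> 'w, 'k) quot" and A \<phi>
  by (induction A rule: infinite_finite_induct) auto
 let ?F = "%y z. tens2 s (?d y) z + (\<Sum>n | hp n y ~= 0. fun_scale ((- 1) ^ n) (tens2 s (hp n y) (?d z)))"
 have F2: "(\<Sum>n | hp n y ~= 0. fun_scale ((- 1) ^ n) (tens2 s (hp n y) (?d z))) \<phi> = tens2 s (?J y) (?d z) \<phi>" for y z \<phi>
  by (simp add: sum_apply fun_scale_def lin_dm_eq[OF bi1[OF tens_bi]])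
 have F: "?F y z \<phi> = tens2 s (?d y) z \<phi> + tens2 s (?J y) (?d z) \<phi>" for y z \<phi>
  by (simp add: sum_apply fun_scale_def lin_dm_eq[OF bi1[OF tens_bi]])
 have eq: "ssum (cD WC (?d x)) f = ssum (cD WC x) (%y z. f (?d y) z + f (?J y) (?d z))" if f: "f \<in> bi (lin s) (lin s)" for f x
 proof -
  have "scomult W (?d x) = ssum (cD WC x) ?F"
   unfolding dco WC_simps
   by (rule tlift_quot[OF _ tW]) (unfold F, intro biI forms_add[OF forms_lin] dl[OF bi1[OF tens_bi]] dl[OF bi2[OF tens_bi]]
    bi2[OF tens_bi] lin_dm[OF bi1[OF tens_bi]])
  from fun_cong[OF this, of "case_prod f"] show ?thesis
   using tensor_apply[OF tW, of "?d x" "case_prod f"] f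
   by (simp add: ssum_apply F2 tens_apply tensor_forms_full)
 qed
 show ?thesis
 proof (rule morphI, unfold bF_WB WB_ssum)
  show "(%x. \<phi> (?d x)) \<in> lin s" if "\<phi> \<in> lin s" for \<phi> by (rule dl[OF that])
  show "ssum (cD WC (?d x)) (%a b. f (pr a) b) = ssum (cD WC x) (%a b. f (pr a) (?d b))"
   if f: "f \<in> bi (hlin H) (lin s)" for f x
   using eq[OF biI[OF pi_lin[OF bi1[OF f]] bi2[OF f]], of x] lin_0[OF bi1[OF f]] by (simp add: pd pJ)
  show "ssum (cD WC (?d x)) (%a b. f a (pr b)) = ssum (cD WC x) (%a b. f (?d a) (pr b))"
   if f: "f \<in> bi (lin s) (hlin H)" for f x
   using eq[OF biI[OF bi1[OF f] pi_lin[OF bi2[OF f]]], of x] lin_0[OF bi2[OF f]] by (simp add: pd)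
 qed
qed

end

context ext_twist
begin

text \<open>Since d is bicolinear, it passes through the twisted product and the twisted antipode.
  Compatibility with the coproduct carries over as it stands, because neither the coproduct nor d is
  changed.\<close>

theorem tw_differential:
 assumes d: "ext_differential M W"
 shows "ext_differential M' W'"
proof -
 let ?d = "ext_dif W"
 note dm = differential_morph[OF d]
 have dlin: "linear_map (full s) (full s) ?d"
  and lb: "!!n x y. x \<in> grade W n ==> ?d (smult W x y) = smult W (?d x) y + s ((- 1) ^ n) (smult W x (?d y))"
  and Sd: "!!x. santipode W (?d x) = ?d (santipode W x)"
  using d unfolding ext_differential_def Let_def sspace by blast+
 note dl = linear_map_lin[OF dlin]
 have 1: "?d (smult W' x y) = smult W' (?d x) y + s ((- 1) ^ n) (smult W' x (?d y))" if x: "x \<in> grade W n" for n x y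
 proof (rule sepW)
  fix \<phi> assume \<phi>: "\<phi> \<in> lin s"
  let ?T = "twf (prodB WB WB) (case_prod \<chi>) (case_prod \<xi>)"
  \<comment> \<open>The left factor is replaced by its component of degree n, so that the sign in
    the Leibniz rule is a constant on the form that is twisted.\<close>
  have dh: "morph (HC H) (HC H) (%x. x) (%x. ?d (hp n x)) WB WB"
   unfolding morph_def
   using morph_bF[OF dm] morph_bF[OF hp_morph[of n]] morph_bL[OF dm] morph_bR[OF dm]
    morph_bL[OF hp_morph[of n]] morph_bR[OF hp_morph[of n]]
  proof (intro conjI ballI allI)
   show "u \<in> cF (HC H) ==> (%c. u c) \<in> cF (HC H)" for u by simp
   show "\<phi> \<in> bF WB ==> (%v. \<phi> (?d (hp n v))) \<in> bF WB" for \<phi>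
    using morph_bF[OF hp_morph[of n] morph_bF[OF dm]] .
   show "ssum (bL WB (?d (hp n v))) f = ssum (bL WB v) (%c w. f c (?d (hp n w)))" if f: "f \<in> bi (cF (HC H)) (bF WB)" for f v
    unfolding morph_bL[OF dm f]
    by (rule morph_bL[OF hp_morph]) (intro biI bi1[OF f] morph_bF[OF dm bi2[OF f]])
   show "ssum (bR WB (?d (hp n v))) f = ssum (bR WB v) (%w c. f (?d (hp n w)) c)" if f: "f \<in> bi (bF WB) (cF (HC H))" for f v
    unfolding morph_bR[OF dm f]
    by (rule morph_bR[OF hp_morph]) (intro biI bi2[OF f] morph_bF[OF dm bi1[OF f]])
  qed
  have "\<phi> (?d (smult W' (hp n x) y)) = ?T (%(a, b). \<phi> (?d (smult W (hp n a) b))) (x, y)"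
   by (rule twf_mult_morph[OF dl[OF \<phi>] hp_morph morph_id, symmetric])
  \<comment> \<open>The sum is written as a difference with a doubly negated constant, the shape to
    which \<open>twf_diff2\<close> applies.\<close>
  also have "(%(a, b). \<phi> (?d (smult W (hp n a) b))) =
   (%p. (case p of (a, b) => \<phi> (smult W (?d (hp n a)) b)) - (- ((- 1) ^ n)) * (case p of (a, b) => \<phi> (smult W (hp n a) (?d b))))"
   by (auto simp: fun_eq_iff lb[OF hp_in] lin_add[OF \<phi>] lin_scale[OF \<phi>])
  also have "?T ... (x, y) = \<phi> (smult W' (?d (hp n x)) y) + (- 1) ^ n * \<phi> (smult W' (hp n x) (?d y))"
   unfolding twf_diff2 twf_mult_morph[OF \<phi> dh morph_id] twf_mult_morph[OF \<phi> hp_morph dm] by simp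
  finally show "\<phi> (?d (smult W' x y)) = \<phi> (smult W' (?d x) y + s ((- 1) ^ n) (smult W' x (?d y)))"
   using x by (simp add: hp_grade lin_add[OF \<phi>] lin_scale[OF \<phi>])
 qed
 have 2: "santipode W' (?d x) = ?d (santipode W' x)" for x
 proof (rule sepW)
  fix \<phi> assume \<phi>: "\<phi> \<in> lin s"
  show "\<phi> (santipode W' (?d x)) = \<phi> (?d (santipode W' x))"
   unfolding T'_twf[OF \<phi>] T'_twf[OF dl[OF \<phi>]]
   using twf_morph[OF cog bcmW dm U_form V_form, of "%x. \<phi> (santipode W x)" x] antipodeD(1)[OF _ \<phi>] by (simp add: Sd)
 qed
 show ?thesis
  using d 1 2 unfolding ext_differential_def Let_def twist_exterior_simps twist_calculus_simps by blast
qed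

text \<open>A graded map over \<open>H\<close> commutes with the projections to degree 0, and as a
  coalgebra map it is then bicolinear; naturality of the twist gives the rest.\<close>

lemma tw_exterior_hom:
 assumes W2: "ext_twist H M2 W2 \<chi>" and f: "exterior_hom W W2 f"
 shows "exterior_hom W' (twist_exterior H \<chi> W2) f"
proof -
 interpret W2: ext_twist H M2 W2 \<chi> by (rule W2)
 have fl: "linear_map (full s) (full W2.s) f" and fg: "!!n x. x \<in> grade W n ==> f x \<in> grade W2 n"
  and fm: "!!x y. f (smult W x y) = smult W2 (f x) (f y)" and f1: "f (sone W) = sone W2"
  and fc: "!!x. scomult W2 (f x) = tlift (full s) (full s) (%y z. tens (full W2.s) (full W2.s) (f y) (f z)) (scomult W x)"
  and fe: "!!x. scounit W2 (f x) = scounit W x" and fS: "!!x. f (santipode W x) = santipode W2 (f x)"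
  and f0: "!!h. f (inc0 W h) = inc0 W2 h" and fd: "!!x. f (ext_dif W x) = ext_dif W2 (f x)"
  using f unfolding exterior_hom_def super_hopf_hom_def Let_def sspace W2.sspace by auto
 note flin = linear_map_lin[OF fl]
 have fp: "W2.pr (f x) = pr x" for x
 proof (rule separating)
  fix u assume u: "u \<in> cF (HC H)"
  show "u (W2.pr (f x)) = u (pr x)"
  proof (rule lin_homogeneous[where \<phi> = "%x. u (W2.pr (f x))" and \<psi> = "%x. u (pr x)"])
   show "(%x. u (W2.pr (f x))) \<in> lin s" "(%x. u (pr x)) \<in> lin s" using u by (auto intro: flin W2.pi_lin pi_lin)
   fix n x assume x: "x \<in> grade W n"
   show "u (W2.pr (f x)) = u (pr x)"
   proof (cases "n = 0")
    case True
    then have "f x = inc0 W2 (pr x)" using inc0_pi[of x] x f0[of "pr x"] by simp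
    then show ?thesis by simp
   next
    case False
    then show ?thesis using pi_zero[OF x] W2.pi_zero[OF fg[OF x]] by simp
   qed
  qed
 qed
 have fD: "ssum (cD W2.WC (f x)) g = ssum (cD WC x) (%a b. g (f a) (f b))" if "g \<in> bi (lin W2.s) (lin W2.s)" for g x
  using iffD1[OF tensor_eq_map_iff[OF tW flin flin W2.tW] fc[of x]] that by simp
 have fmorph: "morph (HC H) (HC H) (%x. x) f WB W2.WB"
 proof (rule W2.morphI, unfold bF_WB WB_ssum)
  show "(%x. \<phi> (f x)) \<in> lin s" if "\<phi> \<in> lin W2.s" for \<phi> by (rule flin[OF that])
  show "ssum (cD W2.WC (f x)) (%a b. g (W2.pr a) b) = ssum (cD WC x) (%a b. g (pr a) (f b))"
   if g: "g \<in> bi (hlin H) (lin W2.s)" for g x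
   using fD[OF biI[OF W2.pi_lin[OF bi1[OF g]] bi2[OF g]], of x] by (simp add: fp)
  show "ssum (cD W2.WC (f x)) (%a b. g a (W2.pr b)) = ssum (cD WC x) (%a b. g (f a) (pr b))"
   if g: "g \<in> bi (lin W2.s) (hlin H)" for g x
   using fD[OF biI[OF bi1[OF g] W2.pi_lin[OF bi2[OF g]]], of x] by (simp add: fp)
 qed
 have 1: "f (smult W' x y) = smult W2.W' (f x) (f y)" for x y
 proof (rule W2.sepW)
  fix \<phi> assume \<phi>: "\<phi> \<in> lin W2.s"
  show "\<phi> (f (smult W' x y)) = \<phi> (smult W2.W' (f x) (f y))"
   by (rule is_tw_natural[OF cog W2.bcmW bcmW W2.bcmW fmorph fmorph chi xi tw W2.tw \<phi>])
    (use flin[OF \<phi>] W2.m_pform[OF \<phi>] fm in simp_all)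
 qed
 have 2: "f (santipode W' x) = santipode W2.W' (f x)" for x
 proof (rule W2.sepW)
  fix \<phi> assume \<phi>: "\<phi> \<in> lin W2.s"
  show "\<phi> (f (santipode W' x)) = \<phi> (santipode W2.W' (f x))"
   unfolding T'_twf[OF flin[OF \<phi>]] W2.T'_twf[OF \<phi>]
   using twf_morph[OF cog W2.bcmW fmorph U_form V_form, of "%x. \<phi> (santipode W2 x)" x] W2.antipodeD(1)[OF _ \<phi>] by (simp add: fS)
 qed
 show ?thesis
  unfolding exterior_hom_def super_hopf_hom_def Let_def twist_exterior_simps
  using 1 2 f unfolding exterior_hom_def super_hopf_hom_def Let_def by blast
qed

end

text \<open>The product returns by \<open>tw_inverse\<close>, as the bicomodule \<open>WB\<close> is
  the same before and after twisting; the antipode returns by its uniqueness for that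
  product.\<close>

lemma twist_twist_exterior:
 assumes core: "ext_core H M W" and coc: "two_cocycle H \<chi>" and calc: "bicovariant_calculus H M"
 shows "twist_exterior (twist_hopf H \<chi>) (conv_inverse2 H \<chi>) (twist_exterior H \<chi> W) = W"
proof -
 interpret ext_twist H M W \<chi> using core coc by (simp add: ext_twist_def ext_twist_axioms_def)
 have M': "bicovariant_bimodule H' M'"
  using twist_calculus_bicovariant[OF H \<chi> calc] by (simp add: bicovariant_calculus_def Let_def)
 have core': "ext_core H' M' W'" by (rule tw_ext_core[OF M'])
 have t': "ext_twist H' M' W' \<xi>"
  using core' twist_cocycle[OF H \<chi>] by (simp add: ext_twist_def ext_twist_axioms_def)
 let ?W = "twist_exterior H' \<xi> W'"
 have WB': "ext_core.WB W' = WB"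
  unfolding ext_core.WB_def[OF core'] WB_def ext_core.WC_def[OF core'] WC_def by simp
 have mult: "smult ?W = smult W"
 proof (intro ext sepW)
  fix a b \<phi> assume \<phi>: "\<phi> \<in> lin s"
  have s: "is_tw (case_prod \<xi>) (case_prod \<chi>) WB WB (lin s) (smult W') (smult ?W)"
   using ext_twist.tw[OF t'] unfolding WB' twist_conv_inverse[OF H \<chi>] by simp
  show "\<phi> (smult ?W a b) = \<phi> (smult W a b)"
   by (rule tw_inverse[OF bcmW bcmW _ tw s \<phi>]) (use m_pform in simp)
 qed
 have "ext_core (twist_hopf H' \<xi>) (twist_calculus H' \<xi> M') ?W"
  by (rule ext_twist.tw_ext_core[OF t'])
   (unfold twist_twist_hopf[OF H \<chi>] twist_twist_calculus[OF H \<chi> calc], rule ext_core.M[OF core])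
 then have core'': "ext_core H M ?W"
  unfolding twist_twist_hopf[OF H \<chi>] twist_twist_calculus[OF H \<chi> calc] .
 have "santipode ?W = santipode W"
 proof (intro ext sepW)
  fix x \<phi> assume \<phi>: "\<phi> \<in> lin s"
  interpret c: ext_core H M ?W by (rule core'')
  have WC': "c.WC = WC" unfolding c.WC_def WC_def by simp
  show "\<phi> (santipode ?W x) = \<phi> (santipode W x)"
  proof (rule over.T_unique)
   show "\<phi> \<in> cF WC" using \<phi> by simp
   show "(%x. \<phi> (santipode ?W x)) \<in> cF WC" if "\<phi> \<in> cF WC" for \<phi>
    using c.over.T_form[of \<phi>] that unfolding WC' .
   show "ssum (cD WC x) (%a b. \<phi> (smult W (santipode ?W a) b)) = cE WC x * \<phi> (sone W)" if "\<phi> \<in> cF WC" for \<phi> x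
    using c.over.TL[of \<phi> x] that unfolding WC' mult by simp
  qed
 qed
 with mult show ?thesis by (simp add: twist_exterior_def)
qed

section \<open>The antipode on products\<close>

context hopf_over
begin

text \<open>In the convolution algebra of maps from the product coalgebra of \<open>C\<close> and
  \<open>W\<close> to \<open>W\<close>, both sides are inverse to (h, y) \<mapsto> i(h) y.
  Assumption \<open>D\<close> expresses that a factor of degree 0 causes no sign in the
  coproduct.\<close>

lemma T_mult_left:
 assumes i: "!!\<phi>. \<phi> \<in> cF W ==> (%h. \<phi> (i h)) \<in> cF C"
  and D: "!!f h y. f \<in> bi (cF W) (cF W) ==> ssum (cD W (m (i h) y)) f =
   ssum (cD C h) (%a b. ssum (cD W y) (%c d. f (m (i a) c) (m (i b) d)))"
  and E: "!!h y. cE W (m (i h) y) = cE C h * cE W y"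
  and iS: "!!\<phi> h. \<phi> \<in> cF W ==> ssum (cD C h) (%a b. \<phi> (m (i a) (i (S b)))) = cE C h * \<phi> one"
  and \<phi>: "\<phi> \<in> cF W"
 shows "\<phi> (T (m (i h) y)) = \<phi> (m (T y) (i (S h)))"
proof -
 note fC = cog_forms[OF cog] and fW = cog_forms[OF W]
 note m1 = bi1[OF m_form] and m2 = bi2[OF m_form]
 have P: "(%p. \<phi> (T (m (i (fst p)) (snd p)))) \<in> cF (prodC C W)" if "\<phi> \<in> cF W" for \<phi>
  using i[OF m1[OF T_form[OF that]]] m2[OF T_form[OF that]] by (auto intro!: pformI)
 have M: "(%p. \<phi> (m (i (fst p)) (snd p))) \<in> cF (prodC C W)" if "\<phi> \<in> cF W" for \<phi>
  using i[OF m1[OF that]] m2[OF that] by (auto intro!: pformI)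
 have N: "(%p. \<phi> (m (T (snd p)) (i (S (fst p))))) \<in> cF (prodC C W)" if "\<phi> \<in> cF W" for \<phi>
  using S_form[OF i[OF m2[OF that]]] T_form[OF m1[OF that]] by (auto intro!: pformI)
 have PM: "ssum (cD (prodC C W) x) (%a b. \<phi> (m (T (m (i (fst a)) (snd a))) (m (i (fst b)) (snd b)))) = cE (prodC C W) x * \<phi> one"
  if \<phi>: "\<phi> \<in> cF W" for \<phi> x
 proof -
  obtain h y where x: "x = (h, y)" by (cases x)
  have "(%a b. \<phi> (m (T a) b)) \<in> bi (cF W) (cF W)"
   by (intro biI T_form[OF m1[OF \<phi>]] m2[OF \<phi>])
  from D[OF this, of h y] TL[OF \<phi>, of "m (i h) y"] show ?thesis by (simp add: x ssum_plist E)
 qed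
 have MN: "ssum (cD (prodC C W) x) (%a b. \<phi> (m (m (i (fst a)) (snd a)) (m (T (snd b)) (i (S (fst b)))))) = cE (prodC C W) x * \<phi> one"
  if \<phi>: "\<phi> \<in> cF W" for \<phi> x
 proof -
  obtain h y where x: "x = (h, y)" by (cases x)
  have "ssum (cD W y) (%c d. \<phi> (m (m (i a) c) (m (T d) (i (S b))))) = cE W y * \<phi> (m (i a) (i (S b)))" for a b
  proof -
   have "(%x. \<phi> (m (i a) (m x (i (S b))))) \<in> cF W" by (rule m1[OF m2[OF \<phi>]])
   from TR[OF this, of y] show ?thesis by (simp add: m_assoc m_unit)
  qed
  then show ?thesis using iS[OF \<phi>, of h] by (simp add: x ssum_plist ssum_mult_left mult_ac)
 qed
 have "\<phi> (T (m (i (fst (h, y))) (snd (h, y)))) = \<phi> (m (T (snd (h, y))) (i (S (fst (h, y)))))"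
  by (rule conv_unique[OF prodC_is_cog[OF cog W], where F = "cF W" and n = m and u = one
     and P = "%p. T (m (i (fst p)) (snd p))" and M = "%p. m (i (fst p)) (snd p)" and N = "%p. m (T (snd p)) (i (S (fst p)))"
     and \<phi> = \<phi> and x = "(h, y)"])
   (fact m_form m_assoc m_unit P M N PM MN \<phi> | simp add: m_form m_assoc m_unit P M N PM MN \<phi>)+
 then show ?thesis by simp
qed

end

lemma (in hopf) S_antimult: "S (mu a b) = mu (S b) (S a)"
proof (rule separating)
 fix \<phi> assume \<phi>: "\<phi> \<in> cF C"
 show "\<phi> (S (mu a b)) = \<phi> (mu (S b) (S a))"
 proof (rule hopf_over.T_mult_left[OF hopf_over_self, where i = "%x. x"])
  show "ssum (cD C (mu h y)) f = ssum (cD C h) (%a b. ssum (cD C y) (%c d. f (mu a c) (mu b d)))"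
   if "f \<in> bi (cF C) (cF C)" for f h y
   using morph_bL[OF mu_morph, of f "(h, y)"] that by (simp add: ssum_plist)
 qed (simp_all add: SR mu_counit \<phi>)
qed

text \<open>The degree 1 antipode as a map of the bimodule into itself; \<open>antipode_inc1\<close>
  shows that the antipode axiom forces it.\<close>

definition antipode1 :: "('k::field, 'h::ab_group_add) hopf => ('k, 'h, 'v::ab_group_add) calculus => 'v => 'v" where
 "antipode1 H M v = - bicoact3 H M (%v1 v2 v3. ract M (lact M (hantipode H v1) v2) (hantipode H v3)) v"

locale bicov =
 fixes H :: "('k::field, 'h::ab_group_add) hopf" and M :: "('k, 'h, 'v::ab_group_add) calculus"
 assumes H: "hopf_algebra H" and M: "bicovariant_bimodule H M"
begin

sublocale hopf "HC H" "hmult H" "hone H" "hantipode H"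
 using H by (simp add: hopf_algebra_iff)

lemma coH: "is_coalgebra (hspace H) (hcomult H) (hcounit H)" using H by (simp add: hopf_algebra_iff)
lemmas bb = M[unfolded bicovariant_bimodule_iff[OF H]]
lemma bcV: "bicomodule H M" and vsV: "vector_space (vscale M)" using bb by auto
lemmas bcmV = bicomodule_is_bcm[OF coH bcV vsV]
lemma ml: "morph CC (HC H) (case_prod (hmult H)) (case_prod (lact M)) (prodB (selfB (HC H)) (VB H M)) (VB H M)"
 and mr: "morph CC (HC H) (case_prod (hmult H)) (case_prod (ract M)) (prodB (VB H M) (selfB (HC H))) (VB H M)"
 and lact_assoc: "lact M (hmult H h g) v = lact M h (lact M g v)" and lact_one: "lact M (hone H) v = v"
 and ract_assoc: "ract M v (hmult H h g) = ract M (ract M v h) g" and ract_one: "ract M v (hone H) = v"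
 and lact_ract: "ract M (lact M h v) g = lact M h (ract M v g)"
 using bb by auto

lemma act_form: assumes "\<phi> \<in> vlin M"
 shows "(%h. \<phi> (lact M h v)) \<in> hlin H" "(%v. \<phi> (lact M h v)) \<in> vlin M"
  "(%v. \<phi> (ract M v h)) \<in> vlin M" "(%h. \<phi> (ract M v h)) \<in> hlin H"
 using morph_bF[OF ml, of \<phi>] morph_bF[OF mr, of \<phi>] assms by (auto simp: pform_def bi_def)

lemma S_lin: "\<phi> \<in> hlin H ==> (%x. \<phi> (hantipode H x)) \<in> hlin H"
 using S_form[of \<phi>] by simp

lemma lact_bL: "f \<in> bi (hlin H) (vlin M) ==> ssum (bL (VB H M) (lact M h v)) f =
  ssum (cD (HC H) h) (%a b. ssum (bL (VB H M) v) (%c w. f (hmult H a c) (lact M b w)))"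
 using morph_bL[OF ml, of f "(h, v)"] by (simp add: ssum_plist)
lemma lact_bR: "f \<in> bi (vlin M) (hlin H) ==> ssum (bR (VB H M) (lact M h v)) f =
  ssum (cD (HC H) h) (%a b. ssum (bR (VB H M) v) (%w c. f (lact M a w) (hmult H b c)))"
 using morph_bR[OF ml, of f "(h, v)"] by (simp add: ssum_plist)
lemma ract_bL: "f \<in> bi (hlin H) (vlin M) ==> ssum (bL (VB H M) (ract M v h)) f =
  ssum (bL (VB H M) v) (%c w. ssum (cD (HC H) h) (%a b. f (hmult H c a) (ract M w b)))"
 using morph_bL[OF mr, of f "(v, h)"] by (simp add: ssum_plist)
lemma ract_bR: "f \<in> bi (vlin M) (hlin H) ==> ssum (bR (VB H M) (ract M v h)) f =
  ssum (bR (VB H M) v) (%w c. ssum (cD (HC H) h) (%a b. f (ract M w a) (hmult H c b)))"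
 using morph_bR[OF mr, of f "(v, h)"] by (simp add: ssum_plist)

lemma antipode1_form: "\<phi> \<in> vlin M ==> \<phi> (antipode1 H M v) =
  - ssum (bR (VB H M) v) (%w c. ssum (bL (VB H M) w) (%a u. \<phi> (ract M (lact M (hantipode H a) u) (hantipode H c))))"
proof -
 have "bicoact3 H M (%v1 v2 v3. ract M (lact M (hantipode H v1) v2) (hantipode H v3)) v =
   ssum (bR (VB H M) v) (%w c. ssum (bL (VB H M) w) (%a u. ract M (lact M (hantipode H a) u) (hantipode H c)))"
 proof (rule bicoact3_sw[OF bcV vsV, unfolded is_sw_def, rule_format])
  fix \<phi> assume \<phi>: "\<phi> \<in> vlin M"
  show "(%x y z. \<phi> (ract M (lact M (hantipode H x) y) (hantipode H z))) \<in> tri (cF (HC H)) (bF (VB H M)) (cF (HC H))"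
   unfolding HC_simps VB_simps
   by (intro triI S_lin[OF act_form(1)[OF act_form(3)[OF \<phi>]]] act_form(2)[OF act_form(3)[OF \<phi>]] S_lin[OF act_form(4)[OF \<phi>]])
 qed
 then show "\<phi> \<in> vlin M ==> ?thesis" by (simp add: antipode1_def lin_uminus lin_ssum)
qed

lemma antipode1_lin: assumes \<phi>: "\<phi> \<in> vlin M"
 shows "(%v. \<phi> (antipode1 H M v)) \<in> vlin M"
proof -
 note f = S_lin[OF act_form(1)[OF act_form(3)[OF \<phi>]]] act_form(2)[OF act_form(3)[OF \<phi>]] S_lin[OF act_form(4)[OF \<phi>]]
 have "(%v. ssum (bR (VB H M) v) (%w c. ssum (bL (VB H M) w) (%a u. \<phi> (ract M (lact M (hantipode H a) u) (hantipode H c))))) \<in> bF (VB H M)"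
  by (rule bcm_bR[OF bcmV], rule biI, rule bcm_bL[OF bcmV], rule biI, unfold HC_simps VB_simps) (intro f forms_ssum[OF forms_lin])+
 then show ?thesis
  unfolding antipode1_form[OF \<phi>] using forms_mult[OF forms_lin, of _ "vscale M" "- 1"] by simp
qed

lemma antipode1_bi: assumes \<phi>: "\<phi> \<in> vlin M"
 shows "(%w c. ssum (bL (VB H M) w) (%a u. \<phi> (ract M (lact M (hantipode H a) u) (hantipode H c)))) \<in> bi (vlin M) (hlin H)"
proof (rule biI)
 note f = S_lin[OF act_form(1)[OF act_form(3)[OF \<phi>]]] act_form(2)[OF act_form(3)[OF \<phi>]] S_lin[OF act_form(4)[OF \<phi>]]
 show "(%w. ssum (bL (VB H M) w) (%a u. \<phi> (ract M (lact M (hantipode H a) u) (hantipode H c)))) \<in> vlin M" for c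
  using bcm_bL[OF bcmV, of "%a u. \<phi> (ract M (lact M (hantipode H a) u) (hantipode H c))"] f by (simp add: biI)
 show "(%c. ssum (bL (VB H M) w) (%a u. \<phi> (ract M (lact M (hantipode H a) u) (hantipode H c)))) \<in> hlin H" for w
  by (intro f forms_ssum[OF forms_lin])
qed

text \<open>The coactions of v h produce S(h1), h2 and S(h3) around v; the pair h2 S(h3) contracts
  and S(h1) remains on the left. Exchanging left and right actions is what makes the reversal of
  words respect the tensor product over \<open>H\<close>.\<close>

lemma antipode1_ract: "antipode1 H M (ract M v h) = lact M (hantipode H h) (antipode1 H M v)"
proof (rule lin_eqI[OF vsV])
 fix \<phi> assume \<phi>: "\<phi> \<in> vlin M"
 let ?S = "hantipode H" and ?D = "cD (HC H) h"
 note f = S_lin[OF act_form(1)[OF act_form(3)[OF \<phi>]]] act_form(2)[OF act_form(3)[OF \<phi>]] S_lin[OF act_form(4)[OF \<phi>]]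
 note mf = mu_form[unfolded HC_simps]
 note fb = antipode1_bi[OF \<phi>]
 have inner: "ssum ?D (%p q. ssum (cD (HC H) p) (%a b. \<phi> (ract M (lact M (?S (hmult H x a)) (ract M u b)) (?S (hmult H c q))))) =
   \<phi> (lact M (?S h) (ract M (lact M (?S x) u) (?S c)))" for x u c
 proof -
  let ?G = "%a k. \<phi> (lact M (?S a) (ract M (ract M (lact M (?S x) u) k) (?S c)))"
  have G: "(%a. ?G a k) \<in> hlin H" "(%k. ?G a k) \<in> hlin H" for a k
   by (intro S_lin[OF act_form(1)[OF \<phi>]] act_form(4)[OF act_form(3)[OF act_form(2)[OF \<phi>]]])+
  have "\<phi> (ract M (lact M (?S (hmult H x a)) (ract M u b)) (?S (hmult H c q))) = ?G a (hmult H b (?S q))" for a b q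
   by (simp add: S_antimult lact_assoc ract_assoc lact_ract)
  then have "ssum ?D (%p q. ssum (cD (HC H) p) (%a b. \<phi> (ract M (lact M (?S (hmult H x a)) (ract M u b)) (?S (hmult H c q))))) =
    ssum ?D (%p q. ssum (cD (HC H) p) (%a b. ?G a (hmult H b (?S q))))" by simp
  also have "... = ssum ?D (%a t. ssum (cD (HC H) t) (%b q. ?G a (hmult H b (?S q))))"
   by (rule cog_coassoc[OF cog]) (unfold HC_simps, intro triI G(1) mf(1)[OF G(2)] S_lin[OF mf(2)[OF G(2)]])
  also have "... = ssum ?D (%a t. ?G a (hone H) * cE (HC H) t)"
   using SR[of "%k. ?G _ k"] G(2) by (simp add: mult.commute)
  also have "... = ?G h (hone H)" using cog_counitR[OF cog, of "%a. ?G a (hone H)"] G(1) by simp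
  finally show ?thesis by (simp add: ract_one)
 qed
 have "\<phi> (antipode1 H M (ract M v h)) = - ssum (bR (VB H M) v) (%w c. ssum ?D (%p q.
   ssum (bL (VB H M) (ract M w p)) (%a u. \<phi> (ract M (lact M (?S a) u) (?S (hmult H c q))))))"
  unfolding antipode1_form[OF \<phi>] ract_bR[OF fb] ..
 also have "... = - ssum (bR (VB H M) v) (%w c. ssum ?D (%p q. ssum (bL (VB H M) w) (%x u. ssum (cD (HC H) p) (%a b.
   \<phi> (ract M (lact M (?S (hmult H x a)) (ract M u b)) (?S (hmult H c q)))))))"
  by (subst ract_bL) (intro biI f, simp)
 also have "... = - ssum (bR (VB H M) v) (%w c. ssum (bL (VB H M) w) (%x u. ssum ?D (%p q. ssum (cD (HC H) p) (%a b.
   \<phi> (ract M (lact M (?S (hmult H x a)) (ract M u b)) (?S (hmult H c q)))))))"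
  unfolding ssum_swap[of ?D] ..
 also have "... = \<phi> (lact M (?S h) (antipode1 H M v))"
  unfolding inner antipode1_form[OF act_form(2)[OF \<phi>]] ..
 finally show "\<phi> (antipode1 H M (ract M v h)) = \<phi> (lact M (?S h) (antipode1 H M v))" .
qed

text \<open>The mirror image, with the contraction of S(h1) h2.\<close>

lemma antipode1_lact: "antipode1 H M (lact M h v) = ract M (antipode1 H M v) (hantipode H h)"
proof (rule lin_eqI[OF vsV])
 fix \<phi> assume \<phi>: "\<phi> \<in> vlin M"
 let ?S = "hantipode H" and ?D = "cD (HC H) h"
 note f = S_lin[OF act_form(1)[OF act_form(3)[OF \<phi>]]] act_form(2)[OF act_form(3)[OF \<phi>]] S_lin[OF act_form(4)[OF \<phi>]]
 note mf = mu_form[unfolded HC_simps]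
 note fb = antipode1_bi[OF \<phi>]
 have inner: "ssum ?D (%p q. ssum (cD (HC H) p) (%a b. \<phi> (ract M (lact M (?S (hmult H a x)) (lact M b u)) (?S (hmult H q c))))) =
   \<phi> (ract M (ract M (lact M (?S x) u) (?S c)) (?S h))" for x u c
 proof -
  let ?G = "%k q. \<phi> (ract M (ract M (lact M (?S x) (lact M k u)) (?S c)) (?S q))"
  have G: "(%k. ?G k q) \<in> hlin H" "(%q. ?G k q) \<in> hlin H" for q k
   by (intro act_form(1)[OF act_form(2)[OF act_form(3)[OF act_form(3)[OF \<phi>]]]] S_lin[OF act_form(4)[OF \<phi>]])+
  have "\<phi> (ract M (lact M (?S (hmult H a x)) (lact M b u)) (?S (hmult H q c))) = ?G (hmult H (?S a) b) q" for a b q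
   by (simp add: S_antimult lact_assoc ract_assoc lact_ract)
  then have "ssum ?D (%p q. ssum (cD (HC H) p) (%a b. \<phi> (ract M (lact M (?S (hmult H a x)) (lact M b u)) (?S (hmult H q c))))) =
    ssum ?D (%p q. ssum (cD (HC H) p) (%a b. ?G (hmult H (?S a) b) q))" by simp
  also have "... = ssum ?D (%p q. cE (HC H) p * ?G (hone H) q)"
   using SL[of "%k. ?G k _"] G(1) by simp
  also have "... = ?G (hone H) h" using cog_counitL[OF cog, of "%q. ?G (hone H) q"] G(2) by simp
  finally show ?thesis by (simp add: lact_one)
 qed
 have "\<phi> (antipode1 H M (lact M h v)) = - ssum ?D (%p q. ssum (bR (VB H M) v) (%w c.
   ssum (bL (VB H M) (lact M p w)) (%a u. \<phi> (ract M (lact M (?S a) u) (?S (hmult H q c))))))"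
  unfolding antipode1_form[OF \<phi>] lact_bR[OF fb] ..
 also have "... = - ssum ?D (%p q. ssum (bR (VB H M) v) (%w c. ssum (cD (HC H) p) (%a b. ssum (bL (VB H M) w) (%x u.
   \<phi> (ract M (lact M (?S (hmult H a x)) (lact M b u)) (?S (hmult H q c)))))))"
  by (subst lact_bL) (intro biI f, simp)
 also have "... = - ssum (bR (VB H M) v) (%w c. ssum (bL (VB H M) w) (%x u. ssum ?D (%p q. ssum (cD (HC H) p) (%a b.
   \<phi> (ract M (lact M (?S (hmult H a x)) (lact M b u)) (?S (hmult H q c)))))))"
  unfolding ssum_swap[of "cD (HC H) _" "bL (VB H M) _"] ssum_swap[of ?D] ..
 also have "... = \<phi> (ract M (antipode1 H M v) (?S h))"
  unfolding inner antipode1_form[OF act_form(3)[OF \<phi>]] ..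
 finally show "\<phi> (antipode1 H M (lact M h v)) = \<phi> (ract M (antipode1 H M v) (?S h))" .
qed

end

section \<open>The antipode of \<open>W\<close> on degree 1 and on products\<close>

context ext_core
begin

sublocale b: bicov H M by (rule bicov.intro[OF H M])

lemma odd_grade: "x \<in> grade W n ==> odd_part x = (if odd n then x else 0)"
 unfolding odd_part_def by (simp add: dm_grade)

lemma odd_inc0 [simp]: "odd_part (inc0 W h) = 0" and odd_inc1 [simp]: "odd_part (inc1 W v) = inc1 W v"
 using odd_grade[OF inc0_in] odd_grade[OF inc1_in] by simp_all

lemmas m1 = bi1[OF m_bi] and m2 = bi2[OF m_bi]
lemmas Slin = over.T_form[unfolded WC_simps]

lemma m_zero [simp]: "smult W 0 x = 0" "smult W x 0 = 0"
 by (rule lin_eqI[OF vsW], simp add: lin_0 lin_0[OF m1] lin_0[OF m2])+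

lemma antipode_inc0_left: "santipode W (smult W (inc0 W h) y) = smult W (santipode W y) (inc0 W (hantipode H h))"
proof (rule lin_eqI[OF vsW])
 fix \<phi> assume \<phi>: "\<phi> \<in> lin s"
 show "\<phi> (santipode W (smult W (inc0 W h) y)) = \<phi> (smult W (santipode W y) (inc0 W (hantipode H h)))"
 proof (rule over.T_mult_left, unfold WC_simps(1,2))
  show "\<phi> \<in> lin s ==> (%h. \<phi> (inc0 W h)) \<in> cF (HC H)" for \<phi> using inc0_lin by simp
  show "ssum (cD WC (smult W (inc0 W h) y)) f = ssum (cD (HC H) h) (%a b. ssum (cD WC y) (%c d. f (smult W (inc0 W a) c) (smult W (inc0 W b) d)))"
   if f: "f \<in> bi (lin s) (lin s)" for f h y
  proof -
   let ?g = "%a b. ssum (cD WC y) (%c e. f (smult W a c) (smult W b e) - 2 * f (smult W a (odd_part c)) (smult W (odd_part b) e))"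
   have g: "?g \<in> bi (lin s) (lin s)"
    unfolding odd_part_def
    by (intro biI forms_ssum[OF forms_lin] forms_diff[OF forms_lin] forms_mult[OF forms_lin] m1[OF bi1[OF f]] m1[OF bi2[OF f]] lin_dm[OF m1[OF bi2[OF f]]])
   show ?thesis
    unfolding comult_mult[OF f] inc0_D[OF g] using lin_0[OF bi2[OF f]] by simp
  qed
  show "scounit W (smult W (inc0 W h) y) = cE (HC H) h * scounit W y" for h y
   by (simp add: pi_counit' pi_mult mu_counit[unfolded HC_simps])
  show "ssum (cD (HC H) h) (%a b. \<phi> (smult W (inc0 W a) (inc0 W (hantipode H b)))) = cE (HC H) h * \<phi> (sone W)"
   if "\<phi> \<in> lin s" for \<phi> h
   using SR[of "%x. \<phi> (inc0 W x)" h] inc0_lin[OF that] by (simp add: inc0_mult inc0_one)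
  show "\<phi> \<in> lin s" by fact
 qed
qed

lemma inc0_antipode_R: "\<phi> \<in> lin s ==>
  ssum (cD (HC H) c) (%h g. \<phi> (smult W (inc0 W h) (inc0 W (hantipode H g)))) = cE (HC H) c * \<phi> (sone W)"
 using SR[of "%x. \<phi> (inc0 W x)" c] inc0_lin[of \<phi>] by (simp add: inc0_mult inc0_one)

lemma inc1_act: "smult W (smult W (inc0 W h) (inc1 W v)) (inc0 W g) = inc1 W (ract M (lact M h v) g)"
 by (simp add: inc1_left inc1_right)

text \<open>The antipode axiom on an element of degree 1: the coproduct splits into the two
  coactions and the counit vanishes.\<close>

lemma antipode_rel: assumes \<phi>: "\<phi> \<in> lin s"
 shows "ssum (bR (VB H M) v) (%w h. \<phi> (smult W (santipode W (inc1 W w)) (inc0 W h))) =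
  - ssum (bL (VB H M) v) (%h w. \<phi> (smult W (inc0 W (hantipode H h)) (inc1 W w)))"
proof -
 have "(%a b. \<phi> (smult W (santipode W a) b)) \<in> bi (lin s) (lin s)" by (intro biI Slin[OF m1[OF \<phi>]] m2[OF \<phi>])
 from inc1_D[OF this, of v] over.TL[of \<phi> "inc1 W v"] \<phi>
 have "ssum (bL (VB H M) v) (%h w. \<phi> (smult W (inc0 W (hantipode H h)) (inc1 W w))) +
  ssum (bR (VB H M) v) (%w h. \<phi> (smult W (santipode W (inc1 W w)) (inc0 W h))) = 0"
  using lin_0[of "hcounit H" "hscale H"] cog_cE[OF cog] by (simp add: inc0_antipode pi_counit')
 then show ?thesis by (simp add: eq_neg_iff_add_eq_0 add.commute)
qed

text \<open>Solves \<open>antipode_rel\<close> for the antipode: the counit of the right coefficient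
  is expanded as h S(g), after which the relation applies to the first part.\<close>

lemma antipode_inc1: "santipode W (inc1 W v) = inc1 W (antipode1 H M v)"
proof (rule lin_eqI[OF vsW])
 fix \<phi> assume \<phi>: "\<phi> \<in> lin s"
 let ?S = "hantipode H"
 let ?f = "%w h g. \<phi> (smult W (smult W (santipode W (inc1 W w)) (inc0 W h)) (inc0 W (?S g)))"
 have f: "?f \<in> tri (bF (VB H M)) (cF (HC H)) (cF (HC H))"
  unfolding VB_simps HC_simps
  by (intro triI inc1_lin[OF Slin[OF m1[OF m1[OF \<phi>]]]] inc0_lin[OF m2[OF m1[OF \<phi>]]] b.S_lin[OF inc0_lin[OF m2[OF \<phi>]]])
 have "\<phi> (santipode W (inc1 W v)) = ssum (bR (VB H M) v) (%w c. \<phi> (santipode W (inc1 W w)) * cE (HC H) c)"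
  by (rule bcm_counitR[OF bcmV, symmetric]) (simp add: inc1_lin[OF Slin[OF \<phi>]])
 also have "... = ssum (bR (VB H M) v) (%w c. ssum (cD (HC H) c) (%h g. ?f w h g))"
  using inc0_antipode_R[OF m2[OF \<phi>]] by (simp add: over.m_assoc over.m_unit mult.commute)
 also have "... = ssum (bR (VB H M) v) (%w g. ssum (bR (VB H M) w) (%u h. ?f u h g))"
  by (rule bcm_RR[OF bcmV f])
 also have "... = ssum (bR (VB H M) v) (%w g. - ssum (bL (VB H M) w) (%h u. \<phi> (inc1 W (ract M (lact M (?S h) u) (?S g)))))"
  unfolding antipode_rel[OF m1[OF \<phi>]] inc1_act ..
 also have "... = \<phi> (inc1 W (antipode1 H M v))"
  unfolding ssum_minus b.antipode1_form[OF inc1_lin[OF \<phi>]] ..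
 finally show "\<phi> (santipode W (inc1 W v)) = \<phi> (inc1 W (antipode1 H M v))" .
qed

text \<open>The parity automorphism, which is the sign \<open>(-1)^n\<close> on degree n, see
  \<open>J_grade\<close>.\<close>

abbreviation "J x \<equiv> x - s 2 (odd_part x)"

lemma lin_J: "\<phi> \<in> lin s ==> (%x. \<phi> (J x)) \<in> lin s"
 unfolding odd_part_def using lin_dm[of \<phi>]
 by (simp add: lin_diff lin_scale) (intro forms_diff[OF forms_lin] forms_mult[OF forms_lin])

lemma lin_J_eq: "\<phi> \<in> lin s ==> \<phi> (J x) = \<phi> x - 2 * \<phi> (odd_part x)"
 by (simp add: lin_diff lin_scale)

text \<open>A sign occurs only in the summand with the degree 1 letter in the second leg, where it
  must pass the first leg of y.\<close>

lemma inc1_comult_mult: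
 assumes f: "f \<in> bi (lin s) (lin s)"
 shows "ssum (cD WC (smult W (inc1 W v) y)) f =
  ssum (bL (VB H M) v) (%h w. ssum (cD WC y) (%c e. f (smult W (inc0 W h) (J c)) (smult W (inc1 W w) e))) +
  ssum (bR (VB H M) v) (%w h. ssum (cD WC y) (%c e. f (smult W (inc1 W w) c) (smult W (inc0 W h) e)))"
proof -
 let ?g = "%a b. ssum (cD WC y) (%c e. f (smult W a c) (smult W b e) - 2 * f (smult W a (odd_part c)) (smult W (odd_part b) e))"
 have g: "?g \<in> bi (lin s) (lin s)"
  unfolding odd_part_def
  by (intro biI forms_ssum[OF forms_lin] forms_diff[OF forms_lin] forms_mult[OF forms_lin] m1[OF bi1[OF f]] m1[OF bi2[OF f]] lin_dm[OF m1[OF bi2[OF f]]])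
 show ?thesis
  unfolding comult_mult[OF f] inc1_D[OF g] lin_J_eq[OF m2[OF bi1[OF f]]] using lin_0[OF bi2[OF f]] by simp
qed

lemma antipode_rel2: assumes \<phi>: "\<phi> \<in> lin s"
 shows "ssum (bR (VB H M) v) (%w h. ssum (cD WC y) (%c e. \<phi> (smult W (santipode W (smult W (inc1 W w) c)) (smult W (inc0 W h) e)))) =
  - ssum (bL (VB H M) v) (%h w. ssum (cD WC y) (%c e.
    \<phi> (smult W (smult W (santipode W (J c)) (inc0 W (hantipode H h))) (smult W (inc1 W w) e))))"
proof -
 have "(%a b. \<phi> (smult W (santipode W a) b)) \<in> bi (lin s) (lin s)" by (intro biI Slin[OF m1[OF \<phi>]] m2[OF \<phi>])
 from inc1_comult_mult[OF this, of v y] over.TL[of \<phi> "smult W (inc1 W v) y"] \<phi>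
 have "ssum (bL (VB H M) v) (%h w. ssum (cD WC y) (%c e.
    \<phi> (smult W (smult W (santipode W (J c)) (inc0 W (hantipode H h))) (smult W (inc1 W w) e)))) +
  ssum (bR (VB H M) v) (%w h. ssum (cD WC y) (%c e. \<phi> (smult W (santipode W (smult W (inc1 W w) c)) (smult W (inc0 W h) e)))) =
   scounit W (smult W (inc1 W v) y) * \<phi> (sone W)"
  unfolding antipode_inc0_left by simp
 moreover have "scounit W (smult W (inc1 W v) y) = 0"
  using sup_counit_mult lin_0[of "hcounit H" "hscale H"] cog_cE[OF cog] by (simp add: pi_counit'[of "inc1 W v"])
 ultimately show ?thesis by (simp add: eq_neg_iff_add_eq_0 add.commute)
qed

text \<open>The rule S(vy) = (-1)^|y| S(y) S(v) for v of degree 1, with the sign carried by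
  \<open>J\<close>. It is obtained like \<open>antipode_inc1\<close>, by solving
  \<open>antipode_rel2\<close>.\<close>

lemma antipode_inc1_left: "santipode W (smult W (inc1 W v) y) = smult W (santipode W (J y)) (santipode W (inc1 W v))"
proof (rule lin_eqI[OF vsW])
 fix \<phi> assume \<phi>: "\<phi> \<in> lin s"
 let ?S = "hantipode H" and ?T = "santipode W" and ?m = "smult W"
 let ?f = "%w y h g e z. \<phi> (?m (?m (?T (?m (inc1 W w) y)) (?m (inc0 W h) e)) (?m (?T z) (inc0 W (?S g))))"
 note intro = inc1_lin[OF m1[OF Slin[OF m1[OF m1[OF \<phi>]]]]] m2[OF Slin[OF m1[OF m1[OF \<phi>]]]] inc0_lin[OF m1[OF m2[OF m1[OF \<phi>]]]]
  m2[OF m2[OF m1[OF \<phi>]]] Slin[OF m1[OF m2[OF \<phi>]]] b.S_lin[OF inc0_lin[OF m2[OF m2[OF \<phi>]]]]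
 have c1: "ssum (cD WC y2) (%e z. ?f w y1 h g e z) = cE WC y2 * \<phi> (?m (?T (?m (inc1 W w) y1)) (?m (inc0 W h) (inc0 W (?S g))))" for y2 w y1 h g
 proof -
  let ?\<phi> = "%x. \<phi> (?m (?T (?m (inc1 W w) y1)) (?m (inc0 W h) (?m x (inc0 W (?S g)))))"
  have "?\<phi> \<in> cF WC" using m1[OF m2[OF m2[OF \<phi>]]] by simp
  from over.TR[OF this, of y2] show ?thesis by (simp add: over.m_assoc over.m_unit)
 qed
 have c2: "ssum (cD (HC H) c) (%h g. \<phi> (?m x (?m (inc0 W h) (inc0 W (?S g))))) = cE (HC H) c * \<phi> x" for c x
  using inc0_antipode_R[OF m2[OF \<phi>]] by (simp add: over.m_unit)
 have ca: "ssum (cD WC y) (%y' z. ssum (cD WC y') (%y1 e. ?f u y1 h g e z)) =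
   ssum (cD WC y) (%y1 y2. ssum (cD WC y2) (%e z. ?f u y1 h g e z))" for u h g
  by (rule cog_coassoc[OF cogW]) (unfold WC_simps, intro triI intro)
 have ph: "(%y. \<phi> (?T (?m x y))) \<in> cF WC" for x using m2[OF Slin[OF \<phi>]] by simp
 \<comment> \<open>The counits of y and of the right coefficient of v are inserted and expanded as e
   T(z) and h S(g). The part T(w y1) h e is then the left side of \<open>antipode_rel2\<close>, and
   the remaining e T(z) contracts at the end.\<close>
 have "\<phi> (?T (?m (inc1 W v) y)) = ssum (bR (VB H M) v) (%w c. \<phi> (?T (?m (inc1 W w) y)) * cE (HC H) c)"
  by (rule bcm_counitR[OF bcmV, symmetric]) (simp add: inc1_lin[OF m1[OF Slin[OF \<phi>]]])
 also have "... = ssum (bR (VB H M) v) (%w c. ssum (cD WC y) (%y1 y2. \<phi> (?T (?m (inc1 W w) y1)) * cE WC y2 * cE (HC H) c))"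
  using cog_counitR[OF cogW ph] by (simp add: ssum_mult_right)
 also have "... = ssum (bR (VB H M) v) (%w c. ssum (cD WC y) (%y1 y2. ssum (cD (HC H) c) (%h g. ssum (cD WC y2) (%e z. ?f w y1 h g e z))))"
  unfolding c1 ssum_mult_left c2 by (simp add: mult_ac)
 also have "... = ssum (bR (VB H M) v) (%w c. ssum (cD (HC H) c) (%h g. ssum (cD WC y) (%y1 y2. ssum (cD WC y2) (%e z. ?f w y1 h g e z))))"
  unfolding ssum_swap[of "cD WC y" "cD (HC H) _"] ..
 also have "... = ssum (bR (VB H M) v) (%w g. ssum (bR (VB H M) w) (%u h. ssum (cD WC y) (%y1 y2. ssum (cD WC y2) (%e z. ?f u y1 h g e z))))"
  by (rule bcm_RR[OF bcmV]) (unfold VB_simps HC_simps, intro triI forms_ssum[OF forms_lin] intro)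
 also have "... = ssum (bR (VB H M) v) (%w g. ssum (bR (VB H M) w) (%u h. ssum (cD WC y) (%y' z. ssum (cD WC y') (%y1 e. ?f u y1 h g e z))))"
  unfolding ca ..
 also have "... = ssum (bR (VB H M) v) (%w g. ssum (cD WC y) (%y' z. ssum (bR (VB H M) w) (%u h. ssum (cD WC y') (%y1 e. ?f u y1 h g e z))))"
  unfolding ssum_swap[of "bR (VB H M) _" "cD WC y"] ..
 also have "... = ssum (bR (VB H M) v) (%w g. ssum (cD WC y) (%y' z. - ssum (bL (VB H M) w) (%h u. ssum (cD WC y') (%c e.
   \<phi> (?m (?m (?m (?T (J c)) (inc0 W (?S h))) (?m (inc1 W u) e)) (?m (?T z) (inc0 W (?S g))))))))"
  unfolding antipode_rel2[OF m1[OF \<phi>]] ..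
 also have "... = - ssum (bR (VB H M) v) (%w g. ssum (bL (VB H M) w) (%h u. ssum (cD WC y) (%y' z. ssum (cD WC y') (%c e.
   \<phi> (?m (?m (?m (?T (J c)) (inc0 W (?S h))) (?m (inc1 W u) e)) (?m (?T z) (inc0 W (?S g))))))))"
  unfolding ssum_minus ssum_swap[of "cD WC y" "bL (VB H M) _"] ..
 also have "... = - ssum (bR (VB H M) v) (%w g. ssum (bL (VB H M) w) (%h u. \<phi> (?m (?T (J y)) (inc1 W (ract M (lact M (?S h) u) (?S g))))))"
 proof -
  have "ssum (cD WC y) (%y' z. ssum (cD WC y') (%c e.
    \<phi> (?m (?m (?m (?T (J c)) (inc0 W (?S h))) (?m (inc1 W u) e)) (?m (?T z) (inc0 W (?S g)))))) =
    \<phi> (?m (?T (J y)) (inc1 W (ract M (lact M (?S h) u) (?S g))))" (is "?l = ?r") for h u g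
  proof -
   let ?\<phi> = "%c x. \<phi> (?m (?T (J c)) (?m (inc0 W (?S h)) (?m (inc1 W u) (?m x (inc0 W (?S g))))))"
   have a: "(%c. ?\<phi> c x) \<in> lin s" "(%x. ?\<phi> c x) \<in> lin s" for c x
    by (intro lin_J[OF Slin[OF m1[OF \<phi>]]] m1[OF m2[OF m2[OF m2[OF \<phi>]]]])+
   have "?l = ssum (cD WC y) (%y' z. ssum (cD WC y') (%c e. ?\<phi> c (?m e (?T z))))"
    by (simp add: over.m_assoc)
   also have "... = ssum (cD WC y) (%c t. ssum (cD WC t) (%e z. ?\<phi> c (?m e (?T z))))"
    by (rule cog_coassoc[OF cogW]) (unfold WC_simps, intro triI a m1[OF a(2)] Slin[OF m2[OF a(2)]])
   also have "... = ssum (cD WC y) (%c t. ?\<phi> c (sone W) * cE WC t)"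
    using over.TR[of "?\<phi> _"] a(2) by (simp add: mult.commute)
   also have "... = ?\<phi> y (sone W)"
    by (rule cog_counitR[OF cogW]) (simp add: a(1))
   also have "... = ?r" using inc1_act[of "?S h" u "?S g"] by (simp add: over.m_assoc over.m_unit)
   finally show ?thesis .
  qed
  then show ?thesis by simp
 qed
 also have "... = \<phi> (?m (?T (J y)) (?T (inc1 W v)))"
  unfolding antipode_inc1 b.antipode1_form[OF inc1_lin[OF m2[OF \<phi>]]] ..
 finally show "\<phi> (?T (?m (inc1 W v) y)) = \<phi> (?m (?T (J y)) (?T (inc1 W v)))" .
qed

end

section \<open>The tensor algebra in terms of words\<close>

text \<open>Realises a scalar multiple of a word as a word, so that plain sums of words are closed
  under scaling.\<close>

fun word_scale :: "('k => 'h => 'h) => ('k => 'v => 'v) => 'k => ('h, 'v) word => ('h, 'v) word" where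
 "word_scale s t c (Inl h) = Inl (s c h)"
| "word_scale s t c (Inr vs) = Inr (t c (hd vs) # tl vs)"

lemma sum_list_swap: "(SUM x<-xs. SUM y<-ys. f x y) = (SUM y<-ys. SUM x<-xs. f x y :: 'c::comm_monoid_add)"
 by (induction xs) (simp_all add: sum_list_addf)

section \<open>Words, balanced forms and the product of the tensor algebra\<close>

context bicov
begin

abbreviation "WF \<equiv> word_forms H M"
abbreviation "wg \<equiv> wgen H M"
abbreviation "wm \<equiv> word_mult H M"
abbreviation "sc \<equiv> word_scale (hscale H) (vscale M)"
abbreviation "T \<equiv> T_space H M"
abbreviation "TG \<equiv> T_grade H M"
abbreviation "wsum xs \<equiv> (SUM x<-xs. wg x)"

lemma WF_h: "\<phi> \<in> WF ==> (%h. \<phi> (Inl h)) \<in> hlin H"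
 and WF_v: "\<phi> \<in> WF ==> (%v. \<phi> (Inr (us @ v # ws))) \<in> vlin M"
 and WF_b: "\<phi> \<in> WF ==> \<phi> (Inr (us @ ract M v h # w # ws)) = \<phi> (Inr (us @ v # lact M h w # ws))"
 by (simp_all add: word_forms_def lin_def)

lemmas WF_v0 = WF_v[where us = "[]", simplified] and WF_b0 = WF_b[where us = "[]", simplified]

lemma WFI:
 assumes "(%h. \<phi> (Inl h)) \<in> hlin H" "!!us ws. (%v. \<phi> (Inr (us @ v # ws))) \<in> vlin M"
  "!!us v h w ws. \<phi> (Inr (us @ ract M v h # w # ws)) = \<phi> (Inr (us @ v # lact M h w # ws))"
 shows "\<phi> \<in> WF"
 using assms by (simp add: word_forms_def lin_def)

lemma words_simps [simp]: "Inl h \<in> words" "Inr vs \<in> words \<longleftrightarrow> vs ~= []"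
 by (auto simp: words_def)

lemma words_cases:
 assumes "w \<in> words" obtains h where "w = Inl h" | v vs where "w = Inr (v # vs)"
 using assms by (auto simp: words_def neq_Nil_conv)

lemma wm_words [simp]: "x \<in> words ==> y \<in> words ==> wm x y \<in> words"
 by (elim words_cases) auto

lemma wm_degree [simp]: "x \<in> words ==> y \<in> words ==> word_degree (wm x y) = word_degree x + word_degree y"
 by (elim words_cases) auto

lemma sc_words [simp]: "x \<in> words ==> sc c x \<in> words" and sc_degree [simp]: "x \<in> words ==> word_degree (sc c x) = word_degree x"
 by (elim words_cases; simp)+

lemma WF_sc: "\<phi> \<in> WF ==> x \<in> words ==> \<phi> (sc c x) = c * \<phi> x"
 by (erule words_cases) (simp_all add: lin_scale[OF WF_h] lin_scale[OF WF_v0])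

lemma forms_WF [simp]: "forms WF"
 unfolding forms_def by (auto intro!: WFI simp: WF_b intro: WF_h WF_v forms_zero[OF forms_lin] forms_add[OF forms_lin] forms_mult[OF forms_lin])

lemma WF_sum: "(!!y. y \<in> set ys ==> (%x. \<Phi> x y) \<in> WF) ==> (%x. SUM y<-ys. \<Phi> x y) \<in> WF"
 by (induction ys) (auto intro: forms_zero[OF forms_WF] forms_add[OF forms_WF])

text \<open>The relations between words are homogeneous, so a form may be rescaled degree by degree;
  signs and degree projections on words are handled in this way.\<close>

lemma WF_degree:
 assumes "\<phi> \<in> WF" shows "(%w. c (word_degree w) * \<phi> w) \<in> WF"
 by (rule WFI) (auto simp: WF_b[OF assms] intro: forms_mult[OF forms_lin] WF_h[OF assms] WF_v[OF assms])

lemma WF_wm1: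
 assumes \<phi>: "\<phi> \<in> WF" and y: "y \<in> words" shows "(%x. \<phi> (wm x y)) \<in> WF"
 using y
proof (cases rule: words_cases)
 case (1 g)
 show ?thesis unfolding 1
 proof (rule WFI)
  show "(%h. \<phi> (wm (Inl h) (Inl g))) \<in> hlin H"
   using mu_form[unfolded HC_simps, OF WF_h[OF \<phi>]] by simp
  show "(%v. \<phi> (wm (Inr (us @ v # ws)) (Inl g))) \<in> vlin M" for us ws
   using act_form(3)[OF WF_v[OF \<phi>]] WF_v[OF \<phi>] by (cases "ws = []") (simp_all add: butlast_append)
  show "\<phi> (wm (Inr (us @ ract M v h # w # ws)) (Inl g)) = \<phi> (wm (Inr (us @ v # lact M h w # ws)) (Inl g))" for us v h w ws
   by (cases "ws = []") (simp_all add: butlast_append WF_b[OF \<phi>] lact_ract)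
 qed
next
 case (2 z zs)
 show ?thesis unfolding 2
  by (rule WFI) (simp_all add: act_form(1)[OF WF_v0[OF \<phi>]] WF_v[OF \<phi>] WF_b[OF \<phi>])
qed

lemma WF_wm2:
 assumes \<phi>: "\<phi> \<in> WF" and x: "x \<in> words" shows "(%y. \<phi> (wm x y)) \<in> WF"
 using x
proof (cases rule: words_cases)
 case (1 g)
 show ?thesis unfolding 1
 proof (rule WFI)
  show "(%h. \<phi> (wm (Inl g) (Inl h))) \<in> hlin H"
   using mu_form[unfolded HC_simps, OF WF_h[OF \<phi>]] by simp
  show "(%v. \<phi> (wm (Inl g) (Inr (us @ v # ws)))) \<in> vlin M" for us ws
   using act_form(2)[OF WF_v0[OF \<phi>]] WF_v[OF \<phi>, of "lact M g (hd us) # tl us"] by (cases us) simp_all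
  show "\<phi> (wm (Inl g) (Inr (us @ ract M v h # w # ws))) = \<phi> (wm (Inl g) (Inr (us @ v # lact M h w # ws)))" for us v h w ws
   using WF_b[OF \<phi>, of "lact M g (hd us) # tl us"] by (cases us) (simp_all add: WF_b0[OF \<phi>] lact_ract[symmetric])
 qed
next
 case (2 z zs)
 have "(%h. \<phi> (Inr (butlast (z # zs) @ [ract M (last (z # zs)) h]))) \<in> hlin H"
  by (rule act_form(4)[OF WF_v[OF \<phi>]])
 then show ?thesis unfolding 2
  using WF_v[OF \<phi>, of "z # zs @ _"] WF_b[OF \<phi>, of "z # zs @ _"] by (intro WFI) simp_all
qed

lemma wg_apply: "wg x \<phi> = (if \<phi> \<in> WF then \<phi> x else 0)" by (simp add: gen_def)

lemma wg_eqI: "(!!\<phi>. \<phi> \<in> WF ==> \<phi> x = \<phi> y) ==> wg x = wg y"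
 by (auto simp: fun_eq_iff wg_apply)

lemma wg_sc: "x \<in> words ==> wg (sc c x) = fun_scale c (wg x)"
 by (auto simp: fun_eq_iff wg_apply fun_scale_def WF_sc)

lemma wsum_not: "\<phi> \<notin> WF ==> wsum xs \<phi> = 0"
 by (induction xs) (simp_all add: wg_apply)

lemma wsum_scale: "xs \<in> lists words ==> fun_scale c (wsum xs) = wsum (map (sc c) xs)"
 by (induction xs) (simp_all add: fun_scale_def fun_eq_iff wg_sc algebra_simps)

lemma scl_T: "scl T = fun_scale" by (simp add: T_space_def graded_space_def)

lemma T_gradeE:
 assumes "t \<in> TG n" obtains xs where "xs \<in> lists words" "!!x. x \<in> set xs ==> word_degree x = n" "t = wsum xs"
 using assms by (auto simp: T_grade_def gen_sums_def)

lemma T_gradeI: "xs \<in> lists words ==> (!!x. x \<in> set xs ==> word_degree x = n) ==> wsum xs \<in> TG n"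
 by (auto simp: T_grade_def gen_sums_def intro!: bexI[of _ xs])

lemma elems_T: "elems T = {t. \<exists>xs\<in>lists words. t = wsum xs}"
proof -
 interpret F: vector_space "fun_scale :: 'k => (('h, 'v) word, 'k) quot => _" by (rule vector_space_fun_scale)
 let ?G = "{t. \<exists>xs\<in>lists words. t = wsum xs}"
 have "F.subspace ?G"
 proof (rule F.subspaceI)
  show "0 \<in> ?G" by (auto intro!: bexI[of _ "[]"])
  show "x + y \<in> ?G" if xy: "x \<in> ?G" "y \<in> ?G" for x y
  proof -
   obtain xs ys where "xs \<in> lists words" "x = wsum xs" "ys \<in> lists words" "y = wsum ys" using xy by blast
   then show ?thesis by (auto intro!: bexI[of _ "xs @ ys"])
  qed
  show "fun_scale c x \<in> ?G" if x: "x \<in> ?G" for c x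
  proof -
   obtain xs where "xs \<in> lists words" "x = wsum xs" using x by blast
   then show ?thesis using wsum_scale[of xs c] by (auto intro!: bexI[of _ "map (sc c) xs"])
  qed
 qed
 moreover have "(\<Union>n. TG n) \<subseteq> ?G" by (auto elim!: T_gradeE)
 ultimately have "F.span (\<Union>n. TG n) \<subseteq> ?G" by (intro F.span_minimal)
 moreover have "wsum xs \<in> F.span (\<Union>n. TG n)" if "xs \<in> lists words" for xs
  using that
 proof (induction xs)
  case (Cons x xs)
  then have "wg x \<in> TG (word_degree x)" using T_gradeI[of "[x]"] by simp
  then have "wg x \<in> F.span (\<Union>n. TG n)" by (intro F.span_base) auto
  from F.span_add[OF this] show ?case using Cons by (simp only: list.map sum_list.Cons)
 qed (simp only: list.map sum_list.Nil F.span_zero)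
 ultimately show ?thesis by (auto simp: T_space_def graded_space_def)
qed

lemma T_cases: assumes "t \<in> elems T" obtains xs where "xs \<in> lists words" "t = wsum xs"
 using assms by (auto simp: elems_T)

lemma wsum_T [simp]: "xs \<in> lists words ==> wsum xs \<in> elems T" by (auto simp: elems_T)
lemma wg_T [simp]: "x \<in> words ==> wg x \<in> elems T" using wsum_T[of "[x]"] by simp

lemma T_linI:
 assumes s: "vector_space s" and f: "!!xs. xs \<in> lists words ==> f (wsum xs) = (SUM x<-xs. g x)"
  and g: "!!c x. x \<in> words ==> g (sc c x) = s c (g x)"
 shows "linear_map T (full s) f"
 unfolding linear_map_def
proof (intro conjI ballI allI)
 interpret vector_space s by (rule s)
 fix x assume "x \<in> elems T"
 then obtain xs where x: "xs \<in> lists words" "x = wsum xs" by (rule T_cases)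
 show "f (x + y) = f x + f y" if "y \<in> elems T" for y
 proof -
  from that obtain ys where "ys \<in> lists words" "y = wsum ys" by (rule T_cases)
  then show ?thesis using f[of "xs @ ys"] f[of xs] f[of ys] x by simp
 qed
 have "(SUM x<-map (sc c) xs. g x) = s c (SUM x<-xs. g x)" for c
  using x(1) by (induction xs) (simp_all add: g scale_right_distrib)
 moreover have "map (sc c) xs \<in> lists words" for c using x(1) by auto
 ultimately show "f (scl T c x) = scl (full s) c (f x)" for c
  using f[of "map (sc c) xs"] f[of xs] x wsum_scale[of xs c] by (simp add: scl_T)
qed simp

lemma T_formI:
 assumes "g \<in> WF" "!!xs. xs \<in> lists words ==> f (wsum xs) = (SUM x<-xs. g x)"
 shows "linear_map T ground f"
 by (rule T_linI[of "(*)" f g]) (use is_space_ground assms in \<open>simp_all add: is_space_full WF_sc\<close>)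

lemma T_lin_sum: "linear_map T (full s) f ==> xs \<in> lists words ==> f (wsum xs) = (SUM x<-xs. f (wg x))"
proof (induction xs)
 case Nil
 have "0 \<in> elems T" using wsum_T[of "[]"] by simp
 then have "f (0 + 0) = f 0 + f 0" using Nil(1) by (simp only: linear_map_def)
 then have "f 0 = 0" by (metis add_0_right add_cancel_right_right)
 then show ?case by (simp only: list.map sum_list.Nil)
next
 case (Cons x xs)
 then have "f (wg x + wsum xs) = f (wg x) + f (wsum xs)" using wsum_T[of xs] wg_T[of x]
  by (simp only: linear_map_def) auto
 moreover have "f (wsum xs) = (SUM x<-xs. f (wg x))" using Cons by simp
 ultimately show ?case by (simp only: list.map sum_list.Cons)
qed

text \<open>The converse of \<open>T_formI\<close>: the relations between words hold among their
  classes, so a linear form on the quotient restricts to a balanced form.\<close>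

lemma T_lin_WF:
 assumes \<beta>: "linear_map T ground \<beta>" shows "(%x. \<beta> (wg x)) \<in> WF"
proof -
 have add: "\<beta> (wg x) = \<beta> (wg y) + \<beta> (wg z)" if "x \<in> words" "y \<in> words" "z \<in> words" "!!\<phi>. \<phi> \<in> WF ==> \<phi> x = \<phi> y + \<phi> z" for x y z
 proof -
  have "wg x = wg y + wg z" using that(4) by (auto simp: fun_eq_iff wg_apply)
  then show ?thesis using \<beta> wg_T[OF that(2)] wg_T[OF that(3)] by (simp add: linear_map_def)
 qed
 have scale: "\<beta> (wg x) = c * \<beta> (wg y)" if "x \<in> words" "y \<in> words" "!!\<phi>. \<phi> \<in> WF ==> \<phi> x = c * \<phi> y" for x y c
 proof -
  have "wg x = fun_scale c (wg y)" using that(3) by (auto simp: fun_eq_iff wg_apply fun_scale_def)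
  then show ?thesis using \<beta> wg_T[OF that(2)] by (simp add: linear_map_def scl_T)
 qed
 show ?thesis
  by (rule WFI; (rule arg_cong[of _ _ \<beta>], rule wg_eqI, simp add: WF_b)?)
   (auto simp: lin_iff intro!: add scale intro: lin_add[OF WF_h] lin_add[OF WF_v] lin_scale[OF WF_h] lin_scale[OF WF_v])
qed

text \<open>The bilinear forms on the tensor algebra as functions of pairs of words. Only genuine
  words are tested, because \<open>Inr []\<close> stands for no element.\<close>

definition PF :: "(('h, 'v) word => ('h, 'v) word => 'k) set" where
 "PF = {\<Phi>. \<forall>x\<in>words. \<Phi> x \<in> WF \<and> (%y. \<Phi> y x) \<in> WF}"

lemma PF1: "\<Phi> \<in> PF ==> y \<in> words ==> (%x. \<Phi> x y) \<in> WF" and PF2: "\<Phi> \<in> PF ==> x \<in> words ==> (%y. \<Phi> x y) \<in> WF"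
 by (auto simp: PF_def)

lemma T_biI:
 assumes "\<Phi> \<in> PF" "!!xs ys. xs \<in> lists words ==> ys \<in> lists words ==> f (wsum xs) (wsum ys) = (SUM x<-xs. SUM y<-ys. \<Phi> x y)"
 shows "bilinear_map T T ground f"
 unfolding bilinear_map_def
proof (intro conjI ballI; erule T_cases)
 fix u xs assume xs: "xs \<in> lists words" "u = wsum xs"
 show "linear_map T ground (f u)"
  by (rule T_formI[of "%y. SUM x<-xs. \<Phi> x y"]) (use xs in \<open>auto intro!: WF_sum PF2[OF assms(1)] simp: assms(2) sum_list_swap[of _ xs]\<close>)
 show "linear_map T ground (%v. f v u)"
  by (rule T_formI[of "%y. SUM x<-xs. \<Phi> y x"]) (use xs in \<open>auto intro!: WF_sum PF1[OF assms(1)] simp: assms(2)\<close>)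
qed

lemma T_bi_PF: "bilinear_map T T ground f ==> (%x y. f (wg x) (wg y)) \<in> PF"
 by (auto simp: PF_def bilinear_map_def intro: T_lin_WF)

lemma T_bi_sum:
 assumes "bilinear_map T T ground f" "xs \<in> lists words" "ys \<in> lists words"
 shows "f (wsum xs) (wsum ys) = (SUM x<-xs. SUM y<-ys. f (wg x) (wg y))"
proof -
 have "f (wsum xs) (wsum ys) = (SUM x<-xs. f (wg x) (wsum ys))"
  by (rule T_lin_sum[where s = "(*)" and f = "%x. f x _"]) (use assms in \<open>auto simp: bilinear_map_def\<close>)
 moreover have "f (wg x) (wsum ys) = (SUM y<-ys. f (wg x) (wg y))" if "x \<in> words" for x
  by (rule T_lin_sum[where s = "(*)"]) (use assms that in \<open>auto simp: bilinear_map_def\<close>)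
 ultimately show ?thesis using assms(2) by (auto intro!: arg_cong[of _ _ sum_list] map_cong)
qed

text \<open>The values are functions, so the relations may be checked at each argument \<phi>
  separately.\<close>

lemma gen_lift_words:
 assumes "!!\<phi>. (%w. f w \<phi>) \<in> WF" "xs \<in> lists words"
 shows "gen_lift words WF f (wsum xs) = (SUM x<-xs. f x :: ('x, 'k) quot)"
proof (rule gen_lift_sum[OF vector_space_fun_scale _ assms(2)])
 fix \<psi> :: "('x, 'k) quot => 'k" assume \<psi>: "linear_map (full fun_scale) ground \<psi>"
 have "f (Inl (a + b)) = f (Inl a) + f (Inl b)" "f (Inl (hscale H c a)) = fun_scale c (f (Inl a))"
  "f (Inr (us @ (v + w) # ws)) = f (Inr (us @ v # ws)) + f (Inr (us @ w # ws))"
  "f (Inr (us @ vscale M c v # ws)) = fun_scale c (f (Inr (us @ v # ws)))"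
  "f (Inr (us @ ract M v a # w # ws)) = f (Inr (us @ v # lact M a w # ws))" for a b c us v w ws
  using lin_add[OF WF_h[OF assms(1)]] lin_scale[OF WF_h[OF assms(1)]] lin_add[OF WF_v[OF assms(1)]]
   lin_scale[OF WF_v[OF assms(1)]] WF_b[OF assms(1)] by (simp_all add: fun_eq_iff fun_scale_def)
 then show "\<psi> \<circ> f \<in> WF" using \<psi> by (intro WFI) (simp_all add: lin_iff linear_map_def)
qed

lemma T_mult_wsum:
 assumes "xs \<in> lists words" "ys \<in> lists words"
 shows "T_mult H M (wsum xs) (wsum ys) = (SUM x<-xs. SUM y<-ys. wg (wm x y))"
proof -
 have w1: "(%x. wg (wm x y) \<phi>) \<in> WF" and w2: "(%y. wg (wm x y) \<phi>) \<in> WF" if "x \<in> words" "y \<in> words" for x y \<phi>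
  using WF_wm1[OF _ that(2)] WF_wm2[OF _ that(1)] forms_zero[OF forms_WF]
  by (cases "\<phi> \<in> WF"; simp add: wg_apply)+
 have 1: "gen_lift words WF (%w'. wg (wm x w')) (wsum ys) = (SUM y<-ys. wg (wm x y))" if "x \<in> words" for x
  by (rule gen_lift_words[OF w2 assms(2)]) (use that in auto)
 have "T_mult H M (wsum xs) (wsum ys) = (SUM x<-xs. gen_lift words WF (%w'. wg (wm x w')) (wsum ys))"
  unfolding T_mult_def
 proof (rule gen_lift_sum[OF vector_space_fun_scale _ assms(1)])
  fix \<psi> :: "(('h, 'v) word, 'k) quot => 'k" assume \<psi>: "linear_map (full fun_scale) ground \<psi>"
  have "linear_map T ground \<psi>" using \<psi> by (simp add: linear_map_def scl_T)
  note w = WF_wm1[OF T_lin_WF[OF this]]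
  have "(%x. SUM y<-ys. \<psi> (wg (wm x y))) \<in> WF" by (rule WF_sum) (use w assms(2) in auto)
  note g = this
  have e: "\<psi> (gen_lift words WF (%w'. wg (wm x w')) (wsum ys)) = (SUM y<-ys. \<psi> (wg (wm x y)))" if "x \<in> words" for x
   unfolding 1[OF that] by (rule linear_map_sum_list[OF \<psi>])
  have "(%x. \<psi> (gen_lift words WF (%w'. wg (wm x w')) (wsum ys))) \<in> WF"
   by (rule WFI) (use WF_h[OF g] WF_v[OF g] WF_b[OF g] in \<open>simp_all add: e\<close>)
  then show "\<psi> \<circ> (%x. gen_lift words WF (%w'. wg (wm x w')) (wsum ys)) \<in> WF" by (simp add: comp_def)
 qed
 then show ?thesis using assms(1) 1 by (auto intro!: arg_cong[of _ _ sum_list] map_cong)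
qed

lemma T_mult_wg: "x \<in> words ==> y \<in> words ==> T_mult H M (wg x) (wg y) = wg (wm x y)"
 using T_mult_wsum[of "[x]" "[y]"] by simp

end

section \<open>Degrees and the super tensor product on words\<close>

lemma sum_list_products: "(SUM u<-concat (map (%x. map (g x) ys) xs). f u) = (SUM x<-xs. SUM y<-ys. f (g x y) :: 'c::comm_monoid_add)"
 by (induction xs) (simp_all add: comp_def)

lemma lists_TimesD: "L \<in> lists (A \<times> B) ==> (x, y) \<in> set L ==> x \<in> A \<and> y \<in> B"
 by auto

context bicov
begin

lemma wsum_filter:
 assumes "xs \<in> lists words" "\<phi> \<in> WF"
 shows "wsum xs (%w. if word_degree w = n then \<phi> w else 0) = wsum (filter (%w. word_degree w = n) xs) \<phi>"
proof -
 have "(%w. if word_degree w = n then \<phi> w else 0) \<in> WF"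
  using WF_degree[OF assms(2), of "%m. if m = n then 1 else 0"] by (simp add: if_distrib[of "%x. x * _"] cong: if_cong)
 then show ?thesis using assms(1) by (induction xs) (simp_all add: wg_apply assms(2))
qed

text \<open>Uniqueness comes from testing a decomposition against forms that vanish outside a single
  degree; such a form sees only one component.\<close>

lemma T_parts:
 assumes xs: "xs \<in> lists words"
 shows "is_decomposition TG (wsum xs) (%n. wsum (filter (%w. word_degree w = n) xs))" (is "is_decomposition _ _ ?f")
  and "hparts TG (wsum xs) = (%n. wsum (filter (%w. word_degree w = n) xs))"
proof -
 let ?D = "word_degree ` set xs"
 have nz: "{n. ?f n ~= 0} \<subseteq> ?D"
 proof
  fix n assume "n \<in> {n. ?f n ~= 0}"
  then have "filter (%w. word_degree w = n) xs ~= []" by (metis (mono_tags, lifting) list.simps(8) mem_Collect_eq sum_list.Nil)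
  then show "n \<in> ?D" by (auto simp: filter_empty_conv)
 qed
 have sum_apply: "(sum F A) \<phi> = (\<Sum>x\<in>A. F x \<phi>)" for F :: "nat => (('h, 'v) word, 'k) quot" and A \<phi>
  by (induction A rule: infinite_finite_induct) auto
 have "wsum xs = (\<Sum>n\<in>N. ?f n)" if "finite N" "?D \<subseteq> N" for N
  using that
 proof (induction xs)
  case (Cons x xs)
  have "?f n = ?f n" for n ..
  have "wsum (filter (%w. word_degree w = n) (x # xs)) = (if n = word_degree x then wg x else 0) + wsum (filter (%w. word_degree w = n) xs)" for n
   by (simp only: filter.simps) (simp add: zero_fun_def)
  then have "(\<Sum>n\<in>N. wsum (filter (%w. word_degree w = n) (x # xs))) = wg x + wsum xs"
   using Cons by (simp only: sum.distrib sum.delta) auto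
  then show ?case by (simp only: list.map sum_list.Cons)
 qed (simp only: filter.simps list.map sum_list.Nil sum.neutral_const)
 from this[of ?D] nz show dec: "is_decomposition TG (wsum xs) ?f"
  unfolding is_decomposition_def
  by (intro conjI allI T_gradeI) (use xs finite_subset[OF nz] in \<open>auto intro: sum.mono_neutral_right\<close>)
 show "hparts TG (wsum xs) = ?f"
  unfolding hparts_def
 proof (rule the_equality[where P = "is_decomposition TG (wsum xs)", OF dec])
  fix f assume f: "is_decomposition TG (wsum xs) f"
  show "f = ?f"
  proof (intro ext)
   fix n \<phi>
   have fn: "f n \<in> TG n" for n using f by (simp add: is_decomposition_def)
   show "f n \<phi> = ?f n \<phi>"
   proof (cases "\<phi> \<in> WF")
    case True
    \<comment> \<open>The form cut down to degree n, again balanced by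
      \<open>WF_degree\<close>.\<close>
    let ?\<phi> = "%w. if word_degree w = n then \<phi> w else 0"
    have z: "f m ?\<phi> = (if m = n then f n \<phi> else 0)" for m
    proof -
     obtain ys where ys: "ys \<in> lists words" "!!y. y \<in> set ys ==> word_degree y = m" "f m = wsum ys" using T_gradeE[OF fn] by blast
     have "filter (%w. word_degree w = n) ys = (if m = n then ys else [])" using ys(2) by (induction ys) auto
     then show ?thesis using wsum_filter[OF ys(1) True, of n] ys(3) by auto
    qed
    have "wsum xs ?\<phi> = (\<Sum>m | f m ~= 0. f m ?\<phi>)" using f by (simp only: is_decomposition_def sum_apply)
    also have "... = f n \<phi>" using f unfolding z by (auto simp: is_decomposition_def)
    finally show ?thesis using wsum_filter[OF xs True] by simp
   next
    case False
    then show ?thesis using T_gradeE[OF fn[of n]] wsum_not by metis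
   qed
  qed
 qed
qed

lemma hparts_sum:
 fixes G :: "nat => (('h, 'v) word, 'k) quot => 'k"
 assumes zs: "zs \<in> lists words" and G: "!!j ys. ys \<in> lists words ==> G j (wsum ys) = (SUM y<-ys. g j y)"
 shows "(\<Sum>j | hparts TG (wsum zs) j ~= 0. G j (hparts TG (wsum zs) j)) = (SUM z<-zs. g (word_degree z) z)"
proof -
 let ?f = "%n. filter (%w. word_degree w = n) zs"
 have G0: "G j 0 = 0" for j using G[of "[]" j] by (simp only: list.map sum_list.Nil) simp
 have nz: "{n. wsum (?f n) ~= 0} \<subseteq> word_degree ` set zs"
 proof
  fix n assume "n \<in> {n. wsum (?f n) ~= 0}"
  then have "?f n ~= []" by (metis (mono_tags, lifting) list.simps(8) mem_Collect_eq sum_list.Nil)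
  then show "n \<in> word_degree ` set zs" by (auto simp: filter_empty_conv)
 qed
 have "(\<Sum>j | hparts TG (wsum zs) j ~= 0. G j (hparts TG (wsum zs) j)) = (\<Sum>j\<in>word_degree ` set zs. G j (wsum (?f j)))"
  unfolding T_parts(2)[OF zs] by (rule sum.mono_neutral_left) (use nz in \<open>auto simp: G0\<close>)
 also have "... = (\<Sum>j\<in>word_degree ` set zs. SUM y<-?f j. g j y)" using zs by (intro sum.cong G) auto
 also have "... = (SUM z<-zs. g (word_degree z) z)"
 proof -
  have "(\<Sum>j\<in>N. SUM y<-?f j. g j y) = (SUM z<-zs. g (word_degree z) z)" if "finite N" "word_degree ` set zs \<subseteq> N" for N
   using that
  proof (induction zs)
   case (Cons x xs)
   have "(SUM y<-filter (%w. word_degree w = j) (x # xs). g j y) = (if j = word_degree x then g (word_degree x) x else 0) + (SUM y<-filter (%w. word_degree w = j) xs. g j y)" for j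
    by simp
   then show ?case using Cons by (simp only: sum.distrib sum.delta) auto
  qed simp
  then show ?thesis by simp
 qed
 finally show ?thesis .
qed

abbreviation "tw x y \<equiv> tens T T (wg x) (wg y)"

lemma tw_PF: "(%x y. tw x y \<phi>) \<in> PF"
proof (cases "\<phi> \<in> tensor_forms T T")
 case True
 then have "bilinear_map T T ground (%x y. \<phi> (x, y))" by (simp add: tensor_forms_def curry_def)
 from T_bi_PF[OF this] show ?thesis using True by (simp add: tens_apply)
qed (simp add: tens_apply PF_def forms_zero[OF forms_WF])

lemma T_tlift:
 assumes C: "is_space C" and f: "bilinear_map T T C f" and L: "L \<in> lists (words \<times> words)"
 shows "tlift T T f (ssum L tw) = ssum L (%x y. f (wg x) (wg y))"
proof -
 have "map (%(x, y). (wg x, wg y)) L \<in> lists (elems T \<times> elems T)" using L by fastforce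
 from tlift_sum[OF C f this] show ?thesis by (simp add: ssum_def comp_def case_prod_beta')
qed

lemma bilinear_pointwise:
 assumes "!!\<phi>. bilinear_map T T ground (%a b. f a b \<phi>)"
 shows "bilinear_map T T (full fun_scale) (f :: _ => _ => ('x, 'k) quot)"
 using assms by (simp add: bilinear_map_def linear_map_def fun_eq_iff fun_scale_def)

lemma is_space_quot: "is_space (full fun_scale :: ('k, ('x, 'k) quot) space)"
 by (simp add: is_space_full vector_space_fun_scale)

lemma stm_term:
 assumes B: "bilinear_map T T ground B"
  and l: "xs \<in> lists words" "ys \<in> lists words" "zs \<in> lists words" "ws \<in> lists words"
 shows "(\<Sum>i | hparts TG (wsum ys) i ~= 0. \<Sum>j | hparts TG (wsum zs) j ~= 0.
   (- 1) ^ (i * j) * B (T_mult H M (wsum xs) (hparts TG (wsum zs) j)) (T_mult H M (hparts TG (wsum ys) i) (wsum ws))) =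
  (SUM x<-xs. SUM y<-ys. SUM z<-zs. SUM w<-ws. (- 1) ^ (word_degree y * word_degree z) * B (wg (wm x z)) (wg (wm y w)))"
proof -
 have m: "T_mult H M (wsum xs) (wsum ys) = wsum (concat (map (%x. map (wm x) ys) xs))"
  and c: "concat (map (%x. map (wm x) ys) xs) \<in> lists words" if "xs \<in> lists words" "ys \<in> lists words" for xs ys
  using that by (auto simp: T_mult_wsum sum_list_products)
 have b: "B (T_mult H M (wsum xs) (wsum zs)) (T_mult H M (wsum ys) (wsum ws)) =
   (SUM x<-xs. SUM z<-zs. SUM y<-ys. SUM w<-ws. B (wg (wm x z)) (wg (wm y w)))"
  if "xs \<in> lists words" "ys \<in> lists words" "zs \<in> lists words" "ws \<in> lists words" for xs ys zs ws
 proof -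
  show ?thesis unfolding m[OF that(1,3)] m[OF that(2,4)] T_bi_sum[OF B c[OF that(1,3)] c[OF that(2,4)]] by (simp only: sum_list_products)
 qed
 have r: "(SUM x<-xs. c * f x) = c * (SUM x<-xs. f x)" for c :: 'k and xs :: "('h, 'v) word list" and f by (rule sum_list_const_mult)
 have "(\<Sum>j | hparts TG (wsum zs) j ~= 0. (- 1) ^ (i * j) * B (T_mult H M (wsum xs) (hparts TG (wsum zs) j)) (T_mult H M (wsum ys) (wsum ws))) =
   (SUM z<-zs. (- 1) ^ (i * word_degree z) * (SUM x<-xs. SUM y<-ys. SUM w<-ws. B (wg (wm x z)) (wg (wm y w))))"
  if "ys \<in> lists words" for i ys
  by (rule hparts_sum[OF l(3)]) (simp add: b l that r sum_list_swap[of _ xs])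
 also have "... i ys = (SUM y<-ys. SUM x<-xs. SUM z<-zs. SUM w<-ws. (- 1) ^ (i * word_degree z) * B (wg (wm x z)) (wg (wm y w)))" for i ys
  by (simp add: r[symmetric] sum_list_swap[of _ ys] sum_list_swap[of _ xs zs])
 finally have in': "ys \<in> lists words ==> (\<Sum>j | hparts TG (wsum zs) j ~= 0. (- 1) ^ (i * j) * B (T_mult H M (wsum xs) (hparts TG (wsum zs) j)) (T_mult H M (wsum ys) (wsum ws))) =
   (SUM y<-ys. SUM x<-xs. SUM z<-zs. SUM w<-ws. (- 1) ^ (i * word_degree z) * B (wg (wm x z)) (wg (wm y w)))" for i ys .
 show ?thesis
  by (subst hparts_sum[OF l(2), where G = "%i b. \<Sum>j | hparts TG (wsum zs) j ~= 0. (- 1) ^ (i * j) * B (T_mult H M (wsum xs) (hparts TG (wsum zs) j)) (T_mult H M b (wsum ws))", OF in'])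
   (simp_all add: sum_list_swap[of _ xs ys])
qed

text \<open>The super tensor product of two lists of pairs; the sign is absorbed into the left word
  so that the result is again a plain list.\<close>

definition LM :: "(('h, 'v) word \<times> ('h, 'v) word) list => (('h, 'v) word \<times> ('h, 'v) word) list => (('h, 'v) word \<times> ('h, 'v) word) list" where
 "LM L K = concat (map (%(a, b). map (%(c, e). (sc ((- 1) ^ (word_degree b * word_degree c)) (wm a c), wm b e)) K) L)"

lemma ssum_LM': "ssum (LM L K) f = ssum L (%a b. ssum K (%c e. f (sc ((- 1) ^ (word_degree b * word_degree c)) (wm a c)) (wm b e)))"
proof (induction L)
 case (Cons p L)
 obtain a b where p: "p = (a, b)" by (cases p)
 have "LM (p # L) K = map (%(c, e). (sc ((- 1) ^ (word_degree b * word_degree c)) (wm a c), wm b e)) K @ LM L K"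
  by (simp add: LM_def p)
 then show ?case using Cons by (simp add: p ssum_append ssum_map)
qed (simp add: LM_def)

lemma LM_words: "L \<in> lists (words \<times> words) ==> K \<in> lists (words \<times> words) ==> LM L K \<in> lists (words \<times> words)"
 by (fastforce simp: LM_def)

lemma ssum_LM:
 assumes "\<Phi> \<in> PF" "L \<in> lists (words \<times> words)" "K \<in> lists (words \<times> words)"
 shows "ssum (LM L K) \<Phi> = ssum L (%a b. ssum K (%c e. (- 1) ^ (word_degree b * word_degree c) * \<Phi> (wm a c) (wm b e)))"
 unfolding ssum_LM' by (intro ssum_cong WF_sc[OF PF1[OF assms(1)]]) (auto dest!: lists_TimesD[OF assms(2)] lists_TimesD[OF assms(3)])

lemma T_stm:
 assumes L: "L \<in> lists (words \<times> words)" and K: "K \<in> lists (words \<times> words)"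
 shows "super_tensor_mult T TG (T_mult H M) (ssum L tw) (ssum K tw) = ssum (LM L K) tw"
proof -
 let ?F = "%a b c e. \<Sum>i | hparts TG b i ~= 0. \<Sum>j | hparts TG c j ~= 0.
     fun_scale ((- 1) ^ (i * j)) (tens T T (T_mult H M a (hparts TG c j)) (T_mult H M (hparts TG b i) e))"
 have sum_apply: "(sum F A) \<phi> = (\<Sum>x\<in>A. F x \<phi>)" for F :: "nat => ((('h, 'v) word, 'k) quot \<times> (('h, 'v) word, 'k) quot, 'k) quot" and A \<phi>
  by (induction A rule: infinite_finite_induct) auto
 have F: "?F (wsum xs) (wsum ys) (wsum zs) (wsum ws) \<phi> =
   (SUM x<-xs. SUM y<-ys. SUM z<-zs. SUM w<-ws. (- 1) ^ (word_degree y * word_degree z) * tw (wm x z) (wm y w) \<phi>)"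
  if "xs \<in> lists words" "ys \<in> lists words" "zs \<in> lists words" "ws \<in> lists words" for xs ys zs ws \<phi>
 proof (cases "\<phi> \<in> tensor_forms T T")
  case True
  then have B: "bilinear_map T T ground (%x y. \<phi> (x, y))" by (simp add: tensor_forms_def curry_def)
  show ?thesis
   using stm_term[OF B that] True by (simp add: sum_apply fun_scale_def tens_apply)
 qed (simp add: sum_apply fun_scale_def tens_apply)
 have P1: "(%z w. (- 1) ^ (word_degree y * word_degree z) * tw (wm x z) (wm y w) \<phi>) \<in> PF" if "x \<in> words" "y \<in> words" for x y \<phi>
  using that by (auto simp: PF_def intro!: forms_mult[OF forms_WF] WF_wm2[OF PF2[OF tw_PF]]
   WF_degree[of "%z. tw (wm _ z) (wm _ _) _" "%n. (- 1) ^ (_ * n)"] WF_wm2[OF PF1[OF tw_PF]])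
 have P2: "(%x y. (- 1) ^ (word_degree y * word_degree z) * tw (wm x z) (wm y w) \<phi>) \<in> PF" if "z \<in> words" "w \<in> words" for z w \<phi>
  using that by (auto simp: PF_def intro!: forms_mult[OF forms_WF] WF_wm1[OF PF1[OF tw_PF]]
   WF_degree[of "%y. tw (wm _ _) (wm y _) _" "%n. (- 1) ^ (n * _)"] WF_wm1[OF PF2[OF tw_PF]])
 have PS: "(%x y. SUM p<-ps. f p x y) \<in> PF" if "!!p. p \<in> set ps ==> f p \<in> PF" for f :: "'q => ('h, 'v) word => ('h, 'v) word => 'k" and ps
  using that by (auto simp: PF_def intro!: WF_sum)
 have b1: "bilinear_map T T (full fun_scale) (?F a b)" if ab: "a \<in> elems T" "b \<in> elems T" for a b
 proof (rule bilinear_pointwise)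
  fix \<phi>
  obtain xs ys where xs: "xs \<in> lists words" "a = wsum xs" and ys: "ys \<in> lists words" "b = wsum ys" using ab by (auto simp: elems_T)
  show "bilinear_map T T ground (%c e. ?F a b c e \<phi>)"
  proof (rule T_biI[of "%z w. SUM x<-xs. SUM y<-ys. (- 1) ^ (word_degree y * word_degree z) * tw (wm x z) (wm y w) \<phi>"])
   show "(%z w. SUM x<-xs. SUM y<-ys. (- 1) ^ (word_degree y * word_degree z) * tw (wm x z) (wm y w) \<phi>) \<in> PF"
    by (intro PS P1) (use xs ys in auto)
  next
   fix zs ws :: "('h, 'v) word list" assume l: "zs \<in> lists words" "ws \<in> lists words"
   show "?F a b (wsum zs) (wsum ws) \<phi> = (SUM z<-zs. SUM w<-ws. SUM x<-xs. SUM y<-ys. (- 1) ^ (word_degree y * word_degree z) * tw (wm x z) (wm y w) \<phi>)"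
    unfolding xs ys F[OF xs(1) ys(1) l] by (simp only: sum_list_swap[of _ ws ys] sum_list_swap[of _ zs ys] sum_list_swap[of _ ws xs] sum_list_swap[of _ zs xs])
  qed
 qed
 have 1: "tlift T T (?F a b) (ssum K tw) = ssum K (%c e. ?F a b (wg c) (wg e))" if "a \<in> elems T" "b \<in> elems T" for a b
  by (rule T_tlift[OF is_space_quot b1[OF that] K])
 have b2: "bilinear_map T T (full fun_scale) (%a b. tlift T T (?F a b) (ssum K tw))"
 proof (rule bilinear_pointwise)
  fix \<phi>
  have "(%x y. ssum K (%z w. (- 1) ^ (word_degree y * word_degree z) * tw (wm x z) (wm y w) \<phi>)) \<in> PF"
   unfolding ssum_def case_prod_beta' by (intro PS P2) (auto dest!: lists_TimesD[OF K])
  then show "bilinear_map T T ground (%a b. tlift T T (?F a b) (ssum K tw) \<phi>)"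
  proof (rule T_biI)
   fix xs ys :: "('h, 'v) word list" assume l: "xs \<in> lists words" "ys \<in> lists words"
   have "tlift T T (?F (wsum xs) (wsum ys)) (ssum K tw) \<phi> = ssum K (%c e. SUM x<-xs. SUM y<-ys. (- 1) ^ (word_degree y * word_degree c) * tw (wm x c) (wm y e) \<phi>)"
    unfolding 1[OF wsum_T[OF l(1)] wsum_T[OF l(2)]] ssum_apply
    by (rule ssum_cong) (use F[OF l, of "[_]" "[_]"] in \<open>auto dest!: lists_TimesD[OF K]\<close>)
   then show "tlift T T (?F (wsum xs) (wsum ys)) (ssum K tw) \<phi> = (SUM x<-xs. SUM y<-ys. ssum K (%c e. (- 1) ^ (word_degree y * word_degree c) * tw (wm x c) (wm y e) \<phi>))"
    unfolding ssum_def case_prod_beta' by (simp only: sum_list_swap[of _ K])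
  qed
 qed
 show ?thesis
 proof
  fix \<phi>
  have "super_tensor_mult T TG (T_mult H M) (ssum L tw) (ssum K tw) = ssum L (%a b. tlift T T (?F (wg a) (wg b)) (ssum K tw))"
   unfolding super_tensor_mult_def by (rule T_tlift[OF is_space_quot b2 L])
  also have "... = ssum L (%a b. ssum K (%c e. ?F (wg a) (wg b) (wg c) (wg e)))"
   by (rule ssum_cong, rule 1) (auto dest!: lists_TimesD[OF L])
  finally have "super_tensor_mult T TG (T_mult H M) (ssum L tw) (ssum K tw) \<phi> = ssum L (%a b. ssum K (%c e. ?F (wg a) (wg b) (wg c) (wg e) \<phi>))"
   by (simp only: ssum_apply)
  also have "... = ssum L (%a b. ssum K (%c e. (- 1) ^ (word_degree b * word_degree c) * tw (wm a c) (wm b e) \<phi>))"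
   by (intro ssum_cong) (use F[of "[_]" "[_]" "[_]" "[_]"] in \<open>auto dest!: lists_TimesD[OF L] lists_TimesD[OF K]\<close>)
  finally show "super_tensor_mult T TG (T_mult H M) (ssum L tw) (ssum K tw) \<phi> = ssum (LM L K) tw \<phi>"
   unfolding ssum_apply ssum_LM[OF tw_PF L K] .
 qed
qed

end

lemma forms_ssum_set: "forms F ==> (!!a b. (a, b) \<in> set r ==> (%x. f x a b) \<in> F) ==> (%x. ssum r (f x)) \<in> F"
proof (induction r)
 case (Cons p r)
 obtain a b where p: "p = (a, b)" by (cases p)
 have "(%x. f x a b + ssum r (f x)) \<in> F" by (rule forms_add) (use Cons p in auto)
 then show ?case by (simp add: p)
qed (simp add: forms_zero)

section \<open>Coproduct, counit and antipode on words\<close>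

context bicov
begin

abbreviation "VV \<equiv> VB H M"
abbreviation "A \<equiv> antipode1 H M"

lemma coact_tensor: "lcoact M v \<in> elems (tensor (hspace H) (vspace M))" "rcoact M v \<in> elems (tensor (vspace M) (hspace H))"
 and comult_tensor: "hcomult H h \<in> elems (tensor (hspace H) (hspace H))"
 using bcV coH by (auto simp: bicomodule_def Let_def linear_map_def is_coalgebra_def)

text \<open>A list of words representing \<open>T_comult1\<close>; \<open>Kh\<close> does this in
  degree 0, and \<open>Lw\<close> multiplies the lists of the letters of a word.\<close>

definition Kv :: "'v => (('h, 'v) word \<times> ('h, 'v) word) list" where
 "Kv v = map (%(h, w). (Inl h, Inr [w])) (bL VV v) @ map (%(w, h). (Inr [w], Inl h)) (bR VV v)"

definition Kh :: "'h => (('h, 'v) word \<times> ('h, 'v) word) list" where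
 "Kh h = map (%(a, b). (Inl a, Inl b)) (cD (HC H) h)"

definition Lw :: "'v list => (('h, 'v) word \<times> ('h, 'v) word) list" where
 "Lw vs = foldr (%v. LM (Kv v)) vs [(Inl (hone H), Inl (hone H))]"

lemma K_words: "Kv v \<in> lists (words \<times> words)" "Kh h \<in> lists (words \<times> words)"
 by (auto simp: Kv_def Kh_def)

lemma Lw_words: "Lw vs \<in> lists (words \<times> words)"
 by (induction vs) (simp_all add: Lw_def LM_words[OF K_words(1)])

lemma ssum_Kv: "ssum (Kv v) f = ssum (bL VV v) (%h w. f (Inl h) (Inr [w])) + ssum (bR VV v) (%w h. f (Inr [w]) (Inl h))"
 and ssum_Kh: "ssum (Kh h) f = ssum (cD (HC H) h) (%a b. f (Inl a) (Inl b))"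
 by (simp_all add: Kv_def Kh_def ssum_append ssum_map)

lemma PF_slices: assumes "\<Phi> \<in> PF"
 shows "y \<in> words ==> (%h. \<Phi> (Inl h) y) \<in> hlin H" "y \<in> words ==> (%w. \<Phi> (Inr [w]) y) \<in> vlin M"
  "x \<in> words ==> (%h. \<Phi> x (Inl h)) \<in> hlin H" "x \<in> words ==> (%w. \<Phi> x (Inr [w])) \<in> vlin M"
 by (rule WF_h[OF PF1[OF assms]] WF_v0[OF PF1[OF assms]] WF_h[OF PF2[OF assms]] WF_v0[OF PF2[OF assms]]; assumption)+

lemma T_comult1: "T_comult1 H M v = ssum (Kv v) tw"
proof -
 have "tlift (hspace H) (vspace M) (%h w. tw (Inl h) (Inr [w])) (lcoact M v) = ssum (bL VV v) (%h w. tw (Inl h) (Inr [w]))"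
  "tlift (vspace M) (hspace H) (%w h. tw (Inr [w]) (Inl h)) (rcoact M v) = ssum (bR VV v) (%w h. tw (Inr [w]) (Inl h))"
  unfolding VB_simps by (rule tlift_quot[OF _ coact_tensor(1)] tlift_quot[OF _ coact_tensor(2)], simp add: biI PF_slices[OF tw_PF])+
 then show ?thesis by (simp only: T_comult1_def ssum_Kv)
qed

lemma word_comult_Inl: "word_comult H M (Inl h) = ssum (Kh h) tw"
 unfolding word_comult.simps ssum_Kh HC_simps
 by (rule tlift_quot[OF _ comult_tensor]) (simp add: biI PF_slices[OF tw_PF])

lemma word_comult_Inr: "word_comult H M (Inr vs) = ssum (Lw vs) tw"
proof (induction vs)
 case (Cons v vs)
 have "Lw (v # vs) = LM (Kv v) (Lw vs)" by (simp add: Lw_def)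
 then show ?case using Cons T_stm[OF K_words(1) Lw_words, of v vs] by (simp add: T_comult1)
qed (simp add: Lw_def T_one_def)

text \<open>The transpose of left multiplication by the tensor \<open>K\<close> for the super
  product. Peeling letters off the front of a word thus becomes a left fold on bilinear
  forms.\<close>

definition DK :: "(('h, 'v) word \<times> ('h, 'v) word) list => (('h, 'v) word => ('h, 'v) word => 'k) => ('h, 'v) word => ('h, 'v) word => 'k" where
 "DK K \<Phi> c e = ssum K (%a b. (- 1) ^ (word_degree b * word_degree c) * \<Phi> (wm a c) (wm b e))"

lemma DK_PF:
 assumes K: "K \<in> lists (words \<times> words)" and \<Phi>: "\<Phi> \<in> PF" shows "DK K \<Phi> \<in> PF"
 unfolding PF_def DK_def
 by (auto intro!: forms_ssum_set[OF forms_WF] forms_mult[OF forms_WF] WF_wm2[OF PF2[OF \<Phi>]] WF_wm2[OF PF1[OF \<Phi>]]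
  WF_degree[of "%c. \<Phi> (wm _ c) _" "%n. (- 1) ^ (_ * n)"] dest!: lists_TimesD[OF K])

lemma DK_cong:
 assumes "K \<in> lists (words \<times> words)" "!!x y. x \<in> words ==> y \<in> words ==> \<Phi> x y = \<Psi> x y" "c \<in> words" "e \<in> words"
 shows "DK K \<Phi> c e = DK K \<Psi> c e"
 unfolding DK_def by (rule ssum_cong) (use assms(2-4) in \<open>auto dest!: lists_TimesD[OF assms(1)]\<close>)

lemma ssum_Lw_Cons: "\<Phi> \<in> PF ==> ssum (Lw (v # vs)) \<Phi> = ssum (Lw vs) (DK (Kv v) \<Phi>)"
proof -
 assume "\<Phi> \<in> PF"
 from ssum_LM[OF this K_words(1) Lw_words, of v vs] show ?thesis
  unfolding DK_def ssum_swap[of "Lw vs"] by (simp add: Lw_def)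
qed

lemma foldl_PF: "\<Phi> \<in> PF ==> foldl (%\<Phi> u. DK (Kv u) \<Phi>) \<Phi> us \<in> PF"
 by (induction us arbitrary: \<Phi>) (simp_all add: DK_PF[OF K_words(1)])

lemma ssum_Lw_append: "\<Phi> \<in> PF ==> ssum (Lw (us @ ws)) \<Phi> = ssum (Lw ws) (foldl (%\<Phi> u. DK (Kv u) \<Phi>) \<Phi> us)"
 by (induction us arbitrary: \<Phi>) (simp_all add: ssum_Lw_Cons DK_PF[OF K_words(1)])

lemma wm_assoc_Inl: "x \<in> words ==> wm (Inl g) (wm (Inl a) x) = wm (Inl (hmult H g a)) x"
 and wm_Inl_Inr: "x \<in> words ==> wm (Inl a) (wm (Inr [w]) x) = wm (Inr [lact M a w]) x"
 by (elim words_cases; simp add: mu_assoc lact_assoc lact_ract)+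

lemma wm_Inr_Inl: "\<phi> \<in> WF ==> x \<in> words ==> \<phi> (wm (Inr [w]) (wm (Inl b) x)) = \<phi> (wm (Inr [ract M w b]) x)"
 by (elim words_cases; simp add: ract_assoc WF_b0)

lemma DK_term_bi:
 assumes \<Phi>: "\<Phi> \<in> PF" and c: "c \<in> words" and e: "e \<in> words"
 shows "(%h w. r * \<Phi> (wm (Inl h) c) (wm (Inr [w]) e)) \<in> bi (hlin H) (vlin M)"
  "(%w h. r * \<Phi> (wm (Inr [w]) c) (wm (Inl h) e)) \<in> bi (vlin M) (hlin H)"
 by (intro biI forms_mult[OF forms_lin] WF_h[OF WF_wm1[OF PF1[OF \<Phi>] c]] WF_v0[OF WF_wm1[OF PF2[OF \<Phi>] e]]
  WF_v0[OF WF_wm1[OF PF1[OF \<Phi>] c]] WF_h[OF WF_wm1[OF PF2[OF \<Phi>] e]]; simp add: c e)+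

lemma DK_Kv: "c \<in> words ==> DK (Kv v) \<Phi> c e = ssum (bL VV v) (%h w. (- 1) ^ word_degree c * \<Phi> (wm (Inl h) c) (wm (Inr [w]) e)) +
  ssum (bR VV v) (%w h. 1 * \<Phi> (wm (Inr [w]) c) (wm (Inl h) e))"
 by (simp add: DK_def ssum_Kv)

lemma DK_lin:
 assumes "\<Phi> \<in> PF" "c \<in> words" "e \<in> words" shows "(%v. DK (Kv v) \<Phi> c e) \<in> vlin M"
 unfolding DK_Kv[OF assms(2)]
 using bcm_bL[OF bcmV, unfolded VB_simps HC_simps, OF DK_term_bi(1)[OF assms]] bcm_bR[OF bcmV, unfolded VB_simps HC_simps, OF DK_term_bi(2)[OF assms]]
 unfolding VB_simps by (rule forms_add[OF forms_lin])

text \<open>Bicovariance says that the coproduct of v h is that of v times that of h; no sign arises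
  because h has degree 0. Together with \<open>DK_lact\<close> this carries the balancing relation
  through the coproduct.\<close>

lemma DK_ract:
 assumes \<Phi>: "\<Phi> \<in> PF" and c: "c \<in> words" and e: "e \<in> words"
 shows "DK (Kv (ract M v h)) \<Phi> c e = DK (Kh h) (DK (Kv v) \<Phi>) c e"
proof -
 have r: "\<Phi> (wm (Inl g) (wm (Inl a) c)) (wm (Inr [w]) (wm (Inl b) e)) = \<Phi> (wm (Inl (hmult H g a)) c) (wm (Inr [ract M w b]) e)"
  "\<Phi> (wm (Inr [w]) (wm (Inl a) c)) (wm (Inl g) (wm (Inl b) e)) = \<Phi> (wm (Inr [ract M w a]) c) (wm (Inl (hmult H g b)) e)" for g a w b
  using c e by (simp_all add: wm_assoc_Inl wm_Inr_Inl[OF PF1[OF \<Phi>]] wm_Inr_Inl[OF PF2[OF \<Phi>]])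
 have "DK (Kh h) (DK (Kv v) \<Phi>) c e = ssum (cD (HC H) h) (%a b. DK (Kv v) \<Phi> (wm (Inl a) c) (wm (Inl b) e))"
  by (simp only: DK_def[of "Kh h"] ssum_Kh) simp
 then show ?thesis
  using c by (simp add: DK_Kv ract_bL[OF DK_term_bi(1)[OF \<Phi> c e]] ract_bR[OF DK_term_bi(2)[OF \<Phi> c e, of 1, simplified]] r ssum_add ssum_swap[of "cD (HC H) h"] del: HC_simps VB_simps)
qed

lemma DK_lact:
 assumes \<Phi>: "\<Phi> \<in> PF" and c: "c \<in> words" and e: "e \<in> words"
 shows "DK (Kv (lact M h w)) \<Phi> c e = DK (Kv w) (DK (Kh h) \<Phi>) c e"
proof -
 have d: "DK (Kh h) \<Phi> x y = ssum (cD (HC H) h) (%a b. \<Phi> (wm (Inl a) x) (wm (Inl b) y))" for x y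
  by (simp only: DK_def ssum_Kh) simp
 show ?thesis
  using c e by (simp add: DK_Kv lact_bL[OF DK_term_bi(1)[OF \<Phi> c e]] lact_bR[OF DK_term_bi(2)[OF \<Phi> c e, of 1, simplified]] d wm_assoc_Inl wm_Inl_Inr ssum_mult_left[symmetric] ssum_swap[of "cD (HC H) h"] del: HC_simps VB_simps)
qed

definition Cw :: "('h, 'v) word => (('h, 'v) word \<times> ('h, 'v) word) list" where
 "Cw = case_sum Kh Lw"

lemma Cw_words: "Cw w \<in> lists (words \<times> words)"
 by (cases w) (simp_all only: Cw_def sum.case K_words Lw_words)

lemma word_comult: "word_comult H M w = ssum (Cw w) tw"
 by (cases w) (simp_all only: Cw_def sum.case word_comult_Inl word_comult_Inr)

text \<open>Shows that the coproduct of words descends to the quotient. The prefix \<open>us\<close>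
  is folded into the form, so the balancing relation need only be checked at the front, where both
  sides are the product of the coproducts of v, h and w.\<close>

lemma Cw_WF: assumes \<Phi>: "\<Phi> \<in> PF" shows "(%w. ssum (Cw w) \<Phi>) \<in> WF"
proof (rule WFI; unfold Cw_def sum.case)
 have "(%a b. \<Phi> (Inl a) (Inl b)) \<in> bi (cF (HC H)) (cF (HC H))" by (simp add: biI PF_slices[OF \<Phi>])
 from cog_cD[OF cog this] show "(%h. ssum (Kh h) \<Phi>) \<in> hlin H" unfolding ssum_Kh by simp
 fix us ws
 note f = foldl_PF[OF \<Phi>, of us]
 show "(%v. ssum (Lw (us @ v # ws)) \<Phi>) \<in> vlin M"
  unfolding ssum_Lw_append[OF \<Phi>] ssum_Lw_Cons[OF f]
  by (rule forms_ssum_set[OF forms_lin]) (auto intro!: DK_lin f dest!: lists_TimesD[OF Lw_words])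
 fix v h w
 show "ssum (Lw (us @ ract M v h # w # ws)) \<Phi> = ssum (Lw (us @ v # lact M h w # ws)) \<Phi>"
  unfolding ssum_Lw_append[OF \<Phi>] ssum_Lw_Cons[OF f] ssum_Lw_Cons[OF DK_PF[OF K_words(1) f]]
 proof (rule ssum_cong)
  fix x y assume "(x, y) \<in> set (Lw ws)"
  then have xy: "x \<in> words" "y \<in> words" by (auto dest!: lists_TimesD[OF Lw_words])
  show "DK (Kv w) (DK (Kv (ract M v h)) (foldl (%\<Phi> u. DK (Kv u) \<Phi>) \<Phi> us)) x y =
    DK (Kv (lact M h w)) (DK (Kv v) (foldl (%\<Phi> u. DK (Kv u) \<Phi>) \<Phi> us)) x y"
   unfolding DK_lact[OF DK_PF[OF K_words(1) f] xy] by (rule DK_cong[OF K_words(1) DK_ract[OF f] xy])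
 qed
qed

lemma scomult_T: "xs \<in> lists words ==> scomult (T_minus_one H M) (wsum xs) = (SUM x<-xs. ssum (Cw x) tw)"
 unfolding T_minus_one_def super_hopf.simps word_comult[symmetric]
 by (rule gen_lift_words) (simp_all only: word_comult ssum_apply Cw_WF[OF tw_PF])

lemma scounit_T: "xs \<in> lists words ==> scounit (T_minus_one H M) (wsum xs) = (SUM x<-xs. word_counit H x)"
proof -
 have c: "linear_map (hspace H) ground (hcounit H)" using coH by (simp add: is_coalgebra_def)
 have "\<psi> \<circ> word_counit H \<in> WF" if \<psi>: "linear_map ground ground \<psi>" for \<psi>
 proof -
  have "\<psi> \<in> lin (*)" using \<psi> by (simp only: lin_def mem_Collect_eq)
  from linear_map_lin[OF c this] lin_0[OF this] show ?thesis by (intro WFI) (simp_all add: forms_zero[OF forms_lin])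
 qed
 then show "xs \<in> lists words ==> ?thesis"
  unfolding T_minus_one_def super_hopf.simps using is_space_ground by (intro gen_lift_sum[of "(*)"]) (simp_all add: is_space_full)
qed

lemma T_antipode1: "T_antipode1 H M v = wg (Inr [A v])"
proof -
 let ?f = "%a u c. ract M (lact M (hantipode H a) u) (hantipode H c)"
 have "bicoact3 H M (%a u c. wg (Inr [?f a u c])) v = ssum (bR VV v) (%w c. ssum (bL VV w) (%a u. wg (Inr [?f a u c])))"
 proof (rule bicoact3_sw[OF bcV vector_space_fun_scale, unfolded is_sw_def, rule_format])
  fix \<psi> :: "(('h, 'v) word, 'k) quot => 'k" assume "\<psi> \<in> lin fun_scale"
  then have "linear_map T ground \<psi>" by (simp add: lin_def linear_map_def scl_T)
  note \<phi> = WF_v0[OF T_lin_WF[OF this], of "[]"]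
  show "(%a u c. \<psi> (wg (Inr [?f a u c]))) \<in> tri (cF (HC H)) (bF VV) (cF (HC H))"
   unfolding HC_simps VB_simps
   by (intro triI S_lin[OF act_form(1)[OF act_form(3)[OF \<phi>]]] act_form(2)[OF act_form(3)[OF \<phi>]] S_lin[OF act_form(4)[OF \<phi>]])
 qed
 then have "T_antipode1 H M v \<phi> = - ssum (bR VV v) (%w c. ssum (bL VV w) (%a u. wg (Inr [?f a u c]) \<phi>))" for \<phi>
  by (simp add: T_antipode1_def ssum_apply)
 then show ?thesis using antipode1_form[OF WF_v0[where ws = "[]"], of _ v] by (auto simp: fun_eq_iff wg_apply)
qed

text \<open>The sign of reversing n odd letters, which is (-1) to the power n(n-1)/2.\<close>

definition csg :: "nat => 'k" where "csg n = (\<Prod>i<n. (- 1) ^ i)"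

lemma list_antipode: "vs ~= [] ==> list_antipode H M vs = wg (sc (csg (length vs)) (Inr (rev (map A vs))))"
proof (induction vs rule: list_nonempty_induct)
 case (single v)
 have "wg (Inr [A v]) = wg (sc 1 (Inr [A v]))" by (rule wg_eqI) (simp add: WF_sc del: word_scale.simps)
 then show ?case by (simp add: T_antipode1 T_one_def T_mult_wg csg_def lact_one fun_scale_def)
next
 case (cons v vs)
 let ?X = "Inr (rev (map A vs))" and ?n = "length vs"
 have X: "?X \<in> words" and Av: "Inr [A v] \<in> words" using cons by simp_all
 have "list_antipode H M (v # vs) = fun_scale ((- 1) ^ ?n) (T_mult H M (wg (sc (csg ?n) ?X)) (wg (Inr [A v])))"
  by (simp only: list_antipode.simps cons.IH T_antipode1)
 also have "... = wg (sc ((- 1) ^ ?n) (wm (sc (csg ?n) ?X) (Inr [A v])))"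
  unfolding T_mult_wg[OF sc_words[OF X] Av] wg_sc[OF wm_words[OF sc_words[OF X] Av]] ..
 also have "... = wg (sc (csg (length (v # vs))) (Inr (rev (map A (v # vs)))))"
 proof (rule wg_eqI)
  fix \<phi> assume \<phi>: "\<phi> \<in> WF"
  have eq: "Inr (rev (map A (v # vs))) = wm ?X (Inr [A v])" by simp
  have "\<phi> (wm (sc (csg ?n) ?X) (Inr [A v])) = csg ?n * \<phi> (wm ?X (Inr [A v]))"
   by (rule WF_sc[OF WF_wm1[OF \<phi>] X]) simp
  then show "\<phi> (sc ((- 1) ^ ?n) (wm (sc (csg ?n) ?X) (Inr [A v]))) = \<phi> (sc (csg (length (v # vs))) (Inr (rev (map A (v # vs)))))"
   unfolding eq WF_sc[OF \<phi> wm_words[OF sc_words[OF X] Av]] WF_sc[OF \<phi> wm_words[OF X Av]]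
   by (simp add: csg_def del: word_mult.simps word_scale.simps)
 qed
 finally show ?case .
qed

text \<open>After reversal the relation between v h, w and v, h w becomes the relation between A(w),
  S(h) A(v) and A(w) S(h), A(v), again a balancing relation by \<open>antipode1_ract\<close> and
  \<open>antipode1_lact\<close>; the sign depends only on the length.\<close>

lemma word_antipode_WF: "(%w. word_antipode H M w \<phi>) \<in> WF"
proof (cases "\<phi> \<in> WF")
 case True
 have e: "word_antipode H M (Inr vs) \<phi> = csg (length vs) * \<phi> (Inr (rev (map A vs)))" if "vs ~= []" for vs
  using that WF_sc[OF True, of "Inr (rev (map A vs))"] by (simp add: list_antipode wg_apply True del: word_scale.simps)
 show ?thesis
 proof (rule WFI)
  show "(%h. word_antipode H M (Inl h) \<phi>) \<in> hlin H" using S_lin[OF WF_h[OF True]] by (simp add: wg_apply True)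
  show "(%v. word_antipode H M (Inr (us @ v # ws)) \<phi>) \<in> vlin M" for us ws
   using forms_mult[OF forms_lin antipode1_lin[OF WF_v[OF True]]] by (simp add: e del: word_antipode.simps)
  show "word_antipode H M (Inr (us @ ract M v h # w # ws)) \<phi> = word_antipode H M (Inr (us @ v # lact M h w # ws)) \<phi>" for us v h w ws
   using WF_b[OF True] by (simp add: e antipode1_ract antipode1_lact del: word_antipode.simps)
 qed
next
 case False
 have "word_antipode H M (Inr vs) \<phi> = 0" if "vs ~= []" for vs
  using that by (simp add: list_antipode wg_apply False)
 then show ?thesis by (intro WFI) (simp_all add: wg_apply False forms_zero[OF forms_lin] del: list_antipode.simps)
qed

lemma santipode_T: "xs \<in> lists words ==> santipode (T_minus_one H M) (wsum xs) = (SUM x<-xs. word_antipode H M x)"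
 unfolding T_minus_one_def super_hopf.simps by (rule gen_lift_words) (rule word_antipode_WF)

lemma T_simps: "sspace (T_minus_one H M) = T" "sscale (T_minus_one H M) = fun_scale" "grade (T_minus_one H M) = TG"
 "smult (T_minus_one H M) = T_mult H M" "sone (T_minus_one H M) = wg (Inl (hone H))"
 by (simp_all add: T_minus_one_def T_space_def T_one_def)

end

section \<open>Quotients of the tensor algebra\<close>

context ext_core
begin

definition pw :: "('h, 'v) word => 'w" where
 "pw = case_sum (inc0 W) (%vs. foldr (%v. smult W (inc1 W v)) vs (sone W))"

lemma pw_simps [simp]: "pw (Inl h) = inc0 W h" "pw (Inr []) = sone W" "pw (Inr (v # vs)) = smult W (inc1 W v) (pw (Inr vs))"
 by (simp_all add: pw_def)

lemma pw_append: "pw (Inr (us @ vs)) = smult W (pw (Inr us)) (pw (Inr vs))"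
 by (induction us) (simp_all add: over.m_assoc over.m_unit)

lemma pw_WF: assumes \<phi>: "\<phi> \<in> lin s" shows "(%w. \<phi> (pw w)) \<in> b.WF"
proof (rule b.WFI)
 show "(%h. \<phi> (pw (Inl h))) \<in> hlin H" by (simp add: inc0_lin[OF \<phi>])
 show "(%v. \<phi> (pw (Inr (us @ v # ws)))) \<in> vlin M" for us ws
  by (simp add: pw_append inc1_lin[OF m1[OF m2[OF \<phi>]]])
 show "\<phi> (pw (Inr (us @ ract M v h # w # ws))) = \<phi> (pw (Inr (us @ v # lact M h w # ws)))" for us v h w ws
  by (simp add: pw_append inc1_left inc1_right over.m_assoc)
qed

lemma pw_mult: "x \<in> words ==> y \<in> words ==> pw (b.wm x y) = smult W (pw x) (pw y)"
proof (elim b.words_cases)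
 fix g v vs assume x: "x = Inr (v # vs)" and y: "y = Inl g"
 obtain us u where us: "v # vs = us @ [u]" by (metis append_butlast_last_id list.distinct(1))
 show "pw (b.wm x y) = smult W (pw x) (pw y)"
  unfolding x y us by (simp add: pw_append inc1_right over.m_assoc over.m_unit)
qed (simp_all add: inc0_mult inc1_left pw_append over.m_assoc)

lemma pw_grade: "pw w \<in> grade W (word_degree w)"
proof (cases w)
 case (Inr vs)
 have "pw (Inr vs) \<in> grade W (length vs)"
  by (induction vs) (use sup_one smult_grade[OF inc1_in] in auto)
 then show ?thesis by (simp add: Inr)
qed (simp add: inc0_in)

definition p :: "(('h, 'v) word, 'k) quot => 'w" where
 "p = gen_lift words b.WF pw"

lemma p_wsum: "xs \<in> lists words ==> p (b.wsum xs) = (SUM x<-xs. pw x)"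
 unfolding p_def by (rule gen_lift_sum[OF vsW]) (simp_all add: comp_def pw_WF lin_def)

lemma p_wg: "x \<in> words ==> p (b.wg x) = pw x"
 using p_wsum[of "[x]"] by simp

lemma p_linear: "linear_map b.T (full s) p"
 by (rule b.T_linI[OF vsW p_wsum]) (auto intro: lin_eqI[OF vsW] simp: b.WF_sc[OF pw_WF] lin_scale)

lemma m_sum: "smult W (SUM x<-xs. f x) y = (SUM x<-xs. smult W (f x) y)" "smult W y (SUM x<-xs. f x) = (SUM x<-xs. smult W y (f x))"
proof -
 have "smult W (a + b) y = smult W a y + smult W b y" "smult W y (a + b) = smult W y a + smult W y b" for a b
  by (rule lin_eqI[OF vsW], simp add: lin_add lin_add[OF m1] lin_add[OF m2])+
 then show "smult W (SUM x<-xs. f x) y = (SUM x<-xs. smult W (f x) y)" "smult W y (SUM x<-xs. f x) = (SUM x<-xs. smult W y (f x))"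
  by (induction xs) simp_all
qed

lemma p_mult: assumes "t \<in> elems b.T" "u \<in> elems b.T" shows "p (T_mult H M t u) = smult W (p t) (p u)"
proof -
 obtain xs ys where x: "xs \<in> lists words" "t = b.wsum xs" and y: "ys \<in> lists words" "u = b.wsum ys"
  using assms by (auto simp: b.elems_T)
 let ?zs = "concat (map (%x. map (b.wm x) ys) xs)"
 have "T_mult H M t u = b.wsum ?zs" by (simp only: x y b.T_mult_wsum sum_list_products)
 moreover have "?zs \<in> lists words" using x(1) y(1) by auto
 ultimately have "p (T_mult H M t u) = (SUM z<-?zs. pw z)" by (simp only: p_wsum)
 also have "... = (SUM x<-xs. SUM y<-ys. pw (b.wm x y))" by (rule sum_list_products)
 also have "... = (SUM x<-xs. SUM y<-ys. smult W (pw x) (pw y))"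
  using x(1) y(1) by (intro arg_cong[of _ _ sum_list] map_cong refl pw_mult) auto
 finally show ?thesis by (simp only: x y p_wsum m_sum sum_list_swap[of _ ys xs])
qed

lemma J_grade: "x \<in> grade W n ==> J x = s ((- 1) ^ n) x"
 using V.scale_left_diff_distrib[of 1 2 x] by (simp add: odd_grade)

lemma pw_PF: assumes f: "f \<in> bi (lin s) (lin s)" shows "(%x y. f (pw x) (pw y)) \<in> b.PF"
 using pw_WF[OF bi1[OF f]] pw_WF[OF bi2[OF f]] by (simp add: b.PF_def)

text \<open>Induction on the letters: \<open>inc1_comult_mult\<close> peels off a factor of degree 1
  in \<open>W\<close> exactly as \<open>DK\<close> does on words.\<close>

lemma pw_comult: "f \<in> bi (lin s) (lin s) ==> ssum (cD WC (pw w)) f = ssum (b.Cw w) (%x y. f (pw x) (pw y))"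
proof (cases w)
 case (Inl h)
 assume "f \<in> bi (lin s) (lin s)"
 from inc0_D[OF this] show ?thesis by (simp only: Inl b.Cw_def sum.case b.ssum_Kh pw_simps)
next
 case (Inr vs)
 have "f \<in> bi (lin s) (lin s) ==> ssum (cD WC (pw (Inr vs))) f = ssum (b.Lw vs) (%x y. f (pw x) (pw y))"
 proof (induction vs arbitrary: f)
  case Nil
  then show ?case using comult_one[of f] by (simp add: b.Lw_def inc0_one)
 next
  case (Cons v vs)
  note f = Cons.prems
  have g: "(%c e. f (smult W (inc0 W h) (J c)) (smult W (inc1 W w) e)) \<in> bi (lin s) (lin s)"
   "(%c e. f (smult W (inc1 W w) c) (smult W (inc0 W h) e)) \<in> bi (lin s) (lin s)" for h w
   by (intro biI lin_J[OF m2[OF bi1[OF f]]] m2[OF bi1[OF f]] m2[OF bi2[OF f]])+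
  \<comment> \<open>\<open>pw c\<close> is homogeneous of degree \<open>word_degree c\<close>, so
    \<open>J\<close> produces the sign that appears in \<open>DK_Kv\<close>.\<close>
  have t: "f (smult W (inc0 W h) (J (pw c))) (smult W (inc1 W w) (pw e)) = (- 1) ^ word_degree c * f (pw (b.wm (Inl h) c)) (pw (b.wm (Inr [w]) e))"
   "f (smult W (inc1 W w) (pw c)) (smult W (inc0 W h) (pw e)) = 1 * f (pw (b.wm (Inr [w]) c)) (pw (b.wm (Inl h) e))"
   if "c \<in> words" "e \<in> words" for h w c e
   using that by (simp_all add: pw_mult J_grade[OF pw_grade] lin_scale[OF m2[OF bi1[OF f]]] over.m_unit)
  have "ssum (cD WC (pw (Inr (v # vs)))) f =
    ssum (bL (VB H M) v) (%h w. ssum (b.Lw vs) (%c e. f (smult W (inc0 W h) (J (pw c))) (smult W (inc1 W w) (pw e)))) +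
    ssum (bR (VB H M) v) (%w h. ssum (b.Lw vs) (%c e. f (smult W (inc1 W w) (pw c)) (smult W (inc0 W h) (pw e))))"
   unfolding pw_simps inc1_comult_mult[OF f] Cons.IH[OF g(1)] Cons.IH[OF g(2)] ..
  also have "... = ssum (b.Lw vs) (b.DK (b.Kv v) (%x y. f (pw x) (pw y)))"
   unfolding ssum_swap[of _ "b.Lw vs"] ssum_add[symmetric]
  proof (rule ssum_cong)
   fix c e assume "(c, e) \<in> set (b.Lw vs)"
   then have "c \<in> words" "e \<in> words" by (auto dest!: lists_TimesD[OF b.Lw_words])
   then show "ssum (bL (VB H M) v) (%h w. f (smult W (inc0 W h) (J (pw c))) (smult W (inc1 W w) (pw e))) +
    ssum (bR (VB H M) v) (%w h. f (smult W (inc1 W w) (pw c)) (smult W (inc0 W h) (pw e))) = b.DK (b.Kv v) (%x y. f (pw x) (pw y)) c e"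
    by (simp only: b.DK_Kv t)
  qed
  finally show ?case unfolding b.ssum_Lw_Cons[OF pw_PF[OF f]] .
 qed
 moreover assume "f \<in> bi (lin s) (lin s)"
 ultimately show ?thesis by (simp only: Inr b.Cw_def sum.case)
qed

lemma ssum_concat: "(SUM x<-xs. ssum (L x) f) = ssum (concat (map L xs)) f"
 by (induction xs) (simp_all add: ssum_append)

lemma p_comult: assumes "t \<in> elems b.T"
 shows "scomult W (p t) = tlift b.T b.T (%y z. tens2 s (p y) (p z)) (scomult (T_minus_one H M) t)"
proof -
 obtain xs where x: "xs \<in> lists words" "t = b.wsum xs" using assms by (auto simp: b.elems_T)
 let ?t = "%y z. tens2 s (pw y) (pw z)"
 have w: "scomult W (pw x) = ssum (b.Cw x) ?t" for x
 proof (rule tensor_eqI[OF tW])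
  show i: "ssum (b.Cw x) ?t \<in> elems (tensor (full s) (full s))" by (intro ssum_in_tensor tens_in_tensor) simp_all
  show "ssum (rp2 s (scomult W (pw x))) f = ssum (rp2 s (ssum (b.Cw x) ?t)) f" if "f \<in> bi (lin s) (lin s)" for f
   using pw_comult[OF that, of x] by (simp add: rp_ssum[OF that] tens_in_tensor rp_tens[OF that])
 qed
 have b: "bilinear_map b.T b.T (full fun_scale) (%y z. tens2 s (p y) (p z))"
 proof (rule b.bilinear_pointwise)
  fix \<phi>
  show "bilinear_map b.T b.T ground (%y z. tens2 s (p y) (p z) \<phi>)"
   using p_linear bi1[OF tens_bi, of s s _ \<phi>] bi2[OF tens_bi, of s s _ \<phi>] unfolding bilinear_map_def linear_map_def lin_iff by simp
 qed
 have "tlift b.T b.T (%y z. tens2 s (p y) (p z)) (scomult (T_minus_one H M) t) =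
   ssum (concat (map b.Cw xs)) (%y z. tens2 s (p (b.wg y)) (p (b.wg z)))"
  unfolding x b.scomult_T[OF x(1)] ssum_concat
  by (rule b.T_tlift[OF b.is_space_quot b]) (auto dest!: lists_TimesD[OF b.Cw_words])
 also have "... = ssum (concat (map b.Cw xs)) ?t"
  by (rule ssum_cong) (auto simp: p_wg dest!: lists_TimesD[OF b.Cw_words])
 also have "... = (SUM x<-xs. scomult W (pw x))" by (simp only: ssum_concat[symmetric] w)
 also have "... = scomult W (p t)"
 proof -
  have add: "scomult W (x + y) = scomult W x + scomult W y" for x y using comult_linear by (simp add: linear_map_def)
  then have "scomult W 0 = 0" by (metis add_0 add_cancel_right_right)
  then have "scomult W (SUM x<-xs. pw x) = (SUM x<-xs. scomult W (pw x))"
   by (induction xs) (simp_all only: list.map sum_list.Nil sum_list.Cons add)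
  then show ?thesis by (simp only: x p_wsum)
 qed
 finally show ?thesis ..
qed

text \<open>On words both antipodes obey the same recursion, by definition in the tensor algebra and
  by \<open>antipode_inc1_left\<close> in \<open>W\<close>, and they agree on letters by
  \<open>antipode_inc1\<close>.\<close>

lemma p_antipode: assumes "t \<in> elems b.T" shows "p (santipode (T_minus_one H M) t) = santipode W (p t)"
proof -
 have add: "santipode W (x + y) = santipode W x + santipode W y" for x y
  by (rule lin_eqI[OF vsW]) (simp add: lin_add lin_add[OF Slin])
 have padd: "p (x + y) = p x + p y" if "x \<in> elems b.T" "y \<in> elems b.T" for x y using p_linear that by (simp add: linear_map_def)
 have scale: "santipode W (s c x) = s c (santipode W x)" for x c
  by (rule lin_eqI[OF vsW]) (simp add: lin_scale lin_scale[OF Slin])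
 have mscale: "smult W (s c x) y = s c (smult W x y)" for x y c
  by (rule lin_eqI[OF vsW]) (simp add: lin_scale lin_scale[OF m1])
 have l: "list_antipode H M vs \<in> elems b.T \<and> p (list_antipode H M vs) = santipode W (pw (Inr vs))" for vs
 proof (induction vs)
  case Nil
  have "santipode W (sone W) = sone W"
   using inc0_antipode[of "hone H"] S_unit by (simp add: inc0_one)
  then show ?case by (simp add: T_one_def p_wg inc0_one)
 next
  case (Cons v vs)
  have "list_antipode H M (v # vs) \<in> elems b.T" unfolding b.list_antipode[OF list.distinct(2)] by simp
  moreover have "T_mult H M (list_antipode H M vs) (T_antipode1 H M v) \<in> elems b.T"
  proof -
   let ?y = "Inr [b.A v]"
   obtain xs where xs: "xs \<in> lists words" "list_antipode H M vs = b.wsum xs" using Cons by (auto simp: b.elems_T)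
   have "T_mult H M (b.wsum xs) (b.wsum [?y]) = b.wsum (map (%x. b.wm x ?y) xs)"
    using xs(1) by (subst b.T_mult_wsum) (simp_all add: comp_def)
   moreover have "map (%x. b.wm x ?y) xs \<in> lists words" using xs(1) by auto
   ultimately show ?thesis using b.wsum_T[of "map (%x. b.wm x ?y) xs"] by (simp add: xs(2) b.T_antipode1)
  qed
  then have "p (list_antipode H M (v # vs)) = s ((- 1) ^ length vs) (smult W (p (list_antipode H M vs)) (p (T_antipode1 H M v)))"
   using p_linear p_mult[of "list_antipode H M vs" "T_antipode1 H M v"] Cons by (simp add: linear_map_def b.scl_T b.T_antipode1)
  moreover have "santipode W (pw (Inr (v # vs))) = s ((- 1) ^ length vs) (smult W (santipode W (pw (Inr vs))) (santipode W (inc1 W v)))"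
   using J_grade[OF pw_grade[of "Inr vs"]] by (simp add: antipode_inc1_left scale mscale)
  ultimately show ?case using Cons by (simp add: b.T_antipode1 p_wg antipode_inc1 over.m_unit)
 qed
 have w: "word_antipode H M x \<in> elems b.T \<and> p (word_antipode H M x) = santipode W (pw x)" for x
  using l by (cases x) (simp_all add: p_wg inc0_antipode)
 obtain xs where x: "xs \<in> lists words" "t = b.wsum xs" using assms by (auto simp: b.elems_T)
 have 0: "santipode W 0 = 0" using add[of 0 0] by simp
 have "(SUM x<-xs. word_antipode H M x) \<in> elems b.T \<and> p (SUM x<-xs. word_antipode H M x) = santipode W (SUM x<-xs. pw x)" for xs
 proof (induction xs)
  case Nil
  show ?case using b.wsum_T[of "[]"] p_wsum[of "[]"] by (simp only: list.map sum_list.Nil 0 lists.Nil)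
 next
  case (Cons x xs)
  from w[of x] obtain ys where y: "ys \<in> lists words" "word_antipode H M x = b.wsum ys" by (auto simp: b.elems_T)
  from Cons obtain zs where z: "zs \<in> lists words" "(SUM x<-xs. word_antipode H M x) = b.wsum zs" by (auto simp: b.elems_T)
  have "(SUM x<-x # xs. word_antipode H M x) = b.wsum (ys @ zs)" using y z by (simp only: list.map sum_list.Cons map_append sum_list_append)
  then have "(SUM x<-x # xs. word_antipode H M x) \<in> elems b.T" using b.wsum_T[of "ys @ zs"] y z by simp
  then show ?case using Cons w[of x] padd by (simp only: list.map sum_list.Cons add)
 qed
 then show ?thesis by (simp only: x b.santipode_T p_wsum)
qed

text \<open>Induction on the degree: \<open>generated\<close> writes degree n + 1 as the span of
  letters times elements already in the image.\<close>

lemma p_surj: "p ` elems b.T = UNIV"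
proof -
 have add: "x + y \<in> p ` elems b.T" if xy: "x \<in> p ` elems b.T" "y \<in> p ` elems b.T" for x y
 proof -
  obtain xs ys where "xs \<in> lists words" "ys \<in> lists words" "x = p (b.wsum xs)" "y = p (b.wsum ys)" using xy by (auto simp: b.elems_T)
  moreover from this have "x + y = p (b.wsum (xs @ ys))" by (subst p_wsum) (simp_all add: p_wsum)
  moreover have "xs @ ys \<in> lists words" using calculation by simp
  ultimately show ?thesis using b.wsum_T by blast
 qed
 have sub: "V.subspace (p ` elems b.T)"
 proof (rule V.subspaceI[OF _ add])
  show "0 \<in> p ` elems b.T" using p_wsum[of "[]"] b.wsum_T[of "[]"] by (force simp only: list.map sum_list.Nil lists.Nil)
  show "s c x \<in> p ` elems b.T" if x: "x \<in> p ` elems b.T" for c x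
  proof -
   obtain xs where xs: "xs \<in> lists words" "x = p (b.wsum xs)" using x by (auto simp: b.elems_T)
   have "s c x = p (fun_scale c (b.wsum xs))" using p_linear b.wsum_T[OF xs(1)] by (simp add: xs linear_map_def b.scl_T)
   moreover have "map (b.sc c) xs \<in> lists words" using xs(1) by auto
   ultimately show ?thesis using b.wsum_T by (auto simp only: b.wsum_scale[OF xs(1)])
  qed
 qed
 have "grade W n \<subseteq> p ` elems b.T" for n
 proof (induction n)
  case 0
  have "inc0 W h \<in> p ` elems b.T" for h using p_wg[of "Inl h"] b.wg_T[of "Inl h"] by (metis b.words_simps(1) imageI pw_simps(1))
  then have "range (inc0 W) \<subseteq> p ` elems b.T" by blast
  then show ?case using bij0 by (simp add: bij_betw_def)
 next
  case (Suc n)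
  have "smult W (inc1 W v) y \<in> p ` elems b.T" if y: "y \<in> grade W n" for v y
  proof -
   obtain xs where x: "xs \<in> lists words" "y = p (b.wsum xs)" using Suc y by (auto simp: b.elems_T)
   have e: "pw (b.wm (Inr [v]) w) = smult W (inc1 W v) (pw w)" if "w \<in> words" for w
    using that by (simp add: pw_mult over.m_unit)
   have "(SUM x<-xs. smult W (inc1 W v) (pw x)) = (SUM x<-xs. pw (b.wm (Inr [v]) x))"
    using x(1) by (induction xs) (simp_all add: e)
   then have "smult W (inc1 W v) y = (SUM x<-map (b.wm (Inr [v])) xs. pw x)"
    by (simp add: x p_wsum m_sum comp_def)
   moreover have "map (b.wm (Inr [v])) xs \<in> lists words" using x(1) by auto
   ultimately show ?thesis using p_wsum b.wsum_T by (metis imageI)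
  qed
  then have "{smult W (inc1 W v) y |v y. y \<in> grade W n} \<subseteq> p ` elems b.T" by blast
  from V.span_minimal[OF this sub] show ?case using generated by blast
 qed
 then have "x \<in> p ` elems b.T" for x
  by (subst hp_sum[of x]) (rule V.subspace_sum[OF sub], use hp_in in blast)
 then show ?thesis by blast
qed

lemma p_hom: "super_hopf_hom (T_minus_one H M) W p"
 unfolding super_hopf_hom_def Let_def b.T_simps T_space_def[symmetric] sspace
proof (intro conjI allI ballI p_linear p_mult p_comult p_antipode)
 fix n x assume x: "x \<in> T_grade H M n"
 obtain xs where x: "xs \<in> lists words" "!!x. x \<in> set xs ==> word_degree x = n" "x = b.wsum xs" using b.T_gradeE[OF x] by blast
 then have "(SUM x<-xs. pw x) \<in> grade W n" by (induction xs arbitrary: x) (use pw_grade in \<open>auto intro!: G_zero G_add\<close>)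
 then show "p x \<in> grade W n" using x by (simp add: p_wsum)
next
 fix x assume "x \<in> elems b.T"
 then obtain xs where x: "xs \<in> lists words" "x = b.wsum xs" by (rule b.T_cases)
 have 0: "scounit W 0 = 0" and add: "scounit W (x + y) = scounit W x + scounit W y" for x y
  using cog_cE[OF cogW] lin_0[of "scounit W" s] lin_add[of "scounit W" s] by simp_all
 have w: "scounit W (pw y) = word_counit H y" if "y \<in> words" for y
  using that by (elim b.words_cases) (use sup_counit0 pw_grade[of y] in \<open>auto simp: inc0_counit\<close>)
 have "scounit W (SUM x<-xs. pw x) = (SUM x<-xs. word_counit H x)" using x(1) by (induction xs) (simp_all add: 0 add w)
 then show "scounit W (p x) = scounit (T_minus_one H M) x" by (simp only: x p_wsum b.scounit_T)
qed (simp_all add: p_wg inc0_one)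

end

section \<open>Recovering \<open>ext_core\<close> from a quotient map\<close>

lemma (in bicov) wm_one: "x \<in> words ==> wm x (Inl (hone H)) = x"
 by (erule words_cases) (auto simp: mu_unit ract_one)

lemma (in bicov) Lw_single: "ssum (Lw [v]) tw = ssum (Kv v) tw"
proof
 fix \<phi>
 have "ssum (LM (Kv v) [(Inl (hone H), Inl (hone H))]) (%x y. tw x y \<phi>) = ssum (Kv v) (%x y. tw x y \<phi>)"
  by (subst ssum_LM[OF tw_PF K_words(1)], simp, rule ssum_cong) (auto simp: wm_one dest!: lists_TimesD[OF K_words(1)])
 then show "ssum (Lw [v]) tw \<phi> = ssum (Kv v) tw \<phi>" by (simp add: Lw_def ssum_apply)
qed

text \<open>The conditions on \<open>inc0\<close> and \<open>inc1\<close> are the homomorphism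
  properties of the quotient map at words of length at most 1. Generation holds because the map is
  surjective and graded: only words of length n + 1 contribute to degree n + 1, and from them a
  first letter splits off.\<close>

lemma exterior_algebra_core:
 fixes W :: "('k::field, 'h::ab_group_add, 'v::ab_group_add, 'w::ab_group_add) ext_alg"
 assumes H: "hopf_algebra H" and M: "bicovariant_bimodule H M" and E: "exterior_algebra H M W"
 shows "ext_core H M W"
proof -
 interpret b: bicov H M by (rule bicov.intro[OF H M])
 let ?s = "sscale W"
 note E' = E[unfolded exterior_algebra_def Let_def]
 have super: "super_hopf_algebra W" and el: "elems (sspace W) = UNIV" and bij0: "bij_betw (inc0 W) UNIV (grade W 0)"
  and bij1: "bij_betw (inc1 W) UNIV (grade W 1)" using E' by blast+
 obtain p where hom: "super_hopf_hom (T_minus_one H M) W p" and surj: "p ` elems (sspace (T_minus_one H M)) = UNIV"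
  and p0: "!!h. p (b.wg (Inl h)) = inc0 W h" and p1: "!!v. p (b.wg (Inr [v])) = inc1 W v" using E' by blast
 have ss: "sspace W = full ?s" using el by (simp add: graded_space_def full_def)
 note sup = super[unfolded super_hopf_algebra_def Let_def ss]
 have vs: "vector_space ?s" using sup by (simp add: is_algebra_full)
 have "\<exists>!f. is_decomposition (grade W) x f" for x using sup by simp
 then interpret graded_full ?s "grade W" by (intro graded_full.intro[OF vs]) (use sup in auto)
 note hom' = hom[unfolded super_hopf_hom_def Let_def b.T_simps T_space_def[symmetric] ss]
 have pl: "linear_map b.T (full ?s) p" and pg: "!!n x. x \<in> b.TG n ==> p x \<in> grade W n"
  and pm: "!!x y. x \<in> elems b.T ==> y \<in> elems b.T ==> p (T_mult H M x y) = smult W (p x) (p y)"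
  and pone: "p (b.wg (Inl (hone H))) = sone W"
  and pc: "!!x. x \<in> elems b.T ==> scomult W (p x) = tlift b.T b.T (%y z. tens (full ?s) (full ?s) (p y) (p z)) (scomult (T_minus_one H M) x)"
  and pe: "!!x. x \<in> elems b.T ==> scounit W (p x) = scounit (T_minus_one H M) x"
  and pa: "!!x. x \<in> elems b.T ==> p (santipode (T_minus_one H M) x) = santipode W (p x)"
  using hom' by blast+
 have pwm: "p (b.wg (b.wm x y)) = smult W (p (b.wg x)) (p (b.wg y))" if "x \<in> words" "y \<in> words" for x y
  using pm[OF b.wg_T b.wg_T, OF that] that by (simp only: b.T_mult_wg)
 have pWF: "(%x. \<phi> (p (b.wg x))) \<in> b.WF" if \<phi>: "\<phi> \<in> lin ?s" for \<phi>
  by (rule b.T_lin_WF) (use pl \<phi> in \<open>simp add: linear_map_def lin_iff\<close>)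
 have b: "bilinear_map b.T b.T (full fun_scale) (%y z. tens (full ?s) (full ?s) (p y) (p z))"
 proof (rule b.bilinear_pointwise)
  fix \<phi>
  show "bilinear_map b.T b.T ground (%y z. tens (full ?s) (full ?s) (p y) (p z) \<phi>)"
   using pl bi1[OF tens_bi, of ?s ?s _ \<phi>] bi2[OF tens_bi, of ?s ?s _ \<phi>] unfolding bilinear_map_def linear_map_def lin_iff by simp
 qed
 note tl = b.T_tlift[OF b.is_space_quot b]
 have l0: "(%h. \<phi> (inc0 W h)) \<in> hlin H" and l1: "(%v. \<phi> (inc1 W v)) \<in> vlin M" if "\<phi> \<in> lin ?s" for \<phi>
  using b.WF_h[OF pWF[OF that]] b.WF_v0[OF pWF[OF that], of "[]"] by (simp_all add: p0 p1)
 note tb = l0[OF bi1[OF tens_bi]] l0[OF bi2[OF tens_bi]] l1[OF bi1[OF tens_bi]] l1[OF bi2[OF tens_bi]]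
 show ?thesis
 proof (rule ext_core.intro[OF H M super el bij0 bij1])
  show "linear_map (hspace H) (full ?s) (inc0 W)" "linear_map (vspace M) (full ?s) (inc1 W)"
   by (rule linear_mapI_lin[OF vs], erule l0 l1)+
  show "inc0 W (hmult H h g) = smult W (inc0 W h) (inc0 W g)" for h g
   using pwm[of "Inl h" "Inl g"] by (simp add: p0)
  show "inc0 W (hone H) = sone W" using pone by (simp add: p0)
  show "inc1 W (lact M h v) = smult W (inc0 W h) (inc1 W v)" for h v
   using pwm[of "Inl h" "Inr [v]"] by (simp add: p0 p1)
  show "inc1 W (ract M v h) = smult W (inc1 W v) (inc0 W h)" for h v
   using pwm[of "Inr [v]" "Inl h"] by (simp add: p0 p1)
  show "scounit W (inc0 W h) = hcounit H h" for h
   using pe[of "b.wg (Inl h)"] b.scounit_T[of "[Inl h]"] by (simp add: p0)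
  show "santipode W (inc0 W h) = inc0 W (hantipode H h)" for h
   using pa[of "b.wg (Inl h)"] b.santipode_T[of "[Inl h]"] by (simp add: p0)
  show "scomult W (inc0 W h) = tlift (hspace H) (hspace H) (%h1 h2. tens (full ?s) (full ?s) (inc0 W h1) (inc0 W h2)) (hcomult H h)" for h
  proof -
   have "scomult (T_minus_one H M) (b.wg (Inl h)) = ssum (b.Kh h) b.tw"
    using b.scomult_T[of "[Inl h]"] by (simp add: b.Cw_def)
   then have "scomult W (inc0 W h) = ssum (b.Kh h) (%x y. tens (full ?s) (full ?s) (p (b.wg x)) (p (b.wg y)))"
    using pc[of "b.wg (Inl h)"] tl[OF b.K_words(2)] by (simp add: p0)
   also have "... = ssum (rp (hspace H) (hspace H) (hcomult H h)) (%a b. tens (full ?s) (full ?s) (inc0 W a) (inc0 W b))"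
    unfolding b.ssum_Kh p0 HC_simps ..
   also have "... = tlift (hspace H) (hspace H) (%h1 h2. tens (full ?s) (full ?s) (inc0 W h1) (inc0 W h2)) (hcomult H h)"
    by (rule tlift_quot[OF _ b.comult_tensor, symmetric]) (intro biI tb)
   finally show ?thesis .
  qed
  show "scomult W (inc1 W v) =
    tlift (hspace H) (vspace M) (%h w. tens (full ?s) (full ?s) (inc0 W h) (inc1 W w)) (lcoact M v) +
    tlift (vspace M) (hspace H) (%w h. tens (full ?s) (full ?s) (inc1 W w) (inc0 W h)) (rcoact M v)" for v
  proof -
   have "scomult (T_minus_one H M) (b.wg (Inr [v])) = ssum (b.Kv v) b.tw"
    using b.scomult_T[of "[Inr [v]]"] b.Lw_single by (simp add: b.Cw_def)
   then have "scomult W (inc1 W v) = ssum (b.Kv v) (%x y. tens (full ?s) (full ?s) (p (b.wg x)) (p (b.wg y)))"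
    using pc[of "b.wg (Inr [v])"] tl[OF b.K_words(1)] by (simp add: p1)
   also have "... = ssum (rp (hspace H) (vspace M) (lcoact M v)) (%h w. tens (full ?s) (full ?s) (inc0 W h) (inc1 W w)) +
     ssum (rp (vspace M) (hspace H) (rcoact M v)) (%w h. tens (full ?s) (full ?s) (inc1 W w) (inc0 W h))"
    unfolding b.ssum_Kv p0 p1 VB_simps ..
   also have "ssum (rp (hspace H) (vspace M) (lcoact M v)) (%h w. tens (full ?s) (full ?s) (inc0 W h) (inc1 W w)) =
     tlift (hspace H) (vspace M) (%h w. tens (full ?s) (full ?s) (inc0 W h) (inc1 W w)) (lcoact M v)"
    by (rule tlift_quot[OF _ b.coact_tensor(1), symmetric]) (intro biI tb)
   also have "ssum (rp (vspace M) (hspace H) (rcoact M v)) (%w h. tens (full ?s) (full ?s) (inc1 W w) (inc0 W h)) =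
     tlift (vspace M) (hspace H) (%w h. tens (full ?s) (full ?s) (inc1 W w) (inc0 W h)) (rcoact M v)"
    by (rule tlift_quot[OF _ b.coact_tensor(2), symmetric]) (intro biI tb)
   finally show ?thesis .
  qed
  show "grade W (Suc n) \<subseteq> V.span {smult W (inc1 W v) y |v y. y \<in> grade W n}" (is "_ \<subseteq> V.span ?X") for n
  proof
   fix x assume x: "x \<in> grade W (Suc n)"
   have wgr: "p (b.wg w) \<in> grade W (word_degree w)" if "w \<in> words" for w
    using pg[of "b.wg w" "word_degree w"] b.T_gradeI[of "[w]" "word_degree w"] that by simp
   have "x \<in> p ` elems b.T" using surj by (simp add: b.T_simps(1))
   then obtain xs where xs: "xs \<in> lists words" "x = p (b.wsum xs)" by (auto simp: b.elems_T)
   have "hparts (grade W) (SUM w<-xs. p (b.wg w)) (Suc n) \<in> V.span ?X"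
    using xs(1)
   proof (induction xs)
    case Nil
    show ?case using hp_grade[OF G_zero] by (simp add: V.span_zero)
   next
    case (Cons w xs)
    have w: "w \<in> words" using Cons by simp
    have "hparts (grade W) (p (b.wg w)) (Suc n) \<in> V.span ?X"
    proof (cases "word_degree w = Suc n")
     case True
     then obtain v vs where v: "w = Inr (v # vs)" "length vs = n" using w by (elim b.words_cases) auto
     have "\<exists>y\<in>grade W n. p (b.wg w) = smult W (inc1 W v) y"
     \<comment> \<open>A word with one letter has no remaining word, so the cofactor of degree 0 is
       the class of the unit.\<close>
     proof (cases "vs = []")
      case True
      then show ?thesis
       using pwm[of "Inr [v]" "Inl (hone H)"] wgr[of "Inl (hone H)"] v by (auto simp: b.ract_one p1)
     next
      case False
      then show ?thesis
       using pwm[of "Inr [v]" "Inr vs"] wgr[of "Inr vs"] v by (auto simp: p1)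
     qed
     then have "p (b.wg w) \<in> V.span ?X" by (auto intro: V.span_base)
     then show ?thesis using hp_grade[OF wgr[OF w]] True by simp
    next
     case False
     then show ?thesis using hp_grade[OF wgr[OF w]] by (simp add: V.span_zero)
    qed
    then show ?case using Cons by (simp add: hp_add V.span_add)
   qed
   then show "x \<in> V.span ?X" using hp_grade[OF x] b.T_lin_sum[OF pl xs(1)] xs(2) by simp
  qed
 qed
qed

text \<open>Exchanges the existence of a quotient map from the tensor algebra, which depends on the
  product of \<open>H\<close> and on both actions, for conditions that the twist visibly
  preserves.\<close>

lemma exterior_algebra_iff:
 fixes W :: "('k::field, 'h::ab_group_add, 'v::ab_group_add, 'w::ab_group_add) ext_alg"
 assumes H: "hopf_algebra H" and M: "bicovariant_bimodule H M"
 shows "exterior_algebra H M W \<longleftrightarrow> ext_core H M W \<and> ext_differential M W"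
proof
 assume E: "exterior_algebra H M W"
 then show "ext_core H M W \<and> ext_differential M W"
  using exterior_algebra_core[OF H M E] unfolding exterior_algebra_def ext_differential_def Let_def by blast
next
 assume *: "ext_core H M W \<and> ext_differential M W"
 then interpret ext_core H M W by blast
 have "\<exists>p. super_hopf_hom (T_minus_one H M) W p \<and> p ` elems (sspace (T_minus_one H M)) = UNIV \<and>
   (\<forall>h. p (b.wg (Inl h)) = inc0 W h) \<and> (\<forall>v. p (b.wg (Inr [v])) = inc1 W v)"
  using p_hom p_surj by (intro exI[of _ p]) (simp add: b.T_simps(1) p_wg over.m_unit)
 then show "exterior_algebra H M W"
  using * super elems bij0 bij1 unfolding exterior_algebra_def ext_differential_def Let_def by blast
qed

section \<open>Twisting exterior algebras\<close>

lemma exterior_algebras_iff: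
 assumes "hopf_algebra H"
 shows "(M, W) \<in> exterior_algebras H \<longleftrightarrow> bicovariant_calculus H M \<and> ext_core H M W \<and> ext_differential M W"
 using exterior_algebra_iff[OF assms, of M W]
 by (auto simp: exterior_algebras_def bicovariant_calculus_def Let_def)

lemma exterior_algebras_twist:
 assumes H: "hopf_algebra H" and \<chi>: "two_cocycle H \<chi>" and m: "(M, W) \<in> exterior_algebras H"
 shows "(twist_calculus H \<chi> M, twist_exterior H \<chi> W) \<in> exterior_algebras (twist_hopf H \<chi>)"
proof -
 have c: "bicovariant_calculus H M" and core: "ext_core H M W" and d: "ext_differential M W"
  using m by (auto simp: exterior_algebras_iff[OF H])
 interpret ext_twist H M W \<chi> using core \<chi> by (simp add: ext_twist_def ext_twist_axioms_def)
 have c': "bicovariant_calculus (twist_hopf H \<chi>) (twist_calculus H \<chi> M)" by (rule twist_calculus_bicovariant[OF H \<chi> c])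
 have "bicovariant_bimodule (twist_hopf H \<chi>) (twist_calculus H \<chi> M)"
  using c' by (simp add: bicovariant_calculus_def Let_def)
 from tw_ext_core[OF this] tw_differential[OF d] c' show ?thesis
  by (simp add: exterior_algebras_iff[OF twist_hopf_algebra[OF H \<chi>]])
qed

lemma exterior_algebras_twist_twist:
 assumes H: "hopf_algebra H" and \<chi>: "two_cocycle H \<chi>" and m: "(M, W) \<in> exterior_algebras H"
 shows "twist_calculus (twist_hopf H \<chi>) (conv_inverse2 H \<chi>) (twist_calculus H \<chi> M) = M"
  "twist_exterior (twist_hopf H \<chi>) (conv_inverse2 H \<chi>) (twist_exterior H \<chi> W) = W"
 using m by (auto simp: exterior_algebras_iff[OF H] twist_twist_calculus[OF H \<chi>] intro: twist_twist_exterior[OF _ \<chi>])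

lemma exterior_algebras_bij:
 assumes H: "hopf_algebra H" and \<chi>: "two_cocycle H \<chi>"
 shows "bij_betw (%(M, W). (twist_calculus H \<chi> M, twist_exterior H \<chi> W)) (exterior_algebras H) (exterior_algebras (twist_hopf H \<chi>))"
proof -
 note H' = twist_hopf_algebra[OF H \<chi>] and \<chi>' = twist_cocycle[OF H \<chi>]
 note tb = twist_twist_hopf[OF H \<chi>] twist_conv_inverse[OF H \<chi>]
 show ?thesis
  by (rule bij_betw_byWitness[where f' = "%(M, W). (twist_calculus (twist_hopf H \<chi>) (conv_inverse2 H \<chi>) M,
    twist_exterior (twist_hopf H \<chi>) (conv_inverse2 H \<chi>) W)"])
   (auto simp: exterior_algebras_twist_twist[OF H \<chi>] exterior_algebras_twist_twist[OF H' \<chi>', unfolded tb]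
    exterior_algebras_twist[OF H \<chi>] exterior_algebras_twist[OF H' \<chi>', unfolded tb])
qed

lemma exterior_hom_twist:
 assumes H: "hopf_algebra H" and \<chi>: "two_cocycle H \<chi>"
  and W: "(M, W) \<in> exterior_algebras H" and W': "(M', W') \<in> exterior_algebras H" and f: "exterior_hom W W' f"
 shows "exterior_hom (twist_exterior H \<chi> W) (twist_exterior H \<chi> W') f"
proof -
 have t: "ext_twist H M W \<chi>" "ext_twist H M' W' \<chi>"
  using W W' \<chi> by (auto simp: exterior_algebras_iff[OF H] ext_twist_def ext_twist_axioms_def)
 show ?thesis by (rule ext_twist.tw_exterior_hom[OF t f])
qed

theorem proposition3p2:
  fixes H :: "('k::field, 'h::ab_group_add) hopf" and \<chi> :: "'h \<Rightarrow> 'h \<Rightarrow> 'k"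
  assumes "hopf_algebra H" and "two_cocycle H \<chi>"
  shows
    "hopf_algebra (twist_hopf H \<chi>) \<and>
     bij_betw (twist_calculus H \<chi>)
       {\<Omega> :: ('k, 'h, 'v::ab_group_add) calculus. bicovariant_calculus H \<Omega>}
       {\<Omega>. bicovariant_calculus (twist_hopf H \<chi>) \<Omega>} \<and>
     (\<forall>(\<Omega> :: ('k, 'h, 'v) calculus) (\<Omega>' :: ('k, 'h, 'u::ab_group_add) calculus) f.
        bicovariant_calculus H \<Omega> \<longrightarrow> bicovariant_calculus H \<Omega>' \<longrightarrow>
        (calculus_hom H \<Omega> \<Omega>' f \<longleftrightarrow>
         calculus_hom (twist_hopf H \<chi>) (twist_calculus H \<chi> \<Omega>) (twist_calculus H \<chi> \<Omega>') f)) \<and>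
     (\<forall>\<Omega> :: ('k, 'h, 'v) calculus. dif (twist_calculus H \<chi> \<Omega>) = dif \<Omega>) \<and>
     bij_betw (\<lambda>(\<Omega>, W). (twist_calculus H \<chi> \<Omega>, twist_exterior H \<chi> W))
       (exterior_algebras H ::
         (('k, 'h, 'v) calculus \<times> ('k, 'h, 'v, 'w::ab_group_add) ext_alg) set)
       (exterior_algebras (twist_hopf H \<chi>)) \<and>
     (\<forall>(\<Omega> :: ('k, 'h, 'v) calculus) (W :: ('k, 'h, 'v, 'w) ext_alg)
        (\<Omega>' :: ('k, 'h, 'u) calculus) (W' :: ('k, 'h, 'u, 'x::ab_group_add) ext_alg) f.
        (\<Omega>, W) \<in> exterior_algebras H \<longrightarrow> (\<Omega>', W') \<in> exterior_algebras H \<longrightarrow>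
        (exterior_hom W W' f \<longleftrightarrow>
         exterior_hom (twist_exterior H \<chi> W) (twist_exterior H \<chi> W') f)) \<and>
     (\<forall>W :: ('k, 'h, 'v, 'w) ext_alg. ext_dif (twist_exterior H \<chi> W) = ext_dif W)"
proof (intro conjI allI)
  note H = assms(1) and \<chi> = assms(2)
  note H' = twist_hopf_algebra[OF H \<chi>] and \<chi>' = twist_cocycle[OF H \<chi>]
  note tb = twist_twist_hopf[OF H \<chi>] twist_conv_inverse[OF H \<chi>]
  show "hopf_algebra (twist_hopf H \<chi>)" by (rule H')
  show "bij_betw (twist_calculus H \<chi>)
       {\<Omega> :: ('k, 'h, 'v) calculus. bicovariant_calculus H \<Omega>}
       {\<Omega>. bicovariant_calculus (twist_hopf H \<chi>) \<Omega>}"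
    by (rule twist_calculus_bij[OF H \<chi>])
  show "bicovariant_calculus H \<Omega> \<longrightarrow> bicovariant_calculus H \<Omega>' \<longrightarrow>
        (calculus_hom H \<Omega> \<Omega>' f \<longleftrightarrow>
         calculus_hom (twist_hopf H \<chi>) (twist_calculus H \<chi> \<Omega>) (twist_calculus H \<chi> \<Omega>') f)"
    for \<Omega> :: "('k, 'h, 'v) calculus" and \<Omega>' :: "('k, 'h, 'u) calculus" and f
    using twist_calculus_hom_iff[OF H \<chi>] by blast
  show "dif (twist_calculus H \<chi> \<Omega>) = dif \<Omega>" for \<Omega> :: "('k, 'h, 'v) calculus" by simp
  show "bij_betw (\<lambda>(\<Omega>, W). (twist_calculus H \<chi> \<Omega>, twist_exterior H \<chi> W))
       (exterior_algebras H :: (('k, 'h, 'v) calculus \<times> ('k, 'h, 'v, 'w) ext_alg) set)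
       (exterior_algebras (twist_hopf H \<chi>))"
    by (rule exterior_algebras_bij[OF H \<chi>])
  show "(\<Omega>, W) \<in> exterior_algebras H \<longrightarrow> (\<Omega>', W') \<in> exterior_algebras H \<longrightarrow>
        (exterior_hom W W' f \<longleftrightarrow> exterior_hom (twist_exterior H \<chi> W) (twist_exterior H \<chi> W') f)"
    for \<Omega> :: "('k, 'h, 'v) calculus" and W :: "('k, 'h, 'v, 'w) ext_alg"
      and \<Omega>' :: "('k, 'h, 'u) calculus" and W' :: "('k, 'h, 'u, 'x) ext_alg" and f
  proof (intro impI iffI)
    assume W: "(\<Omega>, W) \<in> exterior_algebras H" and W': "(\<Omega>', W') \<in> exterior_algebras H"
    show "exterior_hom (twist_exterior H \<chi> W) (twist_exterior H \<chi> W') f" if "exterior_hom W W' f"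
      by (rule exterior_hom_twist[OF H \<chi> W W' that])
    \<comment> \<open>Twisting back by the inverse cocycle restores both algebras and leaves the map
      f as it is.\<close>
    show "exterior_hom W W' f" if "exterior_hom (twist_exterior H \<chi> W) (twist_exterior H \<chi> W') f"
      using exterior_hom_twist[OF H' \<chi>' exterior_algebras_twist[OF H \<chi> W] exterior_algebras_twist[OF H \<chi> W'] that]
      unfolding exterior_algebras_twist_twist[OF H \<chi> W] exterior_algebras_twist_twist[OF H \<chi> W'] .
  qed
  show "ext_dif (twist_exterior H \<chi> W) = ext_dif W" for W :: "('k, 'h, 'v, 'w) ext_alg"
    by (simp add: twist_exterior_def)
qed

end
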